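(* Let $0<|q|<1$, $0<|b|<1$, $t=(t_1,t_2,t_3,t_4)\in(\mathbb{C}\setminus\{0\})^4$ be generic, and $T=\sqrt{t_1t_2t_3t_4}$ (either choice of root). Define \[ B_2(b;t;q)=\prod_{1\le r<s\le4}(t_rt_s;q)\,\frac{(b^2,qb^2,q;q)}{2(b,qb;q)}\int_{\mathcal{C}}\frac{(z^{\pm2};q)}{(bz^{\pm2};q)}\prod_{r=1}^4\frac{(bt_rz^{\pm1};q)}{(t_rz^{\pm1};q)}\frac{dz}{2\pi iz}. \] Then \[ B_2(b;t;q)=\prod_{1\le r<s\le4}(bt_rt_s;q)\,\frac{(qb^2,b^2,T^2;q)}{(qb,bT^2;q)}\;{}_{14}W_{13}\Bigl(\frac{bT^2}{q};t_1t_2,t_1t_3,t_1t_4,t_2t_3,t_2t_4,t_3t_4,\frac qb,\pm\frac{bT}{\sqrt q},\pm bT;q,b^2\Bigr). \]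
   Context: Notation. $(x;q)=\prod_{r\ge 0}(1-xq^r)$ and $(x;q)_k=\prod_{r=0}^{k-1}(1-xq^r)$. Several arguments denote a product, $(a_1,\dots,a_k;q)=\prod_r(a_r;q)$, and $\pm$ signs denote products over both choices, e.g. $(az^{\pm1};q)=(az,a/z;q)$; in a list of series parameters $\pm x$ stands for the two parameters $x,-x$. The basic hypergeometric series is ${}_{r+1}\phi_r\left(\begin{array}{c}a_1,\dots,a_{r+1}\\ b_1,\dots,b_r\end{array};q,z\right)=\sum_{k\ge0}\frac{(a_1,\dots,a_{r+1};q)_k}{(q,b_1,\dots,b_r;q)_k}z^k$ and the very well poised series is \[ {}_{r+1}W_r(a;b_1,\dots,b_{r-2};q,z)={}_{r+1}\phi_r\left(\begin{array}{c}a,\pm q\sqrt a,b_1,\dots,b_{r-2}\\ \pm\sqrt a,aq/b_1,\dots,aq/b_{r-2}\end{array};q,z\right). \] The contour $\mathcal{C}$ is a deformation of the unit circle traversed in positive direction which separates the zeros of $(t_rz;q)$ ($1\le r\le4$) and $(bz^2;q)$ from their reciprocals; if no such contour exists the integral side is understood by analytic continuation in $b$ and $t_r$. "Generic" means that the expressions appearing are well defined (no vanishing denominators). *)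

theory Defs
  imports "HOL-Complex_Analysis.Complex_Analysis"
begin

section \<open>q-Pochhammer symbols and basic hypergeometric series\<close>

definition qpoch_inf :: "complex \<Rightarrow> complex \<Rightarrow> complex" where
  "qpoch_inf x q = (\<Prod>r. 1 - x * q ^ r)"

definition qpoch :: "complex \<Rightarrow> complex \<Rightarrow> nat \<Rightarrow> complex" where
  "qpoch x q k = (\<Prod>r<k. 1 - x * q ^ r)"

definition qpochs_inf :: "complex list \<Rightarrow> complex \<Rightarrow> complex" where
  "qpochs_inf xs q = (\<Prod>x\<leftarrow>xs. qpoch_inf x q)"

definition qpochs :: "complex list \<Rightarrow> complex \<Rightarrow> nat \<Rightarrow> complex" where
  "qpochs xs q k = (\<Prod>x\<leftarrow>xs. qpoch x q k)"

text \<open>The series with upper parameters \<open>as\<close> and lower parameters \<open>bs\<close>. It is only used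
  with \<open>length as = length bs + 1\<close>, which is the case of the general basic hypergeometric
  series in which no extra power of \<open>q\<close> occurs in the terms.\<close>

definition qhyp :: "complex list \<Rightarrow> complex list \<Rightarrow> complex \<Rightarrow> complex \<Rightarrow> complex" where
  "qhyp as bs q z = (\<Sum>k. qpochs as q k / qpochs (q # bs) q k * z ^ k)"

text \<open>The principal root \<open>csqrt a\<close> always occurs together with its negative, so the choice
  of the root is immaterial.\<close>

definition vwp_lower :: "complex \<Rightarrow> complex list \<Rightarrow> complex \<Rightarrow> complex list" where
  "vwp_lower a bs q = csqrt a # - csqrt a # map (\<lambda>\<beta>. a * q / \<beta>) bs"

definition vwp :: "complex \<Rightarrow> complex list \<Rightarrow> complex \<Rightarrow> complex \<Rightarrow> complex" where
  "vwp a bs q z = qhyp (a # q * csqrt a # - q * csqrt a # bs) (vwp_lower a bs q) q z"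

section \<open>The contour integral\<close>

definition pair_products :: "complex ^ 4 \<Rightarrow> complex list" where
  "pair_products t = [t$1 * t$2, t$1 * t$3, t$1 * t$4, t$2 * t$3, t$2 * t$4, t$3 * t$4]"

definition B2_integrand :: "complex \<Rightarrow> complex ^ 4 \<Rightarrow> complex \<Rightarrow> complex \<Rightarrow> complex" where
  "B2_integrand b t q z =
     qpochs_inf [z^2, 1 / z^2] q / qpochs_inf [b * z^2, b / z^2] q *
     (\<Prod>r\<in>UNIV. qpochs_inf [b * t$r * z, b * t$r / z] q / qpochs_inf [t$r * z, t$r / z] q) /
     (2 * of_real pi * \<i> * z)"

definition B2_along :: "complex \<Rightarrow> complex ^ 4 \<Rightarrow> complex \<Rightarrow> (real \<Rightarrow> complex) \<Rightarrow> complex" where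
  "B2_along b t q \<gamma> =
     qpochs_inf (pair_products t) q *
     (qpochs_inf [b^2, q * b^2, q] q / (2 * qpochs_inf [b, q * b] q)) *
     contour_integral \<gamma> (B2_integrand b t q)"

definition outer_points :: "complex \<Rightarrow> complex ^ 4 \<Rightarrow> complex \<Rightarrow> complex set" where
  "outer_points b t q = {z. (\<exists>r. qpoch_inf (t$r * z) q = 0) \<or> qpoch_inf (b * z^2) q = 0}"

text \<open>A closed path, homotopic in the punctured plane to the positively traversed unit circle,
  that has the zeros outside (winding number 0) and their reciprocals inside (winding number 1).
  Note that 0 is never an outer point.\<close>

definition admissible :: "complex \<Rightarrow> complex ^ 4 \<Rightarrow> complex \<Rightarrow> (real \<Rightarrow> complex) \<Rightarrow> bool" where
  "admissible b t q \<gamma> \<longleftrightarrow>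
     valid_path \<gamma> \<and> homotopic_loops (- {0}) (circlepath 0 1) \<gamma> \<and>
     (\<forall>z\<in>outer_points b t q.
        z \<notin> path_image \<gamma> \<and> inverse z \<notin> path_image \<gamma> \<and>
        winding_number \<gamma> z = 0 \<and> winding_number \<gamma> (inverse z) = 1)"

section \<open>Analytic continuation in the parameters\<close>

text \<open>Joint analyticity in \<open>b\<close> and the components of \<open>t\<close>, expressed as continuity together
  with complex differentiability in each variable separately (Osgood's lemma).\<close>

definition jointly_analytic ::
    "(complex \<times> (complex ^ 4) \<Rightarrow> complex) \<Rightarrow> (complex \<times> (complex ^ 4)) set \<Rightarrow> bool" where
  "jointly_analytic F U \<longleftrightarrow> open U \<and> continuous_on U F \<and>
     (\<forall>(b, t)\<in>U. (\<lambda>w. F (w, t)) field_differentiable at b \<and>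
        (\<forall>r. (\<lambda>w. F (b, t + axis r w)) field_differentiable at 0))"

definition param_domain :: "(complex \<times> (complex ^ 4)) set" where
  "param_domain = {(b, t). 0 < norm b \<and> norm b < 1 \<and> (\<forall>r. t$r \<noteq> 0)}"

definition B2_continuation :: "complex \<Rightarrow> complex ^ 4 \<Rightarrow> complex \<Rightarrow> complex \<Rightarrow> bool" where
  "B2_continuation b t q v \<longleftrightarrow>
     (\<exists>U F. (b, t) \<in> U \<and> U \<subseteq> param_domain \<and> connected U \<and> jointly_analytic F U \<and>
        (\<exists>(b', t')\<in>U. \<exists>\<gamma>. admissible b' t' q \<gamma>) \<and>
        (\<forall>(b', t')\<in>U. \<forall>\<gamma>. admissible b' t' q \<gamma> \<longrightarrow> F (b', t') = B2_along b' t' q \<gamma>) \<and>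
        v = F (b, t))"

text \<open>The continued quantity is the whole product of prefactor and integral: where
  \<open>t$r * t$s * q ^ k = 1\<close> for some \<open>r \<noteq> s\<close> the integral alone has a pole, which is cancelled by a zero
  of the prefactor. The description operator pins down a value only if it is unique, in particular
  independent of the contour and of the continuation.\<close>

definition B2 :: "complex \<Rightarrow> complex ^ 4 \<Rightarrow> complex \<Rightarrow> complex" where
  "B2 b t q = (THE v.
     if \<exists>\<gamma>. admissible b t q \<gamma> then \<exists>\<gamma>. admissible b t q \<gamma> \<and> v = B2_along b t q \<gamma>
     else B2_continuation b t q v)"

section \<open>The right-hand side\<close>

definition W_params :: "complex \<Rightarrow> complex ^ 4 \<Rightarrow> complex \<Rightarrow> complex \<Rightarrow> complex list" where
  "W_params b t T q = pair_products t @
     [q / b, b * T / csqrt q, - (b * T / csqrt q), b * T, - (b * T)]"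

text \<open>No denominator vanishes: neither in the prefactor nor in any term of the series.\<close>

definition generic :: "complex \<Rightarrow> complex ^ 4 \<Rightarrow> complex \<Rightarrow> complex \<Rightarrow> bool" where
  "generic b t T q \<longleftrightarrow> qpochs_inf [q * b, b * T^2] q \<noteq> 0 \<and>
     (\<forall>k. qpochs (q # vwp_lower (b * T^2 / q) (W_params b t T q) q) q k \<noteq> 0)"

end

theory Submission
  imports Defs
begin

text \<open>
  Throughout, \<open>P x\<close> is \<open>(x;q)\<close>, \<open>Pn x k\<close> is \<open>(x;q)\<^sub>k\<close>, \<open>x1, x2, x3, x4\<close> are the parameters,
  \<open>Y\<close> is their product and \<open>Q\<^sup>2 = q\<close>. The integral over the unit circle is \<open>Fint b x1 x2 x3 x4\<close>
  (a mean value, without prefactor). The series side is \<open>Wser\<close>: the very well poised series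
  multiplied by \<open>P Y\<close> and by all \<open>P (b x\<^sub>r x\<^sub>s)\<close>, whose terms then have no poles in the parameters;
  \<open>Fser\<close> is its quotient by \<open>P (b Y)\<close> and all \<open>P (x\<^sub>r x\<^sub>s)\<close>. The theorem amounts to
  \<open>P q * Fint = 2 * P b * Fser\<close>.

  For small parameters (\<open>small_parameters_identity\<close>) both sides are shown to solve the same equation
  \[ \sum_i A_i f(q x_i) = (1+b) (f(x) + b^2 f(Q x)), \qquad
     A_i = \prod_{j \neq i} \frac{b x_i - x_j}{x_i - x_j}, \]
  where \<open>f(q x\<^sub>i)\<close> has only \<open>x\<^sub>i\<close> multiplied by \<open>q\<close> and \<open>f(Q x)\<close> all four variables by \<open>Q\<close>. For the
  integral (\<open>Fint_q_difference\<close>) partial fractions add up the four shifted integrands, and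
  the two extra terms become the integrand at \<open>Q x\<close> when the circle is moved by \<open>z \<mapsto> Q/z\<close>.
  For the series (\<open>Fser_q_difference\<close>) the coefficients are compared term by term, which is a
  rational identity in four variables (\<open>four_variable_identity\<close>).

  The equation determines \<open>f\<close> from its values at \<open>x4 = 0\<close>. On a torus \<open>|x\<^sub>i| = s\<^sup>i\<close> with \<open>s\<close> and \<open>|b|\<close>
  small, the coefficients \<open>A\<^sub>1, A\<^sub>2, A\<^sub>3\<close> are of order \<open>s\<close> and \<open>A\<^sub>4\<close> is close to \<open>1\<close>, but if \<open>f\<close> vanishes
  at \<open>x4 = 0\<close>, the Schwarz lemma bounds \<open>f(q x\<^sub>4)\<close> by \<open>|q|\<close> times the supremum of \<open>f\<close>. So the difference of
  the two sides is bounded by a factor less than \<open>1\<close> times its own supremum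
  (\<open>contraction_imp_zero\<close>). Its vanishing at \<open>x4 = 0\<close> is proved in the same way with three variables,
  and then with two, where a simpler relation takes the place of the equation. If only one variable is
  left, both sides are constant, and \<open>Fint b 0 0 0 0\<close> is found from a recursion in \<open>b\<close>. The identity theorem
  in \<open>b\<close> removes the bound on \<open>|b|\<close>.

  On a general contour finitely many poles matter. The integrand is symmetric under \<open>z \<mapsto> 1/z\<close>, so it is
  a combination of terms \<open>E z / ((1 - p z) (1 - p/z))\<close>, whose integrals depend on the contour only through
  winding numbers and are explicit in \<open>p\<close> (\<open>cint_eq_pole_sum\<close>). The result is holomorphic in a
  common scaling \<open>s\<close> of the parameters, off finitely many \<open>s\<close>, so the identity extends from small
  parameters to every contour (\<open>integral_identity_distinct\<close>). Coinciding poles are avoided by moving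
  the parameters slightly, keeping the contour (\<open>integral_identity_admissible\<close>).

  Consequently \<open>P (b Y)\<close> times the integral side is an explicit analytic function of all
  parameters, for every admissible contour. That makes the value independent of the contour, and the
  series itself is the analytic continuation; uniqueness of the continuation is the identity theorem,
  one variable at a time, on a connected domain (\<open>B2_value\<close>). Finally the terms of the series are matched
  (\<open>vwp_term\<close>).
\<close>

section \<open>Infinite products\<close>

locale nome =
  fixes q :: complex
  assumes q_nz: "q \<noteq> 0" and q_less_1: "norm q < 1"
begin

abbreviation P :: "complex \<Rightarrow> complex" where "P x \<equiv> qpoch_inf x q"

abbreviation Pn :: "complex \<Rightarrow> nat \<Rightarrow> complex" where "Pn x k \<equiv> qpoch x q k"

lemma summable_norm_q: "summable (\<lambda>r. norm x * norm q ^ r)"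
  using q_less_1 by (intro summable_mult summable_geometric) auto

lemma conv_P: "convergent_prod (\<lambda>r. 1 - x * q ^ r)"
proof -
  have "summable (\<lambda>r. norm ((1 - x * q ^ r) - 1))"
    using summable_norm_q[of x] by (simp add: norm_mult norm_power)
  thus ?thesis
    by (intro abs_convergent_prod_imp_convergent_prod) (simp add: abs_convergent_prod_conv_summable)
qed

lemma has_prod_P: "(\<lambda>r. 1 - x * q ^ r) has_prod P x"
  unfolding qpoch_inf_def by (rule convergent_prod_has_prod[OF conv_P])

lemma Pn_tendsto_P: "(\<lambda>k. Pn x k) \<longlonglongrightarrow> P x"
  using has_prod_imp_tendsto'[OF has_prod_P] by (simp add: qpoch_def)

lemma Pn_0 [simp]: "Pn x 0 = 1"
  by (simp add: qpoch_def)

lemma Pn_Suc: "Pn x (Suc k) = Pn x k * (1 - x * q ^ k)"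
  by (simp add: qpoch_def)

lemma Pn_Suc_shift: "Pn x (Suc k) = (1 - x) * Pn (x * q) k"
  unfolding qpoch_def by (subst prod.lessThan_Suc_shift) (simp add: mult_ac)

lemma P_rec: "P x = (1 - x) * P (q * x)"
proof (rule LIMSEQ_unique)
  show "(\<lambda>k. Pn x (Suc k)) \<longlonglongrightarrow> P x"
    using Pn_tendsto_P by (rule LIMSEQ_Suc)
  show "(\<lambda>k. Pn x (Suc k)) \<longlonglongrightarrow> (1 - x) * P (q * x)"
    unfolding Pn_Suc_shift mult.commute[of x q] by (intro tendsto_intros Pn_tendsto_P)
qed

lemma P_split: "P x = Pn x k * P (x * q ^ k)"
proof (induction k)
  case (Suc k)
  have "P (x * q ^ k) = (1 - x * q ^ k) * P (x * q ^ Suc k)"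
    by (subst P_rec) (simp add: mult_ac)
  thus ?case
    using Suc by (simp add: Pn_Suc mult_ac)
qed auto

lemma P_eq_0_iff: "P x = 0 \<longleftrightarrow> (\<exists>r. x * q ^ r = 1)"
proof -
  have "0 = 1 - a \<longleftrightarrow> a = 1" for a :: complex
    by (metis diff_eq_diff_eq diff_self)
  thus ?thesis
    using has_prod_eq_0_iff[OF has_prod_P[of x]] by (simp add: image_iff)
qed

lemma P_nz: "norm x < 1 \<Longrightarrow> P x \<noteq> 0"
proof
  assume x: "norm x < 1" and "P x = 0"
  then obtain r where "x * q ^ r = 1" by (auto simp: P_eq_0_iff)
  hence "norm x * norm q ^ r = 1" by (metis norm_mult norm_one norm_power)
  moreover have "norm x * norm q ^ r \<le> norm x"
    using q_less_1 by (simp add: mult_left_le power_le_one)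
  ultimately show False using x by simp
qed

lemma Pn_nz: "norm x < 1 \<Longrightarrow> Pn x k \<noteq> 0"
  using P_nz P_split[of x k] by auto

lemma Pn_q_nz: "Pn q k \<noteq> 0"
  using Pn_nz q_less_1 by blast

lemma P_at_0 [simp]: "P 0 = 1"
  by (simp add: qpoch_inf_def)

lemma P_at_1 [simp]: "P 1 = 0"
  by (subst P_rec) simp

text \<open>The bound is uniform in \<open>k\<close>; it passes to the limit and controls all products in the
  terms of the series.\<close>

lemma norm_Pn_le: "norm (Pn x k) \<le> exp (norm x / (1 - norm q))"
proof -
  have "norm (Pn x k) = (\<Prod>r<k. norm (1 - x * q ^ r))"
    by (simp add: qpoch_def prod_norm)
  also have "\<dots> \<le> (\<Prod>r<k. 1 + norm x * norm q ^ r)"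
  proof (intro prod_mono conjI norm_ge_zero)
    fix r
    show "norm (1 - x * q ^ r) \<le> 1 + norm x * norm q ^ r"
      using norm_triangle_ineq4[of 1 "x * q ^ r"] by (simp add: norm_mult norm_power)
  qed
  also have "\<dots> \<le> exp (\<Sum>r<k. norm x * norm q ^ r)"
    by (rule prod_le_exp_sum) auto
  also have "(\<Sum>r<k. norm x * norm q ^ r) \<le> (\<Sum>r. norm x * norm q ^ r)"
    by (rule sum_le_suminf[OF summable_norm_q]) auto
  also have "\<dots> = norm x / (1 - norm q)"
    using q_less_1 by (subst suminf_mult) (auto simp: suminf_geometric divide_simps)
  finally show ?thesis by simp
qed

lemma norm_P_le: "norm (P x) \<le> exp (norm x / (1 - norm q))"
  by (rule Lim_bounded[OF tendsto_norm[OF Pn_tendsto_P[of x]]]) (use norm_Pn_le in auto)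

lemma holomorphic_Pn: "(\<lambda>x. Pn x k) holomorphic_on A"
  unfolding qpoch_def by (intro holomorphic_intros)

lemma holomorphic_P_UNIV: "P holomorphic_on UNIV"
proof (rule holomorphic_uniform_sequence[where f = "\<lambda>k x. Pn x k"])
  fix x :: complex
  let ?A = "cball x 1"
  have "uniformly_convergent_on ?A (\<lambda>N x. \<Sum>n<N. norm (- x * q ^ n))"
  proof (rule Weierstrass_m_test')
    fix n y assume "y \<in> ?A"
    hence "norm y \<le> norm x + 1"
      using norm_triangle_ineq2[of y x] by (simp add: dist_norm norm_minus_commute)
    thus "norm (norm (- y * q ^ n)) \<le> (norm x + 1) * norm q ^ n"
      by (simp add: norm_mult norm_power mult_right_mono)
  next
    show "summable (\<lambda>n. (norm x + 1) * norm q ^ n)"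
      using q_less_1 by (intro summable_mult summable_geometric) auto
  qed
  hence "uniformly_convergent_on ?A (\<lambda>N x. \<Prod>n<N. 1 + (- x * q ^ n))"
    by (intro uniformly_convergent_on_prod continuous_intros) auto
  then obtain g where g: "uniform_limit ?A (\<lambda>k x. Pn x k) g sequentially"
    by (auto simp: uniformly_convergent_on_def qpoch_def)
  have "g y = P y" if "y \<in> ?A" for y
    using tendsto_uniform_limitI[OF g that] Pn_tendsto_P LIMSEQ_unique by blast
  hence "uniform_limit ?A (\<lambda>k x. Pn x k) P sequentially"
    using g by (subst uniform_limit_cong'[where g = "\<lambda>k x. Pn x k" and i = g]) auto
  thus "\<exists>d>0. cball x d \<subseteq> UNIV \<and> uniform_limit (cball x d) (\<lambda>k x. Pn x k) P sequentially"
    by (intro exI[of _ 1]) auto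
qed (auto intro: holomorphic_Pn)

lemma holomorphic_P [holomorphic_intros]:
  "f holomorphic_on A \<Longrightarrow> (\<lambda>x. P (f x)) holomorphic_on A"
  using holomorphic_on_compose_gen[OF _ holomorphic_P_UNIV, of f A] by (auto simp: o_def)

lemma holomorphic_Pn' [holomorphic_intros]:
  "f holomorphic_on A \<Longrightarrow> (\<lambda>x. Pn (f x) k) holomorphic_on A"
  using holomorphic_on_compose_gen[OF _ holomorphic_Pn[of k UNIV], of f A] by (auto simp: o_def)

lemma continuous_P [continuous_intros]:
  "continuous_on A f \<Longrightarrow> continuous_on A (\<lambda>x. P (f x))"
  using continuous_on_compose2[OF holomorphic_on_imp_continuous_on[OF holomorphic_P_UNIV], of A f]
  by auto

lemma continuous_Pn [continuous_intros]:
  "continuous_on A f \<Longrightarrow> continuous_on A (\<lambda>x. Pn (f x) k)"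
  unfolding qpoch_def by (intro continuous_intros)

end

section \<open>Contour means\<close>

definition annulus :: "real \<Rightarrow> real \<Rightarrow> complex set" where
  "annulus r R = {z. r < norm z \<and> norm z < R}"

lemma open_annulus [simp]: "open (annulus r R)"
  unfolding annulus_def by (intro open_Collect_conj open_Collect_less continuous_intros)

text \<open>The measure \<open>dz / (2 \<pi> \<i> z)\<close> is invariant under \<open>z \<mapsto> c z\<close>
  and, on the unit circle, under \<open>z \<mapsto> 1/z\<close>.\<close>

definition cint :: "(real \<Rightarrow> complex) \<Rightarrow> (complex \<Rightarrow> complex) \<Rightarrow> complex" where
  "cint \<gamma> f = contour_integral \<gamma> (\<lambda>z. f z / (2 * of_real pi * \<i> * z))"

abbreviation circ :: "real \<Rightarrow> real \<Rightarrow> complex" where "circ \<rho> \<equiv> circlepath 0 \<rho>"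

lemma homotopic_loops_scaled_circle:
  assumes "c \<noteq> 0"
  shows "homotopic_loops (- {0}) (circ 1) (\<lambda>x. c * circ 1 x)"
  unfolding homotopic_loops
proof (intro exI conjI ballI)
  let ?h = "\<lambda>(s::real, x). exp (of_real s * Ln c) * circ 1 x"
  have circ1: "circ 1 x = exp (2 * of_real pi * \<i> * of_real x)" for x
    by (simp add: circlepath)
  show "continuous_on ({0..1} \<times> {0..1}) ?h"
    unfolding case_prod_unfold circ1 by (intro continuous_intros)
  show "?h \<in> {0..1} \<times> {0..1} \<rightarrow> - {0}"
    by (auto simp: circ1)
  show "pathfinish (?h \<circ> Pair t) = pathstart (?h \<circ> Pair t)" for t
    by (simp add: pathfinish_def pathstart_def circlepath)
qed (use assms in auto)

lemma circ_scaled: "circ \<rho> = (\<lambda>x. of_real \<rho> * circ 1 x)"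
  by (simp add: circlepath fun_eq_iff)

lemma homotopic_loops_circ:
  assumes "\<rho> > 0"
  shows "homotopic_loops (- {0}) (circ 1) (circ \<rho>)"
  using homotopic_loops_scaled_circle[of "of_real \<rho>"] assms by (subst circ_scaled) simp

text \<open>Clamping the modulus to the range that occurs on the two loops retracts the punctured plane onto a
  closed annulus and fixes both loops.\<close>

lemma homotopic_loops_in_annulus:
  assumes hom: "homotopic_loops (- {0}) g h"
    and g: "path_image g \<subseteq> annulus r R" and h: "path_image h \<subseteq> annulus r R"
    and r: "0 \<le> r"
  shows "homotopic_loops (annulus r R) g h"
proof -
  have "path g" "path h"
    using homotopic_loops_imp_path[OF hom] by auto
  hence comp: "compact (path_image g \<union> path_image h)"
    by (intro compact_Un compact_path_image)
  have ne: "path_image g \<union> path_image h \<noteq> {}" by auto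
  obtain z1 where z1: "z1 \<in> path_image g \<union> path_image h"
      "\<And>z. z \<in> path_image g \<union> path_image h \<Longrightarrow> norm z1 \<le> norm z"
    using continuous_attains_inf[OF comp ne continuous_on_norm_id] by blast
  obtain z2 where z2: "z2 \<in> path_image g \<union> path_image h"
      "\<And>z. z \<in> path_image g \<union> path_image h \<Longrightarrow> norm z \<le> norm z2"
    using continuous_attains_sup[OF comp ne continuous_on_norm_id] by blast
  define \<rho> where "\<rho> = (\<lambda>z::complex. z * of_real (max (norm z1) (min (norm z2) (norm z)) / norm z))"
  have ann: "z1 \<in> annulus r R" "z2 \<in> annulus r R"
    using z1 z2 g h by auto
  have norm_\<rho>: "norm (\<rho> z) = max (norm z1) (min (norm z2) (norm z))" if "z \<noteq> 0" for z
    using that unfolding \<rho>_def norm_mult norm_of_real by (auto simp: max_def min_def)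
  have "homotopic_loops (annulus r R) (\<rho> \<circ> g) (\<rho> \<circ> h)"
  proof (rule homotopic_loops_continuous_image[OF hom])
    show "continuous_on (- {0}) \<rho>"
      unfolding \<rho>_def by (intro continuous_intros) auto
    show "\<rho> \<in> - {0} \<rightarrow> annulus r R"
      using ann z1(2)[OF z2(1)] norm_\<rho> by (auto simp: annulus_def max_def min_def)
  qed
  moreover have "\<rho> z = z" if "z \<in> path_image g \<union> path_image h" for z
    using z1(2)[OF that] z2(2)[OF that] ann r
    by (auto simp: \<rho>_def annulus_def max_def min_def)
  hence "(\<rho> \<circ> g) x = g x" "(\<rho> \<circ> h) x = h x" if "x \<in> {0..1}" for x
    using that by (auto simp: path_image_def)
  ultimately show ?thesis
    unfolding homotopic_loops by (metis (no_types, lifting))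
qed

lemma path_image_scaled_circle:
  assumes "z \<in> path_image (\<lambda>x. c * circ 1 x)"
  shows "norm z = norm c"
  using assms by (auto simp: path_image_def circlepath norm_mult)

lemma valid_path_scaled_circle [simp]: "valid_path (\<lambda>x. c * circ 1 x)"
proof -
  have "valid_path ((\<lambda>z. c * z) \<circ> circ 1)"
    by (rule valid_path_compose_holomorphic[of _ _ UNIV]) (auto intro!: holomorphic_intros)
  thus ?thesis by (simp add: o_def)
qed

lemma cint_homotopic:
  assumes f: "f holomorphic_on annulus r R" and r: "0 \<le> r"
    and g: "valid_path g" "path_image g \<subseteq> annulus r R" "homotopic_loops (- {0}) (circ 1) g"
    and h: "valid_path h" "path_image h \<subseteq> annulus r R" "homotopic_loops (- {0}) (circ 1) h"
  shows "cint g f = cint h f"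
proof -
  have "homotopic_loops (- {0}) g h"
    using g(3) h(3) homotopic_loops_sym homotopic_loops_trans by blast
  have nz: "z \<noteq> 0" if "z \<in> annulus r R" for z
    using that r by (auto simp: annulus_def)
  from homotopic_loops_in_annulus[OF \<open>homotopic_loops (- {0}) g h\<close> g(2) h(2) r] show ?thesis
    unfolding cint_def
    by (rule Cauchy_theorem_homotopic_loops)
       (use f g h nz in \<open>auto intro!: holomorphic_intros\<close>)
qed

lemma cint_circ:
  assumes "\<rho> > 0"
  shows "cint (circ \<rho>) f = integral (cbox 0 1) (\<lambda>x. f (circ \<rho> x))"
  unfolding cint_def contour_integral_integral cbox_interval
proof (rule integral_cong)
  fix x :: real
  have "vector_derivative (circ \<rho>) (at x) = 2 * of_real pi * \<i> * circ \<rho> x"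
    unfolding vector_derivative_circlepath by (simp add: circlepath)
  moreover have "circ \<rho> x \<noteq> 0"
    using assms by (simp add: circlepath)
  ultimately show "f (circ \<rho> x) / (2 * of_real pi * \<i> * circ \<rho> x) *
      vector_derivative (circ \<rho>) (at x) = f (circ \<rho> x)"
    by simp
qed

lemma cint_circ_scaled:
  assumes "c \<noteq> 0"
  shows "cint (\<lambda>x. c * circ 1 x) f = cint (circ 1) (\<lambda>z. f (c * z))"
proof -
  have "cint (\<lambda>x. c * circ 1 x) f =
          contour_integral ((\<lambda>z. c * z) \<circ> circ 1) (\<lambda>z. f z / (2 * of_real pi * \<i> * z))"
    by (simp add: cint_def o_def)
  also have "\<dots> = contour_integral (circ 1)
      (\<lambda>w. deriv (\<lambda>z. c * z) w * (f (c * w) / (2 * of_real pi * \<i> * (c * w))))"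
    by (rule contour_integral_comp_analyticW[of _ UNIV]) (auto intro!: analytic_intros)
  also have "\<dots> = cint (circ 1) (\<lambda>z. f (c * z))"
    unfolding cint_def using assms by (intro contour_integral_cong) auto
  finally show ?thesis .
qed

lemma cint_scale:
  assumes f: "f holomorphic_on annulus r R" and r: "0 \<le> r" "r < 1" "1 < R" "r < norm c" "norm c < R"
  shows "cint (circ 1) (\<lambda>z. f (c * z)) = cint (circ 1) f"
proof -
  have "c \<noteq> 0" using r by auto
  have "cint (\<lambda>x. c * circ 1 x) f = cint (circ 1) f"
    by (rule cint_homotopic[OF f])
       (use r \<open>c \<noteq> 0\<close> path_image_scaled_circle[of _ c] in
         \<open>auto simp: annulus_def intro: homotopic_loops_scaled_circle homotopic_loops_circ\<close>)
  thus ?thesis using cint_circ_scaled[OF \<open>c \<noteq> 0\<close>] by simp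
qed

lemma cint_inverse: "cint (circ 1) (\<lambda>z. f (1 / z)) = cint (circ 1) f"
proof -
  let ?k = "\<lambda>z. f z / (2 * of_real pi * \<i> * z)"
  have "inverse \<circ> circ 1 = reversepath (circ 1)"
    by (simp add: fun_eq_iff reversepath_def circlepath ring_distribs exp_diff divide_inverse
                  exp_minus [symmetric])
  hence "- cint (circ 1) f = contour_integral (inverse \<circ> circ 1) ?k"
    by (simp add: cint_def contour_integral_reversepath)
  also have "\<dots> = contour_integral (circ 1) (\<lambda>w. deriv inverse w * ?k (inverse w))"
    by (rule contour_integral_comp_analyticW[of _ "- {0}"]) (auto intro!: analytic_intros)
  also have "\<dots> = contour_integral (circ 1) (\<lambda>w. - (f (1 / w) / (2 * of_real pi * \<i> * w)))"
  proof (rule contour_integral_cong)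
    fix w assume "w \<in> path_image (circ 1)"
    hence "w \<noteq> 0" by auto
    hence "deriv inverse w = - (inverse w ^ 2)"
      by (intro DERIV_imp_deriv) (auto intro!: derivative_eq_intros simp: power2_eq_square)
    thus "deriv inverse w * ?k (inverse w) = - (f (1 / w) / (2 * of_real pi * \<i> * w))"
      using \<open>w \<noteq> 0\<close> by (simp add: field_simps power2_eq_square)
  qed auto
  also have "\<dots> = - cint (circ 1) (\<lambda>z. f (1 / z))"
    by (simp add: cint_def contour_integral_neg)
  finally show ?thesis by simp
qed

lemma cint_cong:
  "(\<And>z. z \<in> path_image g \<Longrightarrow> f z = f' z) \<Longrightarrow> cint g f = cint g f'"
  unfolding cint_def by (intro contour_integral_cong) auto

lemma circ_integrable:
  fixes f :: "complex \<Rightarrow> complex"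
  assumes "\<rho> > 0" "continuous_on (sphere 0 \<rho>) f"
  shows "(\<lambda>x. f (circ \<rho> x)) integrable_on (cbox 0 1)"
  unfolding cbox_interval
proof (rule integrable_continuous_interval)
  show "continuous_on {0..1} (\<lambda>x. f (circ \<rho> x))"
    by (rule continuous_on_compose2[OF assms(2)])
       (use assms(1) in \<open>auto simp: circlepath norm_mult intro!: continuous_intros\<close>)
qed

lemma cint_add:
  assumes "\<rho> > 0" "continuous_on (sphere 0 \<rho>) f" "continuous_on (sphere 0 \<rho>) g"
  shows "cint (circ \<rho>) (\<lambda>z. f z + g z) = cint (circ \<rho>) f + cint (circ \<rho>) g"
  unfolding cint_circ[OF assms(1)] by (intro integral_add circ_integrable assms)

lemma cint_cmult: "cint g (\<lambda>z. c * f z) = c * cint g f" if "continuous_on (path_image g) f" "\<rho> > 0" "g = circ \<rho>"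
  unfolding that cint_circ[OF that(2)] by simp

lemma cint_const [simp]: "\<rho> > 0 \<Longrightarrow> cint (circ \<rho>) (\<lambda>z. c) = c"
  by (simp add: cint_circ)

lemma continuous_cint:
  assumes \<rho>: "\<rho> > 0" and h: "continuous_on (U \<times> sphere 0 \<rho>) (\<lambda>(w, z). h w z)"
  shows "continuous_on U (\<lambda>w. cint (circ \<rho>) (h w))"
proof -
  have "continuous_on (U \<times> cbox 0 1) (\<lambda>(w, x). h w (circ \<rho> x))"
    using \<rho> unfolding case_prod_unfold
    by (intro continuous_on_compose2[OF h[unfolded case_prod_unfold], of _ "\<lambda>p. (fst p, circ \<rho> (snd p))", simplified])
       (auto simp: circlepath norm_mult intro!: continuous_intros)
  from integral_continuous_on_param[OF this] show ?thesis
    by (simp add: cint_circ[OF \<rho>])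
qed

text \<open>Morera: the integral over a triangle is exchanged with the integral over the circle.\<close>

lemma holomorphic_cint:
  assumes \<rho>: "\<rho> > 0" and U: "open U"
    and h: "continuous_on (U \<times> sphere 0 \<rho>) (\<lambda>(w, z). h w z)"
    and hol: "\<And>z. norm z = \<rho> \<Longrightarrow> (\<lambda>w. h w z) holomorphic_on U"
  shows "(\<lambda>w. cint (circ \<rho>) (h w)) holomorphic_on U"
proof -
  have "(\<lambda>w. cint (circ \<rho>) (h w)) analytic_on U"
  proof (rule Morera_triangle[OF continuous_cint[OF \<rho> h] U], intro impI)
    fix a b c assume sub: "convex hull {a, b, c} \<subseteq> U"
    let ?k = "\<lambda>w z. h w z / (2 * of_real pi * \<i> * z)"
    have seg: "path_image (linepath x y) \<subseteq> U" if "x \<in> {a,b,c}" "y \<in> {a,b,c}" for x y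
      using that sub closed_segment_subset_convex_hull[of x "{a,b,c}" y] hull_inc[of _ "{a,b,c}"]
      by (metis (no_types, lifting) order.trans path_image_linepath)
    have kcont: "continuous_on (U \<times> sphere 0 \<rho>) (\<lambda>(w, z). ?k w z)"
      using h \<rho> unfolding case_prod_unfold by (intro continuous_intros) auto
    have sph: "path_image (circ \<rho>) = sphere 0 \<rho>"
      using \<rho> by simp
    have swap: "contour_integral (linepath x y) (\<lambda>w. cint (circ \<rho>) (h w)) =
          contour_integral (circ \<rho>) (\<lambda>z. contour_integral (linepath x y) (\<lambda>w. ?k w z))"
      if "x \<in> {a,b,c}" "y \<in> {a,b,c}" for x y
      unfolding cint_def
    proof (rule contour_integral_swap)
      show "continuous_on (path_image (linepath x y) \<times> path_image (circ \<rho>)) (\<lambda>(w, z). ?k w z)"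
        by (rule continuous_on_subset[OF kcont]) (use seg[OF that] sph in auto)
      show "continuous_on {0..1} (\<lambda>t. vector_derivative (linepath x y) (at t))"
        by (simp add: vector_derivative_linepath_at)
      show "continuous_on {0..1} (\<lambda>t. vector_derivative (circ \<rho>) (at t))"
        unfolding vector_derivative_circlepath by (intro continuous_intros)
    qed auto
    have int: "(\<lambda>z. contour_integral (linepath x y) (\<lambda>w. ?k w z)) contour_integrable_on (circ \<rho>)"
      if "x \<in> {a,b,c}" "y \<in> {a,b,c}" for x y
    proof (rule contour_integrable_continuous_circlepath)
      have "continuous_on (sphere 0 \<rho> \<times> cbox 0 1) (\<lambda>(z, t). ?k (linepath x y t) z * (y - x))"
        unfolding case_prod_unfold
        by (intro continuous_intros continuous_on_compose2[OF kcont[unfolded case_prod_unfold],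
              of _ "\<lambda>p. (linepath x y (snd p), fst p)", simplified] continuous_on_linepath)
           (use seg[OF that] \<rho> in \<open>auto simp: path_image_def linepath_def intro!: continuous_intros\<close>)
      from integral_continuous_on_param[OF this]
      show "continuous_on (path_image (circ \<rho>)) (\<lambda>z. contour_integral (linepath x y) (\<lambda>w. ?k w z))"
        using \<rho> by (simp add: contour_integral_integral vector_derivative_linepath_at)
    qed
    have "contour_integral (linepath a b) (\<lambda>w. cint (circ \<rho>) (h w)) +
          contour_integral (linepath b c) (\<lambda>w. cint (circ \<rho>) (h w)) +
          contour_integral (linepath c a) (\<lambda>w. cint (circ \<rho>) (h w)) =
          contour_integral (circ \<rho>) (\<lambda>z. contour_integral (linepath a b) (\<lambda>w. ?k w z) +
            contour_integral (linepath b c) (\<lambda>w. ?k w z) +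
            contour_integral (linepath c a) (\<lambda>w. ?k w z))"
      using int by (simp add: swap contour_integral_add contour_integrable_add)
    also have "\<dots> = contour_integral (circ \<rho>) (\<lambda>z. 0)"
    proof (rule contour_integral_cong)
      fix z assume "z \<in> path_image (circ \<rho>)"
      hence z: "norm z = \<rho>" "z \<noteq> 0" using \<rho> by auto
      have hol': "(\<lambda>w. ?k w z) holomorphic_on convex hull {a, b, c}"
        by (intro holomorphic_intros holomorphic_on_subset[OF hol sub]) (use z in auto)
      show "contour_integral (linepath a b) (\<lambda>w. ?k w z) + contour_integral (linepath b c) (\<lambda>w. ?k w z) +
            contour_integral (linepath c a) (\<lambda>w. ?k w z) = 0"
        using has_chain_integral_chain_integral3[OF Cauchy_theorem_triangle[OF hol']] by simp
    qed auto
    finally show "contour_integral (linepath a b) (\<lambda>w. cint (circ \<rho>) (h w)) +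
          contour_integral (linepath b c) (\<lambda>w. cint (circ \<rho>) (h w)) +
          contour_integral (linepath c a) (\<lambda>w. cint (circ \<rho>) (h w)) = 0" by simp
  qed
  thus ?thesis by (rule analytic_imp_holomorphic)
qed

section \<open>The series and its analytic dependence on the parameters\<close>

definition pairs :: "(complex \<Rightarrow> complex) \<Rightarrow> complex \<Rightarrow> complex \<Rightarrow> complex \<Rightarrow> complex \<Rightarrow> complex" where
  "pairs f x1 x2 x3 x4 =
     f (x1 * x2) * f (x1 * x3) * f (x1 * x4) * f (x2 * x3) * f (x2 * x4) * f (x3 * x4)"

lemma norm_mult_lt_1: "norm x < 1 \<Longrightarrow> norm y < 1 \<Longrightarrow> norm (x * y :: complex) < 1"
  using mult_strict_mono'[of "norm x" 1 "norm y" 1] by (simp add: norm_mult)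

context nome
begin

definition u_coeff :: "complex \<Rightarrow> nat \<Rightarrow> complex" where
  "u_coeff b k = Pn (q / b) k * b ^ (2 * k) / Pn q k"

text \<open>The factor \<open>(1 - b Y q\<^bsup>2k-1\<^esup>) (b Y;q)\<^bsub>k-1\<^esub>\<close>, with the
  value \<open>1\<close> at \<open>k = 0\<close>; it is the very well poised factor times \<open>(b
  Y/q;q)\<^sub>k\<close>, with \<open>1 - b Y/q\<close> cancelled.\<close>

definition c_coeff :: "complex \<Rightarrow> complex \<Rightarrow> nat \<Rightarrow> complex" where
  "c_coeff b Y k = (case k of 0 \<Rightarrow> 1 | Suc j \<Rightarrow> (1 - b * Y * q ^ (2 * j + 1)) * Pn (b * Y) j)"

text \<open>A term of the very well poised series times \<open>P Y\<close> and all \<open>P (b x\<^sub>r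
  x\<^sub>s)\<close>. The infinite products absorb the finite ones in the denominators, so for \<open>b \<noteq>
  0\<close> no parameters are exceptional.\<close>

definition Wterm :: "complex \<Rightarrow> complex \<Rightarrow> complex \<Rightarrow> complex \<Rightarrow> complex \<Rightarrow> nat \<Rightarrow> complex" where
  "Wterm b x1 x2 x3 x4 k =
     u_coeff b k * P (x1 * x2 * x3 * x4 * q ^ (2 * k)) * c_coeff b (x1 * x2 * x3 * x4) k *
     Pn (b ^ 2 * (x1 * x2 * x3 * x4) * q ^ (k - 1)) k *
     pairs (\<lambda>x. P (b * x * q ^ k) * Pn x k) x1 x2 x3 x4"

definition Wser :: "complex \<Rightarrow> complex \<Rightarrow> complex \<Rightarrow> complex \<Rightarrow> complex \<Rightarrow> complex" where
  "Wser b x1 x2 x3 x4 = (\<Sum>k. Wterm b x1 x2 x3 x4 k)"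

definition expq :: "real \<Rightarrow> real" where "expq u = exp (u / (1 - norm q))"

lemma expq_mono: "u \<le> v \<Longrightarrow> expq u \<le> expq v"
  unfolding expq_def using q_less_1 by (simp add: divide_right_mono)

lemma expq_ge_0 [simp]: "expq u \<ge> 0"
  by (simp add: expq_def)

lemma norm_P_le': "norm x \<le> u \<Longrightarrow> norm (P x) \<le> expq u"
  by (rule order.trans[OF norm_P_le[folded expq_def] expq_mono])

lemma norm_Pn_le': "norm x \<le> u \<Longrightarrow> norm (Pn x k) \<le> expq u"
  by (rule order.trans[OF norm_Pn_le[folded expq_def] expq_mono])

lemma norm_qpow_le: "norm (q ^ k) \<le> 1"
  using q_less_1 by (simp add: norm_power power_le_one)

lemma norm_mult_qpow_le: "norm x \<le> u \<Longrightarrow> norm (x * q ^ k) \<le> u"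
  using mult_left_le[OF norm_qpow_le[of k] norm_ge_zero[of x]] by (simp add: norm_mult)

lemma norm_mult_le2: "norm x \<le> u \<Longrightarrow> norm y \<le> v \<Longrightarrow> norm (x * y :: complex) \<le> u * v"
  by (simp add: norm_mult mult_mono' )

lemma norm_inverse_Pn_q_le: "norm (1 / Pn q k) \<le> expq 1 / norm (P q)"
proof -
  have nz: "P q \<noteq> 0" "Pn q k \<noteq> 0"
    using P_nz Pn_q_nz q_less_1 by auto
  hence "1 / Pn q k = P (q * q ^ k) / P q"
    using P_split[of q k] by (simp add: field_simps)
  moreover have "norm (P (q * q ^ k)) \<le> expq 1"
    using q_less_1 by (intro norm_P_le' norm_mult_qpow_le) auto
  ultimately show ?thesis
    by (simp add: norm_divide divide_right_mono)
qed

lemma norm_u_coeff_le: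
  assumes "0 < \<beta>" "\<beta> \<le> norm b" "norm b \<le> B"
  shows "norm (u_coeff b k) \<le> expq (1 / \<beta>) * (expq 1 / norm (P q)) * (B\<^sup>2) ^ k"
proof -
  have "norm (q / b) \<le> 1 / \<beta>"
    using assms q_less_1 by (auto simp: norm_divide intro!: frac_le)
  hence "norm (Pn (q / b) k * (1 / Pn q k) * (b^2) ^ k) \<le>
           expq (1 / \<beta>) * (expq 1 / norm (P q)) * (B\<^sup>2) ^ k"
    using assms
    by (intro norm_mult_le2 norm_Pn_le' norm_inverse_Pn_q_le)
       (auto simp: norm_power intro!: power_mono)
  thus ?thesis
    by (simp add: u_coeff_def power_mult)
qed

lemma norm_c_coeff_le:
  assumes "norm (b * Y) \<le> R"
  shows "norm (c_coeff b Y k) \<le> (1 + R) * expq R"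
proof (cases k)
  case 0
  have R: "0 \<le> R" using assms norm_ge_zero[of "b * Y"] by linarith
  hence "1 \<le> expq R" using q_less_1 by (simp add: expq_def)
  hence "1 * 1 \<le> (1 + R) * expq R" using R by (intro mult_mono) auto
  thus ?thesis using 0 by (simp add: c_coeff_def)
next
  case (Suc j)
  have "norm (1 - b * Y * q ^ (2 * j + 1)) \<le> 1 + norm (b * Y * q ^ (2 * j + 1))"
    using norm_triangle_ineq4[of 1 "b * Y * q ^ (2 * j + 1)"] by simp
  also have "\<dots> \<le> 1 + R"
    using norm_mult_qpow_le[OF assms, of "2 * j + 1"] by simp
  finally have "norm ((1 - b * Y * q ^ (2 * j + 1)) * Pn (b * Y) j) \<le> (1 + R) * expq R"
    by (intro norm_mult_le2 norm_Pn_le' assms)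
  thus ?thesis using Suc by (simp add: c_coeff_def)
qed

lemma norm_Wterm_le:
  assumes b: "0 < \<beta>" "\<beta> \<le> norm b" "norm b \<le> B" "B < 1"
    and x: "norm x1 \<le> R" "norm x2 \<le> R" "norm x3 \<le> R" "norm x4 \<le> R"
  shows "norm (Wterm b x1 x2 x3 x4 k) \<le>
    expq (1 / \<beta>) * (expq 1 / norm (P q)) * (B\<^sup>2) ^ k * expq (R*R*R*R) * ((1 + (R*R*R*R)) * expq (R*R*R*R)) *
    expq (R*R*R*R) * (expq (R*R) * expq (R*R)) ^ 6"
proof -
  have R: "R \<ge> 0" using x(1) norm_ge_zero[of x1] by linarith
  have b1: "norm b \<le> 1" "norm (b^2) \<le> 1" using b by (auto simp: norm_power power_le_one)
  have Y: "norm (x1 * x2 * x3 * x4) \<le> R*R*R*R"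
    by (intro norm_mult_le2 x)
  have bY: "norm (b * (x1 * x2 * x3 * x4)) \<le> R*R*R*R" "norm (b^2 * (x1 * x2 * x3 * x4)) \<le> R*R*R*R"
    using norm_mult_le2[OF b1(1) Y] norm_mult_le2[OF b1(2) Y] by auto
  have pr: "norm (P (b * (x * y) * q ^ k) * Pn (x * y) k) \<le> expq (R*R) * expq (R*R)"
    if "norm x \<le> R" "norm y \<le> R" for x y
    using norm_mult_le2[OF that] norm_mult_le2[OF b1(1) norm_mult_le2[OF that]]
    by (intro norm_mult_le2[OF norm_P_le' norm_Pn_le'] norm_mult_qpow_le) auto
  have "norm (pairs (\<lambda>x. P (b * x * q ^ k) * Pn x k) x1 x2 x3 x4) \<le>
     (expq (R*R) * expq (R*R)) * (expq (R*R) * expq (R*R)) * (expq (R*R) * expq (R*R)) *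
     (expq (R*R) * expq (R*R)) * (expq (R*R) * expq (R*R)) * (expq (R*R) * expq (R*R))"
    unfolding pairs_def by (intro norm_mult_le2[OF norm_mult_le2[OF norm_mult_le2[OF norm_mult_le2[OF norm_mult_le2]]]] pr x)
  also have "\<dots> = (expq (R*R) * expq (R*R)) ^ 6"
    by (simp add: power_numeral_reduce)
  finally show ?thesis
    unfolding Wterm_def
    by (intro norm_mult_le2 norm_u_coeff_le[OF b(1-3)] norm_P_le' norm_mult_qpow_le norm_c_coeff_le
          norm_Pn_le' Y bY) auto
qed

text \<open>Every factor of a term is bounded on compact sets except the power
  \<open>b\<^bsup>2k\<^esup>\<close>, which gives geometric decay.\<close>

lemma Wser_bounds_on_compact:
  fixes b x1 x2 x3 x4 :: "'a :: topological_space \<Rightarrow> complex"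
  assumes "compact K" and cont: "continuous_on K b" "continuous_on K x1" "continuous_on K x2"
      "continuous_on K x3" "continuous_on K x4"
    and b: "\<And>p. p \<in> K \<Longrightarrow> 0 < norm (b p) \<and> norm (b p) < 1"
  obtains C B where "0 \<le> B" "B < 1"
    "\<And>p k. p \<in> K \<Longrightarrow> norm (Wterm (b p) (x1 p) (x2 p) (x3 p) (x4 p) k) \<le> C * (B\<^sup>2) ^ k"
proof (cases "K = {}")
  case True
  thus ?thesis using that[of 0] by auto
next
  case False
  obtain p1 where p1: "p1 \<in> K" "\<And>p. p \<in> K \<Longrightarrow> norm (b p1) \<le> norm (b p)"
    using continuous_attains_inf[OF assms(1) False continuous_on_norm[OF cont(1)]] by blast
  obtain p2 where p2: "p2 \<in> K" "\<And>p. p \<in> K \<Longrightarrow> norm (b p) \<le> norm (b p2)"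
    using continuous_attains_sup[OF assms(1) False continuous_on_norm[OF cont(1)]] by blast
  have "\<exists>R. \<forall>p\<in>K. norm (x p) \<le> R" if "continuous_on K x" for x :: "'a \<Rightarrow> complex"
    using continuous_attains_sup[OF assms(1) False continuous_on_norm[OF that]] by blast
  from this[OF cont(2)] this[OF cont(3)] this[OF cont(4)] this[OF cont(5)]
  obtain R1 R2 R3 R4 where R: "\<forall>p\<in>K. norm (x1 p) \<le> R1" "\<forall>p\<in>K. norm (x2 p) \<le> R2"
     "\<forall>p\<in>K. norm (x3 p) \<le> R3" "\<forall>p\<in>K. norm (x4 p) \<le> R4" by blast
  define R where "R = max (max R1 R2) (max R3 R4)"
  define C where "C = expq (1 / norm (b p1)) * (expq 1 / norm (P q)) * expq (R*R*R*R) * ((1 + (R*R*R*R)) * expq (R*R*R*R)) *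
    expq (R*R*R*R) * (expq (R*R) * expq (R*R)) ^ 6"
  show ?thesis
  proof (rule that[of "norm (b p2)" C])
    fix p k assume p: "p \<in> K"
    have R': "norm (x1 p) \<le> R" "norm (x2 p) \<le> R" "norm (x3 p) \<le> R" "norm (x4 p) \<le> R"
      using R p by (auto simp: R_def le_max_iff_disj)
    have "0 < norm (b p1)" "norm (b p2) < 1" using b p1 p2 by auto
    from norm_Wterm_le[OF this(1) p1(2)[OF p] p2(2)[OF p] this(2) R', of k]
    show "norm (Wterm (b p) (x1 p) (x2 p) (x3 p) (x4 p) k) \<le> C * ((norm (b p2))\<^sup>2) ^ k"
      by (simp add: C_def mult_ac)
  qed (use p2 b in auto)
qed

lemma Wterm_summable:
  assumes "0 < norm b" "norm b < 1"
  shows "summable (\<lambda>k. norm (Wterm b x1 x2 x3 x4 k))"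
proof -
  obtain C B where B: "0 \<le> B" "B < 1"
    "\<And>p k. p \<in> {0::real} \<Longrightarrow> norm (Wterm b x1 x2 x3 x4 k) \<le> C * (B\<^sup>2) ^ k"
    by (rule Wser_bounds_on_compact[of "{0::real}" "\<lambda>_. b" "\<lambda>_. x1" "\<lambda>_. x2" "\<lambda>_. x3" "\<lambda>_. x4"])
       (use assms in auto)
  have "summable (\<lambda>k. C * (B\<^sup>2) ^ k)"
    using B(1,2) by (intro summable_mult summable_geometric) (auto simp: abs_square_less_1)
  thus ?thesis
    by (rule summable_comparison_test[rotated]) (use B(3) in auto)
qed

lemma uniform_limit_Wser:
  fixes b x1 x2 x3 x4 :: "'a :: topological_space \<Rightarrow> complex"
  assumes "compact K" "continuous_on K b" "continuous_on K x1" "continuous_on K x2"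
      "continuous_on K x3" "continuous_on K x4"
    and "\<And>p. p \<in> K \<Longrightarrow> 0 < norm (b p) \<and> norm (b p) < 1"
  shows "uniform_limit K (\<lambda>n p. \<Sum>k<n. Wterm (b p) (x1 p) (x2 p) (x3 p) (x4 p) k)
           (\<lambda>p. Wser (b p) (x1 p) (x2 p) (x3 p) (x4 p)) sequentially"
proof -
  obtain C B where B: "0 \<le> B" "B < 1"
    "\<And>p k. p \<in> K \<Longrightarrow> norm (Wterm (b p) (x1 p) (x2 p) (x3 p) (x4 p) k) \<le> C * (B\<^sup>2) ^ k"
    by (rule Wser_bounds_on_compact[OF assms(1-6)]) (erule assms(7), rule that)
  have "summable (\<lambda>k. C * (B\<^sup>2) ^ k)"
    using B(1,2) by (intro summable_mult summable_geometric) (auto simp: abs_square_less_1)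
  thus ?thesis
    unfolding Wser_def by (intro Weierstrass_m_test[of K _ "\<lambda>k. C * (B\<^sup>2) ^ k"] B(3))
qed

lemma holomorphic_Wterm:
  assumes "b holomorphic_on A" "x1 holomorphic_on A" "x2 holomorphic_on A" "x3 holomorphic_on A"
    "x4 holomorphic_on A" and "\<And>w. w \<in> A \<Longrightarrow> b w \<noteq> 0"
  shows "(\<lambda>w. Wterm (b w) (x1 w) (x2 w) (x3 w) (x4 w) k) holomorphic_on A"
  unfolding Wterm_def u_coeff_def c_coeff_def pairs_def
  by (cases k) (use assms Pn_q_nz in \<open>auto intro!: holomorphic_intros\<close>)

lemma continuous_Wterm:
  assumes "continuous_on A b" "continuous_on A x1" "continuous_on A x2" "continuous_on A x3"
    "continuous_on A x4" and "\<And>w. w \<in> A \<Longrightarrow> b w \<noteq> 0"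
  shows "continuous_on A (\<lambda>w. Wterm (b w) (x1 w) (x2 w) (x3 w) (x4 w) k)"
  unfolding Wterm_def u_coeff_def c_coeff_def pairs_def
  by (cases k) (use assms Pn_q_nz in \<open>auto intro!: continuous_intros\<close>)

lemma holomorphic_Wser:
  assumes "open A" and hol: "b holomorphic_on A" "x1 holomorphic_on A" "x2 holomorphic_on A"
    "x3 holomorphic_on A" "x4 holomorphic_on A"
    and b: "\<And>w. w \<in> A \<Longrightarrow> 0 < norm (b w) \<and> norm (b w) < 1"
  shows "(\<lambda>w. Wser (b w) (x1 w) (x2 w) (x3 w) (x4 w)) holomorphic_on A"
proof -
  let ?S = "\<lambda>n w. \<Sum>k<n. Wterm (b w) (x1 w) (x2 w) (x3 w) (x4 w) k"
  have nz: "b w \<noteq> 0" if "w \<in> A" for w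
    using b[OF that] by auto
  have 1: "?S n holomorphic_on A" for n
    by (intro holomorphic_on_sum holomorphic_Wterm hol nz)
  have 2: "\<exists>d>0. cball w d \<subseteq> A \<and> uniform_limit (cball w d) ?S
             (\<lambda>p. Wser (b p) (x1 p) (x2 p) (x3 p) (x4 p)) sequentially" if "w \<in> A" for w
  proof -
    obtain d where d: "d > 0" "cball w d \<subseteq> A"
      using \<open>open A\<close>[unfolded open_contains_cball] \<open>w \<in> A\<close> by blast
    note hol' = hol[THEN holomorphic_on_imp_continuous_on, THEN continuous_on_subset[OF _ d(2)]]
    have b': "0 < norm (b p) \<and> norm (b p) < 1" if "p \<in> cball w d" for p
      using b[of p] d(2) that by (metis subsetD)
    have "uniform_limit (cball w d) ?S (\<lambda>p. Wser (b p) (x1 p) (x2 p) (x3 p) (x4 p)) sequentially"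
      by (rule uniform_limit_Wser[OF compact_cball hol']) (rule b')
    thus ?thesis
      using d by (intro exI[of _ d] conjI)
  qed
  show ?thesis
    by (rule holomorphic_uniform_sequence[OF \<open>open A\<close> 1 2])
qed

lemma continuous_Wser:
  fixes b x1 x2 x3 x4 :: "'a :: heine_borel \<Rightarrow> complex"
  assumes "open A" and cont: "continuous_on A b" "continuous_on A x1" "continuous_on A x2"
    "continuous_on A x3" "continuous_on A x4"
    and b: "\<And>w. w \<in> A \<Longrightarrow> 0 < norm (b w) \<and> norm (b w) < 1"
  shows "continuous_on A (\<lambda>w. Wser (b w) (x1 w) (x2 w) (x3 w) (x4 w))"
proof -
  have "isCont (\<lambda>w. Wser (b w) (x1 w) (x2 w) (x3 w) (x4 w)) w" if "w \<in> A" for w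
  proof -
    obtain d where d: "d > 0" "cball w d \<subseteq> A"
      using \<open>open A\<close>[unfolded open_contains_cball] \<open>w \<in> A\<close> by blast
    have nz: "0 < norm (b p) \<and> norm (b p) < 1" if "p \<in> cball w d" for p
      using b[of p] d(2) that by (metis subsetD)
    note cont' = cont[THEN continuous_on_subset[OF _ d(2)]]
    have "continuous_on (cball w d) (\<lambda>w. Wser (b w) (x1 w) (x2 w) (x3 w) (x4 w))"
    proof (rule uniform_limit_theorem[where f = "\<lambda>n p. \<Sum>k<n. Wterm (b p) (x1 p) (x2 p) (x3 p) (x4 p) k"
          and F = sequentially])
      show "uniform_limit (cball w d) (\<lambda>n p. \<Sum>k<n. Wterm (b p) (x1 p) (x2 p) (x3 p) (x4 p) k)
           (\<lambda>p. Wser (b p) (x1 p) (x2 p) (x3 p) (x4 p)) sequentially"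
        by (rule uniform_limit_Wser[OF compact_cball cont']) (rule nz)
      show "\<forall>\<^sub>F n in sequentially. continuous_on (cball w d)
              (\<lambda>p. \<Sum>k<n. Wterm (b p) (x1 p) (x2 p) (x3 p) (x4 p) k)"
      proof (intro always_eventually allI continuous_intros)
        fix k
        show "continuous_on (cball w d) (\<lambda>p. Wterm (b p) (x1 p) (x2 p) (x3 p) (x4 p) k)"
          by (rule continuous_Wterm[OF cont']) (use nz in force)
      qed
    qed auto
    thus ?thesis
      by (rule continuous_on_interior) (use d(1) in \<open>simp add: mem_interior, meson ball_subset_cball\<close>)
  qed
  thus ?thesis by (simp add: continuous_at_imp_continuous_on)
qed

text \<open>The series side divided by the products that make it comparable with the integral over the unit
  circle.\<close>

definition Fser :: "complex \<Rightarrow> complex \<Rightarrow> complex \<Rightarrow> complex \<Rightarrow> complex \<Rightarrow> complex" where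
  "Fser b x1 x2 x3 x4 = Wser b x1 x2 x3 x4 / (P (b * (x1 * x2 * x3 * x4)) * pairs P x1 x2 x3 x4)"

text \<open>The part of the \<open>k\<close>-th term of \<open>Fser\<close> that depends on the parameters
  only through their product.\<close>

definition e_coeff :: "complex \<Rightarrow> complex \<Rightarrow> nat \<Rightarrow> complex" where
  "e_coeff b Y k = u_coeff b k * P (Y * q ^ (2 * k)) * Pn (b ^ 2 * Y * q ^ (k - 1)) k *
     (case k of 0 \<Rightarrow> 1 / P (b * Y) | Suc j \<Rightarrow> (1 - b * Y * q ^ (2 * j + 1)) / P (b * Y * q ^ j))"

definition G :: "complex \<Rightarrow> complex \<Rightarrow> complex" where "G b x = P (b * x) / P x"

lemma G_shift: "norm x < 1 \<Longrightarrow> norm b < 1 \<Longrightarrow> G b (q * x) = G b x * (1 - x) / (1 - b * x)"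
proof -
  assume x: "norm x < 1" "norm b < 1"
  have "norm (b * x) < 1" "norm (q * x) < 1" "norm (b * (q * x)) < 1"
    using x q_less_1 by (auto intro!: norm_mult_lt_1)
  hence "P (q * x) \<noteq> 0" "P (b * (q * x)) \<noteq> 0" "1 - x \<noteq> 0" "1 - b * x \<noteq> 0"
    using P_nz x by auto
  moreover have "P x = (1 - x) * P (q * x)" "P (b * x) = (1 - b * x) * P (b * (q * x))"
    using P_rec[of x] P_rec[of "b * x"] by (simp_all add: mult_ac)
  ultimately show ?thesis
    unfolding G_def by simp
qed

text \<open>Dividing \<open>P (b x q\<^sup>k) (x;q)\<^sub>k\<close> by \<open>P x\<close> leaves \<open>G b (x
  q\<^sup>k)\<close>. In this form the shifts of single parameters act on the products of \<open>G\<close> by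
  rational factors.\<close>

lemma Fser_term_sums:
  assumes b: "0 < norm b" "norm b < 1"
    and x: "norm x1 < 1" "norm x2 < 1" "norm x3 < 1" "norm x4 < 1"
  shows "(\<lambda>k. e_coeff b (x1 * x2 * x3 * x4) k * pairs (\<lambda>x. G b (x * q ^ k)) x1 x2 x3 x4)
           sums Fser b x1 x2 x3 x4"
proof -
  let ?Y = "x1 * x2 * x3 * x4"
  have nz: "P (b * ?Y) \<noteq> 0" "P (x1*x2) \<noteq> 0" "P (x1*x3) \<noteq> 0" "P (x1*x4) \<noteq> 0" "P (x2*x3) \<noteq> 0"
     "P (x2*x4) \<noteq> 0" "P (x3*x4) \<noteq> 0"
    by (intro P_nz norm_mult_lt_1 x b)+
  have "(\<lambda>k. Wterm b x1 x2 x3 x4 k) sums Wser b x1 x2 x3 x4"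
    unfolding Wser_def by (rule summable_sums[OF summable_norm_cancel[OF Wterm_summable[OF b]]])
  hence "(\<lambda>k. Wterm b x1 x2 x3 x4 k / (P (b * ?Y) * pairs P x1 x2 x3 x4)) sums Fser b x1 x2 x3 x4"
    unfolding Fser_def by (rule sums_divide)
  moreover have "Wterm b x1 x2 x3 x4 k / (P (b * ?Y) * pairs P x1 x2 x3 x4) =
      e_coeff b ?Y k * pairs (\<lambda>x. G b (x * q ^ k)) x1 x2 x3 x4" for k
  proof -
    have g: "P (b * x * q ^ k) * Pn x k / P x = G b (x * q ^ k)" if "P x \<noteq> 0" for x
      using that P_split[of x k] by (auto simp: G_def field_simps)
    have pr: "pairs (\<lambda>x. P (b * x * q ^ k) * Pn x k) x1 x2 x3 x4 / pairs P x1 x2 x3 x4 =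
          pairs (\<lambda>x. G b (x * q ^ k)) x1 x2 x3 x4"
      unfolding pairs_def g[OF nz(2), symmetric] g[OF nz(3), symmetric] g[OF nz(4), symmetric]
        g[OF nz(5), symmetric] g[OF nz(6), symmetric] g[OF nz(7), symmetric] by simp
    have c: "c_coeff b ?Y k / P (b * ?Y) =
       (case k of 0 \<Rightarrow> 1 / P (b * ?Y) | Suc j \<Rightarrow> (1 - b * ?Y * q ^ (2 * j + 1)) / P (b * ?Y * q ^ j))"
    proof (cases k)
      case (Suc j)
      thus ?thesis using nz(1) P_split[of "b * ?Y" j] by (simp add: c_coeff_def field_simps)
    qed (simp add: c_coeff_def)
    show ?thesis
      unfolding Wterm_def e_coeff_def c[symmetric] pr[symmetric] by simp
  qed
  ultimately show ?thesis by simp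
qed

lemma e_coeff_shift:
  assumes "norm (b * Y) < 1"
  shows "e_coeff b (q * Y) j = u_coeff b j * P (Y * q ^ (2 * j + 1)) * Pn (b ^ 2 * Y * q ^ j) j *
           (1 - b * Y * q ^ (2 * j)) / P (b * Y * q ^ j)"
proof (cases j)
  case 0
  have "norm (q * (b * Y)) < 1"
    by (rule norm_mult_lt_1[OF q_less_1 assms])
  hence "P (b * Y) \<noteq> 0" "P (q * (b * Y)) \<noteq> 0" "1 - b * Y \<noteq> 0"
    using assms P_nz by auto
  thus ?thesis
    using 0 P_rec[of "b * Y"] by (simp add: e_coeff_def mult_ac)
next
  case (Suc i)
  thus ?thesis by (simp add: e_coeff_def mult_ac)
qed

lemma u_coeff_Suc: "b \<noteq> 0 \<Longrightarrow> u_coeff b (Suc j) * (1 - q ^ Suc j) = u_coeff b j * b * (b - q ^ Suc j)"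
proof -
  assume "b \<noteq> 0"
  have "1 - q ^ Suc j \<noteq> 0"
    using Pn_q_nz[of "Suc j"] by (simp add: Pn_Suc)
  thus ?thesis
    using \<open>b \<noteq> 0\<close> Pn_q_nz[of j] unfolding u_coeff_def Pn_Suc[of _ j]
    by (simp add: divide_simps)
qed

lemma e_coeff_0_relation:
  assumes "norm (b * Y) < 1"
  shows "e_coeff b (q * Y) 0 * (1 - Y) / (1 - b * Y) = e_coeff b Y 0"
proof -
  have "1 - b * Y \<noteq> 0" using assms by auto
  thus ?thesis
    unfolding e_coeff_shift[OF assms]
    using P_rec[of Y] by (simp add: e_coeff_def u_coeff_def mult_ac)
qed

text \<open>What remains of the q-difference equation for the coefficient of the \<open>(j+1)\<close>-st
  product, once \<open>four_variable_identity\<close> has been applied.\<close>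

lemma e_coeff_relation:
  assumes b: "0 < norm b" "norm b < 1" and Y: "norm Y < 1"
  shows "e_coeff b (q * Y) (Suc j) * (1 - Y * q ^ (2 * j + 2)) / (1 - b * Y * q ^ (2 * j + 2)) +
         e_coeff b (q * Y) j * (b ^ 2 * (1 - b ^ 2 * Y * q ^ (2 * j))) / (1 - b * Y * q ^ (2 * j)) =
         e_coeff b Y (Suc j) + b ^ 2 * e_coeff b (q ^ 2 * Y) j"
proof -
  define n where "n = Y * q ^ j"
  define p where "p = q ^ Suc j"
  define m where "m = n * p"
  define A where "A = Pn (b ^ 2 * n * q) j"
  define u where "u = u_coeff b (Suc j)"
  define v where "v = u_coeff b j"
  have q2j: "q ^ (2 * j) = q ^ j * q ^ j" "q ^ (j * 2) = q ^ j * q ^ j"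
    by (simp_all add: mult_2 mult_2_right power_add)
  have bY: "norm (b * Y) < 1" "norm (b * (q * Y)) < 1"
    using b Y q_less_1 by (auto intro!: norm_mult_lt_1)
  have lt: "norm (b * Y * q ^ i) < 1" for i
    using norm_mult_qpow_le[of "b * Y" "norm (b * Y)" i] bY(1) by simp
  have nz: "1 - b * Y * q ^ i \<noteq> 0" "P (b * Y * q ^ i) \<noteq> 0" for i
    using lt[of i] P_nz[OF lt[of i]] by auto
  have n: "1 - b * n \<noteq> 0" "P (b * n * q) \<noteq> 0"
    using nz(1)[of j] nz(2)[of "Suc j"] by (auto simp: n_def mult_ac)
  have Pbn: "P (b * n) = (1 - b * n) * P (b * n * q)" and Pm: "P m = (1 - m) * P (m * q)"
    using P_rec[of "b * n"] P_rec[of m] by (simp_all add: mult_ac)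
  have A1: "Pn (b ^ 2 * n * q) (Suc j) = A * (1 - b ^ 2 * m)"
    by (simp add: Pn_Suc A_def m_def p_def mult_ac)
  have A2: "Pn (b ^ 2 * n) j * (1 - b ^ 2 * Y * q ^ (2 * j)) = (1 - b ^ 2 * n) * A"
    using Pn_Suc[of "b ^ 2 * n" j] Pn_Suc_shift[of "b ^ 2 * n" j]
    by (simp add: A_def n_def q2j mult_ac)
  have A3: "Pn (b ^ 2 * n) (Suc j) = (1 - b ^ 2 * n) * A"
    by (simp add: Pn_Suc_shift A_def)
  have t1: "e_coeff b (q * Y) (Suc j) * (1 - Y * q ^ (2 * j + 2)) / (1 - b * Y * q ^ (2 * j + 2)) =
          u * P (m * q) * A * (1 - b ^ 2 * m) / P (b * n * q)"
  proof -
    have "e_coeff b (q * Y) (Suc j) * (1 - Y * q ^ (2 * j + 2)) / (1 - b * Y * q ^ (2 * j + 2)) =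
       u * (P (Y * q ^ (2 * Suc j + 1)) * (1 - Y * q ^ (2 * j + 2))) * Pn (b ^ 2 * Y * q ^ Suc j) (Suc j) / P (b * Y * q ^ Suc j)"
      unfolding e_coeff_shift[OF bY(1)] u_def using nz(1)[of "2 * j + 2"] by simp
    also have "P (Y * q ^ (2 * Suc j + 1)) * (1 - Y * q ^ (2 * j + 2)) = P (m * q)"
      using P_rec[of "m * q"] by (simp add: m_def n_def p_def q2j mult_ac)
    also have "Pn (b ^ 2 * Y * q ^ Suc j) (Suc j) = A * (1 - b ^ 2 * m)"
      using A1 by (simp add: n_def mult_ac)
    also have "P (b * Y * q ^ Suc j) = P (b * n * q)"
      by (simp add: n_def mult_ac)
    finally show ?thesis by simp
  qed
  have t2: "e_coeff b (q * Y) j * (b ^ 2 * (1 - b ^ 2 * Y * q ^ (2 * j))) / (1 - b * Y * q ^ (2 * j)) =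
          v * b ^ 2 * ((1 - m) * P (m * q)) * ((1 - b ^ 2 * n) * A) / ((1 - b * n) * P (b * n * q))"
  proof -
    have "e_coeff b (q * Y) j * (b ^ 2 * (1 - b ^ 2 * Y * q ^ (2 * j))) / (1 - b * Y * q ^ (2 * j)) =
       v * b ^ 2 * P (Y * q ^ (2 * j + 1)) * (Pn (b ^ 2 * n) j * (1 - b ^ 2 * Y * q ^ (2 * j))) / P (b * n)"
      unfolding e_coeff_shift[OF bY(1)] v_def n_def using nz(1)[of "2 * j"] by (simp add: mult_ac)
    also have "P (Y * q ^ (2 * j + 1)) = P m"
      by (simp add: m_def n_def p_def q2j mult_ac)
    finally show ?thesis unfolding A2 Pm Pbn by simp
  qed
  have t3: "e_coeff b Y (Suc j) = u * P (m * q) * ((1 - b ^ 2 * n) * A) * (1 - b * m) / ((1 - b * n) * P (b * n * q))"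
    unfolding e_coeff_def u_def Pbn[symmetric] A3[symmetric]
    by (simp add: m_def n_def p_def q2j mult_ac)
  have t4: "e_coeff b (q ^ 2 * Y) j = v * P (m * q) * A * (1 - b * m) / P (b * n * q)"
    using e_coeff_shift[OF bY(2), of j]
    by (simp add: v_def A_def m_def n_def p_def q2j mult_ac power2_eq_square)
  have rec: "u * (1 - p) = v * b * (b - p)"
    using u_coeff_Suc[of b j] b by (simp add: u_def v_def p_def)
  have "(u * (1 - b ^ 2 * m) * (1 - b * n) + v * b ^ 2 * (1 - m) * (1 - b ^ 2 * n)) -
        (u * (1 - b ^ 2 * n) * (1 - b * m) + v * b ^ 2 * (1 - b * m) * (1 - b * n)) =
        (1 - b) * b * n * (v * b * (b - p) - u * (1 - p))"
    unfolding m_def by (simp add: algebra_simps power2_eq_square)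
  hence key: "u * (1 - b ^ 2 * m) * (1 - b * n) + v * b ^ 2 * (1 - m) * (1 - b ^ 2 * n) =
        u * (1 - b ^ 2 * n) * (1 - b * m) + v * b ^ 2 * (1 - b * m) * (1 - b * n)"
    using rec by simp
  have comb: "u * P (m * q) * A * (1 - b ^ 2 * m) / P (b * n * q) +
      v * b ^ 2 * ((1 - m) * P (m * q)) * ((1 - b ^ 2 * n) * A) / ((1 - b * n) * P (b * n * q)) =
      P (m * q) * A / ((1 - b * n) * P (b * n * q)) *
      (u * (1 - b ^ 2 * m) * (1 - b * n) + v * b ^ 2 * (1 - m) * (1 - b ^ 2 * n))"
    using n by (simp add: divide_simps) (simp add: algebra_simps)
  have comb': "u * P (m * q) * ((1 - b ^ 2 * n) * A) * (1 - b * m) / ((1 - b * n) * P (b * n * q)) +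
      b ^ 2 * (v * P (m * q) * A * (1 - b * m) / P (b * n * q)) =
      P (m * q) * A / ((1 - b * n) * P (b * n * q)) *
      (u * (1 - b ^ 2 * n) * (1 - b * m) + v * b ^ 2 * (1 - b * m) * (1 - b * n))"
    using n by (simp add: divide_simps) (simp add: algebra_simps)
  show ?thesis
    unfolding t1 t2 t3 t4 comb comb' key ..
qed

end

section \<open>A rational identity in four variables\<close>

text \<open>The coefficient of the shift \<open>x \<mapsto> q x\<close> in the q-difference equation.\<close>

definition shift_coeff :: "complex \<Rightarrow> complex \<Rightarrow> complex \<Rightarrow> complex \<Rightarrow> complex \<Rightarrow> complex" where
  "shift_coeff b x y z w = (b * x - y) / (x - y) * ((b * x - z) / (x - z)) * ((b * x - w) / (x - w))"

text \<open>For \<open>k = q\<^sup>j\<close> this is the factor by which \<open>G b (x q\<^sup>j)\<close>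
  changes under \<open>x \<mapsto> q x\<close>.\<close>

definition pair_ratio :: "complex \<Rightarrow> complex \<Rightarrow> complex \<Rightarrow> complex" where
  "pair_ratio b k x = (1 - k * x) / (1 - b * k * x)"

definition tau :: "complex \<Rightarrow> complex \<Rightarrow> complex \<Rightarrow> complex \<Rightarrow> complex \<Rightarrow> complex" where
  "tau b k c d e = (b * c - d) / (c - d) * ((b * c - e) / (c - e)) * pair_ratio b k (c * d) * pair_ratio b k (c * e)"

definition triple_ratio :: "complex \<Rightarrow> complex \<Rightarrow> complex \<Rightarrow> complex \<Rightarrow> complex \<Rightarrow> complex" where
  "triple_ratio b k c d e = pair_ratio b k (c * d) * pair_ratio b k (c * e) * pair_ratio b k (d * e)"

text \<open>The analogue in three variables; it is the case of a vanishing fourth variable.\<close>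

lemma tau_sum:
  assumes "c \<noteq> d" "c \<noteq> e" "d \<noteq> e" "1 - b * k * (c * d) \<noteq> 0" "1 - b * k * (c * e) \<noteq> 0"
    "1 - b * k * (d * e) \<noteq> 0"
  shows "tau b k c d e + tau b k d c e + tau b k e c d = 1 + b * (1 + b) * triple_ratio b k c d e"
proof -
  let ?u = "1 - b * k * (c * d)" and ?v = "1 - b * k * (c * e)" and ?w = "1 - b * k * (d * e)"
  let ?D = "(c - d) * (c - e) * (d - e) * ?u * ?v * ?w"
  have D: "?D \<noteq> 0" using assms by simp
  have nz: "c - d \<noteq> 0" "c - e \<noteq> 0" "d - e \<noteq> 0" "d - c \<noteq> 0" "e - c \<noteq> 0" "e - d \<noteq> 0"
    using assms by auto
  have 1: "tau b k c d e * ?D = (b * c - d) * (b * c - e) * (1 - k * (c * d)) * (1 - k * (c * e)) * (d - e) * ?w"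
    unfolding tau_def pair_ratio_def using nz assms(4-6) by (simp add: divide_simps)
  have 2: "tau b k d c e * ?D = - ((b * d - c) * (b * d - e) * (1 - k * (c * d)) * (1 - k * (d * e)) * (c - e) * ?v)"
  proof -
    have "tau b k d c e = - ((b * d - c) * (b * d - e) * (1 - k * (c * d)) * (1 - k * (d * e)) / ((c - d) * (d - e) * ?u * ?w))"
      unfolding tau_def pair_ratio_def mult.commute[of d c] using nz assms(4-6)
      by (simp add: divide_simps) (simp add: algebra_simps)
    thus ?thesis using D by simp
  qed
  have 3: "tau b k e c d * ?D = (b * e - c) * (b * e - d) * (1 - k * (c * e)) * (1 - k * (d * e)) * (c - d) * ?u"
  proof -
    have "tau b k e c d = (b * e - c) * (b * e - d) * (1 - k * (c * e)) * (1 - k * (d * e)) / ((c - e) * (d - e) * ?v * ?w)"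
      unfolding tau_def pair_ratio_def mult.commute[of e c] mult.commute[of e d] using nz assms(4-6)
      by (simp add: divide_simps) (simp add: algebra_simps)
    thus ?thesis using D by simp
  qed
  have 4: "triple_ratio b k c d e * ?D = (c - d) * (c - e) * (d - e) * ((1 - k * (c * d)) * (1 - k * (c * e)) * (1 - k * (d * e)))"
    unfolding triple_ratio_def pair_ratio_def using assms(4-6) by simp
  have "(tau b k c d e + tau b k d c e + tau b k e c d) * ?D = (1 + b * (1 + b) * triple_ratio b k c d e) * ?D"
  proof -
    have "(tau b k c d e + tau b k d c e + tau b k e c d) * ?D =
       tau b k c d e * ?D + tau b k d c e * ?D + tau b k e c d * ?D"
      by (simp only: distrib_right)
    also have "\<dots> = ?D + b * (1 + b) * (triple_ratio b k c d e * ?D)"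
      unfolding 1 2 3 4 by algebra
    finally show ?thesis by (simp only: distrib_right mult_1 mult.assoc)
  qed
  thus ?thesis using D by simp
qed

text \<open>The difference of the two sides of \<open>four_variable_identity\<close> as a function of the
  fourth variable \<open>u\<close>, multiplied by all denominators that contain \<open>u\<close>.\<close>

definition residual where
  "residual b k c d e u =
     (1 - b * k^2 * (c * d * e) * u) * (b * u - c) * (1 - k * c * u) * (b * u - d) * (1 - k * d * u) * (b * u - e) * (1 - k * e * u)
   - tau b k c d e * ((1 - b * k^2 * (c * d * e) * u) * (b * c - u) * (1 - k * c * u) * (u - d) * (1 - b * k * d * u) * (u - e) * (1 - b * k * e * u))
   - tau b k d c e * ((1 - b * k^2 * (c * d * e) * u) * (b * d - u) * (1 - k * d * u) * (u - c) * (1 - b * k * c * u) * (u - e) * (1 - b * k * e * u))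
   - tau b k e c d * ((1 - b * k^2 * (c * d * e) * u) * (b * e - u) * (1 - k * e * u) * (u - c) * (1 - b * k * c * u) * (u - d) * (1 - b * k * d * u))
   - (1 + b) * ((1 - k^2 * (c * d * e) * u) * (u - c) * (1 - b * k * c * u) * (u - d) * (1 - b * k * d * u) * (u - e) * (1 - b * k * e * u))
   - b^2 * (1 + b) * triple_ratio b k c d e * ((1 - b^2 * k^2 * (c * d * e) * u) * (u - c) * (1 - k * c * u) * (u - d) * (1 - k * d * u) * (u - e) * (1 - k * e * u))"

lemma tau_swap: "tau b k c d e = tau b k c e d"
  by (simp add: tau_def mult_ac)

lemma triple_ratio_swap: "triple_ratio b k c d e = triple_ratio b k d c e" "triple_ratio b k c d e = triple_ratio b k e c d"
  by (simp_all add: triple_ratio_def mult_ac)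

lemma residual_swap: "residual b k c d e u = residual b k d c e u" "residual b k c d e u = residual b k e c d u"
proof -
  show "residual b k c d e u = residual b k d c e u"
    unfolding residual_def triple_ratio_swap(1)[of b k c d e] tau_swap[of b k e d c]
    by (simp only: mult_ac diff_conv_add_uminus add_ac)
  show "residual b k c d e u = residual b k e c d u"
    unfolding residual_def triple_ratio_swap(2)[of b k c d e] tau_swap[of b k c e d] tau_swap[of b k d e c]
    by (simp only: mult_ac diff_conv_add_uminus add_ac)
qed

lemma residual_root_c:
  assumes "c \<noteq> d" "c \<noteq> e" "1 - b * k * (c * d) \<noteq> 0" "1 - b * k * (c * e) \<noteq> 0"
  shows "residual b k c d e c = 0"
proof -
  have rearr: "t * (f1 * f2 * f3 * m1 * m2 * m3 * m4) = f1 * f2 * f3 * (t * (m1 * m2 * m3 * m4))"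
    for t f1 f2 f3 m1 m2 m3 m4 :: complex
    by (simp only: mult_ac)
  have "tau b k c d e * ((c - d) * (1 - b * k * d * c) * (c - e) * (1 - b * k * e * c)) =
      (b * c - d) * (b * c - e) * (1 - k * d * c) * (1 - k * e * c)"
    unfolding tau_def pair_ratio_def using assms by (simp add: mult_ac)
  hence "tau b k c d e * ((1 - b * k^2 * (c * d * e) * c) * (b * c - c) * (1 - k * c * c) * (c - d) * (1 - b * k * d * c) * (c - e) * (1 - b * k * e * c)) =
     (1 - b * k^2 * (c * d * e) * c) * (b * c - c) * (1 - k * c * c) * ((b * c - d) * (b * c - e) * (1 - k * d * c) * (1 - k * e * c))"
    by (simp only: rearr)
  thus ?thesis unfolding residual_def by (simp add: mult_ac) metis
qed

text \<open>At this zero of the denominators three of the six summands survive.\<close>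

lemma residual_root_pole:
  assumes "c \<noteq> d" "c \<noteq> e" "1 - b * k * (c * d) \<noteq> 0" "1 - b * k * (c * e) \<noteq> 0"
    "1 - b * k * (d * e) \<noteq> 0" "b \<noteq> 0" "k \<noteq> 0" "c \<noteq> 0"
  shows "residual b k c d e (1 / (b * k * c)) = 0"
proof -
  let ?u = "1 / (b * k * c)"
  define W where "W = (1 - k * (c * d)) * (1 - k * (c * e)) * (b * c - d) * (b * c - e)"
  have z: "1 - b * k * c * ?u = 0" using assms by simp
  have i1: "b * ?u - s = (1 - k * (c * s)) / (k * c)" for s
    using assms by (simp add: field_simps)
  have i2: "1 - k * s * ?u = (b * c - s) / (b * c)" for s
    using assms by (simp add: field_simps)
  have i3: "?u - s = (1 - b * k * (c * s)) / (b * k * c)" for s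
    using assms by (simp add: field_simps)
  have i4: "1 - b * k * s * ?u = (c - s) / c" for s
    using assms by (simp add: field_simps)
  have i5: "1 - b * k^2 * (c * d * e) * ?u = 1 - k * (d * e)"
    using assms by (simp add: field_simps power2_eq_square)
  have i6: "1 - b^2 * k^2 * (c * d * e) * ?u = 1 - b * k * (d * e)"
    using assms by (simp add: field_simps power2_eq_square)
  have i7: "b * c - ?u = - ((1 - b^2 * k * (c * c)) / (b * k * c))"
    using assms by (simp add: field_simps power2_eq_square)
  have tauW: "tau b k c d e * ((1 - b * k * (c * d)) * (1 - b * k * (c * e)) * (c - d) * (c - e)) = W"
    unfolding tau_def pair_ratio_def W_def using assms by simp
  have R3W: "triple_ratio b k c d e * ((1 - b * k * (c * d)) * (1 - b * k * (c * e)) * (1 - b * k * (d * e))) =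
      (1 - k * (c * d)) * (1 - k * (c * e)) * (1 - k * (d * e))"
    unfolding triple_ratio_def pair_ratio_def using assms by simp
  have T1: "(1 - b * k^2 * (c * d * e) * ?u) * (b * ?u - c) * (1 - k * c * ?u) * (b * ?u - d) * (1 - k * d * ?u) * (b * ?u - e) * (1 - k * e * ?u)
     = (1 - k * (d * e)) * (1 - k * (c * c)) * (b - 1) * W / (k^3 * b^3 * c^5)"
    unfolding i1 i2 i5 W_def using assms(6-8) by (simp add: divide_simps) algebra
  have T2: "tau b k c d e * ((1 - b * k^2 * (c * d * e) * ?u) * (b * c - ?u) * (1 - k * c * ?u) * (?u - d) * (1 - b * k * d * ?u) * (?u - e) * (1 - b * k * e * ?u))
     = - ((1 - k * (d * e)) * (1 - b^2 * k * (c * c)) * (b - 1) * W / (k^3 * b^4 * c^5))"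
    unfolding i2 i3 i4 i5 i7 tauW[symmetric] using assms(6-8) by (simp add: divide_simps) algebra
  have T3: "triple_ratio b k c d e * ((1 - b^2 * k^2 * (c * d * e) * ?u) * (?u - c) * (1 - k * c * ?u) * (?u - d) * (1 - k * d * ?u) * (?u - e) * (1 - k * e * ?u))
     = (1 - k * (d * e)) * (1 - b * k * (c * c)) * (b - 1) * W / (k^3 * b^6 * c^5)"
  proof -
    have "triple_ratio b k c d e * ((1 - b^2 * k^2 * (c * d * e) * ?u) * (?u - c) * (1 - k * c * ?u) * (?u - d) * (1 - k * d * ?u) * (?u - e) * (1 - k * e * ?u))
     = (triple_ratio b k c d e * ((1 - b * k * (c * d)) * (1 - b * k * (c * e)) * (1 - b * k * (d * e)))) *
        (1 - b * k * (c * c)) * (b - 1) * (b * c - d) * (b * c - e) / (k^3 * b^6 * c^5)"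
      unfolding i2 i3 i6 using assms(6-8) by (simp add: divide_simps) algebra
    thus ?thesis unfolding R3W W_def by (simp add: mult_ac)
  qed
  have "residual b k c d e ?u =
     (1 - k * (d * e)) * (1 - k * (c * c)) * (b - 1) * W / (k^3 * b^3 * c^5)
     + (1 - k * (d * e)) * (1 - b^2 * k * (c * c)) * (b - 1) * W / (k^3 * b^4 * c^5)
     - b^2 * (1 + b) * ((1 - k * (d * e)) * (1 - b * k * (c * c)) * (b - 1) * W / (k^3 * b^6 * c^5))"
    unfolding residual_def mult.assoc[of _ "triple_ratio b k c d e"] T1 T2 T3 z by simp
  also have "\<dots> = 0"
    using assms(6-8) by (simp add: divide_simps) algebra
  finally show ?thesis .
qed

text \<open>The zero of \<open>1 - b k\<^sup>2 Y\<close> removes the four shifted terms and leaves the two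
  summands of the right-hand side.\<close>

lemma residual_root_far:
  assumes "1 - b * k * (c * d) \<noteq> 0" "1 - b * k * (c * e) \<noteq> 0"
    "1 - b * k * (d * e) \<noteq> 0" "b \<noteq> 0" "k \<noteq> 0" "c \<noteq> 0" "d \<noteq> 0" "e \<noteq> 0"
  shows "residual b k c d e (1 / (b * k^2 * (c * d * e))) = 0"
proof -
  let ?u = "1 / (b * k^2 * (c * d * e))"
  define Z where "Z = (?u - c) * (?u - d) * (?u - e)"
  define V where "V = (1 - k * (c * d)) * (1 - k * (c * e)) * (1 - k * (d * e))"
  have z: "1 - b * k^2 * (c * d * e) * ?u = 0" using assms by simp
  have i1: "1 - b * k * c * ?u = - ((1 - k * (d * e)) / (k * (d * e)))"
       "1 - b * k * d * ?u = - ((1 - k * (c * e)) / (k * (c * e)))"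
       "1 - b * k * e * ?u = - ((1 - k * (c * d)) / (k * (c * d)))"
    using assms by (simp_all add: field_simps power2_eq_square)
  have i2: "1 - k * c * ?u = - ((1 - b * k * (d * e)) / (b * k * (d * e)))"
       "1 - k * d * ?u = - ((1 - b * k * (c * e)) / (b * k * (c * e)))"
       "1 - k * e * ?u = - ((1 - b * k * (c * d)) / (b * k * (c * d)))"
    using assms by (simp_all add: field_simps power2_eq_square)
  have i3: "1 - k^2 * (c * d * e) * ?u = (b - 1) / b" "1 - b^2 * k^2 * (c * d * e) * ?u = 1 - b"
    using assms by (simp_all add: field_simps power2_eq_square)
  have R3V: "triple_ratio b k c d e * ((1 - b * k * (c * d)) * (1 - b * k * (c * e)) * (1 - b * k * (d * e))) = V"
    unfolding triple_ratio_def pair_ratio_def V_def using assms by simp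
  have T1: "(1 - k^2 * (c * d * e) * ?u) * (?u - c) * (1 - b * k * c * ?u) * (?u - d) * (1 - b * k * d * ?u) * (?u - e) * (1 - b * k * e * ?u)
     = - ((b - 1) / b * (Z * V / (k^3 * (c * d * e)^2)))"
  proof -
    have "(1 - k^2 * (c * d * e) * ?u) * (?u - c) * (1 - b * k * c * ?u) * (?u - d) * (1 - b * k * d * ?u) * (?u - e) * (1 - b * k * e * ?u)
      = (1 - k^2 * (c * d * e) * ?u) * Z * ((1 - b * k * c * ?u) * (1 - b * k * d * ?u) * (1 - b * k * e * ?u))"
      by (simp only: Z_def mult_ac)
    also have "(1 - b * k * c * ?u) * (1 - b * k * d * ?u) * (1 - b * k * e * ?u) = - (V / (k^3 * (c * d * e)^2))"
      unfolding i1 V_def using assms by (simp add: divide_simps) algebra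
    finally show ?thesis unfolding i3 by simp
  qed
  have T2: "triple_ratio b k c d e * ((1 - b^2 * k^2 * (c * d * e) * ?u) * (?u - c) * (1 - k * c * ?u) * (?u - d) * (1 - k * d * ?u) * (?u - e) * (1 - k * e * ?u))
     = - ((1 - b) * (Z * V / (b^3 * k^3 * (c * d * e)^2)))"
  proof -
    have "triple_ratio b k c d e * ((1 - b^2 * k^2 * (c * d * e) * ?u) * (?u - c) * (1 - k * c * ?u) * (?u - d) * (1 - k * d * ?u) * (?u - e) * (1 - k * e * ?u))
      = (1 - b^2 * k^2 * (c * d * e) * ?u) * Z * (triple_ratio b k c d e * ((1 - k * c * ?u) * (1 - k * d * ?u) * (1 - k * e * ?u)))"
      by (simp only: Z_def mult_ac)
    also have "(1 - k * c * ?u) * (1 - k * d * ?u) * (1 - k * e * ?u) =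
       - ((1 - b * k * (c * d)) * (1 - b * k * (c * e)) * (1 - b * k * (d * e)) / (b^3 * k^3 * (c * d * e)^2))"
      unfolding i2 using assms by (simp add: divide_simps) algebra
    also have "triple_ratio b k c d e * - ((1 - b * k * (c * d)) * (1 - b * k * (c * e)) * (1 - b * k * (d * e)) / (b^3 * k^3 * (c * d * e)^2))
       = - (V / (b^3 * k^3 * (c * d * e)^2))"
      unfolding R3V[symmetric] by simp
    finally show ?thesis unfolding i3 by simp
  qed
  have "residual b k c d e ?u = (1 + b) * ((b - 1) / b * (Z * V / (k^3 * (c * d * e)^2))) +
      b^2 * (1 + b) * ((1 - b) * (Z * V / (b^3 * k^3 * (c * d * e)^2)))"
    unfolding residual_def mult.assoc[of _ "triple_ratio b k c d e"] T1 T2 z by simp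
  also have "\<dots> = 0"
    using assms(4-8) by (simp add: divide_simps) algebra
  finally show ?thesis .
qed

lemma residual_root_0:
  assumes "c \<noteq> d" "c \<noteq> e" "d \<noteq> e" "1 - b * k * (c * d) \<noteq> 0" "1 - b * k * (c * e) \<noteq> 0"
    "1 - b * k * (d * e) \<noteq> 0"
  shows "residual b k c d e 0 = 0"
proof -
  have "residual b k c d e 0 = - (c * d * e) * (1 + b * (tau b k c d e + tau b k d c e + tau b k e c d)
      - (1 + b) - b^2 * (1 + b) * triple_ratio b k c d e)"
    unfolding residual_def by (simp add: algebra_simps)
  also have "\<dots> = 0"
    unfolding tau_sum[OF assms] by (simp add: algebra_simps power2_eq_square)
  finally show ?thesis .
qed

lemma degree_smult_prod7_le:
  "degree (smult s ([:a1,b1:] * [:a2,b2:] * [:a3,b3:] * [:a4,b4:] * [:a5,b5:] * [:a6,b6:] * [:a7,b7:] :: complex poly)) \<le> 7"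
proof -
  have 1: "degree [:a, b:] \<le> 1" for a b :: complex by simp
  have "degree (p * [:a, b:]) \<le> Suc n" if "degree p \<le> n" for p :: "complex poly" and n a b
    using degree_mult_le[of p "[:a, b:]"] 1[of a b] that by linarith
  from this[OF this[OF this[OF this[OF this[OF this[OF 1]]]]]]
  show ?thesis
    by (intro order.trans[OF degree_smult_le]) (simp add: eval_nat_numeral)
qed

text \<open>A polynomial of degree at most \<open>7\<close> with eight distinct zeros: \<open>0\<close>, the
  other three variables, the three poles \<open>1 / (b k x)\<close>, and the zero of \<open>1 - b k\<^sup>2
  Y\<close>. By symmetry one zero of each kind has to be checked.\<close>

lemma residual_zero:
  assumes k: "norm k \<le> 1" "k \<noteq> 0" and b: "norm b < 1" "b \<noteq> 0"
    and x: "norm c < 1" "norm d < 1" "norm e < 1" "c \<noteq> 0" "d \<noteq> 0" "e \<noteq> 0"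
    and ne: "c \<noteq> d" "c \<noteq> e" "d \<noteq> e"
  shows "residual b k c d e u = 0"
proof -
  have lt: "norm (b * k * (x * y)) < 1" "norm (k * (x * y)) < 1" if "norm x < 1" "norm y < 1" for x y
  proof -
    have "norm (k * (x * y)) \<le> norm (x * y)"
      using k(1) by (simp add: norm_mult mult_left_le_one_le)
    thus "norm (k * (x * y)) < 1" using norm_mult_lt_1[OF that] by linarith
    from norm_mult_lt_1[OF b(1) this] show "norm (b * k * (x * y)) < 1" by (simp only: mult_ac)
  qed
  have nz: "1 - b * k * (x * y) \<noteq> 0" "k * (x * y) \<noteq> 1" "b * k * (x * y) \<noteq> 1"
    if "norm x < 1" "norm y < 1" for x y
    using lt[OF that] by auto
  have nz4: "b * k^2 * (x * y * z) * w \<noteq> 1" if "norm x < 1" "norm y < 1" "norm z < 1" "norm w < 1" for x y z w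
  proof -
    have "norm ((k * (x * y)) * (b * k * (z * w))) < 1"
      by (intro norm_mult_lt_1 lt that)
    thus ?thesis by (auto simp: power2_eq_square mult_ac)
  qed
  define p where "p =
     smult 1 ([:1, - b * k^2 * (c * d * e):] * [: -c, b:] * [:1, - k * c:] * [: -d, b:] * [:1, - k * d:] * [: -e, b:] * [:1, - k * e:])
   - smult (tau b k c d e) ([:1, - b * k^2 * (c * d * e):] * [:b * c, -1:] * [:1, - k * c:] * [: -d, 1:] * [:1, - b * k * d:] * [: -e, 1:] * [:1, - b * k * e:])
   - smult (tau b k d c e) ([:1, - b * k^2 * (c * d * e):] * [:b * d, -1:] * [:1, - k * d:] * [: -c, 1:] * [:1, - b * k * c:] * [: -e, 1:] * [:1, - b * k * e:])
   - smult (tau b k e c d) ([:1, - b * k^2 * (c * d * e):] * [:b * e, -1:] * [:1, - k * e:] * [: -c, 1:] * [:1, - b * k * c:] * [: -d, 1:] * [:1, - b * k * d:])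
   - smult (1 + b) ([:1, - (k^2 * (c * d * e)):] * [: -c, 1:] * [:1, - b * k * c:] * [: -d, 1:] * [:1, - b * k * d:] * [: -e, 1:] * [:1, - b * k * e:])
   - smult (b^2 * (1 + b) * triple_ratio b k c d e) ([:1, - (b^2 * k^2 * (c * d * e)):] * [: -c, 1:] * [:1, - k * c:] * [: -d, 1:] * [:1, - k * d:] * [: -e, 1:] * [:1, - k * e:])"
  have deg: "degree p \<le> 7"
    unfolding p_def by (intro degree_diff_le degree_smult_prod7_le)
  have lin: "poly [:a, b:] u = a + b * u" for a b u :: complex
    by (simp add: mult_ac)
  have poly_p: "poly p u = residual b k c d e u" for u
    unfolding p_def residual_def poly_diff poly_smult poly_mult lin by (simp add: mult_ac)
  let ?R = "{0, c, d, e, 1 / (b * k * c), 1 / (b * k * d), 1 / (b * k * e), 1 / (b * k^2 * (c * d * e))}"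
  have roots: "?R \<subseteq> {u. poly p u = 0}"
  proof -
    have "residual b k c d e d = 0" "residual b k c d e e = 0" "residual b k c d e (1 / (b * k * d)) = 0"
      "residual b k c d e (1 / (b * k * e)) = 0"
      unfolding residual_swap(1)[of b k c d e d] residual_swap(2)[of b k c d e e]
        residual_swap(1)[of b k c d e "1 / (b * k * d)"] residual_swap(2)[of b k c d e "1 / (b * k * e)"]
      by (intro residual_root_c residual_root_pole nz x b k ne ne[symmetric])+
    moreover have "residual b k c d e 0 = 0" "residual b k c d e c = 0" "residual b k c d e (1 / (b * k * c)) = 0"
      "residual b k c d e (1 / (b * k^2 * (c * d * e))) = 0"
      by (intro residual_root_0 residual_root_c residual_root_pole residual_root_far nz x b k ne)+
    ultimately show ?thesis by (auto simp: poly_p)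
  qed
  have ne1: "x \<noteq> 1 / (b * k * y)" if "norm x < 1" "norm y < 1" "y \<noteq> 0" for x y
    using nz(3)[OF that(1,2)] that(3) b k by (auto simp: field_simps)
  have ne2: "1 / (b * k * x) \<noteq> 1 / (b * k * y)" if "x \<noteq> y" "x \<noteq> 0" "y \<noteq> 0" for x y
    using that b k by (auto simp: field_simps)
  have ne3: "x \<noteq> 1 / (b * k^2 * (c * d * e))" if "norm x < 1" for x
    using nz4[OF x(1-3) that] x b k by (auto simp: field_simps)
  have ne4: "1 / (b * k * c) \<noteq> 1 / (b * k^2 * (c * d * e))" "1 / (b * k * d) \<noteq> 1 / (b * k^2 * (c * d * e))"
    "1 / (b * k * e) \<noteq> 1 / (b * k^2 * (c * d * e))"
    using nz(2)[OF x(2,3)] nz(2)[OF x(1,3)] nz(2)[OF x(1,2)] x b k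
    by (auto simp: field_simps power2_eq_square)
  have "card ?R = 8"
    using x ne ne2[OF ne(1)] ne2[OF ne(2)] ne2[OF ne(3)] ne4 ne3[of c] ne3[of d] ne3[of e] b k
      ne1[OF x(1) x(1)] ne1[OF x(1) x(2)] ne1[OF x(1) x(3)] ne1[OF x(2) x(1)] ne1[OF x(2) x(2)]
      ne1[OF x(2) x(3)] ne1[OF x(3) x(1)] ne1[OF x(3) x(2)] ne1[OF x(3) x(3)]
    by (simp add: card_insert_if)
  have "p = 0"
  proof (rule ccontr)
    assume "p \<noteq> 0"
    have "card ?R \<le> card {u. poly p u = 0}"
      by (rule card_mono[OF poly_roots_finite[OF \<open>p \<noteq> 0\<close>] roots])
    also have "\<dots> \<le> degree p"
      by (rule card_poly_roots_bound[OF \<open>p \<noteq> 0\<close>])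
    finally show False using deg \<open>card ?R = 8\<close> by linarith
  qed
  thus ?thesis using poly_p[of u] by simp
qed

text \<open>The hypotheses keep all denominators away from zero and the zeros in \<open>residual_zero\<close>
  distinct; \<open>k\<close> will be a power of \<open>q\<close>.\<close>

lemma four_variable_identity:
  assumes k: "norm k \<le> 1" "k \<noteq> 0" and b: "norm b < 1" "b \<noteq> 0"
    and x: "norm x1 < 1" "norm x2 < 1" "norm x3 < 1" "norm x4 < 1" "x1 \<noteq> 0" "x2 \<noteq> 0" "x3 \<noteq> 0" "x4 \<noteq> 0"
    and ne: "x1 \<noteq> x2" "x1 \<noteq> x3" "x1 \<noteq> x4" "x2 \<noteq> x3" "x2 \<noteq> x4" "x3 \<noteq> x4"
  shows "shift_coeff b x1 x2 x3 x4 * (pair_ratio b k (x1 * x2) * pair_ratio b k (x1 * x3) * pair_ratio b k (x1 * x4)) +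
         shift_coeff b x2 x1 x3 x4 * (pair_ratio b k (x1 * x2) * pair_ratio b k (x2 * x3) * pair_ratio b k (x2 * x4)) +
         shift_coeff b x3 x1 x2 x4 * (pair_ratio b k (x1 * x3) * pair_ratio b k (x2 * x3) * pair_ratio b k (x3 * x4)) +
         shift_coeff b x4 x1 x2 x3 * (pair_ratio b k (x1 * x4) * pair_ratio b k (x2 * x4) * pair_ratio b k (x3 * x4)) =
         ((1 + b) * (1 - k^2 * (x1 * x2 * x3 * x4)) +
          b^2 * (1 + b) * (1 - b^2 * k^2 * (x1 * x2 * x3 * x4)) * pairs (pair_ratio b k) x1 x2 x3 x4) /
         (1 - b * k^2 * (x1 * x2 * x3 * x4))"
proof -
  have lt: "norm (b * k * (x * y)) < 1" "norm (k * (x * y)) < 1" if "norm x < 1" "norm y < 1" for x y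
  proof -
    have "norm (k * (x * y)) \<le> norm (x * y)"
      using k(1) by (simp add: norm_mult mult_left_le_one_le)
    thus "norm (k * (x * y)) < 1" using norm_mult_lt_1[OF that] by linarith
    from norm_mult_lt_1[OF b(1) this] show "norm (b * k * (x * y)) < 1" by (simp only: mult_ac)
  qed
  have nz0: "1 - b * k * s * x1 \<noteq> 0" if "norm s < 1" for s
    using lt(1)[OF that x(1)] by (auto simp: mult_ac)
  have nzY: "1 - b * k^2 * (x2 * x3 * x4) * x1 \<noteq> 0"
  proof -
    have "norm ((k * (x2 * x3)) * (b * k * (x4 * x1))) < 1"
      by (intro norm_mult_lt_1 lt x)
    thus ?thesis by (auto simp: power2_eq_square mult_ac)
  qed
  define Dp where "Dp = (x1 - x2) * (1 - b * k * x2 * x1) * (x1 - x3) * (1 - b * k * x3 * x1) * (x1 - x4) * (1 - b * k * x4 * x1)"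
  have Dp: "Dp \<noteq> 0" unfolding Dp_def using ne nz0[OF x(2)] nz0[OF x(3)] nz0[OF x(4)] by simp
  let ?Z = "1 - b * k^2 * (x2 * x3 * x4) * x1"
  let ?a = "shift_coeff b x1 x2 x3 x4 * (pair_ratio b k (x1 * x2) * pair_ratio b k (x1 * x3) * pair_ratio b k (x1 * x4))"
  let ?b = "shift_coeff b x2 x1 x3 x4 * (pair_ratio b k (x1 * x2) * pair_ratio b k (x2 * x3) * pair_ratio b k (x2 * x4))"
  let ?c = "shift_coeff b x3 x1 x2 x4 * (pair_ratio b k (x1 * x3) * pair_ratio b k (x2 * x3) * pair_ratio b k (x3 * x4))"
  let ?d = "shift_coeff b x4 x1 x2 x3 * (pair_ratio b k (x1 * x4) * pair_ratio b k (x2 * x4) * pair_ratio b k (x3 * x4))"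
  have B: "pair_ratio b k (x1 * s) * (1 - b * k * s * x1) = 1 - k * s * x1" if "norm s < 1" for s
    using nz0[OF that] unfolding pair_ratio_def by (simp add: mult_ac)
  have F: "(b * x - s) / (x - s) * (x - s) = b * x - s" if "x \<noteq> s" for x s :: complex
    using that by simp
  have F': "(b * s - x1) / (s - x1) * (x1 - s) = - (b * s - x1)" if "x1 \<noteq> s" for s
    using that by (simp add: divide_simps) (simp add: algebra_simps)
  have ta: "?a * Dp = (b * x1 - x2) * (1 - k * x2 * x1) * (b * x1 - x3) * (1 - k * x3 * x1) * (b * x1 - x4) * (1 - k * x4 * x1)"
  proof -
    have "?a * Dp = ((b * x1 - x2) / (x1 - x2) * (x1 - x2)) * (pair_ratio b k (x1 * x2) * (1 - b * k * x2 * x1)) *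
       ((b * x1 - x3) / (x1 - x3) * (x1 - x3)) * (pair_ratio b k (x1 * x3) * (1 - b * k * x3 * x1)) *
       ((b * x1 - x4) / (x1 - x4) * (x1 - x4)) * (pair_ratio b k (x1 * x4) * (1 - b * k * x4 * x1))"
      unfolding shift_coeff_def Dp_def by (simp only: mult_ac)
    thus ?thesis
      unfolding F[OF ne(1)] F[OF ne(2)] F[OF ne(3)] B[OF x(2)] B[OF x(3)] B[OF x(4)] .
  qed
  have neg_rearr: "- X * Y * (T * (m1 * m2 * m3 * m4)) = - (T * (X * Y * m1 * m2 * m3 * m4))"
    for X Y T m1 m2 m3 m4 :: complex
    by (simp add: mult_ac)
  have tb: "?b * Dp = - (tau b k x2 x3 x4 * ((b * x2 - x1) * (1 - k * x2 * x1) * (x1 - x3) * (1 - b * k * x3 * x1) * (x1 - x4) * (1 - b * k * x4 * x1)))"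
  proof -
    have "?b * Dp = ((b * x2 - x1) / (x2 - x1) * (x1 - x2)) * (pair_ratio b k (x1 * x2) * (1 - b * k * x2 * x1)) *
       (tau b k x2 x3 x4 * ((x1 - x3) * (1 - b * k * x3 * x1) * (x1 - x4) * (1 - b * k * x4 * x1)))"
      unfolding shift_coeff_def tau_def Dp_def by (simp only: mult_ac)
    thus ?thesis unfolding F'[OF ne(1)] B[OF x(2)] by (simp only: neg_rearr)
  qed
  have tc: "?c * Dp = - (tau b k x3 x2 x4 * ((b * x3 - x1) * (1 - k * x3 * x1) * (x1 - x2) * (1 - b * k * x2 * x1) * (x1 - x4) * (1 - b * k * x4 * x1)))"
  proof -
    have "?c * Dp = ((b * x3 - x1) / (x3 - x1) * (x1 - x3)) * (pair_ratio b k (x1 * x3) * (1 - b * k * x3 * x1)) *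
       (tau b k x3 x2 x4 * ((x1 - x2) * (1 - b * k * x2 * x1) * (x1 - x4) * (1 - b * k * x4 * x1)))"
      unfolding shift_coeff_def tau_def Dp_def mult.commute[of x3 x2] by (simp only: mult_ac)
    thus ?thesis unfolding F'[OF ne(2)] B[OF x(3)] by (simp only: neg_rearr)
  qed
  have td: "?d * Dp = - (tau b k x4 x2 x3 * ((b * x4 - x1) * (1 - k * x4 * x1) * (x1 - x2) * (1 - b * k * x2 * x1) * (x1 - x3) * (1 - b * k * x3 * x1)))"
  proof -
    have "?d * Dp = ((b * x4 - x1) / (x4 - x1) * (x1 - x4)) * (pair_ratio b k (x1 * x4) * (1 - b * k * x4 * x1)) *
       (tau b k x4 x2 x3 * ((x1 - x2) * (1 - b * k * x2 * x1) * (x1 - x3) * (1 - b * k * x3 * x1)))"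
      unfolding shift_coeff_def tau_def Dp_def mult.commute[of x4 x2] mult.commute[of x4 x3] by (simp only: mult_ac)
    thus ?thesis unfolding F'[OF ne(3)] B[OF x(4)] by (simp only: neg_rearr)
  qed
  have tr: "pairs (pair_ratio b k) x1 x2 x3 x4 * Dp = triple_ratio b k x2 x3 x4 *
      ((x1 - x2) * (1 - k * x2 * x1) * (x1 - x3) * (1 - k * x3 * x1) * (x1 - x4) * (1 - k * x4 * x1))"
    unfolding pairs_def triple_ratio_def Dp_def B[OF x(2), symmetric] B[OF x(3), symmetric] B[OF x(4), symmetric]
    by (simp only: mult_ac)
  have gen: "(a + b' + c' + d') * Z * D - (p * y + s * w * r) * D =
      Z * (a * D) + Z * (b' * D) + Z * (c' * D) + Z * (d' * D) - p * (y * D) - s * (w * (r * D))"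
    for a b' c' d' Z D p y r s w :: complex
    by (simp add: algebra_simps)
  have Y: "x1 * x2 * x3 * x4 = x2 * x3 * x4 * x1" by (simp only: mult_ac)
  have "(?a + ?b + ?c + ?d) * ?Z * Dp - ((1 + b) * (1 - k^2 * (x2 * x3 * x4 * x1)) +
          b^2 * (1 + b) * (1 - b^2 * k^2 * (x2 * x3 * x4 * x1)) * pairs (pair_ratio b k) x1 x2 x3 x4) * Dp
     = ?Z * (?a * Dp) + ?Z * (?b * Dp) + ?Z * (?c * Dp) + ?Z * (?d * Dp)
       - (1 + b) * ((1 - k^2 * (x2 * x3 * x4 * x1)) * Dp)
       - b^2 * (1 + b) * ((1 - b^2 * k^2 * (x2 * x3 * x4 * x1)) * (pairs (pair_ratio b k) x1 x2 x3 x4 * Dp))"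
    by (rule gen)
  also have "\<dots> = residual b k x2 x3 x4 x1"
    unfolding ta tb tc td tr residual_def unfolding Dp_def
    by (simp only: mult_ac mult_minus_right add_uminus_conv_diff)
  also have "\<dots> = 0"
    by (rule residual_zero) (use assms in auto)
  finally have "(?a + ?b + ?c + ?d) * ?Z * Dp = ((1 + b) * (1 - k^2 * (x2 * x3 * x4 * x1)) +
          b^2 * (1 + b) * (1 - b^2 * k^2 * (x2 * x3 * x4 * x1)) * pairs (pair_ratio b k) x1 x2 x3 x4) * Dp"
    by simp
  hence "(?a + ?b + ?c + ?d) * ?Z = (1 + b) * (1 - k^2 * (x2 * x3 * x4 * x1)) +
          b^2 * (1 + b) * (1 - b^2 * k^2 * (x2 * x3 * x4 * x1)) * pairs (pair_ratio b k) x1 x2 x3 x4"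
    using Dp by simp
  thus ?thesis
    unfolding Y using nzY by (simp add: eq_divide_eq mult.assoc)
qed

section \<open>The q-difference equation of the series\<close>

context nome
begin

lemma holomorphic_G: "norm b < 1 \<Longrightarrow> G b holomorphic_on ball 0 1"
  unfolding G_def using P_nz by (auto intro!: holomorphic_intros)

lemma isCont_G: "norm b < 1 \<Longrightarrow> norm x < 1 \<Longrightarrow> isCont (G b) x"
  using holomorphic_on_imp_continuous_on[OF holomorphic_G] by (simp add: continuous_on_eq_continuous_at)

lemma G_0 [simp]: "G b 0 = 1" by (simp add: G_def)

lemma mult_qpow_tendsto_0: "(\<lambda>k. x * q ^ k) \<longlonglongrightarrow> 0"
  using tendsto_mult[OF tendsto_const LIMSEQ_power_zero[OF q_less_1], of x] by simp

lemma G_qpow_tendsto_1: "norm b < 1 \<Longrightarrow> (\<lambda>k. G b (x * q ^ k)) \<longlonglongrightarrow> 1"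
  using isCont_tendsto_compose[OF isCont_G[of b 0] mult_qpow_tendsto_0[of x]] by simp

lemma pairs_G_tendsto_1: "norm b < 1 \<Longrightarrow> (\<lambda>k. pairs (\<lambda>x. G b (x * q ^ k)) x1 x2 x3 x4) \<longlonglongrightarrow> 1"
proof -
  assume b: "norm b < 1"
  have "(\<lambda>k. pairs (\<lambda>x. G b (x * q ^ k)) x1 x2 x3 x4) \<longlonglongrightarrow> 1 * 1 * 1 * 1 * 1 * 1"
    unfolding pairs_def by (intro tendsto_mult G_qpow_tendsto_1 b)
  thus ?thesis by simp
qed

lemma e_coeff_tendsto_0:
  assumes b: "0 < norm b" "norm b < 1"
    and x: "norm x1 < 1" "norm x2 < 1" "norm x3 < 1" "norm x4 < 1"
  shows "(\<lambda>k. e_coeff b (x1 * x2 * x3 * x4) k) \<longlonglongrightarrow> 0"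
proof -
  let ?p = "\<lambda>k. pairs (\<lambda>x. G b (x * q ^ k)) x1 x2 x3 x4"
  have "(\<lambda>k. e_coeff b (x1 * x2 * x3 * x4) k * ?p k) \<longlonglongrightarrow> 0"
    by (rule summable_LIMSEQ_zero[OF sums_summable[OF Fser_term_sums[OF assms]]])
  from tendsto_divide[OF this pairs_G_tendsto_1[OF b(2), of x1 x2 x3 x4]]
  have "(\<lambda>k. e_coeff b (x1 * x2 * x3 * x4) k * ?p k / ?p k) \<longlonglongrightarrow> 0" by simp
  moreover have "eventually (\<lambda>k. ?p k \<noteq> 0) sequentially"
    by (rule tendsto_imp_eventually_ne[OF pairs_G_tendsto_1[OF b(2)]]) simp
  hence "eventually (\<lambda>k. e_coeff b (x1 * x2 * x3 * x4) k * ?p k / ?p k = e_coeff b (x1 * x2 * x3 * x4) k) sequentially"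
    by (rule eventually_mono) simp
  ultimately show ?thesis
    by (rule Lim_transform_eventually)
qed

lemma G_qpow_Suc:
  assumes "norm x < 1" "norm b < 1"
  shows "G b (x * q ^ Suc k) = G b (x * q ^ k) * pair_ratio b (q ^ k) x"
proof -
  have "norm (x * q ^ k) < 1"
    using norm_mult_qpow_le[of x "norm x" k] assms by simp
  from G_shift[OF this assms(2)] show ?thesis
    by (simp add: pair_ratio_def mult_ac)
qed

lemma pairs_G_Suc:
  assumes b: "norm b < 1" and x: "norm x1 < 1" "norm x2 < 1" "norm x3 < 1" "norm x4 < 1"
  shows "pairs (\<lambda>x. G b (x * q ^ Suc k)) x1 x2 x3 x4 =
         pairs (\<lambda>x. G b (x * q ^ k)) x1 x2 x3 x4 * pairs (pair_ratio b (q ^ k)) x1 x2 x3 x4"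
  unfolding pairs_def G_qpow_Suc[OF norm_mult_lt_1[OF x(1,2)] b] G_qpow_Suc[OF norm_mult_lt_1[OF x(1,3)] b]
    G_qpow_Suc[OF norm_mult_lt_1[OF x(1,4)] b] G_qpow_Suc[OF norm_mult_lt_1[OF x(2,3)] b]
    G_qpow_Suc[OF norm_mult_lt_1[OF x(2,4)] b] G_qpow_Suc[OF norm_mult_lt_1[OF x(3,4)] b]
  by (simp only: mult_ac)

text \<open>With \<open>p\<^sub>k\<close> the product of the \<open>G b (x\<^sub>r x\<^sub>s
  q\<^sup>k)\<close>, shifting \<open>x\<^sub>i\<close> multiplies \<open>p\<^sub>k\<close> by three factors
  \<open>pair_ratio\<close>, and scaling everything by \<open>Q\<close> turns \<open>p\<^sub>k\<close> into
  \<open>p\<^bsub>k+1\<^esub>\<close>. By \<open>four_variable_identity\<close> the left-hand side is a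
  combination of \<open>p\<^sub>k\<close> and \<open>p\<^bsub>k+1\<^esub>\<close>, and
  \<open>e_coeff_relation\<close> matches the coefficients.\<close>

lemma Fser_q_difference:
  assumes b: "0 < norm b" "norm b < 1" and Q: "Q ^ 2 = q"
    and x: "norm x1 < 1" "norm x2 < 1" "norm x3 < 1" "norm x4 < 1" "x1 \<noteq> 0" "x2 \<noteq> 0" "x3 \<noteq> 0" "x4 \<noteq> 0"
    and ne: "x1 \<noteq> x2" "x1 \<noteq> x3" "x1 \<noteq> x4" "x2 \<noteq> x3" "x2 \<noteq> x4" "x3 \<noteq> x4"
  shows "shift_coeff b x1 x2 x3 x4 * Fser b (q * x1) x2 x3 x4 + shift_coeff b x2 x1 x3 x4 * Fser b x1 (q * x2) x3 x4 +
         shift_coeff b x3 x1 x2 x4 * Fser b x1 x2 (q * x3) x4 + shift_coeff b x4 x1 x2 x3 * Fser b x1 x2 x3 (q * x4) =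
         (1 + b) * (Fser b x1 x2 x3 x4 + b ^ 2 * Fser b (Q * x1) (Q * x2) (Q * x3) (Q * x4))"
proof -
  define Y where "Y = x1 * x2 * x3 * x4"
  define p where "p k = pairs (\<lambda>x. G b (x * q ^ k)) x1 x2 x3 x4" for k
  \<comment> \<open>By \<open>four_variable_identity\<close> the \<open>k\<close>-th terms on the left add up to \<open>al k * p k + be k * p (Suc k)\<close> times their common coefficient.\<close>
  define al where "al k = (1 + b) * (1 - (q^k)^2 * Y) / (1 - b * (q^k)^2 * Y)" for k
  define be where "be k = b^2 * (1 + b) * (1 - b^2 * (q^k)^2 * Y) / (1 - b * (q^k)^2 * Y)" for k
  have b0: "b \<noteq> 0" using b by auto
  have Y1: "norm Y < 1" unfolding Y_def by (intro norm_mult_lt_1 x)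
  have qx: "norm (q * x) < 1" if "norm x < 1" for x
    by (rule norm_mult_lt_1[OF q_less_1 that])
  have nQ: "norm Q < 1"
  proof -
    have "norm Q ^ 2 < 1" using q_less_1 Q by (metis norm_power)
    thus ?thesis by (simp add: abs_square_less_1)
  qed
  have Qx: "norm (Q * x) < 1" if "norm x < 1" for x
    by (rule norm_mult_lt_1[OF nQ that])
  have sh: "G b (q * x * y * q ^ k) = G b (x * y * q ^ k) * pair_ratio b (q ^ k) (x * y)"
    "G b (y * (q * x) * q ^ k) = G b (y * x * q ^ k) * pair_ratio b (q ^ k) (y * x)"
    if "norm x < 1" "norm y < 1" for x y k
    using G_qpow_Suc[OF norm_mult_lt_1[OF that] b(2), of k] by (simp_all add: mult_ac)
  note shs = sh[OF x(1) x(2)] sh[OF x(1) x(3)] sh[OF x(1) x(4)] sh[OF x(2) x(1)] sh[OF x(2) x(3)]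
    sh[OF x(2) x(4)] sh[OF x(3) x(1)] sh[OF x(3) x(2)] sh[OF x(3) x(4)] sh[OF x(4) x(1)] sh[OF x(4) x(2)] sh[OF x(4) x(3)]
  have p1: "pairs (\<lambda>x. G b (x * q ^ k)) (q * x1) x2 x3 x4 =
      p k * (pair_ratio b (q^k) (x1 * x2) * pair_ratio b (q^k) (x1 * x3) * pair_ratio b (q^k) (x1 * x4))" for k
    unfolding pairs_def p_def shs by (simp only: mult_ac)
  have p2: "pairs (\<lambda>x. G b (x * q ^ k)) x1 (q * x2) x3 x4 =
      p k * (pair_ratio b (q^k) (x1 * x2) * pair_ratio b (q^k) (x2 * x3) * pair_ratio b (q^k) (x2 * x4))" for k
    unfolding pairs_def p_def shs by (simp only: mult_ac)
  have p3: "pairs (\<lambda>x. G b (x * q ^ k)) x1 x2 (q * x3) x4 =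
      p k * (pair_ratio b (q^k) (x1 * x3) * pair_ratio b (q^k) (x2 * x3) * pair_ratio b (q^k) (x3 * x4))" for k
    unfolding pairs_def p_def shs by (simp only: mult_ac)
  have p4: "pairs (\<lambda>x. G b (x * q ^ k)) x1 x2 x3 (q * x4) =
      p k * (pair_ratio b (q^k) (x1 * x4) * pair_ratio b (q^k) (x2 * x4) * pair_ratio b (q^k) (x3 * x4))" for k
    unfolding pairs_def p_def shs by (simp only: mult_ac)
  have pQ: "pairs (\<lambda>x. G b (x * q ^ k)) (Q * x1) (Q * x2) (Q * x3) (Q * x4) = p (Suc k)" for k
  proof -
    have "Q * x * (Q * y) * q ^ k = x * y * q ^ Suc k" for x y
      using Q by (simp add: power2_eq_square mult_ac)
    thus ?thesis by (simp only: pairs_def p_def)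
  qed
  have YQ: "Q * x1 * (Q * x2) * (Q * x3) * (Q * x4) = q^2 * Y"
    unfolding Y_def Q[symmetric] by (simp add: power2_eq_square mult_ac)
  have Yq: "q * x1 * x2 * x3 * x4 = q * Y" "x1 * (q * x2) * x3 * x4 = q * Y"
     "x1 * x2 * (q * x3) * x4 = q * Y" "x1 * x2 * x3 * (q * x4) = q * Y"
    unfolding Y_def by (simp_all add: mult_ac)
  have S1: "(\<lambda>k. e_coeff b (q * Y) k * (p k * (pair_ratio b (q^k) (x1 * x2) * pair_ratio b (q^k) (x1 * x3) * pair_ratio b (q^k) (x1 * x4)))) sums Fser b (q * x1) x2 x3 x4"
    using Fser_term_sums[OF b qx[OF x(1)] x(2-4)] unfolding p1 Yq .
  have S2: "(\<lambda>k. e_coeff b (q * Y) k * (p k * (pair_ratio b (q^k) (x1 * x2) * pair_ratio b (q^k) (x2 * x3) * pair_ratio b (q^k) (x2 * x4)))) sums Fser b x1 (q * x2) x3 x4"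
    using Fser_term_sums[OF b x(1) qx[OF x(2)] x(3,4)] unfolding p2 Yq .
  have S3: "(\<lambda>k. e_coeff b (q * Y) k * (p k * (pair_ratio b (q^k) (x1 * x3) * pair_ratio b (q^k) (x2 * x3) * pair_ratio b (q^k) (x3 * x4)))) sums Fser b x1 x2 (q * x3) x4"
    using Fser_term_sums[OF b x(1,2) qx[OF x(3)] x(4)] unfolding p3 Yq .
  have S4: "(\<lambda>k. e_coeff b (q * Y) k * (p k * (pair_ratio b (q^k) (x1 * x4) * pair_ratio b (q^k) (x2 * x4) * pair_ratio b (q^k) (x3 * x4)))) sums Fser b x1 x2 x3 (q * x4)"
    using Fser_term_sums[OF b x(1-3) qx[OF x(4)]] unfolding p4 Yq .
  have S0: "(\<lambda>k. e_coeff b Y k * p k) sums Fser b x1 x2 x3 x4"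
    using Fser_term_sums[OF b x(1-4)] unfolding p_def Y_def .
  have SQ: "(\<lambda>k. e_coeff b (q^2 * Y) k * p (Suc k)) sums Fser b (Q * x1) (Q * x2) (Q * x3) (Q * x4)"
    using Fser_term_sums[OF b Qx[OF x(1)] Qx[OF x(2)] Qx[OF x(3)] Qx[OF x(4)]] unfolding pQ YQ .
  let ?L = "shift_coeff b x1 x2 x3 x4 * Fser b (q * x1) x2 x3 x4 + shift_coeff b x2 x1 x3 x4 * Fser b x1 (q * x2) x3 x4 +
         shift_coeff b x3 x1 x2 x4 * Fser b x1 x2 (q * x3) x4 + shift_coeff b x4 x1 x2 x3 * Fser b x1 x2 x3 (q * x4)"
  let ?R = "(1 + b) * (Fser b x1 x2 x3 x4 + b ^ 2 * Fser b (Q * x1) (Q * x2) (Q * x3) (Q * x4))"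
  define g where "g k = p k * (e_coeff b (q * Y) k * al k - (1 + b) * e_coeff b Y k)" for k
  have qk: "norm (q ^ k) \<le> 1" "q ^ k \<noteq> 0" for k
    using norm_qpow_le q_nz by auto
  have pS: "p (Suc k) = p k * pairs (pair_ratio b (q ^ k)) x1 x2 x3 x4" for k
    unfolding p_def by (rule pairs_G_Suc[OF b(2) x(1-4)])
  have q2k: "(q ^ k)^2 * Y = Y * q ^ (2 * k)" "b * (q ^ k)^2 * Y = b * Y * q ^ (2 * k)"
     "b^2 * (q ^ k)^2 * Y = b^2 * Y * q ^ (2 * k)" for k
    by (simp_all add: power_mult[symmetric] mult_ac)
  have bY: "norm (b * Y) < 1" by (rule norm_mult_lt_1[OF b(2) Y1])
  have g0: "g 0 = 0"
  proof -
    have "e_coeff b (q * Y) 0 * al 0 = (1 + b) * (e_coeff b (q * Y) 0 * (1 - Y) / (1 - b * Y))"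
      by (simp add: al_def)
    thus ?thesis unfolding e_coeff_0_relation[OF bY] by (simp add: g_def)
  qed
  have main: "shift_coeff b x1 x2 x3 x4 * (e_coeff b (q * Y) k * (p k * (pair_ratio b (q^k) (x1 * x2) * pair_ratio b (q^k) (x1 * x3) * pair_ratio b (q^k) (x1 * x4)))) +
     shift_coeff b x2 x1 x3 x4 * (e_coeff b (q * Y) k * (p k * (pair_ratio b (q^k) (x1 * x2) * pair_ratio b (q^k) (x2 * x3) * pair_ratio b (q^k) (x2 * x4)))) +
     shift_coeff b x3 x1 x2 x4 * (e_coeff b (q * Y) k * (p k * (pair_ratio b (q^k) (x1 * x3) * pair_ratio b (q^k) (x2 * x3) * pair_ratio b (q^k) (x3 * x4)))) +
     shift_coeff b x4 x1 x2 x3 * (e_coeff b (q * Y) k * (p k * (pair_ratio b (q^k) (x1 * x4) * pair_ratio b (q^k) (x2 * x4) * pair_ratio b (q^k) (x3 * x4)))) -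
     (1 + b) * (e_coeff b Y k * p k + b ^ 2 * (e_coeff b (q^2 * Y) k * p (Suc k))) = - (g (Suc k) - g k)" for k
  proof -
    have "shift_coeff b x1 x2 x3 x4 * (e_coeff b (q * Y) k * (p k * (pair_ratio b (q^k) (x1 * x2) * pair_ratio b (q^k) (x1 * x3) * pair_ratio b (q^k) (x1 * x4)))) +
     shift_coeff b x2 x1 x3 x4 * (e_coeff b (q * Y) k * (p k * (pair_ratio b (q^k) (x1 * x2) * pair_ratio b (q^k) (x2 * x3) * pair_ratio b (q^k) (x2 * x4)))) +
     shift_coeff b x3 x1 x2 x4 * (e_coeff b (q * Y) k * (p k * (pair_ratio b (q^k) (x1 * x3) * pair_ratio b (q^k) (x2 * x3) * pair_ratio b (q^k) (x3 * x4)))) +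
     shift_coeff b x4 x1 x2 x3 * (e_coeff b (q * Y) k * (p k * (pair_ratio b (q^k) (x1 * x4) * pair_ratio b (q^k) (x2 * x4) * pair_ratio b (q^k) (x3 * x4)))) =
     e_coeff b (q * Y) k * p k * (
         shift_coeff b x1 x2 x3 x4 * (pair_ratio b (q^k) (x1 * x2) * pair_ratio b (q^k) (x1 * x3) * pair_ratio b (q^k) (x1 * x4)) +
         shift_coeff b x2 x1 x3 x4 * (pair_ratio b (q^k) (x1 * x2) * pair_ratio b (q^k) (x2 * x3) * pair_ratio b (q^k) (x2 * x4)) +
         shift_coeff b x3 x1 x2 x4 * (pair_ratio b (q^k) (x1 * x3) * pair_ratio b (q^k) (x2 * x3) * pair_ratio b (q^k) (x3 * x4)) +
         shift_coeff b x4 x1 x2 x3 * (pair_ratio b (q^k) (x1 * x4) * pair_ratio b (q^k) (x2 * x4) * pair_ratio b (q^k) (x3 * x4)))"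
      by (simp only: distrib_left mult_ac)
    also have "\<dots> = e_coeff b (q * Y) k * p k * (al k + be k * pairs (pair_ratio b (q ^ k)) x1 x2 x3 x4)"
      unfolding four_variable_identity[OF qk b(2) b0 x ne] al_def be_def Y_def
      by (simp add: add_divide_distrib)
    also have "\<dots> = e_coeff b (q * Y) k * al k * p k + e_coeff b (q * Y) k * be k * p (Suc k)"
      unfolding pS by (simp add: algebra_simps)
    also have "\<dots> - (1 + b) * (e_coeff b Y k * p k + b ^ 2 * (e_coeff b (q^2 * Y) k * p (Suc k))) =
        g k + p (Suc k) * (e_coeff b (q * Y) k * be k - (1 + b) * (b^2 * e_coeff b (q^2 * Y) k))"
      unfolding g_def by (simp add: algebra_simps)
    also have "p (Suc k) * (e_coeff b (q * Y) k * be k - (1 + b) * (b^2 * e_coeff b (q^2 * Y) k)) = - g (Suc k)"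
    proof -
      have "e_coeff b (q * Y) (Suc k) * al (Suc k) + e_coeff b (q * Y) k * be k =
         (1 + b) * (e_coeff b (q * Y) (Suc k) * (1 - Y * q ^ (2 * k + 2)) / (1 - b * Y * q ^ (2 * k + 2)) +
         e_coeff b (q * Y) k * (b ^ 2 * (1 - b ^ 2 * Y * q ^ (2 * k))) / (1 - b * Y * q ^ (2 * k)))"
        unfolding al_def be_def q2k by (simp add: ring_distribs mult_ac)
      also have "\<dots> = (1 + b) * (e_coeff b Y (Suc k) + b ^ 2 * e_coeff b (q ^ 2 * Y) k)"
        unfolding e_coeff_relation[OF b Y1] ..
      finally have eq: "e_coeff b (q * Y) k * be k - (1 + b) * (b^2 * e_coeff b (q^2 * Y) k) =
           - (e_coeff b (q * Y) (Suc k) * al (Suc k) - (1 + b) * e_coeff b Y (Suc k))"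
        by (simp add: algebra_simps)
      show ?thesis unfolding eq g_def by (simp only: mult_minus_right)
    qed
    finally show ?thesis by simp
  qed
  have "(\<lambda>k. - (g (Suc k) - g k)) sums (?L - ?R)"
    unfolding main[symmetric]
    by (intro sums_diff sums_add sums_mult S0 S1 S2 S3 S4 SQ)
  moreover have "(\<lambda>k. - (g (Suc k) - g k)) sums (- (0 - g 0))"
  proof (intro sums_minus telescope_sums)
    have "(\<lambda>k. e_coeff b (q * Y) k) \<longlonglongrightarrow> 0"
      using e_coeff_tendsto_0[OF b qx[OF x(1)] x(2-4)] unfolding Yq .
    moreover have "(\<lambda>k. e_coeff b Y k) \<longlonglongrightarrow> 0"
      using e_coeff_tendsto_0[OF b x(1-4)] unfolding Y_def .
    moreover have "al \<longlonglongrightarrow> (1 + b) * (1 - 0) / (1 - 0)"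
    proof -
      have q2: "(\<lambda>k. Z * q ^ (2 * k)) \<longlonglongrightarrow> 0" for Z
      proof -
        have "norm (q^2) < 1" using q_less_1 by (simp add: norm_power abs_square_less_1)
        from tendsto_mult[OF tendsto_const LIMSEQ_power_zero[OF this], of Z]
        show ?thesis by (simp add: power_mult)
      qed
      show ?thesis unfolding al_def q2k by (intro tendsto_intros q2) simp
    qed
    moreover have "p \<longlonglongrightarrow> 1"
      unfolding p_def by (rule pairs_G_tendsto_1[OF b(2)])
    ultimately have "g \<longlonglongrightarrow> 1 * (0 * ((1 + b) * (1 - 0) / (1 - 0)) - (1 + b) * 0)"
      unfolding g_def by (intro tendsto_intros)
    thus "g \<longlonglongrightarrow> 0" by simp
  qed
  ultimately have "?L - ?R = - (0 - g 0)"
    by (rule sums_unique2)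
  thus ?thesis using g0 by simp
qed

text \<open>The series satisfies \<open>(1 - z) E(z) = (1 - a z) E(q z)\<close>, which is iterated down to
  \<open>E(0) = 1\<close>.\<close>

lemma q_binomial:
  assumes z: "norm z < 1"
  shows "(\<lambda>k. Pn a k / Pn q k * z ^ k) sums (P (a * z) / P z)"
proof -
  define c where "c k = Pn a k / Pn q k" for k
  define E where "E z = (\<Sum>k. c k * z ^ k)" for z
  have c_le: "norm (c k) \<le> expq (norm a) * (expq 1 / norm (P q))" for k
    using norm_mult_le2[OF norm_Pn_le'[OF order.refl, of a k] norm_inverse_Pn_q_le[of k]]
    by (simp add: c_def)
  have summ: "summable (\<lambda>k. c k * z ^ k)" if "norm z < 1" for z
  proof (rule summable_comparison_test)
    show "\<exists>N. \<forall>n\<ge>N. norm (c n * z ^ n) \<le> expq (norm a) * (expq 1 / norm (P q)) * norm z ^ n"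
      unfolding norm_mult norm_power using c_le by (intro exI[of _ 0] allI impI mult_right_mono) auto
    show "summable (\<lambda>n. expq (norm a) * (expq 1 / norm (P q)) * norm z ^ n)"
      using that by (intro summable_mult summable_geometric) auto
  qed
  have cS: "c (Suc k) * (1 - q ^ Suc k) = c k * (1 - a * q ^ k)" for k
  proof -
    have "1 - q ^ Suc k \<noteq> 0" using Pn_q_nz[of "Suc k"] by (simp add: Pn_Suc)
    thus ?thesis unfolding c_def Pn_Suc using Pn_q_nz[of k] by (simp add: field_simps)
  qed
  have feq: "(1 - w) * E w = (1 - a * w) * E (q * w)" if w: "norm w < 1" for w
  proof -
    have qw: "norm (q * w) < 1" by (rule norm_mult_lt_1[OF q_less_1 w])
    have s1: "(\<lambda>k. c k * w ^ k) sums E w" "(\<lambda>k. c k * (q * w) ^ k) sums E (q * w)"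
      unfolding E_def by (intro summable_sums summ w qw)+
    hence "(\<lambda>k. c k * w ^ k - c k * (q * w) ^ k) sums (E w - E (q * w))"
      by (intro sums_diff)
    hence "(\<lambda>k. c (Suc k) * w ^ Suc k - c (Suc k) * (q * w) ^ Suc k) sums (E w - E (q * w))"
      by (subst sums_Suc_iff) (simp add: c_def)
    moreover have "c (Suc k) * w ^ Suc k - c (Suc k) * (q * w) ^ Suc k =
        w * (c k * w ^ k - a * (c k * (q * w) ^ k))" for k
    proof -
      have "c (Suc k) * w ^ Suc k - c (Suc k) * (q * w) ^ Suc k = c (Suc k) * (1 - q ^ Suc k) * w ^ Suc k"
        by (simp add: power_mult_distrib algebra_simps)
      thus ?thesis unfolding cS by (simp add: power_mult_distrib algebra_simps)
    qed
    ultimately have "(\<lambda>k. w * (c k * w ^ k - a * (c k * (q * w) ^ k))) sums (E w - E (q * w))"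
      by simp
    moreover have "(\<lambda>k. w * (c k * w ^ k - a * (c k * (q * w) ^ k))) sums (w * (E w - a * E (q * w)))"
      by (intro sums_mult sums_diff s1)
    ultimately have "E w - E (q * w) = w * (E w - a * E (q * w))"
      by (rule sums_unique2)
    thus ?thesis by (simp add: algebra_simps)
  qed
  have iter: "Pn z n * E z = Pn (a * z) n * E (z * q ^ n)" for n
  proof (induction n)
    case (Suc n)
    have "norm (z * q ^ n) < 1" using norm_mult_qpow_le[of z "norm z" n] z by simp
    from feq[OF this] show ?case
      using Suc by (simp add: Pn_Suc mult_ac) (metis (no_types, lifting) mult.assoc mult.left_commute mult.commute)
  qed auto
  have "isCont E 0"
    unfolding E_def
  proof (rule isCont_powser)
    show "summable (\<lambda>n. c n * (1 / 2) ^ n)" by (rule summ) simp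
  qed simp
  from isCont_tendsto_compose[OF this mult_qpow_tendsto_0[of z]]
  have "(\<lambda>n. E (z * q ^ n)) \<longlonglongrightarrow> E 0" .
  moreover have "E 0 = 1"
    unfolding E_def using powser_zero[of c] by (simp add: c_def)
  ultimately have "(\<lambda>n. Pn (a * z) n * E (z * q ^ n)) \<longlonglongrightarrow> P (a * z) * 1"
    by (intro tendsto_mult Pn_tendsto_P) simp
  moreover have "(\<lambda>n. Pn z n * E z) \<longlonglongrightarrow> P z * E z"
    by (intro tendsto_mult Pn_tendsto_P tendsto_const)
  ultimately have "P z * E z = P (a * z)"
    unfolding iter using LIMSEQ_unique by fastforce
  hence "E z = P (a * z) / P z" using P_nz[OF z] by (simp add: field_simps)
  thus ?thesis using summable_sums[OF summ[OF z]] unfolding E_def c_def by simp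
qed

text \<open>The series side at \<open>x3 = x4 = 0\<close>, where it depends on \<open>x1 x2\<close>
  only.\<close>

definition phi :: "complex \<Rightarrow> complex \<Rightarrow> complex" where
  "phi b x = (\<Sum>k. u_coeff b k * G b (x * q ^ k))"

lemma e_coeff_at_0: "e_coeff b 0 k = u_coeff b k"
  by (cases k) (simp_all add: e_coeff_def qpoch_def)

lemma phi_sums_and_Fser:
  assumes b: "0 < norm b" "norm b < 1" and x: "norm x1 < 1" "norm x2 < 1"
  shows "Fser b x1 x2 0 0 = phi b (x1 * x2)"
  using sums_unique[OF Fser_term_sums[OF b x, of 0 0]]
  by (simp add: phi_def pairs_def e_coeff_at_0)

lemma phi_sums:
  assumes b: "0 < norm b" "norm b < 1" and x: "norm x < 1"
  shows "(\<lambda>k. u_coeff b k * G b (x * q ^ k)) sums phi b x"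
proof -
  define y where "y = csqrt x"
  have "norm y < 1" "x = y * y"
    using x by (simp_all add: y_def power2_eq_square[symmetric] real_sqrt_lt_1_iff)
  thus ?thesis
    using Fser_term_sums[OF b, of y y 0 0] phi_sums_and_Fser[OF b, of y y]
    by (simp add: pairs_def e_coeff_at_0)
qed

text \<open>The difference of the two sides is a telescoping sum.\<close>

lemma phi_relation:
  assumes b: "0 < norm b" "norm b < 1" and x: "norm x < 1"
  shows "(1 - x) * (phi b x - b * phi b (q * x)) =
         (1 - b^2 * x) * (phi b (q * x) - b * phi b (q^2 * x))"
proof -
  define a where "a k = Pn (1 / b) k * b ^ (2 * k) / Pn q k" for k
  define g where "g k = G b (x * q ^ k)" for k
  define u where "u = u_coeff b"
  \<comment> \<open>Up to the factor \<open>1 - b\<close>, the partial sums of the difference of the two sides; the factor \<open>1 - q ^ k\<close> makes it start at \<open>0\<close>.\<close>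
  define W where "W k = a k * (1 - q ^ k) * ((1 - b * x) * g k - (1 - b^2 * x) * g (Suc k))" for k
  have b0: "b \<noteq> 0" "b \<noteq> 1" using b by auto
  have qx: "norm (q * x) < 1" "norm (q^2 * x) < 1"
    using x q_less_1 by (auto intro!: norm_mult_lt_1 simp: norm_power power2_eq_square)
  have s0: "(\<lambda>k. u k * g k) sums phi b x"
    using phi_sums[OF b x] by (simp add: u_def g_def)
  have s1: "(\<lambda>k. u k * g (Suc k)) sums phi b (q * x)"
    using phi_sums[OF b qx(1)] by (simp add: u_def g_def mult_ac)
  have s2: "(\<lambda>k. u k * g (Suc (Suc k))) sums phi b (q^2 * x)"
    using phi_sums[OF b qx(2)] by (simp add: u_def g_def mult_ac power2_eq_square)
  have gS: "g (Suc k) * (1 - b * x * q ^ k) = (1 - x * q ^ k) * g k" for k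
  proof -
    have "norm (b * (x * q ^ k)) < 1"
      using norm_mult_qpow_le[of x "norm x" k] x by (intro norm_mult_lt_1[OF b(2)]) auto
    hence "1 - b * x * q ^ k \<noteq> 0" by (auto simp: mult_ac)
    thus ?thesis
      using G_qpow_Suc[OF x b(2), of k] by (simp add: g_def pair_ratio_def mult_ac)
  qed
  have q_ne: "1 - q ^ Suc k \<noteq> 0" for k
    using Pn_q_nz[of "Suc k"] by (simp add: Pn_Suc)
  have aS: "a (Suc k) * (1 - q ^ Suc k) = a k * b * (b - q ^ k)" for k
    using q_ne[of k] Pn_q_nz[of k] b0 unfolding a_def Pn_Suc[of _ k]
    by (simp add: divide_simps power2_eq_square)
  have ua: "(1 - b) * u k = a k * (q ^ k - b)" for k
  proof -
    have "(1 - 1 / b) * Pn (q / b) k = Pn (1 / b) k * (1 - q ^ k / b)"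
      using Pn_Suc[of "1 / b" k] Pn_Suc_shift[of "1 / b" k] by simp
    hence "(b - 1) * Pn (q / b) k = Pn (1 / b) k * (b - q ^ k)"
      using b0 by (simp add: field_simps)
    hence "(1 - b) * Pn (q / b) k = Pn (1 / b) k * (q ^ k - b)"
      by (simp add: algebra_simps)
    thus ?thesis unfolding u_def a_def u_coeff_def
      by (simp add: mult_ac)
  qed
  have W: "(1 - b) * ((1 - x) * (u k * g k - b * (u k * g (Suc k))) -
        (1 - b^2 * x) * (u k * g (Suc k) - b * (u k * g (Suc (Suc k))))) = W (Suc k) - W k" for k
  proof -
    have "(1 - b) * ((1 - x) * (u k * g k - b * (u k * g (Suc k))) -
        (1 - b^2 * x) * (u k * g (Suc k) - b * (u k * g (Suc (Suc k))))) =
       ((1 - b) * u k) * ((1 - x) * (g k - b * g (Suc k)) - (1 - b^2 * x) * (g (Suc k) - b * g (Suc (Suc k))))"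
      by (simp add: algebra_simps)
    also have "\<dots> = a k * b * (b - q ^ k) * ((1 - b * x) * g (Suc k) - (1 - b^2 * x) * g (Suc (Suc k)))
        - W k + a k * (1 - b) * ((1 - x * q ^ k) * g k - g (Suc k) * (1 - b * x * q ^ k))"
      unfolding ua W_def by (simp add: algebra_simps power2_eq_square)
    also have "\<dots> = W (Suc k) - W k"
      unfolding gS W_def aS by simp
    finally show ?thesis .
  qed
  let ?d = "(1 - x) * (phi b x - b * phi b (q * x)) - (1 - b^2 * x) * (phi b (q * x) - b * phi b (q^2 * x))"
  have "(\<lambda>k. W (Suc k) - W k) sums ((1 - b) * ?d)"
    unfolding W[symmetric] by (intro sums_mult sums_diff s0 s1 s2)
  moreover have "(\<lambda>k. W (Suc k) - W k) sums (0 - W 0)"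
  proof (rule telescope_sums)
    have g1: "g \<longlonglongrightarrow> 1" unfolding g_def by (rule G_qpow_tendsto_1[OF b(2)])
    have q0: "(\<lambda>k. q ^ k) \<longlonglongrightarrow> 0" by (rule LIMSEQ_power_zero[OF q_less_1])
    have "a \<longlonglongrightarrow> 0"
    proof -
      have "norm (b^2) < 1" using b by (simp add: norm_power abs_square_less_1)
      from sums_summable[OF q_binomial[OF this, of "1 / b"]]
      have "summable a" by (simp add: a_def[abs_def] power_mult)
      thus ?thesis by (rule summable_LIMSEQ_zero)
    qed
    hence "W \<longlonglongrightarrow> 0 * (1 - 0) * ((1 - b * x) * 1 - (1 - b^2 * x) * 1)"
      unfolding W_def by (intro tendsto_intros q0 g1 LIMSEQ_Suc[OF g1])
    thus "W \<longlonglongrightarrow> 0" by simp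
  qed
  ultimately have "(1 - b) * ?d = 0 - W 0" by (rule sums_unique2)
  moreover have "W 0 = 0" by (simp add: W_def)
  ultimately show ?thesis using b0 by simp
qed

lemma phi_at_0:
  assumes b: "0 < norm b" "norm b < 1"
  shows "phi b 0 = P (q * b) / P (b^2)"
proof -
  have b2: "norm (b^2) < 1" using b by (simp add: norm_power abs_square_less_1)
  have "(\<lambda>k. u_coeff b k) sums (P (q / b * b^2) / P (b^2))"
    using q_binomial[OF b2, of "q / b"] by (simp add: u_coeff_def power_mult)
  moreover have "(\<lambda>k. u_coeff b k) sums phi b 0"
    using phi_sums[OF b, of 0] by simp
  moreover have "q / b * b^2 = q * b" using b by (simp add: power2_eq_square)
  ultimately show ?thesis using sums_unique2 by metis
qed

end

section \<open>Kernel identities\<close>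

text \<open>Partial fractions in \<open>u\<close>; the constant term is the value at infinity.\<close>

lemma partial_fractions_4:
  fixes x1 x2 x3 x4 b u :: complex
  assumes ne: "x1 \<noteq> x2" "x1 \<noteq> x3" "x1 \<noteq> x4" "x2 \<noteq> x3" "x2 \<noteq> x4" "x3 \<noteq> x4"
    and u: "u \<noteq> x1" "u \<noteq> x2" "u \<noteq> x3" "u \<noteq> x4"
  shows "(b * u - x1) / (u - x1) * ((b * u - x2) / (u - x2)) * ((b * u - x3) / (u - x3)) * ((b * u - x4) / (u - x4)) =
     b ^ 4 + (b - 1) * (shift_coeff b x1 x2 x3 x4 * x1 / (u - x1) + shift_coeff b x2 x1 x3 x4 * x2 / (u - x2) +
              shift_coeff b x3 x1 x2 x4 * x3 / (u - x3) + shift_coeff b x4 x1 x2 x3 * x4 / (u - x4))"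
proof -
  define e1 e2 e3 e4 where "e1 = x1 + x2 + x3 + x4"
    and "e2 = x1*x2 + x1*x3 + x1*x4 + x2*x3 + x2*x4 + x3*x4"
    and "e3 = x1*x2*x3 + x1*x2*x4 + x1*x3*x4 + x2*x3*x4" and "e4 = x1*x2*x3*x4"
  define p where "p = [: e4 - b^4 * e4, (b^4 - b) * e3, (b^2 - b^4) * e2, (b^4 - b^3) * e1 :]
    - smult ((b - 1) * shift_coeff b x1 x2 x3 x4 * x1) ([:-x2, 1:] * [:-x3, 1:] * [:-x4, 1:])
    - smult ((b - 1) * shift_coeff b x2 x1 x3 x4 * x2) ([:-x1, 1:] * [:-x3, 1:] * [:-x4, 1:])
    - smult ((b - 1) * shift_coeff b x3 x1 x2 x4 * x3) ([:-x1, 1:] * [:-x2, 1:] * [:-x4, 1:])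
    - smult ((b - 1) * shift_coeff b x4 x1 x2 x3 * x4) ([:-x1, 1:] * [:-x2, 1:] * [:-x3, 1:])"
  have deg3: "degree (smult c ([:a1, b1:] * [:a2, b2:] * [:a3, b3:])) \<le> 3" for c a1 b1 a2 b2 a3 b3 :: complex
    by simp
  have deg: "degree p \<le> 3"
    unfolding p_def by (intro degree_diff_le deg3) simp
  have cub: "poly [: e4 - b^4 * e4, (b^4 - b) * e3, (b^2 - b^4) * e2, (b^4 - b^3) * e1 :] u =
      (b * u - x1) * (b * u - x2) * (b * u - x3) * (b * u - x4) - b^4 * ((u - x1) * (u - x2) * (u - x3) * (u - x4))" for u
    unfolding e1_def e2_def e3_def e4_def by simp algebra
  have poly_p: "poly p u = (b * u - x1) * (b * u - x2) * (b * u - x3) * (b * u - x4) - b^4 * ((u - x1) * (u - x2) * (u - x3) * (u - x4))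
    - (b - 1) * shift_coeff b x1 x2 x3 x4 * x1 * ((u - x2) * (u - x3) * (u - x4))
    - (b - 1) * shift_coeff b x2 x1 x3 x4 * x2 * ((u - x1) * (u - x3) * (u - x4))
    - (b - 1) * shift_coeff b x3 x1 x2 x4 * x3 * ((u - x1) * (u - x2) * (u - x4))
    - (b - 1) * shift_coeff b x4 x1 x2 x3 * x4 * ((u - x1) * (u - x2) * (u - x3))" for u
    unfolding p_def poly_diff poly_smult poly_mult cub by simp
  have A: "shift_coeff b x y z w * ((x - y) * (x - z) * (x - w)) = (b * x - y) * (b * x - z) * (b * x - w)"
    if "x \<noteq> y" "x \<noteq> z" "x \<noteq> w" for x y z w
    using that by (simp add: shift_coeff_def)
  have r: "poly p x1 = (b - 1) * x1 * ((b * x1 - x2) * (b * x1 - x3) * (b * x1 - x4) - shift_coeff b x1 x2 x3 x4 * ((x1 - x2) * (x1 - x3) * (x1 - x4)))"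
    "poly p x2 = (b - 1) * x2 * ((b * x2 - x1) * (b * x2 - x3) * (b * x2 - x4) - shift_coeff b x2 x1 x3 x4 * ((x2 - x1) * (x2 - x3) * (x2 - x4)))"
    "poly p x3 = (b - 1) * x3 * ((b * x3 - x1) * (b * x3 - x2) * (b * x3 - x4) - shift_coeff b x3 x1 x2 x4 * ((x3 - x1) * (x3 - x2) * (x3 - x4)))"
    "poly p x4 = (b - 1) * x4 * ((b * x4 - x1) * (b * x4 - x2) * (b * x4 - x3) - shift_coeff b x4 x1 x2 x3 * ((x4 - x1) * (x4 - x2) * (x4 - x3)))"
    unfolding poly_p by (simp_all add: algebra_simps)
  have "poly p x1 = 0" "poly p x2 = 0" "poly p x3 = 0" "poly p x4 = 0"
    unfolding r using A[of x1 x2 x3 x4] A[of x2 x1 x3 x4] A[of x3 x1 x2 x4] A[of x4 x1 x2 x3] ne ne[symmetric]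
    by simp_all
  hence roots: "{x1, x2, x3, x4} \<subseteq> {u. poly p u = 0}" by auto
  have "p = 0"
  proof (rule ccontr)
    assume "p \<noteq> 0"
    have "card {x1, x2, x3, x4} \<le> card {u. poly p u = 0}"
      by (rule card_mono[OF poly_roots_finite[OF \<open>p \<noteq> 0\<close>] roots])
    also have "\<dots> \<le> degree p" by (rule card_poly_roots_bound[OF \<open>p \<noteq> 0\<close>])
    finally show False using deg ne by simp
  qed
  hence z: "(b * u - x1) * (b * u - x2) * (b * u - x3) * (b * u - x4) = b^4 * ((u - x1) * (u - x2) * (u - x3) * (u - x4))
    + (b - 1) * shift_coeff b x1 x2 x3 x4 * x1 * ((u - x2) * (u - x3) * (u - x4))
    + (b - 1) * shift_coeff b x2 x1 x3 x4 * x2 * ((u - x1) * (u - x3) * (u - x4))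
    + (b - 1) * shift_coeff b x3 x1 x2 x4 * x3 * ((u - x1) * (u - x2) * (u - x4))
    + (b - 1) * shift_coeff b x4 x1 x2 x3 * x4 * ((u - x1) * (u - x2) * (u - x3))"
    using poly_p[of u] by (simp add: algebra_simps)
  have u': "u - x1 \<noteq> 0" "u - x2 \<noteq> 0" "u - x3 \<noteq> 0" "u - x4 \<noteq> 0" using u by auto
  have "(b * u - x1) / (u - x1) * ((b * u - x2) / (u - x2)) * ((b * u - x3) / (u - x3)) * ((b * u - x4) / (u - x4)) =
     ((b * u - x1) * (b * u - x2) * (b * u - x3) * (b * u - x4)) / ((u - x1) * (u - x2) * (u - x3) * (u - x4))"
    by simp
  also have "\<dots> = b^4 + (b - 1) * shift_coeff b x1 x2 x3 x4 * x1 / (u - x1) + (b - 1) * shift_coeff b x2 x1 x3 x4 * x2 / (u - x2)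
      + (b - 1) * shift_coeff b x3 x1 x2 x4 * x3 / (u - x3) + (b - 1) * shift_coeff b x4 x1 x2 x3 * x4 / (u - x4)"
    unfolding z add_divide_distrib using u' by (simp add: mult.assoc)
  finally show ?thesis by (simp only: distrib_left times_divide_eq_right mult.assoc add.assoc)
qed

text \<open>The effect of \<open>x \<mapsto> q x\<close> on the integrand (see
  \<open>kernel_shift\<close>).\<close>

definition kernel_ratio :: "complex \<Rightarrow> complex \<Rightarrow> complex \<Rightarrow> complex" where
  "kernel_ratio b z x = (1 - x * z) * (1 - x / z) / ((1 - b * x * z) * (1 - b * x / z))"

text \<open>The quotient of \<open>half_weight b (1/z)\<close> and \<open>weight b z\<close>.\<close>

definition weight_ratio :: "complex \<Rightarrow> complex \<Rightarrow> complex" where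
  "weight_ratio b z = (1 - b * z^2) / (1 - z^2)"

lemma weight_ratio_eq:
  assumes "z \<noteq> 0" "z^2 \<noteq> 1"
  shows "weight_ratio b z = (b * z^2 - 1) / (z^2 - 1)" "weight_ratio b (1 / z) = (z^2 - b) / (z^2 - 1)"
proof -
  show "weight_ratio b z = (b * z^2 - 1) / (z^2 - 1)"
    unfolding weight_ratio_def by (metis minus_diff_eq minus_divide_divide)
  have "1 - b * (1 / z)^2 = (z^2 - b) / z^2" "1 - (1 / z)^2 = (z^2 - 1) / z^2"
    using assms(1) by (simp_all add: field_simps)
  thus "weight_ratio b (1 / z) = (z^2 - b) / (z^2 - 1)"
    unfolding weight_ratio_def using assms(1) by simp
qed

lemma weight_ratio_sum: "z \<noteq> 0 \<Longrightarrow> z^2 \<noteq> 1 \<Longrightarrow> weight_ratio b z + weight_ratio b (1 / z) = 1 + b"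
  unfolding weight_ratio_eq by (simp add: divide_simps) algebra

text \<open>A combination of the simple fractions at \<open>u = 1/(b z)\<close> and \<open>u = z/b\<close>
  that occur in \<open>partial_fractions_4\<close>.\<close>

lemma kernel_ratio_partial_fractions:
  assumes "z \<noteq> 0" "z^2 \<noteq> 1" "b \<noteq> 0" "1 - b * x * z \<noteq> 0" "1 - b * x / z \<noteq> 0"
  shows "b^2 * kernel_ratio b z x = b^2 + (b - 1) * (weight_ratio b z * (b * x * z / (1 - b * x * z)) +
           weight_ratio b (1 / z) * (b * x / z / (1 - b * x / z)))"
proof -
  have nz: "z^2 - 1 \<noteq> 0" "z - b * x \<noteq> 0" using assms by (auto simp: field_simps)
  have e: "1 - x / z = (z - x) / z" "1 - b * x / z = (z - b * x) / z"
    using assms nz by (simp_all add: field_simps)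
  show ?thesis
    unfolding kernel_ratio_def e weight_ratio_eq[OF assms(1,2)] using assms(1,3,4) nz
    by (simp add: divide_simps) algebra
qed

text \<open>The sum of \<open>partial_fractions_4\<close> at \<open>u = 1/(b z)\<close> and at \<open>u =
  z/b\<close>, weighted so that \<open>kernel_ratio_partial_fractions\<close> applies.\<close>

lemma kernel_identity_4:
  assumes z: "z \<noteq> 0" "z^2 \<noteq> 1" and b: "b \<noteq> 0" "b \<noteq> 1"
    and ne: "x1 \<noteq> x2" "x1 \<noteq> x3" "x1 \<noteq> x4" "x2 \<noteq> x3" "x2 \<noteq> x4" "x3 \<noteq> x4"
    and x0: "x1 \<noteq> 0" "x2 \<noteq> 0" "x3 \<noteq> 0" "x4 \<noteq> 0"
    and nz: "1 - b * x1 * z \<noteq> 0" "1 - b * x2 * z \<noteq> 0" "1 - b * x3 * z \<noteq> 0" "1 - b * x4 * z \<noteq> 0"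
      "1 - b * x1 / z \<noteq> 0" "1 - b * x2 / z \<noteq> 0" "1 - b * x3 / z \<noteq> 0" "1 - b * x4 / z \<noteq> 0"
  shows "shift_coeff b x1 x2 x3 x4 * kernel_ratio b z x1 + shift_coeff b x2 x1 x3 x4 * kernel_ratio b z x2 +
         shift_coeff b x3 x1 x2 x4 * kernel_ratio b z x3 + shift_coeff b x4 x1 x2 x3 * kernel_ratio b z x4 =
     1 + b + b^2 * (weight_ratio b z * ((1 - x1 * z) / (1 - b * x1 * z) * ((1 - x2 * z) / (1 - b * x2 * z)) *
         ((1 - x3 * z) / (1 - b * x3 * z)) * ((1 - x4 * z) / (1 - b * x4 * z))) +
       weight_ratio b (1 / z) * ((1 - x1 / z) / (1 - b * x1 / z) * ((1 - x2 / z) / (1 - b * x2 / z)) *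
         ((1 - x3 / z) / (1 - b * x3 / z)) * ((1 - x4 / z) / (1 - b * x4 / z))))"
proof -
  let ?a1 = "shift_coeff b x1 x2 x3 x4" and ?a2 = "shift_coeff b x2 x1 x3 x4" and ?a3 = "shift_coeff b x3 x1 x2 x4" and ?a4 = "shift_coeff b x4 x1 x2 x3"
  have pf: "b^4 * ((1 - x1 * y) / (1 - b * x1 * y) * ((1 - x2 * y) / (1 - b * x2 * y)) *
         ((1 - x3 * y) / (1 - b * x3 * y)) * ((1 - x4 * y) / (1 - b * x4 * y))) =
     b^4 + (b - 1) * (?a1 * (b * x1 * y / (1 - b * x1 * y)) + ?a2 * (b * x2 * y / (1 - b * x2 * y)) +
       ?a3 * (b * x3 * y / (1 - b * x3 * y)) + ?a4 * (b * x4 * y / (1 - b * x4 * y)))"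
    if "y \<noteq> 0" "1 - b * x1 * y \<noteq> 0" "1 - b * x2 * y \<noteq> 0" "1 - b * x3 * y \<noteq> 0" "1 - b * x4 * y \<noteq> 0" for y
  proof -
    let ?u = "1 / (b * y)"
    have u1: "(b * ?u - x) / (?u - x) = b * ((1 - x * y) / (1 - b * x * y))" if "1 - b * x * y \<noteq> 0" for x
    proof -
      have "?u - x = (1 - b * x * y) / (b * y)" "b * ?u - x = (1 - x * y) / y"
        using b \<open>y \<noteq> 0\<close> by (simp_all add: field_simps)
      thus ?thesis using b \<open>y \<noteq> 0\<close> by simp
    qed
    have u2: "a * x / (?u - x) = a * (b * x * y / (1 - b * x * y))" if "1 - b * x * y \<noteq> 0" for a x
    proof -
      have "?u - x = (1 - b * x * y) / (b * y)"
        using b \<open>y \<noteq> 0\<close> by (simp_all add: field_simps)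
      thus ?thesis using b \<open>y \<noteq> 0\<close> by simp
    qed
    have u3: "?u \<noteq> x" if "1 - b * x * y \<noteq> 0" for x
      using that b \<open>y \<noteq> 0\<close> by (auto simp: field_simps)
    have four: "b * A * (b * B) * (b * C) * (b * D) = b^4 * (A * B * C * D)" for A B C D :: complex
      by (simp add: power4_eq_xxxx mult_ac)
    show ?thesis
      using partial_fractions_4[where b = b, OF ne u3[OF that(2)] u3[OF that(3)] u3[OF that(4)] u3[OF that(5)]]
      unfolding u1[OF that(2)] u1[OF that(3)] u1[OF that(4)] u1[OF that(5)]
        u2[OF that(2)] u2[OF that(3)] u2[OF that(4)] u2[OF that(5)] four by blast
  qed
  have sumA: "(1 - b) * (?a1 + ?a2 + ?a3 + ?a4) = 1 - b^4"
    using partial_fractions_4[OF ne x0[symmetric], of b] x0 by (simp add: algebra_simps)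
  let ?f = "\<lambda>y x. b * x * y / (1 - b * x * y)"
  let ?T = "\<lambda>y. ?a1 * ?f y x1 + ?a2 * ?f y x2 + ?a3 * ?f y x3 + ?a4 * ?f y x4"
  let ?E = "weight_ratio b z" and ?E' = "weight_ratio b (1 / z)"
  let ?P = "(1 - x1 * z) / (1 - b * x1 * z) * ((1 - x2 * z) / (1 - b * x2 * z)) *
         ((1 - x3 * z) / (1 - b * x3 * z)) * ((1 - x4 * z) / (1 - b * x4 * z))"
  let ?P' = "(1 - x1 / z) / (1 - b * x1 / z) * ((1 - x2 / z) / (1 - b * x2 / z)) *
         ((1 - x3 / z) / (1 - b * x3 / z)) * ((1 - x4 / z) / (1 - b * x4 / z))"
  have p1: "(b - 1) * ?T z = b^4 * ?P - b^4"
    using pf[OF z(1) nz(1-4)] by (simp only:) simp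
  have p2: "(b - 1) * ?T (1 / z) = b^4 * ?P' - b^4"
    using pf[of "1 / z"] z(1) nz(5-8) by simp
  have s: "b^2 * kernel_ratio b z x = b^2 + (b - 1) * (?E * ?f z x + ?E' * ?f (1 / z) x)"
    if "1 - b * x * z \<noteq> 0" "1 - b * x / z \<noteq> 0" for x
    using kernel_ratio_partial_fractions[OF z b(1) that] by simp
  have gen: "(1 - b) * (a1 * (b2 + (b - 1) * (E * f1 + E' * g1)) + a2 * (b2 + (b - 1) * (E * f2 + E' * g2)) +
      a3 * (b2 + (b - 1) * (E * f3 + E' * g3)) + a4 * (b2 + (b - 1) * (E * f4 + E' * g4))) =
      b2 * ((1 - b) * (a1 + a2 + a3 + a4)) + (1 - b) * (E * ((b - 1) * (a1 * f1 + a2 * f2 + a3 * f3 + a4 * f4)) +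
        E' * ((b - 1) * (a1 * g1 + a2 * g2 + a3 * g3 + a4 * g4)))"
    for a1 a2 a3 a4 b2 E E' f1 f2 f3 f4 g1 g2 g3 g4 :: complex
    by (simp add: algebra_simps)
  have "(1 - b) * (b^2 * (?a1 * kernel_ratio b z x1 + ?a2 * kernel_ratio b z x2 + ?a3 * kernel_ratio b z x3 + ?a4 * kernel_ratio b z x4)) =
     (1 - b) * (?a1 * (b^2 * kernel_ratio b z x1) + ?a2 * (b^2 * kernel_ratio b z x2) + ?a3 * (b^2 * kernel_ratio b z x3) + ?a4 * (b^2 * kernel_ratio b z x4))"
    by (simp add: algebra_simps)
  also have "\<dots> = b^2 * (1 - b^4) + (1 - b) * (?E * (b^4 * ?P - b^4) + ?E' * (b^4 * ?P' - b^4))"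
    unfolding s[OF nz(1) nz(5)] s[OF nz(2) nz(6)] s[OF nz(3) nz(7)] s[OF nz(4) nz(8)] gen sumA p1 p2 ..
  also have "\<dots> = b^2 * (1 - b^4) + (1 - b) * (b^4 * (?E * ?P + ?E' * ?P') - b^4 * (?E + ?E'))"
    by (simp only: algebra_simps)
  also have "\<dots> = (1 - b) * (b^2 * (1 + b + b^2 * (?E * ?P + ?E' * ?P')))"
  proof -
    have "b^2 * (1 - b^4) + (1 - b) * (b^4 * X - b^4 * (1 + b)) = (1 - b) * (b^2 * (1 + b + b^2 * X))" for X
      by algebra
    thus ?thesis unfolding weight_ratio_sum[OF z] .
  qed
  finally show ?thesis using b by simp
qed

lemma kernel_identity_1:
  assumes z: "z \<noteq> 0" "z^2 \<noteq> 1" and nz: "1 - b * x * z \<noteq> 0" "1 - b * x / z \<noteq> 0"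
  shows "b * kernel_ratio b z x + 1 = weight_ratio b z * ((1 - x * z) / (1 - b * x * z)) + weight_ratio b (1 / z) * ((1 - x / z) / (1 - b * x / z))"
proof -
  have nz': "z^2 - 1 \<noteq> 0" "z - b * x \<noteq> 0" using assms by (auto simp: field_simps)
  have e: "1 - x / z = (z - x) / z" "1 - b * x / z = (z - b * x) / z"
    using assms nz' by (simp_all add: field_simps)
  show ?thesis
    unfolding kernel_ratio_def e weight_ratio_eq[OF assms(1,2)] using assms(1,3) nz'
    by (simp add: divide_simps) algebra
qed

text \<open>With only two variables the shifts are related pointwise, without the substitution \<open>z
  \<mapsto> Q/z\<close>.\<close>

lemma kernel_identity_2:
  assumes z: "z \<noteq> 0" and nz: "1 - b * x1 * z \<noteq> 0" "1 - b * x1 / z \<noteq> 0" "1 - b * x2 * z \<noteq> 0" "1 - b * x2 / z \<noteq> 0"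
  shows "(x2 - x1) * (1 - x1 * x2)
      + (b * x1 * (1 + x2^2) - x2 * (1 + b^2 * x1^2)) * kernel_ratio b z x1
      + (x1 * (1 + b^2 * x2^2) - b * x2 * (1 + x1^2)) * kernel_ratio b z x2
      + b * (x2 - x1) * (1 - b^2 * x1 * x2) * (kernel_ratio b z x1 * kernel_ratio b z x2) = 0"
proof -
  define X where "X = z + 1 / z"
  have d: "(1 - b * x * z) * (1 - b * x / z) = 1 + b^2 * x^2 - b * x * X"
     "(1 - x * z) * (1 - x / z) = 1 + x^2 - x * X" for x
    using z by (simp_all add: X_def field_simps power2_eq_square)
  have S: "kernel_ratio b z x = (1 + x^2 - x * X) / (1 + b^2 * x^2 - b * x * X)" for x
    unfolding kernel_ratio_def d(1)[of x] d(2)[of x] ..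
  have n: "1 + b^2 * x1^2 - b * x1 * X \<noteq> 0" "1 + b^2 * x2^2 - b * x2 * X \<noteq> 0"
    unfolding d(1)[symmetric] using nz by simp_all
  show ?thesis
    unfolding S using n by (simp add: divide_simps) algebra
qed

section \<open>The q-difference equations of the integral\<close>

context nome
begin

definition weight :: "complex \<Rightarrow> complex \<Rightarrow> complex" where
  "weight b z = P (z^2) * P (1 / z^2) / (P (b * z^2) * P (b / z^2))"

text \<open>This is \<open>weight\<close> up to a rational factor. Its symmetrization is \<open>(1 + b)
  weight\<close>, and unlike \<open>weight\<close> it is mapped to its reflection by \<open>z \<mapsto> Q
  z\<close>.\<close>

definition half_weight :: "complex \<Rightarrow> complex \<Rightarrow> complex" where
  "half_weight b z = P (z^2) * P (q / z^2) / (P (b * z^2) * P (q * b / z^2))"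

definition kernel :: "complex \<Rightarrow> complex \<Rightarrow> complex \<Rightarrow> complex" where
  "kernel b x z = G b (x * z) * G b (x / z)"

definition integrand :: "complex \<Rightarrow> complex \<Rightarrow> complex \<Rightarrow> complex \<Rightarrow> complex \<Rightarrow> complex \<Rightarrow> complex" where
  "integrand b x1 x2 x3 x4 z = weight b z * (kernel b x1 z * kernel b x2 z * kernel b x3 z * kernel b x4 z)"

definition Fint :: "complex \<Rightarrow> complex \<Rightarrow> complex \<Rightarrow> complex \<Rightarrow> complex \<Rightarrow> complex" where
  "Fint b x1 x2 x3 x4 = cint (circ 1) (integrand b x1 x2 x3 x4)"

lemma kernel_0 [simp]: "kernel b 0 z = 1" by (simp add: kernel_def)

lemma weight_half_weight_relations:
  assumes z: "z \<noteq> 0" and nz: "1 - b * z^2 \<noteq> 0" "1 - b / z^2 \<noteq> 0"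
  shows "(1 + b) * weight b z = half_weight b z + half_weight b (1 / z)"
    and "weight b z * (1 - b * z^2) = half_weight b (1 / z) * (1 - z^2)"
    and "half_weight b (1 / z) * (b - z^2) = half_weight b z * (1 - b * z^2)"
proof -
  define y where "y = z^2"
  have y: "y \<noteq> 0" using z by (simp add: y_def)
  define M where "M = P (q * y) * P (q / y) / (P (q * b * y) * P (q * b / y))"
  have r: "P y = (1 - y) * P (q * y)" "P (1 / y) = (1 - 1 / y) * P (q / y)"
    "P (b * y) = (1 - b * y) * P (q * b * y)" "P (b / y) = (1 - b / y) * P (q * b / y)"
    using P_rec[of y] P_rec[of "1 / y"] P_rec[of "b * y"] P_rec[of "b / y"] by (simp_all add: mult_ac)
  have w: "weight b z = (1 - y) * (1 - 1 / y) * M / ((1 - b * y) * (1 - b / y))"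
    unfolding weight_def y_def[symmetric] r M_def by (simp add: mult_ac)
  have v: "half_weight b z = (1 - y) * M / (1 - b * y)"
    unfolding half_weight_def y_def[symmetric] r M_def by (simp add: mult_ac)
  have v': "half_weight b (1 / z) = (1 - 1 / y) * M / (1 - b / y)"
  proof -
    have "(1 / z)^2 = 1 / y" by (simp add: y_def power_divide)
    hence "half_weight b (1 / z) = P (1 / y) * P (q * y) / (P (b / y) * P (q * b * y))"
      unfolding half_weight_def by simp
    thus ?thesis unfolding r M_def by (simp add: mult_ac)
  qed
  have nz': "1 - b * y \<noteq> 0" "1 - b / y \<noteq> 0" using nz by (simp_all add: y_def)
  show "weight b z * (1 - b * z^2) = half_weight b (1 / z) * (1 - z^2)"
    unfolding y_def[symmetric] w v' using nz' by simp
  have e: "1 - 1 / y = (y - 1) / y" "1 - b / y = (y - b) / y" using y by (simp_all add: field_simps)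
  have yb: "y - b \<noteq> 0" using nz'(2) y by (auto simp: field_simps)
  show "(1 + b) * weight b z = half_weight b z + half_weight b (1 / z)"
    unfolding w v v' e using nz'(1) y yb by (simp add: divide_simps) algebra
  show "half_weight b (1 / z) * (b - z^2) = half_weight b z * (1 - b * z^2)"
    unfolding y_def[symmetric] v v' e using nz'(1) y yb by (simp add: divide_simps) algebra
qed

lemma half_weight_at_1: "z^2 = 1 \<Longrightarrow> half_weight b z = 0 \<and> half_weight b (1 / z) = 0 \<and> weight b z = 0"
  by (auto simp: half_weight_def weight_def power_divide)

lemma half_weight_shift: "Q^2 = q \<Longrightarrow> z \<noteq> 0 \<Longrightarrow> half_weight b (Q * z) = half_weight b (1 / z)"
proof -
  assume Q: "Q^2 = q" "z \<noteq> 0"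
  have "(Q * z)^2 = q * z^2" "(1 / z)^2 = 1 / z^2"
    using Q by (simp_all add: power_mult_distrib power_divide)
  thus ?thesis
    unfolding half_weight_def using q_nz Q(2) by (simp add: mult_ac)
qed

lemma half_weight_holomorphic:
  assumes b: "0 < norm b" "norm b < 1"
  shows "half_weight b holomorphic_on annulus (sqrt (norm q * norm b)) (1 / sqrt (norm b))"
proof -
  have "P (b * z^2) \<noteq> 0 \<and> P (q * b / z^2) \<noteq> 0 \<and> z \<noteq> 0"
    if z: "z \<in> annulus (sqrt (norm q * norm b)) (1 / sqrt (norm b))" for z
  proof (intro conjI P_nz)
    have z': "sqrt (norm q * norm b) < norm z" "norm z < 1 / sqrt (norm b)"
      using z by (auto simp: annulus_def)
    have "0 \<le> sqrt (norm q * norm b)" by simp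
    hence "0 < norm z" using z'(1) by linarith
    thus z0: "z \<noteq> 0" by simp
    have "norm z ^ 2 < (1 / sqrt (norm b)) ^ 2"
      using z'(2) by (intro power_strict_mono) auto
    thus "norm (b * z^2) < 1"
      using b by (simp add: norm_mult norm_power power_divide field_simps)
    have "sqrt (norm q * norm b) ^ 2 < norm z ^ 2"
      using z'(1) by (intro power_strict_mono) auto
    thus "norm (q * b / z^2) < 1"
      using z0 by (simp add: norm_mult norm_divide norm_power field_simps)
  qed
  thus ?thesis
    unfolding half_weight_def by (intro holomorphic_intros) auto
qed

text \<open>The substitution \<open>z \<mapsto> Q z\<close> moves the circle inside an annulus of holomorphy,
  \<open>half_weight_shift\<close> reflects the weight, and \<open>z \<mapsto> 1/z\<close> reflects it
  back.\<close>

lemma contour_shift: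
  assumes b: "0 < norm b" "norm b < 1" and Q: "Q^2 = q"
    and H: "H holomorphic_on annulus r R" and r: "0 \<le> r" "r < norm Q" "1 < R"
  shows "cint (circ 1) (\<lambda>z. half_weight b z * H z) = cint (circ 1) (\<lambda>z. half_weight b z * H (Q / z))"
proof -
  have nQ: "norm Q = sqrt (norm q)"
    using Q by (metis norm_power real_sqrt_unique norm_ge_zero)
  have Q0: "Q \<noteq> 0" using Q q_nz by auto
  have Q1: "norm Q < 1" using q_less_1 nQ by simp
  let ?r = "max r (sqrt (norm q * norm b))" and ?R = "min R (1 / sqrt (norm b))"
  have rQ: "?r < norm Q"
  proof -
    have "norm q * norm b < norm q" using b q_nz by simp
    thus ?thesis using r unfolding nQ by simp
  qed
  have R1: "1 < ?R" using r b by simp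
  have hol: "(\<lambda>z. half_weight b z * H z) holomorphic_on annulus ?r ?R"
    by (intro holomorphic_intros holomorphic_on_subset[OF half_weight_holomorphic[OF b]] holomorphic_on_subset[OF H])
       (auto simp: annulus_def)
  have "cint (circ 1) (\<lambda>z. half_weight b z * H z) = cint (circ 1) (\<lambda>z. half_weight b (Q * z) * H (Q * z))"
    by (rule cint_scale[OF hol, symmetric]) (use r rQ R1 Q1 norm_mult_lt_1[OF q_less_1 b(2)] in \<open>auto simp: norm_mult\<close>)
  also have "\<dots> = cint (circ 1) (\<lambda>z. half_weight b (1 / z) * H (Q / (1 / z)))"
  proof (rule cint_cong)
    fix z assume "z \<in> path_image (circ 1)"
    hence "z \<noteq> 0" by auto
    from half_weight_shift[OF Q this, of b] show "half_weight b (Q * z) * H (Q * z) = half_weight b (1 / z) * H (Q / (1 / z))"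
      by simp
  qed
  also have "\<dots> = cint (circ 1) (\<lambda>z. half_weight b z * H (Q / z))"
    by (rule cint_inverse[where f = "\<lambda>z. half_weight b z * H (Q / z)"])
  finally show ?thesis .
qed

lemma circle_nz:
  assumes "norm b < 1" "norm z = 1"
  shows "z \<noteq> 0" "1 - b * z^2 \<noteq> 0" "1 - b / z^2 \<noteq> 0" "P (b * z^2) \<noteq> 0" "P (b / z^2) \<noteq> 0"
    "P (q * b / z^2) \<noteq> 0"
proof -
  show "z \<noteq> 0" using assms by auto
  have "norm (b * z^2) < 1" "norm (b / z^2) < 1"
    using assms by (simp_all add: norm_mult norm_divide norm_power)
  moreover from norm_mult_lt_1[OF q_less_1 this(2)] have "norm (q * b / z^2) < 1" by simp
  ultimately show "1 - b * z^2 \<noteq> 0" "1 - b / z^2 \<noteq> 0" "P (b * z^2) \<noteq> 0" "P (b / z^2) \<noteq> 0"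
    "P (q * b / z^2) \<noteq> 0"
    using P_nz by auto
qed

lemma continuous_half_weight: "norm b < 1 \<Longrightarrow> continuous_on (sphere 0 1) (half_weight b)"
  unfolding half_weight_def by (intro continuous_intros) (auto simp: circle_nz)

lemma continuous_weight: "norm b < 1 \<Longrightarrow> continuous_on (sphere 0 1) (weight b)"
  unfolding weight_def by (intro continuous_intros) (auto simp: circle_nz)

lemma continuous_vt': "norm b < 1 \<Longrightarrow> continuous_on (sphere 0 1) (\<lambda>z. half_weight b (1 / z))"
  by (rule continuous_on_compose2[OF continuous_half_weight]) (auto intro!: continuous_intros simp: norm_divide)

text \<open>A symmetric function sees \<open>half_weight b z\<close> and \<open>half_weight b (1/z)\<close>
  alike.\<close>

lemma cint_weight_symmetric:
  assumes b: "norm b < 1" and H: "continuous_on (sphere 0 1) H" "\<And>z. norm z = 1 \<Longrightarrow> H (1 / z) = H z"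
  shows "(1 + b) * cint (circ 1) (\<lambda>z. weight b z * H z) = 2 * cint (circ 1) (\<lambda>z. half_weight b z * H z)"
proof -
  have "(1 + b) * cint (circ 1) (\<lambda>z. weight b z * H z) = cint (circ 1) (\<lambda>z. (1 + b) * (weight b z * H z))"
    by (subst cint_cmult[where \<rho> = 1]) (use b H in \<open>auto intro!: continuous_intros continuous_weight\<close>)
  also have "\<dots> = cint (circ 1) (\<lambda>z. half_weight b z * H z + half_weight b (1 / z) * H (1 / z))"
  proof (rule cint_cong)
    fix z assume "z \<in> path_image (circ 1)"
    hence z: "norm z = 1" by auto
    have "(1 + b) * weight b z * H z = (half_weight b z + half_weight b (1 / z)) * H z"
      using weight_half_weight_relations(1)[OF circle_nz(1-3)[OF b z]] by simp
    thus "(1 + b) * (weight b z * H z) = half_weight b z * H z + half_weight b (1 / z) * H (1 / z)"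
      using H(2)[OF z] by (simp add: algebra_simps)
  qed
  also have "\<dots> = cint (circ 1) (\<lambda>z. half_weight b z * H z) + cint (circ 1) (\<lambda>z. half_weight b (1 / z) * H (1 / z))"
  proof (rule cint_add)
    show "continuous_on (sphere 0 1) (\<lambda>z. half_weight b (1 / z) * H (1 / z))"
      by (rule continuous_on_compose2[of _ "\<lambda>z. half_weight b z * H z"])
         (use b H in \<open>auto intro!: continuous_intros continuous_half_weight simp: norm_divide\<close>)
  qed (use b H in \<open>auto intro!: continuous_intros continuous_half_weight\<close>)
  also have "cint (circ 1) (\<lambda>z. half_weight b (1 / z) * H (1 / z)) = cint (circ 1) (\<lambda>z. half_weight b z * H z)"
    by (rule cint_inverse[where f = "\<lambda>z. half_weight b z * H z"])
  finally show ?thesis by simp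
qed

lemma G_holomorphic_intro:
  "f holomorphic_on A \<Longrightarrow> norm b < 1 \<Longrightarrow> (\<And>z. z \<in> A \<Longrightarrow> norm (f z) < 1) \<Longrightarrow> (\<lambda>z. G b (f z)) holomorphic_on A"
  unfolding G_def by (intro holomorphic_intros) (use P_nz in blast)+

lemma G_continuous_intro:
  "continuous_on A f \<Longrightarrow> norm b < 1 \<Longrightarrow> (\<And>z. z \<in> A \<Longrightarrow> norm (f z) < 1) \<Longrightarrow> continuous_on A (\<lambda>z. G b (f z))"
  unfolding G_def by (intro continuous_intros) (use P_nz in blast)+

lemma continuous_kernel:
  "norm b < 1 \<Longrightarrow> norm x < 1 \<Longrightarrow> continuous_on (sphere 0 1) (kernel b x)"
  unfolding kernel_def by (intro continuous_intros G_continuous_intro) (auto simp: norm_mult norm_divide)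

lemma kernel_symmetric: "kernel b x (1 / z) = kernel b x z"
  by (simp add: kernel_def mult_ac)

lemma kernel_shift:
  assumes "norm b < 1" "norm x < 1" "norm z = 1"
  shows "kernel b (q * x) z = kernel b x z * kernel_ratio b z x"
  using G_shift[of "x * z" b] G_shift[of "x / z" b] assms
  by (simp add: kernel_def kernel_ratio_def norm_mult norm_divide mult_ac)

lemma weight_kernel_weight_ratio:
  assumes b: "norm b < 1" and z: "norm z = 1" "z^2 \<noteq> 1"
  shows "weight b z * weight_ratio b z = half_weight b (1 / z)" "weight b z * weight_ratio b (1 / z) = half_weight b z"
proof -
  note nz = circle_nz[OF b z(1)]
  show 1: "weight b z * weight_ratio b z = half_weight b (1 / z)"
    unfolding weight_ratio_def using weight_half_weight_relations(2)[OF nz(1-3)] z(2) by (simp add: field_simps)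
  have "weight b z * (weight_ratio b z + weight_ratio b (1 / z)) = half_weight b z + half_weight b (1 / z)"
    unfolding weight_ratio_sum[OF nz(1) z(2)] using weight_half_weight_relations(1)[OF nz(1-3)] by (simp add: mult_ac)
  thus "weight b z * weight_ratio b (1 / z) = half_weight b z"
    using 1 by (simp add: algebra_simps)
qed

lemma one_minus_nz: "norm x < 1 \<Longrightarrow> 1 - x \<noteq> (0 :: complex)"
  by auto

lemma circle_one_minus_nz:
  fixes b y z :: complex
  assumes "norm b < 1" "norm y < 1" "norm z = 1"
  shows "1 - b * y * z \<noteq> 0" "1 - b * y / z \<noteq> 0"
  using norm_mult_lt_1[OF assms(1,2)] assms(3)
  by (intro one_minus_nz; simp add: norm_mult norm_divide)+

text \<open>By \<open>kernel_identity_4\<close> the left-hand side is \<open>1 + b\<close> times the integral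
  plus \<open>b\<^sup>2\<close> times two terms exchanged by \<open>z \<mapsto> 1/z\<close>, in which one factor
  \<open>G b (x z)\<close> of each \<open>kernel b x z\<close> is shifted to \<open>G b (q x z)\<close>. The
  substitution \<open>z \<mapsto> Q/z\<close> distributes this shift evenly: it becomes \<open>kernel b (Q x)
  z\<close>.\<close>

lemma Fint_q_difference:
  assumes b: "0 < norm b" "norm b < 1" and Q: "Q ^ 2 = q"
    and x: "norm x1 < 1" "norm x2 < 1" "norm x3 < 1" "norm x4 < 1" "x1 \<noteq> 0" "x2 \<noteq> 0" "x3 \<noteq> 0" "x4 \<noteq> 0"
    and ne: "x1 \<noteq> x2" "x1 \<noteq> x3" "x1 \<noteq> x4" "x2 \<noteq> x3" "x2 \<noteq> x4" "x3 \<noteq> x4"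
  shows "shift_coeff b x1 x2 x3 x4 * Fint b (q * x1) x2 x3 x4 + shift_coeff b x2 x1 x3 x4 * Fint b x1 (q * x2) x3 x4 +
         shift_coeff b x3 x1 x2 x4 * Fint b x1 x2 (q * x3) x4 + shift_coeff b x4 x1 x2 x3 * Fint b x1 x2 x3 (q * x4) =
         (1 + b) * (Fint b x1 x2 x3 x4 + b ^ 2 * Fint b (Q * x1) (Q * x2) (Q * x3) (Q * x4))"
proof -
  let ?a1 = "shift_coeff b x1 x2 x3 x4" and ?a2 = "shift_coeff b x2 x1 x3 x4" and ?a3 = "shift_coeff b x3 x1 x2 x4" and ?a4 = "shift_coeff b x4 x1 x2 x3"
  have b0: "b \<noteq> 0" "b \<noteq> 1" using b by auto
  have nQ: "norm Q < 1"
  proof -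
    have "norm Q ^ 2 < 1" using q_less_1 Q by (metis norm_power)
    thus ?thesis by (simp add: abs_square_less_1)
  qed
  have qQ: "norm q < norm Q"
  proof -
    have "norm Q * norm Q < norm Q * 1" using nQ Q q_nz by (intro mult_strict_left_mono) auto
    thus ?thesis unfolding Q[symmetric] by (simp add: norm_mult power2_eq_square)
  qed
  have qx: "norm (q * x) < 1" "norm (Q * x) < 1" if "norm x < 1" for x
    using norm_mult_lt_1[OF q_less_1 that] norm_mult_lt_1[OF nQ that] by auto
  \<comment> \<open>The substitution \<open>y = Q / z\<close> turns this into the product of the \<open>kernel b (Q * x) z\<close>.\<close>
  define HH where "HH y = G b (q * x1 / y) * G b (x1 * y) * (G b (q * x2 / y) * G b (x2 * y)) *
      (G b (q * x3 / y) * G b (x3 * y)) * (G b (q * x4 / y) * G b (x4 * y))" for y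
  have cont: "continuous_on (sphere 0 1) (integrand b y1 y2 y3 y4)"
    if "norm y1 < 1" "norm y2 < 1" "norm y3 < 1" "norm y4 < 1" for y1 y2 y3 y4
    unfolding integrand_def by (intro continuous_intros continuous_weight continuous_kernel that b)
  have contH: "continuous_on (sphere 0 1) HH"
    unfolding HH_def using x qx b
    by (intro continuous_intros G_continuous_intro) (auto simp: norm_mult norm_divide)
  have contH': "continuous_on (sphere 0 1) (\<lambda>z. HH (1 / z))"
    by (rule continuous_on_compose2[OF contH]) (auto intro!: continuous_intros simp: norm_divide)
  have pointwise: "?a1 * integrand b (q * x1) x2 x3 x4 z + ?a2 * integrand b x1 (q * x2) x3 x4 z +
       ?a3 * integrand b x1 x2 (q * x3) x4 z + ?a4 * integrand b x1 x2 x3 (q * x4) z =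
       (1 + b) * integrand b x1 x2 x3 x4 z + b^2 * (half_weight b (1 / z) * HH (1 / z) + half_weight b z * HH z)"
    if z: "norm z = 1" for z
  proof (cases "z^2 = 1")
    case True
    thus ?thesis using half_weight_at_1[OF True] by (simp add: integrand_def)
  next
    case False
    note nz = circle_nz[OF b(2) z]
    have bx: "1 - b * y * z \<noteq> 0" "1 - b * y / z \<noteq> 0" if "norm y < 1" for y
      using circle_one_minus_nz[OF b(2) that] z by auto
    have g1: "G b (q * y / (1 / z)) = G b (y * z) * ((1 - y * z) / (1 - b * y * z))"
      and g2: "G b (q * y / z) = G b (y / z) * ((1 - y / z) / (1 - b * y / z))" if "norm y < 1" for y
      using G_shift[of "y * z" b] G_shift[of "y / z" b] that z b
      by (simp_all add: norm_mult norm_divide mult_ac)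
    let ?KK = "kernel b x1 z * kernel b x2 z * kernel b x3 z * kernel b x4 z"
    have H1: "HH (1 / z) = ?KK * ((1 - x1 * z) / (1 - b * x1 * z) * ((1 - x2 * z) / (1 - b * x2 * z)) *
         ((1 - x3 * z) / (1 - b * x3 * z)) * ((1 - x4 * z) / (1 - b * x4 * z)))"
      unfolding HH_def g1[OF x(1)] g1[OF x(2)] g1[OF x(3)] g1[OF x(4)] kernel_def times_divide_eq_right mult_1_right
      by simp
    have H2: "HH z = ?KK * ((1 - x1 / z) / (1 - b * x1 / z) * ((1 - x2 / z) / (1 - b * x2 / z)) *
         ((1 - x3 / z) / (1 - b * x3 / z)) * ((1 - x4 / z) / (1 - b * x4 / z)))"
      unfolding HH_def g2[OF x(1)] g2[OF x(2)] g2[OF x(3)] g2[OF x(4)] kernel_def by simp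
    have "?a1 * integrand b (q * x1) x2 x3 x4 z + ?a2 * integrand b x1 (q * x2) x3 x4 z +
       ?a3 * integrand b x1 x2 (q * x3) x4 z + ?a4 * integrand b x1 x2 x3 (q * x4) z =
       weight b z * ?KK * (?a1 * kernel_ratio b z x1 + ?a2 * kernel_ratio b z x2 + ?a3 * kernel_ratio b z x3 + ?a4 * kernel_ratio b z x4)"
      unfolding integrand_def kernel_shift[OF b(2) x(1) z] kernel_shift[OF b(2) x(2) z] kernel_shift[OF b(2) x(3) z] kernel_shift[OF b(2) x(4) z]
      by (simp only: distrib_left mult_ac)
    also have "\<dots> = (1 + b) * (weight b z * ?KK) + b^2 * ((weight b z * weight_ratio b z) * HH (1 / z) + (weight b z * weight_ratio b (1 / z)) * HH z)"
      unfolding kernel_identity_4[OF nz(1) False b0 ne x(5-8) bx(1)[OF x(1)] bx(1)[OF x(2)] bx(1)[OF x(3)] bx(1)[OF x(4)]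
          bx(2)[OF x(1)] bx(2)[OF x(2)] bx(2)[OF x(3)] bx(2)[OF x(4)]] H1 H2
      by (simp only: distrib_left distrib_right mult_1 mult_ac add_ac)
    finally show ?thesis
      unfolding weight_kernel_weight_ratio[OF b(2) z False] integrand_def .
  qed
  have cm: "cint (circ 1) (\<lambda>z. c * f z) = c * cint (circ 1) f" if "continuous_on (sphere 0 1) f" for c f
    using that by (intro cint_cmult[where \<rho> = 1]) auto
  note cq = cont[OF qx(1)[OF x(1)] x(2-4)] cont[OF x(1) qx(1)[OF x(2)] x(3,4)]
     cont[OF x(1,2) qx(1)[OF x(3)] x(4)] cont[OF x(1-3) qx(1)[OF x(4)]]
  have "?a1 * Fint b (q * x1) x2 x3 x4 + ?a2 * Fint b x1 (q * x2) x3 x4 +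
        ?a3 * Fint b x1 x2 (q * x3) x4 + ?a4 * Fint b x1 x2 x3 (q * x4) =
      cint (circ 1) (\<lambda>z. ?a1 * integrand b (q * x1) x2 x3 x4 z + ?a2 * integrand b x1 (q * x2) x3 x4 z +
       ?a3 * integrand b x1 x2 (q * x3) x4 z + ?a4 * integrand b x1 x2 x3 (q * x4) z)"
    unfolding Fint_def using cq
    by (simp add: cint_add cm continuous_intros)
  also have "\<dots> = cint (circ 1) (\<lambda>z. (1 + b) * integrand b x1 x2 x3 x4 z +
        b^2 * (half_weight b (1 / z) * HH (1 / z) + half_weight b z * HH z))"
    by (rule cint_cong) (use pointwise in auto)
  also have "\<dots> = (1 + b) * Fint b x1 x2 x3 x4 + b^2 * (cint (circ 1) (\<lambda>z. half_weight b (1 / z) * HH (1 / z)) +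
        cint (circ 1) (\<lambda>z. half_weight b z * HH z))"
    unfolding Fint_def using cont[OF x(1-4)] contH contH' continuous_half_weight[OF b(2)] continuous_vt'[OF b(2)]
    by (simp add: cint_add cm continuous_intros)
  also have "cint (circ 1) (\<lambda>z. half_weight b (1 / z) * HH (1 / z)) = cint (circ 1) (\<lambda>z. half_weight b z * HH z)"
    by (rule cint_inverse[where f = "\<lambda>z. half_weight b z * HH z"])
  also have "cint (circ 1) (\<lambda>z. half_weight b z * HH z) = cint (circ 1) (\<lambda>z. half_weight b z * HH (Q / z))"
  proof (rule contour_shift[OF b Q])
    define m where "m = max (max (norm x1) (norm x2)) (max (norm x3) (norm x4))"
    have m: "norm x1 \<le> m" "norm x2 \<le> m" "norm x3 \<le> m" "norm x4 \<le> m" "m < 1" "0 < m"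
      using x by (auto simp: m_def less_max_iff_disj)
    show "HH holomorphic_on annulus (norm q) (1 / m)"
    proof -
      have hol: "(\<lambda>y. G b (q * x / y)) holomorphic_on annulus (norm q) (1 / m)"
        "(\<lambda>y. G b (x * y)) holomorphic_on annulus (norm q) (1 / m)" if "norm x \<le> m" for x
      proof -
        show "(\<lambda>y. G b (q * x / y)) holomorphic_on annulus (norm q) (1 / m)"
        proof (intro G_holomorphic_intro holomorphic_intros b)
          fix y assume y: "y \<in> annulus (norm q) (1 / m)"
          hence "0 < norm y" "norm q < norm y" using norm_ge_zero[of q] by (auto simp: annulus_def simp del: norm_ge_zero)
          show "y \<noteq> 0" using \<open>0 < norm y\<close> by auto
          have "norm q * norm x < norm y * 1"
            using \<open>norm q < norm y\<close> that m by (intro mult_strict_mono') auto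
          thus "norm (q * x / y) < 1"
            using \<open>0 < norm y\<close> by (simp add: norm_mult norm_divide divide_simps)
        qed
        show "(\<lambda>y. G b (x * y)) holomorphic_on annulus (norm q) (1 / m)"
        proof (intro G_holomorphic_intro holomorphic_intros b)
          fix y assume y: "y \<in> annulus (norm q) (1 / m)"
          have "norm x * norm y \<le> m * norm y" using that by (intro mult_right_mono) auto
          also have "\<dots> < 1" using y m by (simp add: annulus_def field_simps)
          finally show "norm (x * y) < 1" by (simp add: norm_mult)
        qed
      qed
      show ?thesis unfolding HH_def by (intro holomorphic_intros hol m)
    qed
    show "1 < 1 / m" using m by simp
  qed (use qQ in auto)
  also have "cint (circ 1) (\<lambda>z. half_weight b z * HH (Q / z)) =
     cint (circ 1) (\<lambda>z. half_weight b z * (kernel b (Q * x1) z * kernel b (Q * x2) z * kernel b (Q * x3) z * kernel b (Q * x4) z))"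
  proof (rule cint_cong)
    fix z assume "z \<in> path_image (circ 1)"
    hence z0: "z \<noteq> 0" by auto
    have Q0: "Q \<noteq> 0" using Q q_nz by auto
    have e: "q * x / (Q / z) = Q * x * z" "x * (Q / z) = Q * x / z" for x
      unfolding Q[symmetric] power2_eq_square using z0 Q0 by simp_all
    have "G b (q * x / (Q / z)) * G b (x * (Q / z)) = kernel b (Q * x) z" for x
      unfolding kernel_def e ..
    thus "half_weight b z * HH (Q / z) = half_weight b z * (kernel b (Q * x1) z * kernel b (Q * x2) z * kernel b (Q * x3) z * kernel b (Q * x4) z)"
      unfolding HH_def by simp
  qed
  also have "b^2 * (cint (circ 1) (\<lambda>z. half_weight b z * (kernel b (Q * x1) z * kernel b (Q * x2) z * kernel b (Q * x3) z * kernel b (Q * x4) z)) +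
       cint (circ 1) (\<lambda>z. half_weight b z * (kernel b (Q * x1) z * kernel b (Q * x2) z * kernel b (Q * x3) z * kernel b (Q * x4) z))) =
       b^2 * ((1 + b) * Fint b (Q * x1) (Q * x2) (Q * x3) (Q * x4))"
  proof -
    have "(1 + b) * Fint b (Q * x1) (Q * x2) (Q * x3) (Q * x4) =
       2 * cint (circ 1) (\<lambda>z. half_weight b z * (kernel b (Q * x1) z * kernel b (Q * x2) z * kernel b (Q * x3) z * kernel b (Q * x4) z))"
      unfolding Fint_def integrand_def
      by (rule cint_weight_symmetric) (use b qx(2) x in \<open>auto intro!: continuous_intros continuous_kernel simp: kernel_symmetric\<close>)
    thus ?thesis by simp
  qed
  finally show ?thesis by (simp add: algebra_simps)
qed

lemma Fint_one_variable:
  assumes b: "0 < norm b" "norm b < 1" and Q: "Q ^ 2 = q" and x: "norm x < 1"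
  shows "b * Fint b (q * x) 0 0 0 + Fint b x 0 0 0 = (1 + b) * Fint b (Q * x) 0 0 0"
proof -
  have nQ: "norm Q < 1"
  proof -
    have "norm Q ^ 2 < 1" using q_less_1 Q by (metis norm_power)
    thus ?thesis by (simp add: abs_square_less_1)
  qed
  have qQ: "norm q < norm Q"
  proof -
    have "norm Q * norm Q < norm Q * 1" using nQ Q q_nz by (intro mult_strict_left_mono) auto
    thus ?thesis unfolding Q[symmetric] by (simp add: norm_mult power2_eq_square)
  qed
  have qx: "norm (q * x) < 1" "norm (Q * x) < 1"
    using norm_mult_lt_1[OF q_less_1 x] norm_mult_lt_1[OF nQ x] by auto
  define HH where "HH y = G b (q * x / y) * G b (x * y)" for y
  have F1: "Fint b y 0 0 0 = cint (circ 1) (\<lambda>z. weight b z * kernel b y z)" for y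
    by (simp add: Fint_def integrand_def[abs_def])
  have cont: "continuous_on (sphere 0 1) (\<lambda>z. weight b z * kernel b y z)" if "norm y < 1" for y
    by (intro continuous_intros continuous_weight continuous_kernel that b)
  have contH: "continuous_on (sphere 0 1) HH"
    unfolding HH_def using x qx b
    by (intro continuous_intros G_continuous_intro) (auto simp: norm_mult norm_divide)
  have contH': "continuous_on (sphere 0 1) (\<lambda>z. HH (1 / z))"
    by (rule continuous_on_compose2[OF contH]) (auto intro!: continuous_intros simp: norm_divide)
  have pointwise: "b * (weight b z * kernel b (q * x) z) + weight b z * kernel b x z =
       half_weight b (1 / z) * HH (1 / z) + half_weight b z * HH z"
    if z: "norm z = 1" for z
  proof (cases "z^2 = 1")
    case True
    thus ?thesis using half_weight_at_1[OF True] by simp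
  next
    case False
    note nz = circle_nz[OF b(2) z]
    have bx: "1 - b * x * z \<noteq> 0" "1 - b * x / z \<noteq> 0"
      using circle_one_minus_nz[OF b(2) x] z by auto
    have H: "HH (1 / z) = kernel b x z * ((1 - x * z) / (1 - b * x * z))"
       "HH z = kernel b x z * ((1 - x / z) / (1 - b * x / z))"
      using G_shift[of "x * z" b] G_shift[of "x / z" b] x z b
      by (simp_all add: HH_def kernel_def norm_mult norm_divide mult_ac)
    have "b * (weight b z * kernel b (q * x) z) + weight b z * kernel b x z = weight b z * kernel b x z * (b * kernel_ratio b z x + 1)"
      unfolding kernel_shift[OF b(2) x z] by (simp add: algebra_simps)
    also have "\<dots> = (weight b z * weight_ratio b z) * HH (1 / z) + (weight b z * weight_ratio b (1 / z)) * HH z"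
      unfolding kernel_identity_1[OF nz(1) False bx] H by (simp only: distrib_left mult_ac)
    finally show ?thesis
      unfolding weight_kernel_weight_ratio[OF b(2) z False] .
  qed
  have cm: "cint (circ 1) (\<lambda>z. c * f z) = c * cint (circ 1) f" if "continuous_on (sphere 0 1) f" for c f
    using that by (intro cint_cmult[where \<rho> = 1]) auto
  have "b * Fint b (q * x) 0 0 0 + Fint b x 0 0 0 =
      cint (circ 1) (\<lambda>z. b * (weight b z * kernel b (q * x) z) + weight b z * kernel b x z)"
    unfolding F1 using cont[OF qx(1)] cont[OF x]
    by (simp add: cint_add cm[OF cont[OF qx(1)]] continuous_intros)
  also have "\<dots> = cint (circ 1) (\<lambda>z. half_weight b (1 / z) * HH (1 / z) + half_weight b z * HH z)"
    by (rule cint_cong) (use pointwise in auto)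
  also have "\<dots> = cint (circ 1) (\<lambda>z. half_weight b (1 / z) * HH (1 / z)) + cint (circ 1) (\<lambda>z. half_weight b z * HH z)"
    using contH contH' continuous_half_weight[OF b(2)] continuous_vt'[OF b(2)]
    by (simp add: cint_add continuous_intros)
  also have "cint (circ 1) (\<lambda>z. half_weight b (1 / z) * HH (1 / z)) = cint (circ 1) (\<lambda>z. half_weight b z * HH z)"
    by (rule cint_inverse[where f = "\<lambda>z. half_weight b z * HH z"])
  also have "cint (circ 1) (\<lambda>z. half_weight b z * HH z) = cint (circ 1) (\<lambda>z. half_weight b z * HH (Q / z))"
  proof (rule contour_shift[OF b Q])
    define m where "m = (norm x + 1) / 2"
    have m: "norm x \<le> m" "m < 1" "0 < m"
      using x norm_ge_zero[of x] by (simp_all add: m_def field_simps add_pos_nonneg)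
    show "HH holomorphic_on annulus (norm q) (1 / m)"
      unfolding HH_def
    proof (intro holomorphic_intros G_holomorphic_intro b)
      fix y assume y: "y \<in> annulus (norm q) (1 / m)"
      hence "0 < norm y" "norm q < norm y" using norm_ge_zero[of q] by (auto simp: annulus_def simp del: norm_ge_zero)
      show "y \<noteq> 0" using \<open>0 < norm y\<close> by auto
      have "norm q * norm x < norm y * 1"
        using \<open>norm q < norm y\<close> m by (intro mult_strict_mono') auto
      thus "norm (q * x / y) < 1"
        using \<open>0 < norm y\<close> by (simp add: norm_mult norm_divide divide_simps)
      have "norm x * norm y \<le> m * norm y" using m by (intro mult_right_mono) auto
      also have "\<dots> < 1" using y m by (simp add: annulus_def field_simps)
      finally show "norm (x * y) < 1" by (simp add: norm_mult)
    qed
    show "1 < 1 / m" using m by simp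
  qed (use qQ in auto)
  also have "cint (circ 1) (\<lambda>z. half_weight b z * HH (Q / z)) = cint (circ 1) (\<lambda>z. half_weight b z * kernel b (Q * x) z)"
  proof (rule cint_cong)
    fix z assume "z \<in> path_image (circ 1)"
    hence z0: "z \<noteq> 0" by auto
    have Q0: "Q \<noteq> 0" using Q q_nz by auto
    have e: "q * x / (Q / z) = Q * x * z" "x * (Q / z) = Q * x / z"
      unfolding Q[symmetric] power2_eq_square using z0 Q0 by simp_all
    show "half_weight b z * HH (Q / z) = half_weight b z * kernel b (Q * x) z"
      unfolding kernel_def HH_def e ..
  qed
  also have "cint (circ 1) (\<lambda>z. half_weight b z * kernel b (Q * x) z) + cint (circ 1) (\<lambda>z. half_weight b z * kernel b (Q * x) z) =
       (1 + b) * Fint b (Q * x) 0 0 0"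
    unfolding F1 using cint_weight_symmetric[OF b(2) continuous_kernel[OF b(2) qx(2)] kernel_symmetric] by simp
  finally show ?thesis .
qed

lemma Fint_two_variables:
  assumes b: "norm b < 1" and x: "norm x1 < 1" "norm x2 < 1"
  shows "(x2 - x1) * (1 - x1 * x2) * Fint b x1 x2 0 0
      + (b * x1 * (1 + x2^2) - x2 * (1 + b^2 * x1^2)) * Fint b (q * x1) x2 0 0
      + (x1 * (1 + b^2 * x2^2) - b * x2 * (1 + x1^2)) * Fint b x1 (q * x2) 0 0
      + b * (x2 - x1) * (1 - b^2 * x1 * x2) * Fint b (q * x1) (q * x2) 0 0 = 0"
    (is "?c0 * _ + ?c1 * _ + ?c2 * _ + ?c3 * _ = 0")
proof -
  have qx: "norm (q * x1) < 1" "norm (q * x2) < 1"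
    using norm_mult_lt_1[OF q_less_1 x(1)] norm_mult_lt_1[OF q_less_1 x(2)] by auto
  have F2: "Fint b y1 y2 0 0 = cint (circ 1) (\<lambda>z. weight b z * (kernel b y1 z * kernel b y2 z))" for y1 y2
    by (simp add: Fint_def integrand_def[abs_def])
  have cont: "continuous_on (sphere 0 1) (\<lambda>z. weight b z * (kernel b y1 z * kernel b y2 z))"
    if "norm y1 < 1" "norm y2 < 1" for y1 y2
    by (intro continuous_intros continuous_weight continuous_kernel that b)
  have cm: "cint (circ 1) (\<lambda>z. c * f z) = c * cint (circ 1) f" if "continuous_on (sphere 0 1) f" for c f
    using that by (intro cint_cmult[where \<rho> = 1]) auto
  note c = cont[OF x] cont[OF qx(1) x(2)] cont[OF x(1) qx(2)] cont[OF qx]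
  have "?c0 * Fint b x1 x2 0 0 + ?c1 * Fint b (q * x1) x2 0 0 + ?c2 * Fint b x1 (q * x2) 0 0
      + ?c3 * Fint b (q * x1) (q * x2) 0 0 =
     cint (circ 1) (\<lambda>z. ?c0 * (weight b z * (kernel b x1 z * kernel b x2 z)) + ?c1 * (weight b z * (kernel b (q * x1) z * kernel b x2 z))
       + ?c2 * (weight b z * (kernel b x1 z * kernel b (q * x2) z)) + ?c3 * (weight b z * (kernel b (q * x1) z * kernel b (q * x2) z)))"
    unfolding F2 cm[OF c(1), symmetric] cm[OF c(2), symmetric] cm[OF c(3), symmetric] cm[OF c(4), symmetric]
    using c by (simp add: cint_add continuous_on_add continuous_on_mult_const continuous_on_mult_left)
  also have "\<dots> = cint (circ 1) (\<lambda>z. 0)"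
  proof (rule cint_cong)
    fix z assume "z \<in> path_image (circ 1)"
    hence z: "norm z = 1" "z \<noteq> 0" by auto
    have bx: "1 - b * y * z \<noteq> 0" "1 - b * y / z \<noteq> 0" if "norm y < 1" for y
      using circle_one_minus_nz[OF b that] z by auto
    have gen: "c0 * (w * (k1 * k2)) + c1 * (w * (k1 * s1 * k2)) + c2 * (w * (k1 * (k2 * s2))) + c3 * (w * (k1 * s1 * (k2 * s2)))
        = w * (k1 * k2) * (c0 + c1 * s1 + c2 * s2 + c3 * (s1 * s2))" for c0 c1 c2 c3 w k1 k2 s1 s2 :: complex
      by (simp add: algebra_simps)
    show "?c0 * (weight b z * (kernel b x1 z * kernel b x2 z)) + ?c1 * (weight b z * (kernel b (q * x1) z * kernel b x2 z))
       + ?c2 * (weight b z * (kernel b x1 z * kernel b (q * x2) z)) + ?c3 * (weight b z * (kernel b (q * x1) z * kernel b (q * x2) z)) = 0"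
      unfolding kernel_shift[OF b x(1) z(1)] kernel_shift[OF b x(2) z(1)] gen
        kernel_identity_2[OF z(2) bx[OF x(1)] bx[OF x(2)]] by simp
  qed
  also have "\<dots> = 0" by simp
  finally show ?thesis .
qed

end

section \<open>Contraction on a polytorus and the constant term\<close>

lemma max_modulus_disc:
  assumes g: "g holomorphic_on ball 0 1" and r: "0 < r" "r < 1"
    and M: "\<And>z. norm z = r \<Longrightarrow> norm (g z) \<le> M" and z: "norm z \<le> r"
  shows "norm (g z) \<le> M"
proof (rule maximum_modulus_frontier[of g "cball 0 r"])
  have sub: "cball 0 r \<subseteq> ball (0::complex) 1" using r by auto
  show "g holomorphic_on interior (cball 0 r)"
    using sub by (intro holomorphic_on_subset[OF g]) auto
  show "continuous_on (closure (cball 0 r)) g"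
    using holomorphic_on_imp_continuous_on[OF holomorphic_on_subset[OF g sub]] by simp
qed (use r M z in auto)

text \<open>The Schwarz lemma, combined with the maximum principle on the circle of radius
  \<open>r\<close>.\<close>

lemma Schwarz_disc:
  assumes g: "g holomorphic_on ball 0 1" "g 0 = 0" and r: "0 < r" "r < 1"
    and M: "\<And>z. norm z \<le> r \<Longrightarrow> norm (g z) \<le> M" and z: "norm z \<le> r" and c: "norm c < 1"
  shows "norm (g (c * z)) \<le> norm c * M"
proof -
  have M0: "M \<ge> 0" using M[of 0] g(2) r by simp
  have *: "norm (g (c * z)) \<le> norm c * (M + e)" if e: "e > 0" for e
  proof -
    define f where "f w = g (of_real r * w) / of_real (M + e)" for w
    have "norm (f (c * z / of_real r)) \<le> norm (c * z / of_real r)"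
    proof (rule Schwarz_Lemma(1))
      show "f holomorphic_on ball 0 1"
      proof -
        have "(\<lambda>w. of_real r * w) ` ball 0 1 \<subseteq> ball (0::complex) 1"
        proof safe
          fix w :: complex assume "w \<in> ball 0 1"
          thus "of_real r * w \<in> ball 0 1"
            using norm_mult_lt_1[of "of_real r" w] r by simp
        qed
        from holomorphic_on_compose_gen[OF _ g(1) this]
        have "(\<lambda>w. g (of_real r * w)) holomorphic_on ball 0 1"
          by (auto simp: o_def intro!: holomorphic_intros)
        moreover have "complex_of_real (M + e) \<noteq> 0"
          using e M0 by (simp del: of_real_add)
        ultimately show ?thesis
          unfolding f_def by (intro holomorphic_on_divide holomorphic_on_const)
      qed
      show "f 0 = 0" by (simp add: f_def g)
      show "norm (f w) < 1" if "norm w < 1" for w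
      proof -
        have "norm (of_real r * w) \<le> r" using that r by (simp add: norm_mult mult_left_le)
        hence "norm (g (of_real r * w)) < M + e" using M e by fastforce
        thus ?thesis using M0 e by (simp add: f_def norm_divide del: of_real_add)
      qed
      have "norm c * norm z \<le> norm c * r" using z by (intro mult_left_mono) auto
      also have "\<dots> < 1 * r" using c r by (intro mult_strict_right_mono)
      finally show "norm (c * z / of_real r) < 1"
        using r by (simp add: norm_mult norm_divide)
    qed
    also have "\<dots> \<le> norm c"
      using z r mult_left_mono[OF z, of "norm c"] by (simp add: norm_mult norm_divide divide_le_eq)
    finally have "norm (g (c * z)) / (M + e) \<le> norm c"
      using r M0 e by (simp add: f_def norm_divide del: of_real_add)
    thus ?thesis using M0 e by (simp add: divide_le_eq)
  qed
  have lim: "((\<lambda>e. norm c * (M + e)) \<longlongrightarrow> norm c * (M + 0)) (at_right 0)"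
    by (intro tendsto_intros)
  have ev: "eventually (\<lambda>e. norm (g (c * z)) \<le> norm c * (M + e)) (at_right 0)"
    using eventually_at_right_less[of 0] by eventually_elim (rule *)
  show ?thesis
    using tendsto_lowerbound[OF lim ev] by simp
qed

definition sep_hol :: "(complex \<Rightarrow> complex \<Rightarrow> complex \<Rightarrow> complex \<Rightarrow> complex) \<Rightarrow> bool" where
  "sep_hol f \<longleftrightarrow> (\<forall>a b c. norm a < 1 \<longrightarrow> norm b < 1 \<longrightarrow> norm c < 1 \<longrightarrow>
     (\<lambda>x. f x a b c) holomorphic_on ball 0 1 \<and> (\<lambda>x. f a x b c) holomorphic_on ball 0 1 \<and>
     (\<lambda>x. f a b x c) holomorphic_on ball 0 1 \<and> (\<lambda>x. f a b c x) holomorphic_on ball 0 1)"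

lemma max_modulus_polydisc:
  fixes x1 x2 x3 x4 :: complex
  assumes f: "sep_hol f" and r: "0 < r1" "r1 < 1" "0 < r2" "r2 < 1" "0 < r3" "r3 < 1" "0 < r4" "r4 < 1"
    and M: "\<And>x1 x2 x3 x4. norm x1 = r1 \<Longrightarrow> norm x2 = r2 \<Longrightarrow> norm x3 = r3 \<Longrightarrow> norm x4 = r4 \<Longrightarrow> norm (f x1 x2 x3 x4) \<le> M"
    and x: "norm x1 \<le> r1" "norm x2 \<le> r2" "norm x3 \<le> r3" "norm x4 \<le> r4"
  shows "norm (f x1 x2 x3 x4) \<le> M"
proof -
  note h = f[unfolded sep_hol_def, rule_format]
  have 1: "norm (f y1 y2 y3 x4) \<le> M" if "norm y1 = r1" "norm y2 = r2" "norm y3 = r3" for y1 y2 y3 :: complex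
    by (rule max_modulus_disc[of "\<lambda>x. f y1 y2 y3 x" r4]) (use h[of y1 y2 y3] that r M x in auto)
  have 2: "norm (f y1 y2 x3 x4) \<le> M" if "norm y1 = r1" "norm y2 = r2" for y1 y2 :: complex
    by (rule max_modulus_disc[of "\<lambda>x. f y1 y2 x x4" r3]) (use h[of y1 y2 x4] that r 1 x in auto)
  have 3: "norm (f y1 x2 x3 x4) \<le> M" if "norm y1 = r1" for y1 :: complex
    by (rule max_modulus_disc[of "\<lambda>x. f y1 x x3 x4" r2]) (use h[of y1 x3 x4] that r 2 x in auto)
  show ?thesis
    by (rule max_modulus_disc[of "\<lambda>x. f x x2 x3 x4" r1]) (use h[of x2 x3 x4] r 3 x in auto)
qed

text \<open>By the maximum principle the bound on the torus holds on the polydisc, and it can be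
  iterated.\<close>

lemma contraction_imp_zero:
  fixes x1 x2 x3 x4 :: complex
  assumes f: "sep_hol f" and r: "0 < r1" "r1 < 1" "0 < r2" "r2 < 1" "0 < r3" "r3 < 1" "0 < r4" "r4 < 1"
    and bdd: "\<And>x1 x2 x3 x4. norm x1 \<le> r1 \<Longrightarrow> norm x2 \<le> r2 \<Longrightarrow> norm x3 \<le> r3 \<Longrightarrow> norm x4 \<le> r4 \<Longrightarrow> norm (f x1 x2 x3 x4) \<le> B"
    and \<theta>: "0 \<le> \<theta>" "\<theta> < 1"
    and contr: "\<And>M x1 x2 x3 x4. (\<And>x1 x2 x3 x4. norm x1 \<le> r1 \<Longrightarrow> norm x2 \<le> r2 \<Longrightarrow> norm x3 \<le> r3 \<Longrightarrow> norm x4 \<le> r4 \<Longrightarrow> norm (f x1 x2 x3 x4) \<le> M) \<Longrightarrow>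
       norm x1 = r1 \<Longrightarrow> norm x2 = r2 \<Longrightarrow> norm x3 = r3 \<Longrightarrow> norm x4 = r4 \<Longrightarrow> norm (f x1 x2 x3 x4) \<le> \<theta> * M"
    and x: "norm x1 \<le> r1" "norm x2 \<le> r2" "norm x3 \<le> r3" "norm x4 \<le> r4"
  shows "f x1 x2 x3 x4 = 0"
proof -
  have iter: "\<forall>x1 x2 x3 x4. norm x1 \<le> r1 \<longrightarrow> norm x2 \<le> r2 \<longrightarrow> norm x3 \<le> r3 \<longrightarrow> norm x4 \<le> r4 \<longrightarrow>
      norm (f x1 x2 x3 x4) \<le> \<theta> ^ n * B" for n
  proof (induction n)
    case 0
    thus ?case using bdd by simp
  next
    case (Suc n)
    have "norm (f x1 x2 x3 x4) \<le> \<theta> * (\<theta> ^ n * B)"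
      if "norm x1 \<le> r1" "norm x2 \<le> r2" "norm x3 \<le> r3" "norm x4 \<le> r4" for x1 x2 x3 x4 :: complex
    proof (rule max_modulus_polydisc[OF f r _ that])
      fix y1 y2 y3 y4 :: complex assume "norm y1 = r1" "norm y2 = r2" "norm y3 = r3" "norm y4 = r4"
      thus "norm (f y1 y2 y3 y4) \<le> \<theta> * (\<theta> ^ n * B)"
        using Suc by (intro contr) auto
    qed
    thus ?case by (simp add: mult.assoc)
  qed
  have "(\<lambda>n. \<theta> ^ n * B) \<longlonglongrightarrow> 0 * B"
    using \<theta> by (intro tendsto_intros LIMSEQ_power_zero) auto
  hence "norm (f x1 x2 x3 x4) \<le> 0"
    using iter x by (intro LIMSEQ_le_const[of "\<lambda>n. \<theta> ^ n * B" 0]) auto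
  thus ?thesis by simp
qed

text \<open>The first of the two kinds of factors in \<open>shift_coeff\<close>: the shifted variable is the
  smaller one.\<close>

lemma ratio_small_first:
  assumes "norm (x::complex) \<le> s * norm y" "norm b \<le> 1" "0 \<le> s" "s < 1" "y \<noteq> 0"
  shows "norm ((b * x - y) / (x - y)) \<le> (1 + s) / (1 - s)"
proof -
  have bx: "norm (b * x) \<le> s * norm y"
    using mult_right_mono[OF assms(2) norm_ge_zero[of x]] assms(1) by (simp add: norm_mult)
  have "norm (b * x - y) \<le> (1 + s) * norm y"
    using norm_triangle_ineq4[of "b * x" y] bx by (simp add: algebra_simps)
  moreover have "(1 - s) * norm y \<le> norm (x - y)"
    using norm_triangle_ineq2[of y x] assms(1) by (simp add: algebra_simps norm_minus_commute)
  moreover have "0 < (1 - s) * norm y" using assms by simp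
  ultimately have "norm (b * x - y) / norm (x - y) \<le> (1 + s) * norm y / ((1 - s) * norm y)"
    using assms by (intro frac_le) auto
  thus ?thesis using assms by (simp add: norm_divide)
qed

text \<open>Here the shifted variable is the larger one; smallness of \<open>b\<close> makes the factor
  small.\<close>

lemma ratio_small_second:
  assumes "norm (y::complex) \<le> s * norm x" "norm b \<le> s" "0 \<le> s" "s < 1" "x \<noteq> 0"
  shows "norm ((b * x - y) / (x - y)) \<le> 2 * s / (1 - s)"
proof -
  have bx: "norm (b * x) \<le> s * norm x"
    using mult_right_mono[OF assms(2) norm_ge_zero[of x]] by (simp add: norm_mult)
  have "norm (b * x - y) \<le> 2 * s * norm x"
    using norm_triangle_ineq4[of "b * x" y] bx assms(1) by simp
  moreover have "(1 - s) * norm x \<le> norm (x - y)"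
    using norm_triangle_ineq2[of x y] assms(1) by (simp add: algebra_simps)
  moreover have "0 < (1 - s) * norm x" using assms by simp
  ultimately have "norm (b * x - y) / norm (x - y) \<le> 2 * s * norm x / ((1 - s) * norm x)"
    using assms by (intro frac_le) auto
  thus ?thesis using assms by (simp add: norm_divide)
qed

context nome
begin

lemma integrand_continuous:
  fixes b x1 x2 x3 x4 :: "'a :: topological_space \<Rightarrow> complex"
  assumes cont: "continuous_on U b" "continuous_on U x1" "continuous_on U x2" "continuous_on U x3" "continuous_on U x4"
    and lt: "\<And>w. w \<in> U \<Longrightarrow> norm (b w) < 1" "\<And>w. w \<in> U \<Longrightarrow> norm (x1 w) < 1" "\<And>w. w \<in> U \<Longrightarrow> norm (x2 w) < 1"
      "\<And>w. w \<in> U \<Longrightarrow> norm (x3 w) < 1" "\<And>w. w \<in> U \<Longrightarrow> norm (x4 w) < 1"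
  shows "continuous_on (U \<times> sphere 0 1) (\<lambda>(w, z). integrand (b w) (x1 w) (x2 w) (x3 w) (x4 w) z)"
proof -
  have f: "continuous_on (U \<times> sphere 0 1) (\<lambda>p. g (fst p))" if "continuous_on U g" for g :: "'a \<Rightarrow> complex"
    by (rule continuous_on_compose2[OF that]) (auto intro!: continuous_intros)
  have K: "continuous_on (U \<times> sphere 0 1) (\<lambda>p. kernel (b (fst p)) (x (fst p)) (snd p))"
    if x: "continuous_on U x" "\<And>w. w \<in> U \<Longrightarrow> norm (x w) < 1" for x
    unfolding kernel_def G_def
  proof (intro continuous_intros f[OF x(1)] f[OF cont(1)] ballI P_nz)
    fix p assume p: "p \<in> U \<times> sphere (0::complex) 1"
    thus "norm (x (fst p) * snd p) < 1" "norm (x (fst p) / snd p) < 1" "snd p \<noteq> 0"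
      using x(2)[of "fst p"] by (auto simp: norm_mult norm_divide)
    show "snd p \<noteq> 0" using p by auto
  qed
  show ?thesis
    unfolding case_prod_unfold integrand_def weight_def
    by (intro continuous_intros K cont f[OF cont(1)] lt) (use lt(1) circle_nz in auto)
qed

lemma continuous_Fint:
  fixes b x1 x2 x3 x4 :: "'a :: topological_space \<Rightarrow> complex"
  assumes "continuous_on U b" "continuous_on U x1" "continuous_on U x2" "continuous_on U x3" "continuous_on U x4"
    and "\<And>w. w \<in> U \<Longrightarrow> norm (b w) < 1" "\<And>w. w \<in> U \<Longrightarrow> norm (x1 w) < 1" "\<And>w. w \<in> U \<Longrightarrow> norm (x2 w) < 1"
      "\<And>w. w \<in> U \<Longrightarrow> norm (x3 w) < 1" "\<And>w. w \<in> U \<Longrightarrow> norm (x4 w) < 1"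
  shows "continuous_on U (\<lambda>w. Fint (b w) (x1 w) (x2 w) (x3 w) (x4 w))"
  unfolding Fint_def by (rule continuous_cint[OF _ integrand_continuous[OF assms]]) auto

lemma holomorphic_Fint:
  assumes U: "open U" and hol: "b holomorphic_on U" "x1 holomorphic_on U" "x2 holomorphic_on U" "x3 holomorphic_on U" "x4 holomorphic_on U"
    and lt: "\<And>w. w \<in> U \<Longrightarrow> norm (b w) < 1" "\<And>w. w \<in> U \<Longrightarrow> norm (x1 w) < 1" "\<And>w. w \<in> U \<Longrightarrow> norm (x2 w) < 1"
      "\<And>w. w \<in> U \<Longrightarrow> norm (x3 w) < 1" "\<And>w. w \<in> U \<Longrightarrow> norm (x4 w) < 1"
  shows "(\<lambda>w. Fint (b w) (x1 w) (x2 w) (x3 w) (x4 w)) holomorphic_on U"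
  unfolding Fint_def
proof (rule holomorphic_cint[OF _ U])
  show "continuous_on (U \<times> sphere 0 1) (\<lambda>(w, z). integrand (b w) (x1 w) (x2 w) (x3 w) (x4 w) z)"
    by (intro integrand_continuous hol[THEN holomorphic_on_imp_continuous_on] lt)
  fix z :: complex assume z: "norm z = 1"
  hence z0: "z \<noteq> 0" by auto
  have K: "(\<lambda>w. kernel (b w) (x w) z) holomorphic_on U" if "x holomorphic_on U" "\<And>w. w \<in> U \<Longrightarrow> norm (x w) < 1" for x
    unfolding kernel_def G_def using z z0 that(2) by (intro holomorphic_intros hol that(1) P_nz) (auto simp: norm_mult norm_divide)
  show "(\<lambda>w. integrand (b w) (x1 w) (x2 w) (x3 w) (x4 w) z) holomorphic_on U"
    unfolding integrand_def weight_def using lt(1) z z0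
    by (intro holomorphic_intros K hol lt) (auto simp: circle_nz)
qed auto

text \<open>Since \<open>weight (q b) = weight b (1 - b z\<^sup>2) (1 - b/z\<^sup>2)\<close>, only the means
  of \<open>half_weight\<close> against \<open>1\<close>, \<open>z\<^sup>2\<close> and
  \<open>1/z\<^sup>2\<close> are involved. They are all multiples of one: \<open>contour_shift\<close> relates
  the last two, and the relation between \<open>half_weight b z\<close> and its reflection gives the second
  equation.\<close>

lemma Fint_constant_recursion:
  assumes b: "0 < norm b" "norm b < 1"
  shows "Fint (q * b) 0 0 0 0 * (1 - b * q) = Fint b 0 0 0 0 * ((1 + b) * (1 - b^2 * q))"
proof -
  define Q where "Q = csqrt q"
  have Q: "Q^2 = q" "Q \<noteq> 0" using q_nz by (auto simp: Q_def)
  have F0: "Fint b 0 0 0 0 = cint (circ 1) (\<lambda>z. weight b z)" for b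
    by (simp add: Fint_def integrand_def[abs_def])
  define V0 where "V0 = cint (circ 1) (half_weight b)"
  define J where "J = cint (circ 1) (\<lambda>z. half_weight b z * (1 / z^2))"
  define I where "I = cint (circ 1) (\<lambda>z. half_weight b z * z^2)"
  have cm: "cint (circ 1) (\<lambda>z. c * f z) = c * cint (circ 1) f" if "continuous_on (sphere 0 1) f" for c f
    using that by (intro cint_cmult[where \<rho> = 1]) auto
  note cv = continuous_half_weight[OF b(2)] continuous_vt'[OF b(2)]
  have c2: "continuous_on (sphere 0 1) (\<lambda>z::complex. 1 / z^2)"
    by (intro continuous_intros) auto
  have nQ: "0 < norm Q" using Q by simp
  have I_J: "I = q * J"
  proof -
    have "I = cint (circ 1) (\<lambda>z. half_weight b z * (Q / z)^2)"
      unfolding I_def by (rule contour_shift[OF b Q(1), of "\<lambda>z. z^2" 0 2]) (use nQ in \<open>auto intro!: holomorphic_intros\<close>)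
    also have "\<dots> = cint (circ 1) (\<lambda>z. q * (half_weight b z * (1 / z^2)))"
      by (rule cint_cong) (simp add: power_divide Q)
    also have "\<dots> = q * J"
      unfolding J_def by (rule cm) (intro continuous_intros cv c2)
    finally show ?thesis .
  qed
  have rel: "b * V0 - J = V0 - b * I"
  proof -
    have "cint (circ 1) (\<lambda>z. b * half_weight b (1 / z) + (-1) * (half_weight b (1 / z) * (1 / (1 / z)^2))) =
          cint (circ 1) (\<lambda>z. half_weight b z + (- b) * (half_weight b z * z^2))"
    proof (rule cint_cong)
      fix z assume "z \<in> path_image (circ 1)"
      hence z: "norm z = 1" by auto
      show "b * half_weight b (1 / z) + (-1) * (half_weight b (1 / z) * (1 / (1 / z)^2)) = half_weight b z + (- b) * (half_weight b z * z^2)"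
        using weight_half_weight_relations(3)[OF circle_nz(1-3)[OF b(2) z]] by (simp add: algebra_simps power_divide)
    qed
    moreover have cvz: "continuous_on (sphere 0 1) (\<lambda>z. half_weight b (1 / z) * (1 / (1 / z)^2))"
      by (intro continuous_intros cv) auto
    hence "cint (circ 1) (\<lambda>z. b * half_weight b (1 / z) + (-1) * (half_weight b (1 / z) * (1 / (1 / z)^2))) =
        b * cint (circ 1) (\<lambda>z. half_weight b (1 / z)) + (-1) * cint (circ 1) (\<lambda>z. half_weight b (1 / z) * (1 / (1 / z)^2))"
      unfolding cm[OF cv(2), symmetric] cm[OF cvz, symmetric]
      by (intro cint_add continuous_on_mult_left cv cvz) auto
    moreover have "cint (circ 1) (\<lambda>z. half_weight b z + (- b) * (half_weight b z * z^2)) = V0 + (- b) * I"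
    proof -
      have c: "continuous_on (sphere 0 1) (\<lambda>z. half_weight b z * z^2)" by (intro continuous_intros cv)
      show ?thesis
        unfolding V0_def I_def cm[OF c, symmetric]
        by (intro cint_add continuous_on_mult_left cv c) auto
    qed
    moreover have "cint (circ 1) (\<lambda>z. half_weight b (1 / z)) = V0" "cint (circ 1) (\<lambda>z. half_weight b (1 / z) * (1 / (1 / z)^2)) = J"
      unfolding V0_def J_def using cint_inverse[of "half_weight b"] cint_inverse[of "\<lambda>z. half_weight b z * (1 / z^2)"] by simp_all
    ultimately show ?thesis by simp
  qed
  have C: "(1 + b) * Fint b 0 0 0 0 = 2 * V0"
    using cint_weight_symmetric[OF b(2), of "\<lambda>z. 1"] by (simp add: F0 V0_def)
  have Cq: "(1 + b) * Fint (q * b) 0 0 0 0 = 2 * ((1 + b^2) * V0 - b * (I + J))"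
  proof -
    let ?H = "\<lambda>z::complex. (1 + b^2) * 1 + (- b) * (z^2 + 1 / z^2)"
    have cH: "continuous_on (sphere 0 1) ?H" by (intro continuous_intros) auto
    have "Fint (q * b) 0 0 0 0 = cint (circ 1) (\<lambda>z. weight b z * ?H z)"
      unfolding F0
    proof (rule cint_cong)
      fix z assume "z \<in> path_image (circ 1)"
      hence z: "norm z = 1" by auto
      note nz = circle_nz[OF b(2) z]
      have "weight b z * ((1 - b * z^2) * (1 - b / z^2)) = weight (q * b) z"
        unfolding weight_def using P_rec[of "b * z^2"] P_rec[of "b / z^2"] nz by (simp add: mult_ac)
      moreover have "(1 - b * z^2) * (1 - b / z^2) = ?H z"
        using nz(1) by (simp add: field_simps power2_eq_square)
      ultimately show "weight (q * b) z = weight b z * ?H z" by simp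
    qed
    hence "(1 + b) * Fint (q * b) 0 0 0 0 = 2 * cint (circ 1) (\<lambda>z. half_weight b z * ?H z)"
      using cint_weight_symmetric[OF b(2) cH] by (simp add: power_divide add.commute)
    also have "cint (circ 1) (\<lambda>z. half_weight b z * ?H z) =
        cint (circ 1) (\<lambda>z. (1 + b^2) * half_weight b z + (- b) * (half_weight b z * z^2 + half_weight b z * (1 / z^2)))"
      by (rule cint_cong) (simp add: algebra_simps)
    also have "\<dots> = (1 + b^2) * V0 + (- b) * (I + J)"
    proof -
      have c: "continuous_on (sphere 0 1) (\<lambda>z. half_weight b z * z^2)" "continuous_on (sphere 0 1) (\<lambda>z. half_weight b z * (1 / z^2))"
        by (intro continuous_intros cv c2)+
      have "cint (circ 1) (\<lambda>z. (1 + b^2) * half_weight b z + (- b) * (half_weight b z * z^2 + half_weight b z * (1 / z^2))) =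
          cint (circ 1) (\<lambda>z. (1 + b^2) * half_weight b z) + cint (circ 1) (\<lambda>z. (- b) * (half_weight b z * z^2 + half_weight b z * (1 / z^2)))"
        by (intro cint_add continuous_on_mult_left continuous_on_add cv c) auto
      also have "\<dots> = (1 + b^2) * V0 + (- b) * cint (circ 1) (\<lambda>z. half_weight b z * z^2 + half_weight b z * (1 / z^2))"
        unfolding V0_def cm[OF cv(1)] cm[OF continuous_on_add[OF c]] ..
      also have "cint (circ 1) (\<lambda>z. half_weight b z * z^2 + half_weight b z * (1 / z^2)) = I + J"
        unfolding I_def J_def by (intro cint_add c) auto
      finally show ?thesis .
    qed
    finally show ?thesis by simp
  qed
  have "norm (b * q) < 1" by (rule norm_mult_lt_1[OF b(2) q_less_1])
  hence nz: "1 + b \<noteq> 0" using b by (metis add.commute add_eq_0_iff norm_minus_cancel norm_one less_irrefl)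
  have J: "J * (b * q - 1) = V0 * (1 - b)"
    using rel unfolding I_J by (simp add: algebra_simps)
  have "(1 + b) * (Fint (q * b) 0 0 0 0 * (1 - b * q)) = ((1 + b) * Fint (q * b) 0 0 0 0) * (1 - b * q)"
    by simp
  also have "\<dots> = 2 * ((1 + b^2) * V0 * (1 - b * q) + b * (1 + q) * (J * (b * q - 1)))"
    unfolding Cq I_J by (simp add: algebra_simps)
  also have "\<dots> = (2 * V0) * ((1 + b) * (1 - b^2 * q))"
    unfolding J by (simp add: algebra_simps power2_eq_square)
  also have "\<dots> = (1 + b) * (Fint b 0 0 0 0 * ((1 + b) * (1 - b^2 * q)))"
    unfolding C[symmetric] by (simp add: mult_ac)
  finally show ?thesis using nz by simp
qed

text \<open>For \<open>b = q\<close> the products cancel and the integrand is the Laurent polynomial \<open>(1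
  - z\<^sup>2) (1 - 1/z\<^sup>2)\<close>.\<close>

lemma Fint_constant_at_q: "Fint q 0 0 0 0 = 2"
proof -
  have "Fint q 0 0 0 0 = cint (circ 1) (\<lambda>z. 2 + ((-1) * z^2 + (-1) * (1 / z)^2))"
    unfolding Fint_def integrand_def[abs_def]
  proof (rule cint_cong)
    fix z assume "z \<in> path_image (circ 1)"
    hence z: "norm z = 1" by auto
    note nz = circle_nz[OF q_less_1 z]
    have "weight q z = (1 - z^2) * (1 - 1 / z^2)"
      unfolding weight_def using P_rec[of "z^2"] P_rec[of "1 / z^2"] nz by simp
    also have "\<dots> = 2 + ((-1) * z^2 + (-1) * (1 / z)^2)"
      using nz(1) by (simp add: field_simps power2_eq_square)
    finally show "weight q z * (kernel q 0 z * kernel q 0 z * kernel q 0 z * kernel q 0 z) = 2 + ((-1) * z^2 + (-1) * (1 / z)^2)"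
      by simp
  qed
  also have "\<dots> = 2 + ((-1) * cint (circ 1) (\<lambda>z. z^2) + (-1) * cint (circ 1) (\<lambda>z. (1 / z)^2))"
  proof -
    have c: "continuous_on (sphere 0 1) (\<lambda>z::complex. (1 / z)^2)" "continuous_on (sphere 0 1) (\<lambda>z::complex. z^2)"
      by (intro continuous_intros; auto)+
    have cm: "cint (circ 1) (\<lambda>z. c * f z) = c * cint (circ 1) f" if "continuous_on (sphere 0 1) f" for c f
      using that by (intro cint_cmult[where \<rho> = 1]) auto
    have "cint (circ 1) (\<lambda>z. 2 + ((-1) * z^2 + (-1) * (1 / z)^2)) =
       cint (circ 1) (\<lambda>z. 2) + cint (circ 1) (\<lambda>z. (-1) * z^2 + (-1) * (1 / z)^2)"
      by (intro cint_add continuous_on_add continuous_on_mult_left c) auto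
    also have "cint (circ 1) (\<lambda>z. (-1) * z^2 + (-1) * (1 / z)^2) =
       cint (circ 1) (\<lambda>z. (-1) * z^2) + cint (circ 1) (\<lambda>z. (-1) * (1 / z)^2)"
      by (intro cint_add continuous_on_mult_left c) auto
    finally show ?thesis unfolding cm[OF c(1)] cm[OF c(2)] by simp
  qed
  also have "cint (circ 1) (\<lambda>z. (1 / z)^2) = cint (circ 1) (\<lambda>z. z^2)"
    by (rule cint_inverse)
  also have "cint (circ 1) (\<lambda>z. z^2) = 0"
  proof -
    have "cint (circ 1) (\<lambda>z. (2 * z)^2) = cint (circ 1) (\<lambda>z. z^2)"
      by (rule cint_scale[where r = 0 and R = 4 and f = "\<lambda>z. z^2"]) (auto intro!: holomorphic_intros)
    moreover have "cint (circ 1) (\<lambda>z. (2 * z)^2) = 4 * cint (circ 1) (\<lambda>z. z^2)"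
      unfolding power_mult_distrib by (subst cint_cmult[where \<rho> = 1]) (auto intro!: continuous_intros)
    ultimately show ?thesis by simp
  qed
  finally show ?thesis by simp
qed

text \<open>By the recursion the quotient of the two sides is invariant under \<open>b \<mapsto> q b\<close>
  and it is continuous at \<open>0\<close>, hence constant; \<open>b = q\<close> determines the
  constant.\<close>

lemma Fint_constant:
  assumes b: "0 < norm b" "norm b < 1"
  shows "P q * Fint b 0 0 0 0 * P (b^2) = 2 * P b * P (q * b)"
proof -
  define K where "K b = Fint b 0 0 0 0 * P (b^2) / (P b * P (q * b))" for b
  have nz: "P b \<noteq> 0" "P (q * b) \<noteq> 0" "P (b^2) \<noteq> 0" "1 - b * q \<noteq> 0" "1 - b \<noteq> 0" if "norm b < 1" for b
    using that norm_mult_lt_1[OF q_less_1 that] norm_mult_lt_1[OF that that]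
    by (auto intro!: P_nz one_minus_nz simp: power2_eq_square mult_ac)
  have rec: "K (q * b) = K b" if b: "0 < norm b" "norm b < 1" for b
  proof -
    have qb: "norm (q * b) < 1" by (rule norm_mult_lt_1[OF q_less_1 b(2)])
    have "1 - b^2 * q \<noteq> 0" "1 - b^2 \<noteq> 0"
      using norm_mult_lt_1[OF b(2) qb] norm_mult_lt_1[OF b(2,2)]
      by (auto intro!: one_minus_nz simp: power2_eq_square mult_ac)
    have "P (b^2) = (1 - b^2) * ((1 - b^2 * q) * P ((q * b)^2))"
      using P_rec[of "b^2"] P_rec[of "q * b^2"] by (simp add: power_mult_distrib power2_eq_square mult_ac)
    moreover have "P b = (1 - b) * P (q * b)" "P (q * b) = (1 - b * q) * P (q * (q * b))"
      using P_rec[of b] P_rec[of "q * b"] by (simp_all add: mult_ac)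
    moreover have "Fint (q * b) 0 0 0 0 = Fint b 0 0 0 0 * ((1 + b) * (1 - b^2 * q)) / (1 - b * q)"
      using Fint_constant_recursion[OF b] nz(4)[OF b(2)] by (simp add: field_simps)
    moreover have "1 - b^2 = (1 - b) * (1 + b)" by (simp add: algebra_simps power2_eq_square)
    moreover have "P (q * (q * b)) \<noteq> 0" using nz(2)[OF qb] .
    ultimately show ?thesis
      unfolding K_def using nz[OF b(2)] nz(1)[OF qb] by (simp add: divide_simps)
  qed
  have iter: "K (b * q ^ n) = K b" if b: "0 < norm b" "norm b < 1" for b n
  proof (induction n)
    case (Suc n)
    have "norm (b * q ^ n) < 1" using norm_mult_qpow_le[of b "norm b" n] b by simp
    moreover have "0 < norm (b * q ^ n)" using b q_nz by simp
    ultimately have "K (q * (b * q ^ n)) = K (b * q ^ n)" by (intro rec)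
    thus ?case using Suc by (simp add: mult_ac)
  qed auto
  have "K holomorphic_on ball 0 1"
    unfolding K_def by (intro holomorphic_intros holomorphic_Fint) (use nz in auto)
  from holomorphic_on_imp_continuous_on[OF this] have "isCont K 0"
    by (simp add: continuous_on_eq_continuous_at)
  from isCont_tendsto_compose[OF this mult_qpow_tendsto_0]
  have lim: "(\<lambda>n. K (b * q ^ n)) \<longlonglongrightarrow> K 0" for b .
  have K: "K b = K 0" if "0 < norm b" "norm b < 1" for b
    using lim[of b] unfolding iter[OF that] using LIMSEQ_unique tendsto_const by blast
  have "K q = 2 / P q"
    unfolding K_def Fint_constant_at_q using nz[OF q_less_1] by (simp add: power2_eq_square)
  hence "K b = 2 / P q" using K[OF b] K[of q] q_nz q_less_1 by simp
  thus ?thesis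
    unfolding K_def using nz[OF b(2)] nz(1)[OF q_less_1] by (simp add: field_simps)
qed

text \<open>The relation says that \<open>f(x) - f(Q x)\<close> is \<open>b\<close> times its value at
  \<open>Q x\<close>. Iteration gives \<open>f(x) = f(Q x)\<close>, and then \<open>f(x) = f(0)\<close>.\<close>

lemma Fint_one_variable_constant:
  assumes b: "0 < norm b" "norm b < 1" and x: "norm x < 1"
  shows "Fint b x 0 0 0 = Fint b 0 0 0 0"
proof -
  define Q where "Q = csqrt q"
  have Q: "Q^2 = q" by (simp add: Q_def)
  have nQ: "norm Q < 1"
  proof -
    have "norm Q ^ 2 < 1" using q_less_1 Q by (metis norm_power)
    thus ?thesis by (simp add: abs_square_less_1)
  qed
  define f where "f x = Fint b x 0 0 0" for x
  have hol: "f holomorphic_on ball 0 1"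
    unfolding f_def by (intro holomorphic_Fint holomorphic_intros) (use b in auto)
  hence cont: "isCont f y" if "norm y < 1" for y
    using holomorphic_on_imp_continuous_on[OF hol] that by (auto simp: continuous_on_eq_continuous_at)
  have lt: "norm (y * Q ^ n) < 1" if "norm y < 1" for y n
  proof -
    have "norm (y * Q ^ n) \<le> norm y"
      using nQ by (simp add: norm_mult norm_power mult_left_le power_le_one)
    thus ?thesis using that by simp
  qed
  have lim0: "(\<lambda>n. y * Q ^ n) \<longlonglongrightarrow> 0" for y
    using tendsto_mult[OF tendsto_const LIMSEQ_power_zero[OF nQ], of y] by simp
  have step: "f y - f (y * Q) = b * (f (y * Q) - f (y * Q * Q))" if "norm y < 1" for y
  proof -
    have "q * y = y * Q * Q" using Q by (simp add: power2_eq_square mult_ac)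
    hence "b * f (y * Q * Q) + f y = (1 + b) * f (y * Q)"
      using Fint_one_variable[OF b Q that] unfolding f_def by (simp only: mult.commute[of Q y])
    thus ?thesis by (simp add: algebra_simps)
  qed
  have iter: "f y - f (y * Q) = b ^ n * (f (y * Q ^ n) - f (y * Q ^ Suc n))" if "norm y < 1" for y n
  proof (induction n)
    case (Suc n)
    show ?case
      using Suc step[OF lt[OF that, of n]] by (simp add: mult_ac)
  qed auto
  have inv: "f y = f (y * Q)" if "norm y < 1" for y
  proof -
    have "(\<lambda>n. f (y * Q ^ n)) \<longlonglongrightarrow> f 0"
      by (rule isCont_tendsto_compose[OF cont lim0]) simp
    hence "(\<lambda>n. b ^ n * (f (y * Q ^ n) - f (y * Q ^ Suc n))) \<longlonglongrightarrow> 0 * (f 0 - f 0)"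
      by (intro tendsto_intros LIMSEQ_power_zero[OF b(2)] LIMSEQ_Suc)
    hence "(\<lambda>n. f y - f (y * Q)) \<longlonglongrightarrow> 0"
      unfolding iter[OF that, symmetric] by simp
    thus ?thesis by (simp add: LIMSEQ_const_iff)
  qed
  have "f x = f (x * Q ^ n)" for n
  proof (induction n)
    case (Suc n)
    show ?case using Suc inv[OF lt[OF x, of n]] by (simp add: mult_ac)
  qed auto
  moreover have "(\<lambda>n. f (x * Q ^ n)) \<longlonglongrightarrow> f 0"
    by (rule isCont_tendsto_compose[OF cont lim0]) simp
  ultimately have "(\<lambda>n. f x) \<longlonglongrightarrow> f 0" by simp
  thus ?thesis by (simp add: LIMSEQ_const_iff f_def)
qed

definition Fdiff :: "complex \<Rightarrow> complex \<Rightarrow> complex \<Rightarrow> complex \<Rightarrow> complex \<Rightarrow> complex" where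
  "Fdiff b x1 x2 x3 x4 = P q * Fint b x1 x2 x3 x4 - 2 * P b * Fser b x1 x2 x3 x4"

lemma Fser_denominator_nz:
  assumes "norm b < 1" "norm x1 < 1" "norm x2 < 1" "norm x3 < 1" "norm x4 < 1"
  shows "P (b * (x1 * x2 * x3 * x4)) * pairs P x1 x2 x3 x4 \<noteq> 0"
proof -
  have "P (b * (x1 * x2 * x3 * x4)) \<noteq> 0" "P (x1*x2) \<noteq> 0" "P (x1*x3) \<noteq> 0" "P (x1*x4) \<noteq> 0" "P (x2*x3) \<noteq> 0"
     "P (x2*x4) \<noteq> 0" "P (x3*x4) \<noteq> 0"
    by (intro P_nz norm_mult_lt_1 assms)+
  thus ?thesis by (simp add: pairs_def)
qed

lemma holomorphic_Fdiff:
  assumes U: "open U" and hol: "b holomorphic_on U" "x1 holomorphic_on U" "x2 holomorphic_on U" "x3 holomorphic_on U" "x4 holomorphic_on U"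
    and b: "\<And>w. w \<in> U \<Longrightarrow> 0 < norm (b w) \<and> norm (b w) < 1"
    and lt: "\<And>w. w \<in> U \<Longrightarrow> norm (x1 w) < 1" "\<And>w. w \<in> U \<Longrightarrow> norm (x2 w) < 1"
      "\<And>w. w \<in> U \<Longrightarrow> norm (x3 w) < 1" "\<And>w. w \<in> U \<Longrightarrow> norm (x4 w) < 1"
  shows "(\<lambda>w. Fdiff (b w) (x1 w) (x2 w) (x3 w) (x4 w)) holomorphic_on U"
proof -
  have pr: "(\<lambda>w. pairs P (x1 w) (x2 w) (x3 w) (x4 w)) holomorphic_on U"
    unfolding pairs_def by (intro holomorphic_intros hol)
  have b': "norm (b w) < 1" if "w \<in> U" for w
    using b[OF that] by simp
  have nz: "P (b w * (x1 w * x2 w * x3 w * x4 w)) * pairs P (x1 w) (x2 w) (x3 w) (x4 w) \<noteq> 0" if "w \<in> U" for w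
    by (intro Fser_denominator_nz b' lt that)
  show ?thesis
    unfolding Fdiff_def Fser_def
    by (intro holomorphic_intros holomorphic_Fint holomorphic_Wser hol U lt b b' pr nz)
qed

lemma continuous_Fdiff:
  fixes b x1 x2 x3 x4 :: "'a :: heine_borel \<Rightarrow> complex"
  assumes U: "open U" and hol: "continuous_on U b" "continuous_on U x1" "continuous_on U x2" "continuous_on U x3" "continuous_on U x4"
    and b: "\<And>w. w \<in> U \<Longrightarrow> 0 < norm (b w) \<and> norm (b w) < 1"
    and lt: "\<And>w. w \<in> U \<Longrightarrow> norm (x1 w) < 1" "\<And>w. w \<in> U \<Longrightarrow> norm (x2 w) < 1"
      "\<And>w. w \<in> U \<Longrightarrow> norm (x3 w) < 1" "\<And>w. w \<in> U \<Longrightarrow> norm (x4 w) < 1"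
  shows "continuous_on U (\<lambda>w. Fdiff (b w) (x1 w) (x2 w) (x3 w) (x4 w))"
proof -
  have pr: "continuous_on U (\<lambda>w. pairs P (x1 w) (x2 w) (x3 w) (x4 w))"
    unfolding pairs_def by (intro continuous_intros hol)
  have b': "norm (b w) < 1" if "w \<in> U" for w
    using b[OF that] by simp
  have nz: "P (b w * (x1 w * x2 w * x3 w * x4 w)) * pairs P (x1 w) (x2 w) (x3 w) (x4 w) \<noteq> 0" if "w \<in> U" for w
    by (intro Fser_denominator_nz b' lt that)
  show ?thesis
    unfolding Fdiff_def Fser_def
    by (intro continuous_intros continuous_Fint continuous_Wser hol U lt b b' pr nz ballI)
qed

lemma Fdiff_bounded:
  assumes b: "0 < norm b" "norm b < 1" and s: "s < 1"
  obtains B where "\<And>x1 x2 x3 x4. norm x1 \<le> s \<Longrightarrow> norm x2 \<le> s \<Longrightarrow> norm x3 \<le> s \<Longrightarrow> norm x4 \<le> s \<Longrightarrow>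
    norm (Fdiff b x1 x2 x3 x4) \<le> B"
proof -
  let ?U = "ball (0::complex) 1 \<times> ball (0::complex) 1 \<times> ball (0::complex) 1 \<times> ball (0::complex) 1"
  let ?K = "cball (0::complex) s \<times> cball (0::complex) s \<times> cball (0::complex) s \<times> cball (0::complex) s"
  let ?f = "\<lambda>p. Fdiff b (fst p) (fst (snd p)) (fst (snd (snd p))) (snd (snd (snd p)))"
  have "continuous_on ?U ?f"
    by (intro continuous_Fdiff continuous_intros open_Times) (use b in auto)
  hence "continuous_on ?K ?f"
    by (rule continuous_on_subset) (use s in auto)
  hence "compact (?f ` ?K)"
    by (intro compact_continuous_image compact_Times compact_cball)
  hence "bounded (?f ` ?K)" by (rule compact_imp_bounded)
  then obtain B where "\<forall>y \<in> ?f ` ?K. norm y \<le> B"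
    unfolding bounded_iff by blast
  hence B: "norm y \<le> B" if "y \<in> ?f ` ?K" for y using that by blast
  show ?thesis
  proof (rule that[of B])
    fix x1 x2 x3 x4 :: complex assume "norm x1 \<le> s" "norm x2 \<le> s" "norm x3 \<le> s" "norm x4 \<le> s"
    thus "norm (Fdiff b x1 x2 x3 x4) \<le> B"
      by (intro B image_eqI[of _ _ "(x1, x2, x3, x4)"]) auto
  qed
qed

end

section \<open>Integral and series for small parameters\<close>

context nome
begin

text \<open>The polynomial coefficients factor so that the four terms combine to the relation for
  \<open>phi\<close> at \<open>x1 x2\<close>.\<close>

lemma Fser_two_variables:
  assumes b: "0 < norm b" "norm b < 1" and x: "norm x1 < 1" "norm x2 < 1"
  shows "(x2 - x1) * (1 - x1 * x2) * Fser b x1 x2 0 0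
      + (b * x1 * (1 + x2^2) - x2 * (1 + b^2 * x1^2)) * Fser b (q * x1) x2 0 0
      + (x1 * (1 + b^2 * x2^2) - b * x2 * (1 + x1^2)) * Fser b x1 (q * x2) 0 0
      + b * (x2 - x1) * (1 - b^2 * x1 * x2) * Fser b (q * x1) (q * x2) 0 0 = 0"
proof -
  have qx: "norm (q * x1) < 1" "norm (q * x2) < 1"
    using norm_mult_lt_1[OF q_less_1 x(1)] norm_mult_lt_1[OF q_less_1 x(2)] by auto
  define A B C where "A = phi b (x1 * x2)" and "B = phi b (q * (x1 * x2))" and "C = phi b (q^2 * (x1 * x2))"
  have S: "Fser b x1 x2 0 0 = A" "Fser b (q * x1) x2 0 0 = B" "Fser b x1 (q * x2) 0 0 = B"
    "Fser b (q * x1) (q * x2) 0 0 = C"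
    using phi_sums_and_Fser[OF b x] phi_sums_and_Fser[OF b qx(1) x(2)] phi_sums_and_Fser[OF b x(1) qx(2)]
      phi_sums_and_Fser[OF b qx] by (simp_all add: A_def B_def C_def mult_ac power2_eq_square)
  have rel: "(1 - x1 * x2) * (A - b * B) = (1 - b^2 * (x1 * x2)) * (B - b * C)"
    using phi_relation[OF b norm_mult_lt_1[OF x]] by (simp add: A_def B_def C_def)
  have "(x2 - x1) * (1 - x1 * x2) * A + (b * x1 * (1 + x2^2) - x2 * (1 + b^2 * x1^2)) * B
      + (x1 * (1 + b^2 * x2^2) - b * x2 * (1 + x1^2)) * B + b * (x2 - x1) * (1 - b^2 * x1 * x2) * C =
      (x2 - x1) * ((1 - x1 * x2) * (A - b * B) - (1 - b^2 * (x1 * x2)) * (B - b * C))"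
    by (simp add: algebra_simps power2_eq_square)
  thus ?thesis unfolding S rel by simp
qed

lemma Fdiff_two_variables:
  assumes b: "0 < norm b" "norm b < 1" and x: "norm x1 < 1" "norm x2 < 1"
  shows "(x2 - x1) * (1 - x1 * x2) * Fdiff b x1 x2 0 0
      + (b * x1 * (1 + x2^2) - x2 * (1 + b^2 * x1^2)) * Fdiff b (q * x1) x2 0 0
      + (x1 * (1 + b^2 * x2^2) - b * x2 * (1 + x1^2)) * Fdiff b x1 (q * x2) 0 0
      + b * (x2 - x1) * (1 - b^2 * x1 * x2) * Fdiff b (q * x1) (q * x2) 0 0 = 0"
proof -
  have gen: "c0 * (p * f0 - r * s0) + c1 * (p * f1 - r * s1) + c2 * (p * f2 - r * s2) + c3 * (p * f3 - r * s3) =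
     p * (c0 * f0 + c1 * f1 + c2 * f2 + c3 * f3) - r * (c0 * s0 + c1 * s1 + c2 * s2 + c3 * s3)"
    for c0 c1 c2 c3 p r f0 f1 f2 f3 s0 s1 s2 s3 :: complex
    by (simp add: algebra_simps)
  show ?thesis
    unfolding Fdiff_def gen Fint_two_variables[OF b(2) x] Fser_two_variables[OF b x] by simp
qed

lemma Fdiff_q_difference:
  assumes b: "0 < norm b" "norm b < 1" and Q: "Q ^ 2 = q"
    and x: "norm x1 < 1" "norm x2 < 1" "norm x3 < 1" "norm x4 < 1" "x1 \<noteq> 0" "x2 \<noteq> 0" "x3 \<noteq> 0" "x4 \<noteq> 0"
    and ne: "x1 \<noteq> x2" "x1 \<noteq> x3" "x1 \<noteq> x4" "x2 \<noteq> x3" "x2 \<noteq> x4" "x3 \<noteq> x4"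
  shows "shift_coeff b x1 x2 x3 x4 * Fdiff b (q * x1) x2 x3 x4 + shift_coeff b x2 x1 x3 x4 * Fdiff b x1 (q * x2) x3 x4 +
         shift_coeff b x3 x1 x2 x4 * Fdiff b x1 x2 (q * x3) x4 + shift_coeff b x4 x1 x2 x3 * Fdiff b x1 x2 x3 (q * x4) =
         (1 + b) * (Fdiff b x1 x2 x3 x4 + b ^ 2 * Fdiff b (Q * x1) (Q * x2) (Q * x3) (Q * x4))"
proof -
  have gen: "c0 * (p * f0 - r * s0) + c1 * (p * f1 - r * s1) + c2 * (p * f2 - r * s2) + c3 * (p * f3 - r * s3) =
     p * (c0 * f0 + c1 * f1 + c2 * f2 + c3 * f3) - r * (c0 * s0 + c1 * s1 + c2 * s2 + c3 * s3)"
    for c0 c1 c2 c3 p r f0 f1 f2 f3 s0 s1 s2 s3 :: complex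
    by (simp add: algebra_simps)
  show ?thesis
    unfolding Fdiff_def gen Fint_q_difference[OF assms] Fser_q_difference[OF assms] by (simp add: algebra_simps)
qed

definition shift_coeff3 :: "complex \<Rightarrow> complex \<Rightarrow> complex \<Rightarrow> complex \<Rightarrow> complex" where
  "shift_coeff3 b x y z = (b * x - y) / (x - y) * ((b * x - z) / (x - z))"

lemma sep_hol_Fdiff: "0 < norm b \<Longrightarrow> norm b < 1 \<Longrightarrow> sep_hol (Fdiff b)"
  unfolding sep_hol_def
  by (intro allI impI conjI holomorphic_Fdiff holomorphic_intros) auto

text \<open>The limit \<open>x4 \<rightarrow> 0\<close> of the q-difference equation; the three coefficients
  acquire a factor \<open>b\<close>, and the shift of \<open>x4\<close> has coefficient
  \<open>1\<close>.\<close>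

lemma Fdiff_q_difference_three_variables:
  assumes b: "0 < norm b" "norm b < 1" and Q: "Q ^ 2 = q"
    and x: "norm x1 < 1" "norm x2 < 1" "norm x3 < 1" "x1 \<noteq> 0" "x2 \<noteq> 0" "x3 \<noteq> 0"
    and ne: "x1 \<noteq> x2" "x1 \<noteq> x3" "x2 \<noteq> x3"
  shows "shift_coeff3 b x1 x2 x3 * Fdiff b (q * x1) x2 x3 0 + shift_coeff3 b x2 x1 x3 * Fdiff b x1 (q * x2) x3 0 +
         shift_coeff3 b x3 x1 x2 * Fdiff b x1 x2 (q * x3) 0 =
         Fdiff b x1 x2 x3 0 + (1 + b) * b * Fdiff b (Q * x1) (Q * x2) (Q * x3) 0"
proof -
  have nQ: "norm Q < 1"
  proof -
    have "norm Q ^ 2 < 1" using q_less_1 Q by (metis norm_power)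
    thus ?thesis by (simp add: abs_square_less_1)
  qed
  have qx: "norm (q * x) < 1" "norm (Q * x) < 1" if "norm x < 1" for x
    using norm_mult_lt_1[OF q_less_1 that] norm_mult_lt_1[OF nQ that] by auto
  have cont: "isCont (\<lambda>y. Fdiff b y1 y2 y3 (c * y)) 0"
    if "norm y1 < 1" "norm y2 < 1" "norm y3 < 1" "norm c \<le> 1" for y1 y2 y3 c
  proof -
    have "norm (c * y) < 1" if "norm y < 1" for y
      using mult_left_le_one_le[of "norm y" "norm c"] that \<open>norm c \<le> 1\<close> by (simp add: norm_mult)
    hence "(\<lambda>y. Fdiff b y1 y2 y3 (c * y)) holomorphic_on ball 0 1"
      using that b by (intro holomorphic_Fdiff holomorphic_intros) auto
    from holomorphic_on_imp_continuous_on[OF this] show ?thesis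
      by (simp add: continuous_on_eq_continuous_at)
  qed
  define \<phi> where "\<phi> y = shift_coeff b x1 x2 x3 y * Fdiff b (q * x1) x2 x3 (1 * y) + shift_coeff b x2 x1 x3 y * Fdiff b x1 (q * x2) x3 (1 * y) +
         shift_coeff b x3 x1 x2 y * Fdiff b x1 x2 (q * x3) (1 * y) + shift_coeff b y x1 x2 x3 * Fdiff b x1 x2 x3 (q * y)
         - (1 + b) * (Fdiff b x1 x2 x3 (1 * y) + b ^ 2 * Fdiff b (Q * x1) (Q * x2) (Q * x3) (Q * y))" for y
  have "isCont \<phi> 0"
    unfolding \<phi>_def shift_coeff_def using x
    by (intro continuous_intros cont qx) (use x qx nQ q_less_1 in auto)
  hence "\<phi> \<midarrow>0\<rightarrow> \<phi> 0" by (simp add: isCont_def)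
  moreover have "eventually (\<lambda>y. \<phi> y = 0) (at 0)"
  proof -
    define d where "d = min (norm x1) (min (norm x2) (norm x3))"
    have d: "d > 0" "d \<le> norm x1" "d \<le> norm x2" "d \<le> norm x3" using x by (auto simp: d_def)
    have "eventually (\<lambda>y. y \<noteq> 0 \<and> norm y < d) (at (0::complex))"
      unfolding eventually_at using d(1) by (intro exI[of _ d]) (auto simp: dist_norm)
    thus ?thesis
    proof eventually_elim
      case (elim y)
      have "x1 \<noteq> y" "x2 \<noteq> y" "x3 \<noteq> y" "norm y < 1" using elim d x by auto
      thus ?case
        using Fdiff_q_difference[OF b Q x(1-3) \<open>norm y < 1\<close> x(4-6) _ ne(1,2) _ ne(3)] elim
        by (simp add: \<phi>_def)
    qed
  qed
  hence "\<phi> \<midarrow>0\<rightarrow> 0"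
    by (rule tendsto_eventually)
  ultimately have \<phi>0: "\<phi> 0 = 0"
    using LIM_unique by blast
  have A: "shift_coeff b x1 x2 x3 0 = b * shift_coeff3 b x1 x2 x3" "shift_coeff b x2 x1 x3 0 = b * shift_coeff3 b x2 x1 x3" "shift_coeff b x3 x1 x2 0 = b * shift_coeff3 b x3 x1 x2"
     "shift_coeff b 0 x1 x2 x3 = 1"
    using x by (simp_all add: shift_coeff_def shift_coeff3_def)
  have "b * (shift_coeff3 b x1 x2 x3 * Fdiff b (q * x1) x2 x3 0 + shift_coeff3 b x2 x1 x3 * Fdiff b x1 (q * x2) x3 0 +
         shift_coeff3 b x3 x1 x2 * Fdiff b x1 x2 (q * x3) 0) =
        b * (Fdiff b x1 x2 x3 0 + (1 + b) * b * Fdiff b (Q * x1) (Q * x2) (Q * x3) 0)"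
    using \<phi>0 unfolding \<phi>_def A by (simp add: algebra_simps power2_eq_square)
  thus ?thesis using b by simp
qed

lemma Fdiff_one_variable: "0 < norm b \<Longrightarrow> norm b < 1 \<Longrightarrow> norm x < 1 \<Longrightarrow> Fdiff b x 0 0 0 = 0"
proof -
  assume b: "0 < norm b" "norm b < 1" and x: "norm x < 1"
  have "Fser b x 0 0 0 = P (q * b) / P (b^2)"
    using phi_sums_and_Fser[OF b x, of 0] phi_at_0[OF b] by simp
  moreover have "P (b^2) \<noteq> 0"
    using norm_mult_lt_1[OF b(2,2)] by (intro P_nz) (simp add: power2_eq_square)
  ultimately show ?thesis
  proof -
    assume S: "Fser b x 0 0 0 = P (q * b) / P (b^2)" and nz: "P (b^2) \<noteq> 0"
    have "Fser b x 0 0 0 * P (b^2) = P (q * b)" using S nz by simp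
    moreover have "Fdiff b x 0 0 0 * P (b^2) = P q * Fint b 0 0 0 0 * P (b^2) - 2 * P b * (Fser b x 0 0 0 * P (b^2))"
      unfolding Fdiff_def Fint_one_variable_constant[OF b x] by (simp add: algebra_simps)
    ultimately have "Fdiff b x 0 0 0 * P (b^2) = 0"
      unfolding Fint_constant[OF b] by simp
    thus ?thesis using nz by simp
  qed
qed

text \<open>Both expressions tend to \<open>|q|\<close> as \<open>s \<rightarrow> 0\<close>.\<close>

lemma contraction_radius:
  obtains s :: real where "0 < s" "s < 1 / 3"
    "(((1 + s) / (1 - s)) ^ 3 * (norm q + 6 * s / (1 - s)) + 2 * s) / (1 - s) < 1"
    "((1 + 3 * s) * norm q + 8 * s) / ((1 - s) * (1 - s^2)) < 1"
proof -
  have 1: "((\<lambda>s::real. (((1 + s) / (1 - s)) ^ 3 * (norm q + 6 * s / (1 - s)) + 2 * s) / (1 - s)) \<longlongrightarrow>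
        (((1 + 0) / (1 - 0)) ^ 3 * (norm q + 6 * 0 / (1 - 0)) + 2 * 0) / (1 - 0)) (at_right 0)"
    by (intro tendsto_intros) auto
  have 2: "((\<lambda>s::real. ((1 + 3 * s) * norm q + 8 * s) / ((1 - s) * (1 - s^2))) \<longlongrightarrow>
        ((1 + 3 * 0) * norm q + 8 * 0) / ((1 - 0) * (1 - 0^2))) (at_right 0)"
    by (intro tendsto_intros) auto
  have "eventually (\<lambda>s. (((1 + s) / (1 - s)) ^ 3 * (norm q + 6 * s / (1 - s)) + 2 * s) / (1 - s) < 1) (at_right 0)"
    by (rule order_tendstoD(2)[OF 1]) (use q_less_1 in simp)
  moreover have "eventually (\<lambda>s. ((1 + 3 * s) * norm q + 8 * s) / ((1 - s) * (1 - s^2)) < 1) (at_right 0)"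
    by (rule order_tendstoD(2)[OF 2]) (use q_less_1 in simp)
  moreover have "eventually (\<lambda>s::real. s \<in> {0<..<1/3}) (at_right 0)"
    by (rule eventually_at_right_real) simp
  ultimately have "eventually (\<lambda>s. s \<in> {0<..<1/3} \<and>
      (((1 + s) / (1 - s)) ^ 3 * (norm q + 6 * s / (1 - s)) + 2 * s) / (1 - s) < 1 \<and>
      ((1 + 3 * s) * norm q + 8 * s) / ((1 - s) * (1 - s^2)) < 1) (at_right 0)"
    by eventually_elim auto
  from eventually_happens[OF this] show ?thesis
    using that by (auto simp: trivial_limit_at_right_real)
qed

text \<open>The contraction argument, for two, three and four variables. The radii \<open>s\<^sup>i\<close>
  make consecutive variables differ by the factor \<open>s\<close>, so that with three and four variables
  \<open>ratio_small_first\<close> or \<open>ratio_small_second\<close> applies to every factor of the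
  coefficients.\<close>

lemma Fdiff_zero_small:
  assumes s: "0 < s" "s < 1 / 3"
    and \<theta>1: "(((1 + s) / (1 - s)) ^ 3 * (norm q + 6 * s / (1 - s)) + 2 * s) / (1 - s) < 1"
    and \<theta>2: "((1 + 3 * s) * norm q + 8 * s) / ((1 - s) * (1 - s^2)) < 1"
    and b: "0 < norm b" "norm b \<le> s"
    and x: "norm x1 \<le> s" "norm x2 \<le> s^2" "norm x3 \<le> s^3" "norm x4 \<le> s^4"
  shows "Fdiff b x1 x2 x3 x4 = 0"
proof -
  define Q where "Q = csqrt q"
  have Q: "Q^2 = q" by (simp add: Q_def)
  have nQ: "norm Q \<le> 1"
  proof -
    have "norm Q ^ 2 < 1" using q_less_1 Q by (metis norm_power)
    thus ?thesis by (simp add: abs_square_less_1)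
  qed
  have b1: "norm b < 1" using b s by simp
  have n0: "norm (0::complex) \<le> s" using s by simp
  have s1: "s < 1" using s by simp
  have sp: "0 < s^2" "0 < s^3" "0 < s^4" "s^2 \<le> s" "s^3 \<le> s" "s^4 \<le> s" "s^2 < 1" "s^3 < 1" "s^4 < 1"
    using s power_decreasing[of 1 2 s] power_decreasing[of 1 3 s] power_decreasing[of 1 4 s]
      power_less_one_iff[of s 2] power_less_one_iff[of s 3] power_less_one_iff[of s 4] by auto
  note rad = s(1) s1 sp(1) sp(7) sp(2) sp(8) sp(3) sp(9)
  \<comment> \<open>\<open>K\<close> bounds a factor whose shifted variable is the smaller one, \<open>e\<close> one whose shifted variable is the larger one.\<close>
  define K where "K = (1 + s) / (1 - s)"
  define e where "e = 2 * s / (1 - s)"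
  have K: "1 \<le> K" and e: "0 \<le> e" "e \<le> 1" using s by (auto simp: K_def e_def divide_simps)
  have Ke: "K ^ 3 * norm q + 3 * (K ^ 3 * e) = ((1 + s) / (1 - s)) ^ 3 * (norm q + 6 * s / (1 - s))"
    by (simp add: K_def e_def algebra_simps)
  obtain B where B: "\<And>x1 x2 x3 x4. norm x1 \<le> s \<Longrightarrow> norm x2 \<le> s \<Longrightarrow> norm x3 \<le> s \<Longrightarrow> norm x4 \<le> s \<Longrightarrow>
    norm (Fdiff b x1 x2 x3 x4) \<le> B"
    using Fdiff_bounded[OF b(1) b1 s1] by blast
  note sh = sep_hol_Fdiff[OF b(1) b1]
  note hol = sh[unfolded sep_hol_def, rule_format]
  have shr: "norm (c * y) \<le> r" if "norm y \<le> r" "norm c \<le> 1" for c y :: complex and r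
    using norm_mult_le2[OF that(2,1)] by simp
  have q1: "norm q \<le> 1" using q_less_1 by simp
  \<comment> \<open>With two variables, \<open>Fdiff_two_variables\<close> takes the place of the q-difference equation: the coefficients of the unshifted
    term and of the shift of the smaller variable are of modulus about \<open>|x1|\<close>, the others are small, and \<open>Fdiff_one_variable\<close> supplies the zero for the Schwarz lemma.\<close>
  have D2: "Fdiff b x1 x2 0 0 = 0" if "norm x1 \<le> s" "norm x2 \<le> s^2" for x1 x2
  proof -
    let ?f = "\<lambda>x1 x2 (x3::complex) (x4::complex). Fdiff b x1 x2 0 0"
    have "?f x1 x2 0 0 = 0"
    proof (rule contraction_imp_zero[of ?f s "s^2" s s, OF _ s(1) s1 sp(1) sp(7) s(1) s1 s(1) s1])
      show "sep_hol ?f" unfolding sep_hol_def using hol[of _ 0 0] by auto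
      show "norm (Fdiff b x1 x2 0 0) \<le> B" if "norm x1 \<le> s" "norm x2 \<le> s^2" for x1 x2
        using that sp(4-6) by (intro B n0) linarith+
      show "0 \<le> ((1 + 3 * s) * norm q + 8 * s) / ((1 - s) * (1 - s^2))"
        using s(1) s1 sp(7) by (intro divide_nonneg_nonneg add_nonneg_nonneg mult_nonneg_nonneg) auto
      fix M and x1 x2 x3 x4 :: complex
      assume M: "\<And>x1 x2 x3 x4. norm x1 \<le> s \<Longrightarrow> norm x2 \<le> s^2 \<Longrightarrow> norm (x3::complex) \<le> s \<Longrightarrow> norm (x4::complex) \<le> s \<Longrightarrow>
            norm (Fdiff b x1 x2 0 0) \<le> M"
        and x12: "norm x1 = s" "norm x2 = s^2"
      have M': "norm (Fdiff b y1 y2 0 0) \<le> M" if "norm y1 \<le> s" "norm y2 \<le> s^2" for y1 y2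
        using M[of y1 y2 0 0] that s by simp
      have lt: "norm x1 < 1" "norm x2 < 1" using x12 s1 sp by auto
      have x1n: "x1 \<noteq> 0" using x12 s by auto
      have x2s: "norm x2 = s * norm x1" using x12 by (simp add: power2_eq_square)
      define c1 c2 c3 where "c1 = b * x1 * (1 + x2^2) - x2 * (1 + b^2 * x1^2)"
        and "c2 = x1 * (1 + b^2 * x2^2) - b * x2 * (1 + x1^2)" and "c3 = b * (x2 - x1) * (1 - b^2 * x1 * x2)"
      have sq: "norm (1 + y) \<le> 2" "norm (1 - y) \<le> 2" if "norm y \<le> 1" for y :: complex
        using norm_triangle_ineq[of 1 y] norm_triangle_ineq4[of 1 y] that by auto
      have le1: "norm (x2^2) \<le> s" "norm (b^2 * x1^2) \<le> s" "norm (b^2 * x2^2) \<le> s" "norm (x1^2) \<le> s" "norm (b^2 * x1 * x2) \<le> s"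
      proof -
        have bs: "norm (b^2) \<le> 1" "norm (b^2) \<le> s" using b b1 sp power_mono[OF b(2), of 2] by (auto simp: norm_power power_le_one)
        have xs: "norm (x1^2) \<le> s" "norm (x2^2) \<le> s" "norm (x1^2) \<le> 1" "norm (x2^2) \<le> 1"
          using x12 sp s s1 power_mono[of "s^2" s 2] by (auto simp: norm_power power_le_one)
        show "norm (x2^2) \<le> s" "norm (x1^2) \<le> s" by fact+
        show "norm (b^2 * x1^2) \<le> s" "norm (b^2 * x2^2) \<le> s"
          using norm_mult_le2[OF bs(2) xs(3)] norm_mult_le2[OF bs(2) xs(4)] by auto
        show "norm (b^2 * x1 * x2) \<le> s"
          using norm_mult_le2[OF norm_mult_le2[OF bs(2), of x1 1], of x2 1] lt by simp
      qed
      have c0: "norm ((x2 - x1) * (1 - x1 * x2)) \<ge> norm x1 * ((1 - s) * (1 - s^2))"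
      proof -
        have "norm (x2 - x1) \<ge> norm x1 * (1 - s)"
          using norm_triangle_ineq2[of x1 x2] x2s by (simp add: norm_minus_commute algebra_simps)
        moreover have "norm (x1 * x2) \<le> s^2"
          using norm_mult_le2[of x1 1 x2 "s^2"] lt x12 by simp
        hence "norm (1 - x1 * x2) \<ge> 1 - s^2"
          using norm_triangle_ineq2[of 1 "x1 * x2"] by simp
        ultimately have "norm x1 * (1 - s) * (1 - s^2) \<le> norm (x2 - x1) * norm (1 - x1 * x2)"
          using s1 sp by (intro mult_mono) auto
        thus ?thesis by (simp add: norm_mult mult.assoc)
      qed
      have n1: "norm c1 \<le> norm x1 * (4 * s)"
      proof -
        have "norm (b * x1 * (1 + x2^2)) \<le> s * norm x1 * 2"
          using le1 s1 by (intro norm_mult_le2 b sq order.refl) auto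
        moreover have "norm (x2 * (1 + b^2 * x1^2)) \<le> s * norm x1 * 2"
          using le1 s1 x2s by (intro norm_mult_le2 sq) auto
        ultimately have "norm c1 \<le> s * norm x1 * 2 + s * norm x1 * 2"
          unfolding c1_def by (intro order.trans[OF norm_triangle_ineq4 add_mono])
        thus ?thesis by (simp add: mult_ac)
      qed
      have n2: "norm c2 \<le> norm x1 * (1 + 3 * s)"
      proof -
        have "norm (1 + b^2 * x2^2) \<le> 1 + s"
          using norm_triangle_ineq[of 1 "b^2 * x2^2"] le1 by simp
        hence "norm (x1 * (1 + b^2 * x2^2)) \<le> norm x1 * (1 + s)"
          by (intro norm_mult_le2) auto
        moreover have "norm (b * x2 * (1 + x1^2)) \<le> 1 * (s * norm x1) * 2"
          using le1 s1 x2s b1 by (intro norm_mult_le2 sq) auto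
        ultimately have "norm c2 \<le> norm x1 * (1 + s) + 1 * (s * norm x1) * 2"
          unfolding c2_def by (intro order.trans[OF norm_triangle_ineq4 add_mono])
        also have "\<dots> = norm x1 * (1 + 3 * s)" by (simp add: algebra_simps)
        finally show ?thesis .
      qed
      have n3: "norm c3 \<le> norm x1 * (4 * s)"
      proof -
        have "norm (x2 - x1) \<le> 2 * norm x1"
          using norm_triangle_ineq4[of x2 x1] x2s s1 mult_left_le_one_le[of "norm x1" s] s by simp
        hence "norm c3 \<le> s * (2 * norm x1) * 2"
          unfolding c3_def using le1 s1 by (intro norm_mult_le2 b sq) auto
        thus ?thesis by (simp add: mult_ac)
      qed
      have Sch: "norm (Fdiff b x1 (q * x2) 0 0) \<le> norm q * M"
        by (rule Schwarz_disc[of "\<lambda>y. Fdiff b x1 y 0 0" "s^2"])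
           (use hol[of x1 0 0] lt x12 sp M' q_less_1 Fdiff_one_variable[OF b(1) b1 lt(1)] in auto)
      have "(x2 - x1) * (1 - x1 * x2) * Fdiff b x1 x2 0 0 =
          - (c1 * Fdiff b (q * x1) x2 0 0 + c2 * Fdiff b x1 (q * x2) 0 0 + c3 * Fdiff b (q * x1) (q * x2) 0 0)"
        using Fdiff_two_variables[OF b(1) b1 lt] unfolding c1_def c2_def c3_def by (simp add: add_eq_0_iff add.assoc)
      hence "norm ((x2 - x1) * (1 - x1 * x2)) * norm (Fdiff b x1 x2 0 0) =
          norm (c1 * Fdiff b (q * x1) x2 0 0 + c2 * Fdiff b x1 (q * x2) 0 0 + c3 * Fdiff b (q * x1) (q * x2) 0 0)"
        by (metis norm_minus_cancel norm_mult)
      also have "\<dots> \<le> norm x1 * (4 * s) * M + norm x1 * (1 + 3 * s) * (norm q * M) + norm x1 * (4 * s) * M"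
        by (intro norm_triangle_le add_mono norm_mult_le2 n1 n2 n3 Sch M' shr q1)
           (use x12 in auto)
      finally have "norm ((x2 - x1) * (1 - x1 * x2)) * norm (Fdiff b x1 x2 0 0) \<le>
           norm x1 * (((1 + 3 * s) * norm q + 8 * s) * M)" by (simp add: algebra_simps)
      moreover have "norm x1 * ((1 - s) * (1 - s^2)) * norm (Fdiff b x1 x2 0 0) \<le>
          norm ((x2 - x1) * (1 - x1 * x2)) * norm (Fdiff b x1 x2 0 0)"
        by (intro mult_right_mono c0) auto
      ultimately have "norm x1 * (((1 - s) * (1 - s^2)) * norm (Fdiff b x1 x2 0 0)) \<le>
           norm x1 * (((1 + 3 * s) * norm q + 8 * s) * M)" by (simp add: mult.assoc)
      hence "((1 - s) * (1 - s^2)) * norm (Fdiff b x1 x2 0 0) \<le> ((1 + 3 * s) * norm q + 8 * s) * M"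
        using x1n by simp
      moreover have "0 < (1 - s) * (1 - s^2)" using s1 sp by simp
      ultimately show "norm (Fdiff b x1 x2 0 0) \<le> ((1 + 3 * s) * norm q + 8 * s) / ((1 - s) * (1 - s^2)) * M"
        by (simp add: pos_le_divide_eq mult_ac)
    qed (use that \<theta>2 s in auto)
    thus ?thesis .
  qed
  have sx: "norm (y::complex) \<le> s * norm x" if "norm y = s ^ Suc j" "norm x = s ^ i" "i \<le> j" for x y i j
  proof -
    have "s ^ j \<le> s ^ i" using that s1 s by (intro power_decreasing) auto
    thus ?thesis using that s by simp
  qed
  let ?\<theta> = "(((1 + s) / (1 - s)) ^ 3 * (norm q + 6 * s / (1 - s)) + 2 * s) / (1 - s)"
  have \<theta>0: "0 \<le> ?\<theta>" using s by (intro divide_nonneg_nonneg add_nonneg_nonneg mult_nonneg_nonneg) auto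
  have r1: "norm ((b * x - y) / (x - y)) \<le> K" if "norm x \<le> s * norm y" "y \<noteq> 0" for x y
    unfolding K_def using that b1 s s1 by (intro ratio_small_first) auto
  have r2: "norm ((b * x - y) / (x - y)) \<le> e" if "norm y \<le> s * norm x" "x \<noteq> 0" for x y
    unfolding e_def using that b s s1 by (intro ratio_small_second) auto
  have KK: "0 \<le> K" using K by simp
  have mono: "u \<le> v" if "u \<le> K * K * e" "v = K^3 * e" for u v
  proof -
    have "K * K * e \<le> K * (K * K) * e" using K e by (intro mult_right_mono) auto
    thus ?thesis using that by (simp add: power3_eq_cube mult_ac)
  qed
  have D3: "Fdiff b x1 x2 x3 0 = 0" if "norm x1 \<le> s" "norm x2 \<le> s^2" "norm x3 \<le> s^3" for x1 x2 x3
  proof -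
    let ?f = "\<lambda>x1 x2 x3 (x4::complex). Fdiff b x1 x2 x3 0"
    have "?f x1 x2 x3 0 = 0"
    proof (rule contraction_imp_zero[of ?f s "s^2" "s^3" s, OF _ s(1) s1 sp(1) sp(7) sp(2) sp(8) s(1) s1])
      show "sep_hol ?f" unfolding sep_hol_def using hol[of _ _ 0] by auto
      show "norm (Fdiff b x1 x2 x3 0) \<le> B" if "norm x1 \<le> s" "norm x2 \<le> s^2" "norm x3 \<le> s^3" for x1 x2 x3
        using that sp(4-6) by (intro B n0) linarith+
      show "0 \<le> ?\<theta>" by fact
      fix M and x1 x2 x3 x4 :: complex
      assume M: "\<And>x1 x2 x3 x4. norm x1 \<le> s \<Longrightarrow> norm x2 \<le> s^2 \<Longrightarrow> norm x3 \<le> s^3 \<Longrightarrow> norm (x4::complex) \<le> s \<Longrightarrow>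
            norm (Fdiff b x1 x2 x3 0) \<le> M"
        and n: "norm x1 = s" "norm x2 = s^2" "norm x3 = s^3"
      have M': "norm (Fdiff b y1 y2 y3 0) \<le> M" if "norm y1 \<le> s" "norm y2 \<le> s^2" "norm y3 \<le> s^3" for y1 y2 y3
        using M[of y1 y2 y3 0] that s by simp
      have M0: "0 \<le> M"
        by (rule order.trans[OF norm_ge_zero M'[of 0 0 0]]) (use n0 sp(1,2) in simp_all)
      have lt: "norm x1 < 1" "norm x2 < 1" "norm x3 < 1" using n s1 sp by auto
      have nz: "x1 \<noteq> 0" "x2 \<noteq> 0" "x3 \<noteq> 0" using n s by auto
      have sx': "norm x2 \<le> s * norm x1" "norm x3 \<le> s * norm x1" "norm x3 \<le> s * norm x2"
        using sx[of x2 1 x1 1] sx[of x3 2 x1 1] sx[of x3 2 x2 2] n by (auto simp: eval_nat_numeral)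
      have ne: "x1 \<noteq> x2" "x1 \<noteq> x3" "x2 \<noteq> x3"
        using sx' nz s1 by auto
      have a1: "norm (shift_coeff3 b x1 x2 x3) \<le> K^3 * e"
      proof (rule mono)
        have "norm (shift_coeff3 b x1 x2 x3) \<le> e * e" unfolding shift_coeff3_def by (intro norm_mult_le2 r2 sx' nz)
        also have "e * e \<le> K * K * e" using K e by (intro mult_right_mono order.trans[OF e(2)]) (auto intro: order.trans[OF _ mult_mono[of 1 K 1 K]])
        finally show "norm (shift_coeff3 b x1 x2 x3) \<le> K * K * e" .
      qed auto
      have a2: "norm (shift_coeff3 b x2 x1 x3) \<le> K^3 * e"
      proof (rule mono)
        have "norm (shift_coeff3 b x2 x1 x3) \<le> K * e" unfolding shift_coeff3_def by (intro norm_mult_le2 r1 r2 sx' nz)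
        also have "K * e \<le> K * K * e" using K e by (intro mult_right_mono) auto
        finally show "norm (shift_coeff3 b x2 x1 x3) \<le> K * K * e" .
      qed auto
      have a3: "norm (shift_coeff3 b x3 x1 x2) \<le> K^3"
      proof -
        have "norm (shift_coeff3 b x3 x1 x2) \<le> K * K" unfolding shift_coeff3_def by (intro norm_mult_le2 r1 sx' nz)
        also have "K * K \<le> K * (K * K)" using K by simp
        finally show ?thesis by (simp add: power3_eq_cube mult_ac)
      qed
      have Sch: "norm (Fdiff b x1 x2 (q * x3) 0) \<le> norm q * M"
        by (rule Schwarz_disc[of "\<lambda>y. Fdiff b x1 x2 y 0" "s^3"])
           (use hol[of x1 x2 0] lt n sp M' q_less_1 D2[of x1 x2] in auto)
      have "Fdiff b x1 x2 x3 0 = shift_coeff3 b x1 x2 x3 * Fdiff b (q * x1) x2 x3 0 + shift_coeff3 b x2 x1 x3 * Fdiff b x1 (q * x2) x3 0 +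
         shift_coeff3 b x3 x1 x2 * Fdiff b x1 x2 (q * x3) 0 + (- ((1 + b) * b)) * Fdiff b (Q * x1) (Q * x2) (Q * x3) 0"
        using Fdiff_q_difference_three_variables[OF b(1) b1 Q lt nz ne] by (simp add: algebra_simps)
      also have "norm \<dots> \<le> K^3 * e * M + K^3 * e * M + K^3 * (norm q * M) + 2 * s * M"
      proof (intro norm_triangle_le add_mono norm_mult_le2 a1 a2 a3 Sch M' shr q1 nQ)
        have "norm (1 + b) \<le> 2" using norm_triangle_ineq[of 1 b] b1 by simp
        from norm_mult_le2[OF this b(2)] show "norm (- ((1 + b) * b)) \<le> 2 * s" by simp
      qed (use n in auto)
      also have "\<dots> \<le> (K ^ 3 * norm q + 3 * (K ^ 3 * e) + 2 * s) * M"
        using mult_nonneg_nonneg[OF mult_nonneg_nonneg[OF zero_le_power[OF KK, of 3] e(1)] M0] by (simp add: algebra_simps)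
      also have "\<dots> \<le> ?\<theta> * M"
      proof (rule mult_right_mono[OF _ M0])
        have "0 \<le> K ^ 3 * norm q + 3 * (K ^ 3 * e) + 2 * s" using KK e s by auto
        hence "(K ^ 3 * norm q + 3 * (K ^ 3 * e) + 2 * s) * (1 - s) \<le> K ^ 3 * norm q + 3 * (K ^ 3 * e) + 2 * s"
          using s by (intro mult_left_le) auto
        thus "K ^ 3 * norm q + 3 * (K ^ 3 * e) + 2 * s \<le> ?\<theta>"
          unfolding Ke[symmetric] using s1 by (simp add: pos_le_divide_eq)
      qed
      finally show "norm (Fdiff b x1 x2 x3 0) \<le> ?\<theta> * M" .
    qed (use that \<theta>1 s in auto)
    thus ?thesis .
  qed
  show ?thesis
  proof (rule contraction_imp_zero[OF sh rad, of B ?\<theta>])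
    show "norm (Fdiff b x1 x2 x3 x4) \<le> B" if "norm x1 \<le> s" "norm x2 \<le> s^2" "norm x3 \<le> s^3" "norm x4 \<le> s^4" for x1 x2 x3 x4
      using that sp(4-6) by (intro B n0) linarith+
    show "0 \<le> ?\<theta>" by fact
    show "?\<theta> < 1" by fact
    fix M and x1 x2 x3 x4 :: complex
    assume M: "\<And>x1 x2 x3 x4. norm x1 \<le> s \<Longrightarrow> norm x2 \<le> s^2 \<Longrightarrow> norm x3 \<le> s^3 \<Longrightarrow> norm x4 \<le> s^4 \<Longrightarrow>
          norm (Fdiff b x1 x2 x3 x4) \<le> M"
      and n: "norm x1 = s" "norm x2 = s^2" "norm x3 = s^3" "norm x4 = s^4"
    have M0: "0 \<le> M"
      by (rule order.trans[OF norm_ge_zero M[of 0 0 0 0]]) (use n0 sp(1-3) in simp_all)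
    have lt: "norm x1 < 1" "norm x2 < 1" "norm x3 < 1" "norm x4 < 1" using n s1 sp by auto
    have nz: "x1 \<noteq> 0" "x2 \<noteq> 0" "x3 \<noteq> 0" "x4 \<noteq> 0" using n s by auto
    have sx': "norm x2 \<le> s * norm x1" "norm x3 \<le> s * norm x1" "norm x3 \<le> s * norm x2"
       "norm x4 \<le> s * norm x1" "norm x4 \<le> s * norm x2" "norm x4 \<le> s * norm x3"
      using sx[of x2 1 x1 1] sx[of x3 2 x1 1] sx[of x3 2 x2 2] sx[of x4 3 x1 1] sx[of x4 3 x2 2] sx[of x4 3 x3 3] n
      by (auto simp: eval_nat_numeral)
    have ne: "x1 \<noteq> x2" "x1 \<noteq> x3" "x1 \<noteq> x4" "x2 \<noteq> x3" "x2 \<noteq> x4" "x3 \<noteq> x4"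
      using sx' nz s1 by auto
    have eK: "e * e \<le> K * K" "e * e * e \<le> K * K * e" "K * e * e \<le> K * K * e"
    proof -
      have "e \<le> K" using K e by simp
      thus "e * e \<le> K * K" using e KK by (intro mult_mono) auto
      thus "e * e * e \<le> K * K * e" using e by (intro mult_right_mono)
      show "K * e * e \<le> K * K * e" using \<open>e \<le> K\<close> e KK by (intro mult_right_mono mult_left_mono) auto
    qed
    have a1: "norm (shift_coeff b x1 x2 x3 x4) \<le> K^3 * e"
    proof (rule mono)
      have "norm (shift_coeff b x1 x2 x3 x4) \<le> e * e * e" unfolding shift_coeff_def by (intro norm_mult_le2 r2 sx' nz)
      thus "norm (shift_coeff b x1 x2 x3 x4) \<le> K * K * e" using eK by simp
    qed auto
    have a2: "norm (shift_coeff b x2 x1 x3 x4) \<le> K^3 * e"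
    proof (rule mono)
      have "norm (shift_coeff b x2 x1 x3 x4) \<le> K * e * e" unfolding shift_coeff_def by (intro norm_mult_le2 r1 r2 sx' nz)
      thus "norm (shift_coeff b x2 x1 x3 x4) \<le> K * K * e" using eK by simp
    qed auto
    have a3: "norm (shift_coeff b x3 x1 x2 x4) \<le> K^3 * e"
    proof (rule mono)
      show "norm (shift_coeff b x3 x1 x2 x4) \<le> K * K * e" unfolding shift_coeff_def by (intro norm_mult_le2 r1 r2 sx' nz)
    qed auto
    have a4: "norm (shift_coeff b x4 x1 x2 x3) \<le> K^3"
    proof -
      have "norm (shift_coeff b x4 x1 x2 x3) \<le> K * K * K" unfolding shift_coeff_def by (intro norm_mult_le2 r1 sx' nz)
      thus ?thesis by (simp add: power3_eq_cube)
    qed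
    have Sch: "norm (Fdiff b x1 x2 x3 (q * x4)) \<le> norm q * M"
      by (rule Schwarz_disc[of "\<lambda>y. Fdiff b x1 x2 x3 y" "s^4"])
         (use hol[of x1 x2 x3] lt n sp M q_less_1 D3[of x1 x2 x3] in auto)
    have "(1 + b) * Fdiff b x1 x2 x3 x4 = shift_coeff b x1 x2 x3 x4 * Fdiff b (q * x1) x2 x3 x4 + shift_coeff b x2 x1 x3 x4 * Fdiff b x1 (q * x2) x3 x4 +
       shift_coeff b x3 x1 x2 x4 * Fdiff b x1 x2 (q * x3) x4 + shift_coeff b x4 x1 x2 x3 * Fdiff b x1 x2 x3 (q * x4) +
       (- ((1 + b) * b^2)) * Fdiff b (Q * x1) (Q * x2) (Q * x3) (Q * x4)"
      using Fdiff_q_difference[OF b(1) b1 Q lt nz ne] by (simp add: algebra_simps)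
    also have "norm \<dots> \<le> K^3 * e * M + K^3 * e * M + K^3 * e * M + K^3 * (norm q * M) + 2 * s * M"
    proof (intro norm_triangle_le add_mono norm_mult_le2 a1 a2 a3 a4 Sch M shr q1 nQ)
      have "norm (1 + b) \<le> 2" using norm_triangle_ineq[of 1 b] b1 by simp
      moreover have "norm (b^2) \<le> s"
        unfolding norm_power by (rule order.trans[OF power_mono[OF b(2) norm_ge_zero] sp(4)])
      ultimately have "norm ((1 + b) * b^2) \<le> 2 * s" by (rule norm_mult_le2)
      thus "norm (- ((1 + b) * b^2)) \<le> 2 * s" by simp
    qed (use n in auto)
    also have "\<dots> = (K ^ 3 * norm q + 3 * (K ^ 3 * e) + 2 * s) * M"
      by (simp add: algebra_simps)
    finally have "norm (1 + b) * norm (Fdiff b x1 x2 x3 x4) \<le> (K ^ 3 * norm q + 3 * (K ^ 3 * e) + 2 * s) * M"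
      by (simp add: norm_mult)
    moreover have "1 - s \<le> norm (1 + b)"
      using norm_triangle_ineq2[of 1 "- b"] b by simp
    hence "(1 - s) * norm (Fdiff b x1 x2 x3 x4) \<le> norm (1 + b) * norm (Fdiff b x1 x2 x3 x4)"
      by (intro mult_right_mono) auto
    ultimately have "(1 - s) * norm (Fdiff b x1 x2 x3 x4) \<le> (K ^ 3 * norm q + 3 * (K ^ 3 * e) + 2 * s) * M"
      by simp
    thus "norm (Fdiff b x1 x2 x3 x4) \<le> ?\<theta> * M"
      unfolding Ke using s1 by (simp add: pos_le_divide_eq mult_ac)
  qed (use x in auto)
qed

lemma small_parameters_identity:
  obtains \<delta> where "0 < \<delta>" "\<delta> < 1"
    "\<And>b x1 x2 x3 x4. 0 < norm b \<Longrightarrow> norm b < 1 \<Longrightarrow> norm x1 \<le> \<delta> \<Longrightarrow> norm x2 \<le> \<delta> \<Longrightarrow> norm x3 \<le> \<delta> \<Longrightarrow> norm x4 \<le> \<delta> \<Longrightarrow>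
       P q * Fint b x1 x2 x3 x4 = 2 * P b * Fser b x1 x2 x3 x4"
proof -
  obtain s where s: "0 < s" "s < 1 / 3"
    "(((1 + s) / (1 - s)) ^ 3 * (norm q + 6 * s / (1 - s)) + 2 * s) / (1 - s) < 1"
    "((1 + 3 * s) * norm q + 8 * s) / ((1 - s) * (1 - s^2)) < 1"
    by (rule contraction_radius)
  have s4: "0 < s^4" "s^4 < 1" "s^4 \<le> s" "s^4 \<le> s^2" "s^4 \<le> s^3"
    using s power_decreasing[of 1 4 s] power_decreasing[of 2 4 s] power_decreasing[of 3 4 s]
       power_less_one_iff[of s 4] by auto
  show ?thesis
  proof (rule that[OF s4(1,2)])
    fix b x1 x2 x3 x4 :: complex assume b: "0 < norm b" "norm b < 1"
      and x: "norm x1 \<le> s^4" "norm x2 \<le> s^4" "norm x3 \<le> s^4" "norm x4 \<le> s^4"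
    let ?A = "ball (0::complex) 1 - {0}" and ?inner = "ball (0::complex) s - {0}"
    have "Fdiff b x1 x2 x3 x4 = 0"
    proof (rule analytic_continuation_open[of ?inner ?A "\<lambda>b. Fdiff b x1 x2 x3 x4" "\<lambda>_. 0"])
      show "?inner \<noteq> {}"
      proof -
        have "of_real (s / 2) \<in> ?inner" using s by simp
        thus ?thesis by blast
      qed
      show "connected ?A"
        by (intro connected_open_delete) auto
      show "?inner \<subseteq> ?A" using s(2) by auto
      show "(\<lambda>b. Fdiff b x1 x2 x3 x4) holomorphic_on ?A"
        using x s4 by (intro holomorphic_Fdiff holomorphic_intros) auto
      show "Fdiff b x1 x2 x3 x4 = 0" if "b \<in> ?inner" for b
        by (rule Fdiff_zero_small[OF s]) (use that x s4 in auto)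
    qed (use b in \<open>auto intro!: holomorphic_intros\<close>)
    thus "P q * Fint b x1 x2 x3 x4 = 2 * P b * Fser b x1 x2 x3 x4"
      by (simp add: Fdiff_def)
  qed
qed

end

section \<open>Partial fractions on a general contour\<close>

text \<open>After subtracting the pole the integrand is holomorphic in the annulus; the pole contributes its
  winding number.\<close>

lemma contour_integral_simple_pole_eq:
  assumes e: "e holomorphic_on annulus r R" and r: "0 \<le> r"
    and g: "valid_path g" "path_image g \<subseteq> annulus r R" "homotopic_loops (- {0}) (circ 1) g"
    and h: "valid_path h" "path_image h \<subseteq> annulus r R" "homotopic_loops (- {0}) (circ 1) h"
    and p: "p \<notin> path_image g" "p \<notin> path_image h" "winding_number g p = winding_number h p"
  shows "contour_integral g (\<lambda>z. e z / (z - p)) = contour_integral h (\<lambda>z. e z / (z - p))"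
proof -
  have "homotopic_loops (- {0}) g h"
    using g(3) h(3) homotopic_loops_sym homotopic_loops_trans by blast
  hence hom: "homotopic_loops (annulus r R) g h"
    by (rule homotopic_loops_in_annulus) fact+
  show ?thesis
  proof (cases "p \<in> annulus r R")
    case False
    show ?thesis
      by (rule Cauchy_theorem_homotopic_loops[OF hom open_annulus _ g(1) h(1)])
         (use e False in \<open>auto intro!: holomorphic_intros\<close>)
  next
    case True
    define d where "d = (\<lambda>z. if z = p then deriv e p else (e z - e p) / (z - p))"
    have d: "d holomorphic_on annulus r R"
      unfolding d_def by (rule pole_lemma_open[OF e open_annulus])
    have *: "contour_integral k (\<lambda>z. e z / (z - p)) =
        contour_integral k d + e p * (2 * of_real pi * \<i> * winding_number k p)"
      if k: "valid_path k" "path_image k \<subseteq> annulus r R" "p \<notin> path_image k" for k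
    proof -
      have "contour_integral k (\<lambda>z. e z / (z - p)) = contour_integral k (\<lambda>z. d z + e p * (1 / (z - p)))"
      proof (rule contour_integral_cong)
        fix z assume "z \<in> path_image k"
        hence "z \<noteq> p" using k by auto
        thus "e z / (z - p) = d z + e p * (1 / (z - p))"
          by (simp add: d_def diff_divide_distrib)
      qed auto
      also have "\<dots> = contour_integral k d + contour_integral k (\<lambda>z. e p * (1 / (z - p)))"
        using k d by (intro contour_integral_add contour_integrable_lmul contour_integrable_inversediff
            contour_integrable_holomorphic_simple[OF d open_annulus])
      also have "contour_integral k (\<lambda>z. e p * (1 / (z - p))) = e p * contour_integral k (\<lambda>z. 1 / (z - p))"
        using k by (intro contour_integral_lmul contour_integrable_inversediff)
      also have "contour_integral k (\<lambda>z. 1 / (z - p)) = 2 * of_real pi * \<i> * winding_number k p"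
        using k by (simp add: winding_number_valid_path)
      finally show ?thesis .
    qed
    have "contour_integral g d = contour_integral h d"
      by (rule Cauchy_theorem_homotopic_loops[OF hom open_annulus d g(1) h(1)])
    thus ?thesis using *[OF g(1,2) p(1)] *[OF h(1,2) p(2)] p(3) by simp
  qed
qed

lemma cint_inverse_radius:
  assumes "\<rho> > 0"
  shows "cint (circ (1 / \<rho>)) f = cint (circ \<rho>) (\<lambda>z. f (1 / z))"
proof -
  have "cint (circ (1 / \<rho>)) f = cint (\<lambda>x. of_real (1 / \<rho>) * circ 1 x) f"
    by (subst circ_scaled) simp
  also have "\<dots> = cint (circ 1) (\<lambda>z. f (of_real (1 / \<rho>) * z))"
    using assms by (intro cint_circ_scaled) auto
  also have "\<dots> = cint (circ 1) (\<lambda>z. f (of_real (1 / \<rho>) * (1 / z)))"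
    by (rule cint_inverse[symmetric, where f = "\<lambda>z. f (of_real (1 / \<rho>) * z)"])
  also have "\<dots> = cint (circ 1) (\<lambda>z. f (1 / (of_real \<rho> * z)))"
    by simp
  also have "\<dots> = cint (\<lambda>x. of_real \<rho> * circ 1 x) (\<lambda>z. f (1 / z))"
    using assms by (intro cint_circ_scaled[symmetric]) auto
  also have "\<dots> = cint (circ \<rho>) (\<lambda>z. f (1 / z))"
    by (subst (2) circ_scaled) simp
  finally show ?thesis .
qed

text \<open>Write \<open>2 (1 - p\<^sup>2) / ((1 - p z) (1 - p/z))\<close> as \<open>(1 + p z)/(1 - p z) + (z
  + p)/(z - p)\<close>. In the second term the contour is expanded beyond \<open>p\<close>, which it encloses,
  in the first it is shrunk away from \<open>1/p\<close>. By the symmetry of \<open>E\<close> the two integrals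
  are equal.\<close>

lemma cint_kernel:
  assumes E: "E holomorphic_on annulus (1 / R) R" and sym: "\<And>z. z \<noteq> 0 \<Longrightarrow> E (1 / z) = E z"
    and \<rho>: "1 < \<rho>" "\<rho> < R" "norm p < \<rho>" and p0: "p \<noteq> 0"
    and g: "valid_path g" "path_image g \<subseteq> annulus (1 / R) R" "homotopic_loops (- {0}) (circ 1) g"
    and p: "p \<notin> path_image g" "1 / p \<notin> path_image g" "winding_number g p = 1" "winding_number g (1 / p) = 0"
  shows "cint g (\<lambda>z. E z / ((1 - p * z) * (1 - p / z))) =
           1 / (1 - p^2) * cint (circ \<rho>) (\<lambda>z. E z * ((z + p) / (z - p)))"
    and "(\<lambda>z. E z / ((1 - p * z) * (1 - p / z)) / (2 * of_real pi * \<i> * z)) contour_integrable_on g"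
    and "p^2 \<noteq> 1"
proof -
  have R: "0 < R" "1 < R" using \<rho> by auto
  have nz: "z \<noteq> 0" if "z \<in> annulus (1 / R) R" for z
    using that R by (auto simp: annulus_def)
  show p2: "p^2 \<noteq> 1"
  proof
    assume "p^2 = 1"
    hence "1 / p = p" using p0 by (simp add: field_simps power2_eq_square)
    thus False using p by simp
  qed
  let ?U = "annulus (1 / R) R - {p, 1 / p}"
  have U: "open ?U" by (intro open_Diff open_annulus) auto
  have gU: "path_image g \<subseteq> ?U" using g(2) p by auto
  have nzU: "z \<noteq> 0" "z - p \<noteq> 0" "1 - p * z \<noteq> 0" "1 - p / z \<noteq> 0" if "z \<in> ?U" for z
    using that nz p0 by (auto simp: field_simps)
  have EU: "E holomorphic_on ?U" by (rule holomorphic_on_subset[OF E]) auto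
  show "(\<lambda>z. E z / ((1 - p * z) * (1 - p / z)) / (2 * of_real pi * \<i> * z)) contour_integrable_on g"
    by (rule contour_integrable_holomorphic_simple[OF _ U g(1) gU])
       (use nzU EU in \<open>auto intro!: holomorphic_intros\<close>)
  define f1 where "f1 = (\<lambda>z. E z * ((1 + p * z) / (1 - p * z)))"
  define f2 where "f2 = (\<lambda>z. E z * ((z + p) / (z - p)))"
  have int: "(\<lambda>z. f1 z / (2 * of_real pi * \<i> * z)) contour_integrable_on g"
            "(\<lambda>z. f2 z / (2 * of_real pi * \<i> * z)) contour_integrable_on g"
    unfolding f1_def f2_def
    by (rule contour_integrable_holomorphic_simple[OF _ U g(1) gU];
        use nzU EU in \<open>auto intro!: holomorphic_intros\<close>)+
  have "cint g (\<lambda>z. E z / ((1 - p * z) * (1 - p / z))) =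
      contour_integral g (\<lambda>z. 1 / (2 * (1 - p^2)) * (f1 z / (2 * of_real pi * \<i> * z) + f2 z / (2 * of_real pi * \<i> * z)))"
    unfolding cint_def
  proof (rule contour_integral_cong)
    fix z assume "z \<in> path_image g"
    hence n: "z \<noteq> 0" "z - p \<noteq> 0" "1 - p * z \<noteq> 0" using gU nzU by blast+
    have "1 - p^2 \<noteq> 0" using p2 by simp
    hence "E z / ((1 - p * z) * (1 - p / z)) = 1 / (2 * (1 - p^2)) * (f1 z + f2 z)"
      using n unfolding f1_def f2_def
      by (simp add: divide_simps) algebra
    thus "E z / ((1 - p * z) * (1 - p / z)) / (2 * of_real pi * \<i> * z) =
      1 / (2 * (1 - p^2)) * (f1 z / (2 * of_real pi * \<i> * z) + f2 z / (2 * of_real pi * \<i> * z))"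
      by (simp only: add_divide_distrib[symmetric] times_divide_eq_right)
  qed auto
  also have "\<dots> = 1 / (2 * (1 - p^2)) * (cint g f1 + cint g f2)"
    unfolding cint_def
    by (simp only: contour_integral_lmul[OF contour_integrable_add[OF int]] contour_integral_add[OF int])
  also have "cint g f2 = cint (circ \<rho>) f2"
  proof -
    have "cint k f2 = contour_integral k (\<lambda>z. (E z * (z + p) / (2 * of_real pi * \<i> * z)) / (z - p))" for k
      unfolding cint_def f2_def by (simp add: mult_ac)
    moreover have "contour_integral g (\<lambda>z. (E z * (z + p) / (2 * of_real pi * \<i> * z)) / (z - p)) =
        contour_integral (circ \<rho>) (\<lambda>z. (E z * (z + p) / (2 * of_real pi * \<i> * z)) / (z - p))"
    proof (rule contour_integral_simple_pole_eq[OF _ _ g])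
      show "(\<lambda>z. E z * (z + p) / (2 * of_real pi * \<i> * z)) holomorphic_on annulus (1 / R) R"
        using nz by (intro holomorphic_intros E) auto
      show "path_image (circ \<rho>) \<subseteq> annulus (1 / R) R"
      proof -
        have "1 / R < 1" using R by simp
        hence "1 / R < \<rho>" using \<rho> by linarith
        thus ?thesis using \<rho> by (auto simp: annulus_def)
      qed
      show "winding_number g p = winding_number (circ \<rho>) p"
        using winding_number_circlepath[of p 0 \<rho>] \<rho> p by simp
    qed (use R \<rho> p homotopic_loops_circ in auto)
    ultimately show ?thesis by simp
  qed
  also have "cint g f1 = cint (circ (1 / \<rho>)) f1"
  proof -
    have "cint k f1 = contour_integral k (\<lambda>z. ((- 1 / p) * E z * (1 + p * z) / (2 * of_real pi * \<i> * z)) / (z - 1 / p))" for k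
    proof -
      have "f1 z / (2 * of_real pi * \<i> * z) = ((- 1 / p) * E z * (1 + p * z) / (2 * of_real pi * \<i> * z)) / (z - 1 / p)" for z
      proof -
        have "1 - p * z = (- p) * (z - 1 / p)" using p0 by (simp add: field_simps)
        thus ?thesis unfolding f1_def using p0 by simp
      qed
      thus ?thesis unfolding cint_def by simp
    qed
    moreover have "contour_integral g (\<lambda>z. ((- 1 / p) * E z * (1 + p * z) / (2 * of_real pi * \<i> * z)) / (z - 1 / p)) =
        contour_integral (circ (1 / \<rho>)) (\<lambda>z. ((- 1 / p) * E z * (1 + p * z) / (2 * of_real pi * \<i> * z)) / (z - 1 / p))"
    proof (rule contour_integral_simple_pole_eq[OF _ _ g])
      show "(\<lambda>z. (- 1 / p) * E z * (1 + p * z) / (2 * of_real pi * \<i> * z)) holomorphic_on annulus (1 / R) R"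
        using nz by (intro holomorphic_intros E) auto
      have *: "1 / \<rho> < norm (1 / p)"
        using \<rho> p0 by (simp add: norm_divide divide_strict_left_mono)
      have "1 / R < 1 / \<rho>" "1 / \<rho> < 1" using \<rho> by (auto simp: divide_strict_left_mono)
      moreover from this(2) have "1 / \<rho> < R" using \<rho> by linarith
      ultimately show "path_image (circ (1 / \<rho>)) \<subseteq> annulus (1 / R) R"
        using \<rho> by (auto simp: annulus_def)
      show "1 / p \<notin> path_image (circ (1 / \<rho>))"
        using * \<rho> by auto
      have "winding_number (circ (1 / \<rho>)) (1 / p) = 0"
        by (rule winding_number_zero_outside[of _ "cball 0 (1 / \<rho>)"]) (use * \<rho> in auto)
      thus "winding_number g (1 / p) = winding_number (circ (1 / \<rho>)) (1 / p)" using p by simp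
    qed (use R \<rho> p homotopic_loops_circ in auto)
    ultimately show ?thesis by simp
  qed
  also have "cint (circ (1 / \<rho>)) f1 = cint (circ \<rho>) (\<lambda>z. f1 (1 / z))"
    using \<rho> by (intro cint_inverse_radius) auto
  also have "\<dots> = cint (circ \<rho>) f2"
  proof (rule cint_cong)
    fix z assume "z \<in> path_image (circ \<rho>)"
    hence z: "z \<noteq> 0" using \<rho> by auto
    have "(1 + p * (1 / z)) / (1 - p * (1 / z)) = (z + p) / (z - p)"
    proof -
      have "1 + p * (1 / z) = (z + p) / z" "1 - p * (1 / z) = (z - p) / z" using z by (simp_all add: field_simps)
      thus ?thesis using z by simp
    qed
    thus "f1 (1 / z) = f2 z" unfolding f1_def f2_def sym[OF z] by simp
  qed
  also have "1 / (2 * (1 - p^2)) * (cint (circ \<rho>) f2 + cint (circ \<rho>) f2) = 1 / (1 - p^2) * cint (circ \<rho>) f2"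
  proof -
    have "1 / (2 * d) * (C + C) = 1 / d * C" for d C :: complex by simp
    thus ?thesis .
  qed
  finally show "cint g (\<lambda>z. E z / ((1 - p * z) * (1 - p / z))) =
           1 / (1 - p^2) * cint (circ \<rho>) (\<lambda>z. E z * ((z + p) / (z - p)))"
    unfolding f2_def .
qed

lemma partial_fractions_distinct:
  fixes X :: "'i \<Rightarrow> complex"
  assumes "finite I" "I \<noteq> {}" "inj_on X I" "\<And>i. i \<in> I \<Longrightarrow> X i \<noteq> Y"
  shows "(\<Prod>i\<in>I. 1 / (X i - Y)) = (\<Sum>i\<in>I. 1 / (X i - Y) * (\<Prod>j\<in>I-{i}. 1 / (X j - X i)))"
  using assms
proof (induction I arbitrary: Y rule: finite_ne_induct)
  case (singleton k)
  thus ?case by simp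
next
  case (insert k I)
  define c where "c i = (\<Prod>j\<in>I-{i}. 1 / (X j - X i))" for i
  have Xk: "X i \<noteq> X k" if "i \<in> I" for i
    using insert.prems(1) insert.hyps that by (auto simp: inj_on_def)
  have inj: "inj_on X I" using insert.prems(1) by (auto simp: inj_on_def)
  have IH: "(\<Prod>i\<in>I. 1 / (X i - Z)) = (\<Sum>i\<in>I. 1 / (X i - Z) * c i)" if "\<And>i. i \<in> I \<Longrightarrow> X i \<noteq> Z" for Z
    unfolding c_def by (rule insert.IH[OF inj that])
  have "(\<Prod>i\<in>insert k I. 1 / (X i - Y)) = 1 / (X k - Y) * (\<Sum>i\<in>I. 1 / (X i - Y) * c i)"
    using insert by (simp add: IH)
  also have "\<dots> = (\<Sum>i\<in>I. 1 / (X i - Y) * (c i * (1 / (X k - X i))) + 1 / (X k - Y) * (1 / (X i - X k) * c i))"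
    unfolding sum_distrib_left
  proof (rule sum.cong)
    fix i assume i: "i \<in> I"
    have n: "X k - Y \<noteq> 0" "X i - Y \<noteq> 0" "X k - X i \<noteq> 0" "X i - X k \<noteq> 0"
      using insert.prems(2) i Xk[OF i] by auto
    have "1 / (X k - Y) * (1 / (X i - Y)) = 1 / (X i - Y) * (1 / (X k - X i)) + 1 / (X k - Y) * (1 / (X i - X k))"
      using n by (simp add: divide_simps) (simp add: algebra_simps)
    hence "1 / (X k - Y) * (1 / (X i - Y)) * c i = (1 / (X i - Y) * (1 / (X k - X i)) + 1 / (X k - Y) * (1 / (X i - X k))) * c i"
      by (rule arg_cong)
    thus "1 / (X k - Y) * (1 / (X i - Y) * c i) =
        1 / (X i - Y) * (c i * (1 / (X k - X i))) + 1 / (X k - Y) * (1 / (X i - X k) * c i)"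
      by (simp only: distrib_left mult_ac)
  qed auto
  also have "\<dots> = (\<Sum>i\<in>I. 1 / (X i - Y) * (c i * (1 / (X k - X i)))) + 1 / (X k - Y) * (\<Sum>i\<in>I. 1 / (X i - X k) * c i)"
    by (simp only: sum.distrib sum_distrib_left)
  also have "(\<Sum>i\<in>I. 1 / (X i - X k) * c i) = (\<Prod>i\<in>I. 1 / (X i - X k))"
    by (rule IH[symmetric]) (rule Xk)
  also have "(\<Sum>i\<in>I. 1 / (X i - Y) * (c i * (1 / (X k - X i)))) =
      (\<Sum>i\<in>I. 1 / (X i - Y) * (\<Prod>j\<in>insert k I-{i}. 1 / (X j - X i)))"
  proof (rule sum.cong)
    fix i assume i: "i \<in> I"
    have "insert k I - {i} = insert k (I - {i})" using i insert.hyps by auto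
    thus "1 / (X i - Y) * (c i * (1 / (X k - X i))) = 1 / (X i - Y) * (\<Prod>j\<in>insert k I-{i}. 1 / (X j - X i))"
      using insert.hyps i by (simp add: c_def mult_ac)
  qed auto
  finally show ?case
    using insert.hyps by (simp add: add.commute insert_Diff_if)
qed

text \<open>In the variable \<open>z + 1/z\<close> the kernels are simple fractions, because \<open>(1 - p z)
  (1 - p/z) = p ((p + 1/p) - (z + 1/z))\<close>.\<close>

lemma partial_fractions_kernels:
  fixes p :: "'i \<Rightarrow> complex"
  assumes I: "finite I" "I \<noteq> {}" and p0: "\<And>i. i \<in> I \<Longrightarrow> p i \<noteq> 0"
    and inj: "\<And>i j. i \<in> I \<Longrightarrow> j \<in> I \<Longrightarrow> i \<noteq> j \<Longrightarrow> p i \<noteq> p j \<and> p i * p j \<noteq> 1"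
    and z: "z \<noteq> 0" "\<And>i. i \<in> I \<Longrightarrow> (1 - p i * z) * (1 - p i / z) \<noteq> 0"
  shows "(\<Prod>i\<in>I. 1 / ((1 - p i * z) * (1 - p i / z))) =
    (\<Sum>i\<in>I. (\<Prod>j\<in>I-{i}. 1 / ((1 - p j * p i) * (1 - p j / p i))) * (1 / ((1 - p i * z) * (1 - p i / z))))"
proof -
  define X where "X i = p i + 1 / p i" for i
  define Y where "Y = z + 1 / z"
  have k: "(1 - a * w) * (1 - a / w) = a * ((a + 1 / a) - (w + 1 / w))" if "a \<noteq> 0" "w \<noteq> 0" for a w :: complex
    using that by (simp add: field_simps)
  have kz: "1 / ((1 - p i * z) * (1 - p i / z)) = 1 / p i * (1 / (X i - Y))" if "i \<in> I" for i
    unfolding k[OF p0[OF that] z(1)] X_def Y_def by simp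
  have kp: "1 / ((1 - p j * p i) * (1 - p j / p i)) = 1 / p j * (1 / (X j - X i))" if "i \<in> I" "j \<in> I" for i j
    unfolding k[OF p0[OF that(2)] p0[OF that(1)]] X_def by simp
  have injX: "inj_on X I"
  proof (rule inj_onI, rule ccontr)
    fix i j assume ij: "i \<in> I" "j \<in> I" "X i = X j" "i \<noteq> j"
    have "(1 - p i * p j) * (1 - p i / p j) = 0"
      unfolding k[OF p0[OF ij(1)] p0[OF ij(2)]] using ij(3) by (simp add: X_def)
    hence "1 - p i * p j = 0 \<or> 1 - p i / p j = 0" by (simp only: mult_eq_0_iff)
    thus False using inj[OF ij(1,2,4)] p0[OF ij(2)] by auto
  qed
  have XY: "X i \<noteq> Y" if "i \<in> I" for i
    using z(2)[OF that] unfolding k[OF p0[OF that] z(1)] X_def Y_def by auto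
  have "(\<Prod>i\<in>I. 1 / ((1 - p i * z) * (1 - p i / z))) = (\<Prod>i\<in>I. 1 / p i) * (\<Prod>i\<in>I. 1 / (X i - Y))"
    unfolding prod.distrib[symmetric] by (rule prod.cong) (use kz in auto)
  also have "\<dots> = (\<Sum>i\<in>I. (\<Prod>i\<in>I. 1 / p i) * (1 / (X i - Y) * (\<Prod>j\<in>I-{i}. 1 / (X j - X i))))"
  proof -
    have "(\<Prod>i\<in>I. 1 / (X i - Y)) = (\<Sum>i\<in>I. 1 / (X i - Y) * (\<Prod>j\<in>I-{i}. 1 / (X j - X i)))"
      by (rule partial_fractions_distinct[OF I injX]) (rule XY)
    thus ?thesis by (simp only: sum_distrib_left)
  qed
  also have "\<dots> = (\<Sum>i\<in>I. (\<Prod>j\<in>I-{i}. 1 / ((1 - p j * p i) * (1 - p j / p i))) * (1 / ((1 - p i * z) * (1 - p i / z))))"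
  proof (rule sum.cong)
    fix i assume i: "i \<in> I"
    have "(\<Prod>j\<in>I-{i}. 1 / ((1 - p j * p i) * (1 - p j / p i))) = (\<Prod>j\<in>I-{i}. 1 / p j) * (\<Prod>j\<in>I-{i}. 1 / (X j - X i))"
      unfolding prod.distrib[symmetric] by (rule prod.cong) (use kp i in auto)
    moreover have "(\<Prod>j\<in>I. 1 / p j) = 1 / p i * (\<Prod>j\<in>I-{i}. 1 / p j)"
      by (rule prod.remove[OF I(1) i])
    ultimately show "(\<Prod>i\<in>I. 1 / p i) * (1 / (X i - Y) * (\<Prod>j\<in>I-{i}. 1 / (X j - X i))) =
        (\<Prod>j\<in>I-{i}. 1 / ((1 - p j * p i) * (1 - p j / p i))) * (1 / ((1 - p i * z) * (1 - p i / z)))"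
      unfolding kz[OF i] by (simp only: mult_ac)
  qed auto
  finally show ?thesis .
qed

text \<open>The integral of a symmetric \<open>E\<close> times the kernels of the poles \<open>p i\<close>,
  over a contour that encloses all \<open>p i\<close> and none of their reciprocals; \<open>\<rho>\<close>
  exceeds all \<open>|p i|\<close>.\<close>

definition pole_sum :: "'i set \<Rightarrow> ('i \<Rightarrow> complex) \<Rightarrow> real \<Rightarrow> (complex \<Rightarrow> complex) \<Rightarrow> complex" where
  "pole_sum I p \<rho> E = (\<Sum>i\<in>I. (\<Prod>j\<in>I-{i}. 1 / ((1 - p j * p i) * (1 - p j / p i))) *
     (1 / (1 - (p i)^2) * cint (circ \<rho>) (\<lambda>z. E z * ((z + p i) / (z - p i)))))"

lemma cint_eq_pole_sum:
  fixes p :: "'i \<Rightarrow> complex"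
  assumes I: "finite I" "I \<noteq> {}"
    and E: "E holomorphic_on annulus (1 / R) R" and sym: "\<And>z. z \<noteq> 0 \<Longrightarrow> E (1 / z) = E z"
    and \<rho>: "1 < \<rho>" "\<rho> < R" "\<And>i. i \<in> I \<Longrightarrow> norm (p i) < \<rho>" and p0: "\<And>i. i \<in> I \<Longrightarrow> p i \<noteq> 0"
    and inj: "\<And>i j. i \<in> I \<Longrightarrow> j \<in> I \<Longrightarrow> i \<noteq> j \<Longrightarrow> p i \<noteq> p j"
    and g: "valid_path g" "path_image g \<subseteq> annulus (1 / R) R" "homotopic_loops (- {0}) (circ 1) g"
    and p: "\<And>i. i \<in> I \<Longrightarrow> p i \<notin> path_image g" "\<And>i. i \<in> I \<Longrightarrow> 1 / p i \<notin> path_image g"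
       "\<And>i. i \<in> I \<Longrightarrow> winding_number g (p i) = 1" "\<And>i. i \<in> I \<Longrightarrow> winding_number g (1 / p i) = 0"
  shows "cint g (\<lambda>z. E z * (\<Prod>i\<in>I. 1 / ((1 - p i * z) * (1 - p i / z)))) = pole_sum I p \<rho> E"
    and "\<And>i j. i \<in> I \<Longrightarrow> j \<in> I \<Longrightarrow> p i * p j \<noteq> 1"
proof -
  note K = cint_kernel[OF E sym \<rho>(1,2) \<rho>(3) p0 g p(1) p(2) p(3) p(4)]
  show pp: "p i * p j \<noteq> 1" if "i \<in> I" "j \<in> I" for i j
  proof
    assume "p i * p j = 1"
    hence "p i = 1 / p j" using p0[OF that(2)] by (simp add: field_simps)
    thus False using p(3)[OF that(1)] p(4)[OF that(2)] by simp
  qed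
  let ?c = "\<lambda>i. \<Prod>j\<in>I-{i}. 1 / ((1 - p j * p i) * (1 - p j / p i))"
  have "cint g (\<lambda>z. E z * (\<Prod>i\<in>I. 1 / ((1 - p i * z) * (1 - p i / z)))) =
     contour_integral g (\<lambda>z. \<Sum>i\<in>I. ?c i * (E z / ((1 - p i * z) * (1 - p i / z)) / (2 * of_real pi * \<i> * z)))"
    unfolding cint_def
  proof (rule contour_integral_cong)
    fix z assume z: "z \<in> path_image g"
    have z0: "z \<noteq> 0" using z g(2) \<rho> by (auto simp: annulus_def dest!: subsetD)
    have nz: "(1 - p i * z) * (1 - p i / z) \<noteq> 0" if "i \<in> I" for i
    proof -
      have "z \<noteq> p i" "z \<noteq> 1 / p i" using p(1,2)[OF that] z by auto
      hence "1 - p i / z \<noteq> 0" "1 - p i * z \<noteq> 0" using z0 p0[OF that] by (auto simp: field_simps)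
      thus ?thesis by simp
    qed
    have "(\<Prod>i\<in>I. 1 / ((1 - p i * z) * (1 - p i / z))) = (\<Sum>i\<in>I. ?c i * (1 / ((1 - p i * z) * (1 - p i / z))))"
      by (rule partial_fractions_kernels[OF I p0 _ z0 nz]) (use inj pp in auto)
    thus "E z * (\<Prod>i\<in>I. 1 / ((1 - p i * z) * (1 - p i / z))) / (2 * of_real pi * \<i> * z) =
      (\<Sum>i\<in>I. ?c i * (E z / ((1 - p i * z) * (1 - p i / z)) / (2 * of_real pi * \<i> * z)))"
      by (simp add: sum_distrib_left sum_divide_distrib mult_ac)
  qed auto
  also have "\<dots> = (\<Sum>i\<in>I. contour_integral g (\<lambda>z. ?c i * (E z / ((1 - p i * z) * (1 - p i / z)) / (2 * of_real pi * \<i> * z))))"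
    by (intro contour_integral_sum I contour_integrable_lmul K(2))
  also have "\<dots> = (\<Sum>i\<in>I. ?c i * cint g (\<lambda>z. E z / ((1 - p i * z) * (1 - p i / z))))"
    unfolding cint_def by (intro sum.cong refl contour_integral_lmul K(2))
  also have "\<dots> = pole_sum I p \<rho> E"
    unfolding pole_sum_def by (intro sum.cong refl arg_cong2[of _ _ _ _ "(*)"] K(1))
  finally show "cint g (\<lambda>z. E z * (\<Prod>i\<in>I. 1 / ((1 - p i * z) * (1 - p i / z)))) = pole_sum I p \<rho> E" .
qed

section \<open>The integrand as a sum over simple poles\<close>

context nome
begin

text \<open>The point \<open>(i, r)\<close> is the zero of the \<open>i\<close>-th factor of
  \<open>(x\<^sub>r/z;q)\<close> for \<open>r < 4\<close>, and one of the two zeros of the \<open>i\<close>-th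
  factor of \<open>(b/z\<^sup>2;q)\<close> for \<open>r = 4, 5\<close>.\<close>

definition pole :: "complex \<Rightarrow> complex \<Rightarrow> complex \<Rightarrow> complex \<Rightarrow> complex \<Rightarrow> nat \<times> nat \<Rightarrow> complex" where
  "pole b x1 x2 x3 x4 ir = (case ir of (i, r) \<Rightarrow>
     if r = 0 then x1 * q ^ i else if r = 1 then x2 * q ^ i else if r = 2 then x3 * q ^ i
     else if r = 3 then x4 * q ^ i else if r = 4 then csqrt (b * q ^ i) else - csqrt (b * q ^ i))"

definition pole_indices :: "nat \<Rightarrow> (nat \<times> nat) set" where "pole_indices m = {..<m} \<times> {..<6}"

text \<open>The integrand with the first \<open>m\<close> factors of all denominators removed.\<close>

definition cofactor :: "nat \<Rightarrow> complex \<Rightarrow> complex \<Rightarrow> complex \<Rightarrow> complex \<Rightarrow> complex \<Rightarrow> complex \<Rightarrow> complex" where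
  "cofactor m b x1 x2 x3 x4 z =
     P (z^2) * P (1 / z^2) / (P (b * z^2 * q ^ m) * P (b / z^2 * q ^ m)) *
     (P (b * (x1 * z)) * P (b * (x1 / z)) / (P (x1 * z * q ^ m) * P (x1 / z * q ^ m))) *
     (P (b * (x2 * z)) * P (b * (x2 / z)) / (P (x2 * z * q ^ m) * P (x2 / z * q ^ m))) *
     (P (b * (x3 * z)) * P (b * (x3 / z)) / (P (x3 * z * q ^ m) * P (x3 / z * q ^ m))) *
     (P (b * (x4 * z)) * P (b * (x4 / z)) / (P (x4 * z * q ^ m) * P (x4 / z * q ^ m)))"

lemma finite_pole_indices [simp]: "finite (pole_indices m)"
  by (simp add: pole_indices_def)

lemma pole_indices_nonempty: "m > 0 \<Longrightarrow> pole_indices m \<noteq> {}"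
proof -
  assume "m > 0"
  hence "(0, 0) \<in> pole_indices m" by (simp add: pole_indices_def)
  thus ?thesis by blast
qed

lemma prod_lessThan_6: "(\<Prod>r<6. f r) = f 0 * f 1 * f 2 * f 3 * f 4 * (f (5::nat) :: complex)"
  by (simp add: eval_nat_numeral mult_ac)

lemma prod_pole_indices:
  assumes z: "z \<noteq> 0"
  shows "(\<Prod>ir\<in>pole_indices m. (1 - pole b x1 x2 x3 x4 ir * z) * (1 - pole b x1 x2 x3 x4 ir / z)) =
    Pn (x1 * z) m * Pn (x1 / z) m * (Pn (x2 * z) m * Pn (x2 / z) m) * (Pn (x3 * z) m * Pn (x3 / z) m) *
    (Pn (x4 * z) m * Pn (x4 / z) m) * (Pn (b * z^2) m * Pn (b / z^2) m)"
proof -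
  have one: "(\<Prod>r<6. (1 - pole b x1 x2 x3 x4 (i, r) * z) * (1 - pole b x1 x2 x3 x4 (i, r) / z)) =
     ((1 - x1 * z * q ^ i) * (1 - x1 / z * q ^ i)) * ((1 - x2 * z * q ^ i) * (1 - x2 / z * q ^ i)) *
     ((1 - x3 * z * q ^ i) * (1 - x3 / z * q ^ i)) * ((1 - x4 * z * q ^ i) * (1 - x4 / z * q ^ i)) *
     ((1 - b * z^2 * q ^ i) * (1 - b / z^2 * q ^ i))" for i
  proof -
    define \<beta> where "\<beta> = csqrt (b * q ^ i)"
    have \<beta>: "\<beta>^2 = b * q ^ i" by (simp add: \<beta>_def)
    have "(1 - \<beta> * z) * (1 - \<beta> / z) * ((1 - (- \<beta>) * z) * (1 - (- \<beta>) / z)) = (1 - \<beta>^2 * z^2) * (1 - \<beta>^2 / z^2)"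
      using z by (simp add: field_simps power2_eq_square)
    also have "\<dots> = (1 - b * z^2 * q ^ i) * (1 - b / z^2 * q ^ i)"
      unfolding \<beta> by (simp add: mult_ac)
    finally have e: "(1 - \<beta> * z) * (1 - \<beta> / z) * ((1 - (- \<beta>) * z) * (1 - (- \<beta>) / z)) =
       (1 - b * z^2 * q ^ i) * (1 - b / z^2 * q ^ i)" .
    show ?thesis
      unfolding prod_lessThan_6 e[symmetric] by (simp add: pole_def \<beta>_def[symmetric] mult_ac)
  qed
  show ?thesis
  proof -
    have "(\<Prod>ir\<in>pole_indices m. (1 - pole b x1 x2 x3 x4 ir * z) * (1 - pole b x1 x2 x3 x4 ir / z)) =
      (\<Prod>i<m. \<Prod>r<6. (1 - pole b x1 x2 x3 x4 (i, r) * z) * (1 - pole b x1 x2 x3 x4 (i, r) / z))"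
      unfolding pole_indices_def
      using prod.cartesian_product[of "\<lambda>i r. (1 - pole b x1 x2 x3 x4 (i, r) * z) * (1 - pole b x1 x2 x3 x4 (i, r) / z)" "{..<6}" "{..<m}"]
      by (simp only: case_prod_unfold prod.collapse)
    also note prod.cong[OF refl one]
    finally show ?thesis
      unfolding prod.distrib qpoch_def by (simp only: mult_ac)
  qed
qed

lemma integrand_factor:
  assumes z: "z \<noteq> 0"
  shows "integrand b x1 x2 x3 x4 z = cofactor m b x1 x2 x3 x4 z *
     (\<Prod>ir\<in>pole_indices m. 1 / ((1 - pole b x1 x2 x3 x4 ir * z) * (1 - pole b x1 x2 x3 x4 ir / z)))"
proof -
  have inv: "(\<Prod>ir\<in>pole_indices m. 1 / ((1 - pole b x1 x2 x3 x4 ir * z) * (1 - pole b x1 x2 x3 x4 ir / z))) =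
    1 / (Pn (x1 * z) m * Pn (x1 / z) m * (Pn (x2 * z) m * Pn (x2 / z) m) * (Pn (x3 * z) m * Pn (x3 / z) m) *
    (Pn (x4 * z) m * Pn (x4 / z) m) * (Pn (b * z^2) m * Pn (b / z^2) m))"
    unfolding prod_pole_indices[OF z, symmetric] by (simp add: prod_dividef)
  show ?thesis
    unfolding inv integrand_def weight_def kernel_def G_def cofactor_def P_split[of "b * z^2" m] P_split[of "b / z^2" m]
      P_split[of "x1 * z" m] P_split[of "x1 / z" m] P_split[of "x2 * z" m] P_split[of "x2 / z" m]
      P_split[of "x3 * z" m] P_split[of "x3 / z" m] P_split[of "x4 * z" m] P_split[of "x4 / z" m]
    by (simp add: mult_ac)
qed

lemma cofactor_symmetric: "z \<noteq> 0 \<Longrightarrow> cofactor m b x1 x2 x3 x4 (1 / z) = cofactor m b x1 x2 x3 x4 z"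
  unfolding cofactor_def by (simp add: power_divide mult_ac)

text \<open>The poles of the removed factors are the only ones in the annulus when \<open>m\<close> is
  large.\<close>

lemma cofactor_nz:
  assumes R: "0 < R" "norm b * R^2 * norm q ^ m < 1"
    and z: "1 / R < norm z" "norm z < R"
  shows "P (b * z^2 * q ^ m) * P (b / z^2 * q ^ m) \<noteq> 0"
    and "norm x * R * norm q ^ m < 1 \<Longrightarrow> P (x * z * q ^ m) * P (x / z * q ^ m) \<noteq> 0"
proof -
  have "0 < norm z" using R z by (smt (verit) divide_pos_pos)
  hence zi: "norm (1 / z) < R" using R z by (simp add: norm_divide field_simps)
  have 1: "norm (x * w * q ^ m) < 1" if "norm x * R * norm q ^ m < 1" "norm w < R" for x w
  proof -
    have "norm x * norm w * norm q ^ m \<le> norm x * R * norm q ^ m"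
      using that R by (intro mult_right_mono mult_left_mono) auto
    thus ?thesis using that by (simp add: norm_mult norm_power)
  qed
  have 2: "norm (b * w^2 * q ^ m) < 1" if "norm w < R" for w
  proof -
    have "norm b * norm w ^ 2 * norm q ^ m \<le> norm b * R^2 * norm q ^ m"
      using that R by (intro mult_right_mono mult_left_mono power_mono) auto
    thus ?thesis using R by (simp add: norm_mult norm_power)
  qed
  show "P (b * z^2 * q ^ m) * P (b / z^2 * q ^ m) \<noteq> 0"
    using P_nz[OF 2[OF z(2)]] P_nz[OF 2[OF zi]] by (simp add: power_divide)
  show "P (x * z * q ^ m) * P (x / z * q ^ m) \<noteq> 0" if "norm x * R * norm q ^ m < 1"
    using P_nz[OF 1[OF that z(2)]] P_nz[OF 1[OF that zi]] by simp
qed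

lemma cofactor_holomorphic:
  assumes R: "0 < R" "norm b * R^2 * norm q ^ m < 1"
    and x: "norm x1 * R * norm q ^ m < 1" "norm x2 * R * norm q ^ m < 1" "norm x3 * R * norm q ^ m < 1" "norm x4 * R * norm q ^ m < 1"
  shows "cofactor m b x1 x2 x3 x4 holomorphic_on annulus (1 / R) R"
proof -
  have nz: "z \<noteq> 0" "z^2 \<noteq> 0" if "z \<in> annulus (1 / R) R" for z
    using that R by (auto simp: annulus_def)
  have nz': "P (b * z^2 * q ^ m) * P (b / z^2 * q ^ m) \<noteq> 0"
    "norm x * R * norm q ^ m < 1 \<Longrightarrow> P (x * z * q ^ m) * P (x / z * q ^ m) \<noteq> 0"
    if "z \<in> annulus (1 / R) R" for z x
    using cofactor_nz[OF R] that unfolding annulus_def by blast+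
  have 1: "(\<lambda>z. P (z^2) * P (1 / z^2) / (P (b * z^2 * q ^ m) * P (b / z^2 * q ^ m))) holomorphic_on annulus (1 / R) R"
    by (intro holomorphic_on_divide nz'(1)) (auto intro!: holomorphic_intros dest: nz)
  have 2: "(\<lambda>z. P (b * (x * z)) * P (b * (x / z)) / (P (x * z * q ^ m) * P (x / z * q ^ m))) holomorphic_on annulus (1 / R) R"
    if "norm x * R * norm q ^ m < 1" for x
    by (intro holomorphic_on_divide nz'(2)[OF _ that]) (auto intro!: holomorphic_intros dest: nz)
  show ?thesis
    unfolding cofactor_def by (intro holomorphic_on_mult 1 2 x)
qed

lemma cofactor_holomorphic_param:
  assumes R: "0 < R" "norm b * R^2 * norm q ^ m < 1" and z: "1 / R < norm z" "norm z < R"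
    and hol: "x1 holomorphic_on A" "x2 holomorphic_on A" "x3 holomorphic_on A" "x4 holomorphic_on A"
    and x: "\<And>w. w \<in> A \<Longrightarrow> norm (x1 w) * R * norm q ^ m < 1" "\<And>w. w \<in> A \<Longrightarrow> norm (x2 w) * R * norm q ^ m < 1"
      "\<And>w. w \<in> A \<Longrightarrow> norm (x3 w) * R * norm q ^ m < 1" "\<And>w. w \<in> A \<Longrightarrow> norm (x4 w) * R * norm q ^ m < 1"
  shows "(\<lambda>w. cofactor m b (x1 w) (x2 w) (x3 w) (x4 w) z) holomorphic_on A"
proof -
  have z0: "z \<noteq> 0" using R z by auto
  have 2: "(\<lambda>w. P (b * (y w * z)) * P (b * (y w / z)) / (P (y w * z * q ^ m) * P (y w / z * q ^ m))) holomorphic_on A"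
    if "y holomorphic_on A" "\<And>w. w \<in> A \<Longrightarrow> norm (y w) * R * norm q ^ m < 1" for y
    by (intro holomorphic_on_divide cofactor_nz(2)[OF R z] that) (use z0 in \<open>auto intro!: holomorphic_intros that\<close>)
  show ?thesis
    unfolding cofactor_def by (intro holomorphic_on_mult 2 holomorphic_on_const hol x)
qed

lemma cofactor_continuous_param:
  assumes R: "0 < R" "norm b * R^2 * norm q ^ m < 1" and \<rho>: "1 / R < \<rho>" "\<rho> < R"
    and cont: "continuous_on A x1" "continuous_on A x2" "continuous_on A x3" "continuous_on A x4"
    and x: "\<And>w. w \<in> A \<Longrightarrow> norm (x1 w) * R * norm q ^ m < 1" "\<And>w. w \<in> A \<Longrightarrow> norm (x2 w) * R * norm q ^ m < 1"
      "\<And>w. w \<in> A \<Longrightarrow> norm (x3 w) * R * norm q ^ m < 1" "\<And>w. w \<in> A \<Longrightarrow> norm (x4 w) * R * norm q ^ m < 1"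
  shows "continuous_on (A \<times> sphere 0 \<rho>) (\<lambda>p. cofactor m b (x1 (fst p)) (x2 (fst p)) (x3 (fst p)) (x4 (fst p)) (snd p))"
proof -
  have c: "continuous_on (A \<times> sphere (0::complex) \<rho>) (\<lambda>p. f (fst p))" if "continuous_on A f" for f :: "'a \<Rightarrow> complex"
    by (rule continuous_on_compose2[OF that]) (auto intro!: continuous_intros)
  have n: "1 / R < norm (snd p)" "norm (snd p) < R" "snd p \<noteq> 0" "fst p \<in> A" if "p \<in> A \<times> sphere (0::complex) \<rho>" for p
  proof -
    have "norm (snd p) = \<rho>" using that by auto
    thus "1 / R < norm (snd p)" "norm (snd p) < R" "fst p \<in> A" using \<rho> that by auto
    thus "snd p \<noteq> 0" using R by auto
  qed
  have 1: "continuous_on (A \<times> sphere 0 \<rho>) (\<lambda>p. P ((snd p)^2) * P (1 / (snd p)^2) / (P (b * (snd p)^2 * q ^ m) * P (b / (snd p)^2 * q ^ m)))"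
    by (intro continuous_on_divide ballI cofactor_nz(1)[OF R n(1) n(2)])
       (auto intro!: continuous_intros dest!: n(3))
  have 2: "continuous_on (A \<times> sphere 0 \<rho>) (\<lambda>p. P (b * (y (fst p) * snd p)) * P (b * (y (fst p) / snd p)) /
      (P (y (fst p) * snd p * q ^ m) * P (y (fst p) / snd p * q ^ m)))"
    if "continuous_on A y" "\<And>w. w \<in> A \<Longrightarrow> norm (y w) * R * norm q ^ m < 1" for y
    by (intro continuous_on_divide ballI cofactor_nz(2)[OF R n(1) n(2) that(2)[OF n(4)]])
       (auto intro!: continuous_intros c[OF that(1)] dest!: n(3))
  show ?thesis
    unfolding cofactor_def by (intro continuous_on_mult 1 2 cont x)
qed

text \<open>The separation condition in terms of the poles instead of the zeros of infinite products.\<close>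

definition good_path :: "complex \<Rightarrow> complex \<Rightarrow> complex \<Rightarrow> complex \<Rightarrow> complex \<Rightarrow> (real \<Rightarrow> complex) \<Rightarrow> bool" where
  "good_path b x1 x2 x3 x4 \<gamma> \<longleftrightarrow> valid_path \<gamma> \<and> homotopic_loops (- {0}) (circ 1) \<gamma> \<and>
     (\<forall>ir. pole b x1 x2 x3 x4 ir \<notin> path_image \<gamma> \<and> 1 / pole b x1 x2 x3 x4 ir \<notin> path_image \<gamma> \<and>
        winding_number \<gamma> (pole b x1 x2 x3 x4 ir) = 1 \<and> winding_number \<gamma> (1 / pole b x1 x2 x3 x4 ir) = 0)"

lemma pole_nz: "b \<noteq> 0 \<Longrightarrow> x1 \<noteq> 0 \<Longrightarrow> x2 \<noteq> 0 \<Longrightarrow> x3 \<noteq> 0 \<Longrightarrow> x4 \<noteq> 0 \<Longrightarrow> pole b x1 x2 x3 x4 ir \<noteq> 0"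
  using q_nz by (cases ir) (auto simp: pole_def)

lemma cint_integrand_eq_pole_sum:
  assumes b: "b \<noteq> 0" and x0: "x1 \<noteq> 0" "x2 \<noteq> 0" "x3 \<noteq> 0" "x4 \<noteq> 0" and m: "m > 0"
    and R: "norm b * R^2 * norm q ^ m < 1"
    and x: "norm x1 * R * norm q ^ m < 1" "norm x2 * R * norm q ^ m < 1" "norm x3 * R * norm q ^ m < 1" "norm x4 * R * norm q ^ m < 1"
    and \<rho>: "1 < \<rho>" "\<rho> < R" "\<And>ir. norm (pole b x1 x2 x3 x4 ir) < \<rho>"
    and g: "good_path b x1 x2 x3 x4 \<gamma>" "path_image \<gamma> \<subseteq> annulus (1 / R) R"
    and inj: "inj_on (pole b x1 x2 x3 x4) (pole_indices m)"
  shows "cint \<gamma> (integrand b x1 x2 x3 x4) = pole_sum (pole_indices m) (pole b x1 x2 x3 x4) \<rho> (cofactor m b x1 x2 x3 x4)"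
proof -
  have R0: "0 < R" using \<rho> by simp
  have "cint \<gamma> (integrand b x1 x2 x3 x4) = cint \<gamma> (\<lambda>z. cofactor m b x1 x2 x3 x4 z *
     (\<Prod>ir\<in>pole_indices m. 1 / ((1 - pole b x1 x2 x3 x4 ir * z) * (1 - pole b x1 x2 x3 x4 ir / z))))"
  proof (rule cint_cong)
    fix z assume "z \<in> path_image \<gamma>"
    hence "z \<noteq> 0" using g(2) R0 by (auto simp: annulus_def dest!: subsetD)
    thus "integrand b x1 x2 x3 x4 z = cofactor m b x1 x2 x3 x4 z *
     (\<Prod>ir\<in>pole_indices m. 1 / ((1 - pole b x1 x2 x3 x4 ir * z) * (1 - pole b x1 x2 x3 x4 ir / z)))"
      by (rule integrand_factor)
  qed
  also have "\<dots> = pole_sum (pole_indices m) (pole b x1 x2 x3 x4) \<rho> (cofactor m b x1 x2 x3 x4)"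
    by (rule cint_eq_pole_sum[OF finite_pole_indices pole_indices_nonempty[OF m] cofactor_holomorphic[OF R0 R x] cofactor_symmetric \<rho>(1,2) \<rho>(3) pole_nz[OF b x0]])
       (use g inj in \<open>auto simp: good_path_def inj_on_def\<close>)
  finally show ?thesis .
qed

lemma norm_csqrt_lt_1: "norm b < 1 \<Longrightarrow> norm (csqrt (b * q ^ i)) < 1"
  using norm_mult_qpow_le[of b "norm b" i] by (simp add: real_sqrt_lt_1_iff)

lemma norm_pole_lt:
  assumes "norm b < 1" "1 \<le> \<rho>" "norm x1 < \<rho>" "norm x2 < \<rho>" "norm x3 < \<rho>" "norm x4 < \<rho>"
  shows "norm (pole b x1 x2 x3 x4 ir) < \<rho>"
proof -
  obtain i r where ir: "ir = (i, r)" by (cases ir)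
  have "norm (x * q ^ i) < \<rho>" if "norm x < \<rho>" for x
    using norm_mult_qpow_le[of x "norm x" i] that by simp
  thus ?thesis
    using assms norm_csqrt_lt_1[OF assms(1), of i] by (simp del: norm_csqrt add: ir pole_def)
qed

lemma good_path_circ:
  assumes "norm b < 1" "b \<noteq> 0" "norm x1 < 1" "norm x2 < 1" "norm x3 < 1" "norm x4 < 1"
    "x1 \<noteq> 0" "x2 \<noteq> 0" "x3 \<noteq> 0" "x4 \<noteq> 0"
  shows "good_path b x1 x2 x3 x4 (circ 1)"
  unfolding good_path_def
proof (intro conjI allI)
  fix ir
  have p: "norm (pole b x1 x2 x3 x4 ir) < 1" "pole b x1 x2 x3 x4 ir \<noteq> 0"
    using norm_pole_lt[of b 1] pole_nz assms by auto
  hence ip: "1 < norm (1 / pole b x1 x2 x3 x4 ir)"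
    by (simp add: norm_divide)
  show "pole b x1 x2 x3 x4 ir \<notin> path_image (circ 1)" "1 / pole b x1 x2 x3 x4 ir \<notin> path_image (circ 1)"
    using p ip by auto
  show "winding_number (circ 1) (pole b x1 x2 x3 x4 ir) = 1"
    using p by (intro winding_number_circlepath) auto
  show "winding_number (circ 1) (1 / pole b x1 x2 x3 x4 ir) = 0"
    by (rule winding_number_zero_outside[of _ "cball 0 1"]) (use ip in auto)
qed (auto intro: homotopic_loops_circ)

text \<open>The power of \<open>s\<close> by which a pole is multiplied when the parameters are scaled by
  \<open>s\<close>.\<close>

definition pole_exp :: "nat \<times> nat \<Rightarrow> nat" where "pole_exp ir = (if snd ir < 4 then 1 else 0)"

lemma pole_scale: "pole b (s * x1) (s * x2) (s * x3) (s * x4) ir = s ^ pole_exp ir * pole b x1 x2 x3 x4 ir"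
  by (cases ir) (auto simp: pole_def pole_exp_def)

lemma pole_exp_0: "norm b < 1 \<Longrightarrow> pole_exp ir = 0 \<Longrightarrow> norm (pole b x1 x2 x3 x4 ir) < 1"
  using norm_csqrt_lt_1 by (cases ir) (auto simp: pole_def pole_exp_def split: if_splits)

lemma finite_monomial_roots: "0 < n \<Longrightarrow> finite {s::complex. s ^ n * c = 1}"
proof -
  assume n: "0 < n"
  have "monom c n - 1 \<noteq> 0"
  proof
    assume "monom c n - 1 = 0"
    hence "coeff (monom c n) 0 = coeff 1 0" by simp
    thus False using n by simp
  qed
  hence "finite {s. poly (monom c n - 1) s = 0}" by (rule poly_roots_finite)
  moreover have "{s. poly (monom c n - 1) s = 0} = {s. s ^ n * c = 1}"
    by (auto simp: poly_monom mult_ac)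
  ultimately show ?thesis by simp
qed

lemma holomorphic_pole_sum:
  assumes S: "open S" and b: "norm b * R^2 * norm q ^ m < 1" and \<rho>: "1 < \<rho>" "\<rho> < R"
    and x: "norm x1 * 2 * R * norm q ^ m < 1" "norm x2 * 2 * R * norm q ^ m < 1" "norm x3 * 2 * R * norm q ^ m < 1" "norm x4 * 2 * R * norm q ^ m < 1"
    and s2: "\<And>s. s \<in> S \<Longrightarrow> norm s < 2"
    and p\<rho>: "\<And>s ir. s \<in> S \<Longrightarrow> norm (pole b (s * x1) (s * x2) (s * x3) (s * x4) ir) < \<rho>"
    and p0: "\<And>s ir. s \<in> S \<Longrightarrow> pole b (s * x1) (s * x2) (s * x3) (s * x4) ir \<noteq> 0"
    and ne: "\<And>s i j. s \<in> S \<Longrightarrow> i \<in> pole_indices m \<Longrightarrow> j \<in> pole_indices m \<Longrightarrow> i \<noteq> j \<Longrightarrow>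
        pole b (s * x1) (s * x2) (s * x3) (s * x4) i \<noteq> pole b (s * x1) (s * x2) (s * x3) (s * x4) j"
    and ne1: "\<And>s i j. s \<in> S \<Longrightarrow> i \<in> pole_indices m \<Longrightarrow> j \<in> pole_indices m \<Longrightarrow>
        pole b (s * x1) (s * x2) (s * x3) (s * x4) i * pole b (s * x1) (s * x2) (s * x3) (s * x4) j \<noteq> 1"
  shows "(\<lambda>s. pole_sum (pole_indices m) (pole b (s * x1) (s * x2) (s * x3) (s * x4)) \<rho> (cofactor m b (s * x1) (s * x2) (s * x3) (s * x4))) holomorphic_on S"
proof -
  let ?p = "\<lambda>s. pole b (s * x1) (s * x2) (s * x3) (s * x4)"
  have hp: "(\<lambda>s. ?p s ir) holomorphic_on A" for ir A
    unfolding pole_scale by (intro holomorphic_intros)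
  have R0: "0 < R" using \<rho> by simp
  have \<rho>R: "1 / R < \<rho>"
  proof -
    have "1 / R < 1" using \<rho> by simp
    thus ?thesis using \<rho> by linarith
  qed
  have xs: "norm (s * y) * R * norm q ^ m < 1" if "s \<in> S" "norm y * 2 * R * norm q ^ m < 1" for s y
  proof -
    have "norm (s * y) * R * norm q ^ m = norm y * norm s * R * norm q ^ m" by (simp add: norm_mult)
    also have "\<dots> \<le> norm y * 2 * R * norm q ^ m"
      using s2[OF that(1)] R0 by (intro mult_right_mono mult_left_mono) auto
    finally show ?thesis using that by simp
  qed
  have hc: "(\<lambda>s. cint (circ \<rho>) (\<lambda>z. cofactor m b (s * x1) (s * x2) (s * x3) (s * x4) z * ((z + ?p s i) / (z - ?p s i)))) holomorphic_on S" for i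
  proof (rule holomorphic_cint[OF _ S])
    show "0 < \<rho>" using \<rho> by simp
    have "continuous_on (S \<times> sphere 0 \<rho>) (\<lambda>w. ?p (fst w) i)"
      unfolding pole_scale by (intro continuous_intros)
    moreover have "snd w - ?p (fst w) i \<noteq> 0" if "w \<in> S \<times> sphere 0 \<rho>" for w
      using p\<rho>[of "fst w" i] that by auto
    ultimately show "continuous_on (S \<times> sphere 0 \<rho>) (\<lambda>(s, z). cofactor m b (s * x1) (s * x2) (s * x3) (s * x4) z * ((z + ?p s i) / (z - ?p s i)))"
      unfolding case_prod_unfold
      by (intro continuous_intros cofactor_continuous_param[OF R0 b \<rho>R \<rho>(2)] xs x) auto
    fix z :: complex assume z: "norm z = \<rho>"
    have "z - ?p s i \<noteq> 0" if "s \<in> S" for s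
      using p\<rho>[OF that, of i] z by auto
    thus "(\<lambda>s. cofactor m b (s * x1) (s * x2) (s * x3) (s * x4) z * ((z + ?p s i) / (z - ?p s i))) holomorphic_on S"
      using z \<rho> \<rho>R by (intro holomorphic_intros cofactor_holomorphic_param[OF R0 b] xs x hp) auto
  qed
  show ?thesis
    unfolding pole_sum_def
  proof (intro holomorphic_intros hp hc)
    fix i s assume i: "i \<in> pole_indices m" and s: "s \<in> S"
    show "1 - (?p s i)^2 \<noteq> 0" using ne1[OF s i i] by (simp add: power2_eq_square)
    show "?p s i \<noteq> 0" by (rule p0[OF s])
    fix j assume j: "j \<in> pole_indices m - {i}"
    show "(1 - ?p s j * ?p s i) * (1 - ?p s j / ?p s i) \<noteq> 0"
    proof -
      have "p' \<noteq> p \<Longrightarrow> p \<noteq> 0 \<Longrightarrow> 1 - p' / p \<noteq> 0" for p p' :: complex by simp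
      thus ?thesis using ne1[OF s, of j i] ne[OF s, of j i] i j p0[OF s, of i] by simp
    qed
  qed
qed

end

section \<open>Contours with pairwise distinct poles\<close>

text \<open>Any larger annulus will do as well, which leaves room for further conditions on
  \<open>R\<close>.\<close>

lemma loop_in_annulus:
  assumes "path g" "path_image g \<subseteq> - {0 :: complex}"
  obtains R0 where "1 < R0" "\<And>R. R0 \<le> R \<Longrightarrow> path_image g \<subseteq> annulus (1 / R) R"
proof -
  have comp: "compact (path_image g)" by (rule compact_path_image[OF assms(1)])
  then obtain B where B: "\<And>z. z \<in> path_image g \<Longrightarrow> norm z \<le> B"
    using compact_imp_bounded bounded_iff by metis
  have "open (- path_image g)" "0 \<in> - path_image g"
    using comp assms(2) by (auto intro: compact_imp_closed)
  then obtain d where d: "0 < d" "ball 0 d \<subseteq> - path_image g"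
    using open_contains_ball by metis
  define R0 where "R0 = 2 + \<bar>B\<bar> + 2 / d"
  show ?thesis
  proof (rule that)
    show "1 < R0" using d by (simp add: R0_def add_pos_nonneg)
    fix R assume R: "R0 \<le> R"
    have pos: "0 < 2 / d" using d by simp
    have RB: "B < R" and Rd: "2 / d < R" and R0: "0 < R" using R pos unfolding R0_def by linarith+
    have "1 / R < d"
    proof -
      have "2 < d * R" using Rd d by (simp add: field_simps)
      hence "1 < d * R" by simp
      thus ?thesis using R0 by (simp add: field_simps)
    qed
    moreover have "d \<le> norm z" if "z \<in> path_image g" for z
      using d(2) that by (force simp: subset_iff)
    ultimately show "path_image g \<subseteq> annulus (1 / R) R"
      using B RB by (fastforce simp: annulus_def)
  qed
qed

context nome
begin

definition integral_identity :: "complex \<Rightarrow> complex \<Rightarrow> complex \<Rightarrow> complex \<Rightarrow> complex \<Rightarrow> (real \<Rightarrow> complex) \<Rightarrow> bool" where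
  "integral_identity b x1 x2 x3 x4 \<gamma> \<longleftrightarrow>
     P q * (P (b * (x1 * x2 * x3 * x4)) * pairs P x1 x2 x3 x4) * cint \<gamma> (integrand b x1 x2 x3 x4) = 2 * P b * Wser b x1 x2 x3 x4"

lemma exists_power_small:
  obtains m where "m > 0" "C * norm q ^ m < 1"
proof -
  have "0 < \<bar>C\<bar> + 1" by linarith
  then obtain n where n: "norm q ^ n < 1 / (\<bar>C\<bar> + 1)"
    using real_arch_pow_inv[of "1 / (\<bar>C\<bar> + 1)" "norm q"] q_less_1 by auto
  show ?thesis
  proof (rule that[of "Suc n"])
    have "norm q ^ Suc n \<le> norm q ^ n"
      using q_less_1 by (intro power_decreasing) auto
    hence "(\<bar>C\<bar> + 1) * norm q ^ Suc n \<le> (\<bar>C\<bar> + 1) * norm q ^ n"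
      by (intro mult_left_mono) auto
    also have "\<dots> < 1" using n by (simp add: pos_less_divide_eq mult.commute)
    finally have "(\<bar>C\<bar> + 1) * norm q ^ Suc n < 1" .
    moreover have "C * norm q ^ Suc n \<le> (\<bar>C\<bar> + 1) * norm q ^ Suc n"
      by (intro mult_right_mono) auto
    ultimately show "C * norm q ^ Suc n < 1" by linarith
  qed simp
qed

text \<open>Scale the parameters by \<open>s\<close>. With \<open>m\<close>, \<open>R\<close> and
  \<open>\<rho>\<close> chosen once for all \<open>|s| < 2\<close>, the sum over the poles is holomorphic in
  \<open>s\<close> outside the finite set where two poles coincide or are reciprocal. For small \<open>s\<close>
  it is the integral over the unit circle, at \<open>s = 1\<close> the integral over
  \<open>\<gamma>\<close>.\<close>

lemma integral_identity_distinct: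
  assumes b: "0 < norm b" "norm b < 1" and x0: "x1 \<noteq> 0" "x2 \<noteq> 0" "x3 \<noteq> 0" "x4 \<noteq> 0"
    and g: "good_path b x1 x2 x3 x4 \<gamma>"
    and inj: "\<And>m. inj_on (pole b x1 x2 x3 x4) (pole_indices m)"
  shows "integral_identity b x1 x2 x3 x4 \<gamma>"
proof -
  obtain \<delta> where \<delta>: "0 < \<delta>" "\<delta> < 1"
    and small: "\<And>b x1 x2 x3 x4. 0 < norm b \<Longrightarrow> norm b < 1 \<Longrightarrow> norm x1 \<le> \<delta> \<Longrightarrow> norm x2 \<le> \<delta> \<Longrightarrow> norm x3 \<le> \<delta> \<Longrightarrow> norm x4 \<le> \<delta> \<Longrightarrow>
       P q * Fint b x1 x2 x3 x4 = 2 * P b * Fser b x1 x2 x3 x4"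
    by (rule small_parameters_identity) blast
  have b0: "b \<noteq> 0" using b by auto
  have path: "path \<gamma>" and im: "path_image \<gamma> \<subseteq> - {0}"
    using g homotopic_loops_imp_subset valid_path_imp_path unfolding good_path_def by blast+
  obtain R0 where R0: "1 < R0" "\<And>R. R0 \<le> R \<Longrightarrow> path_image \<gamma> \<subseteq> annulus (1 / R) R"
    by (rule loop_in_annulus[OF path im]) blast
  define M where "M = norm x1 + norm x2 + norm x3 + norm x4"
  have M: "norm x1 \<le> M" "norm x2 \<le> M" "norm x3 \<le> M" "norm x4 \<le> M" "0 \<le> M"
    unfolding M_def by (auto simp: add_nonneg_nonneg add_increasing add_increasing2)
  \<comment> \<open>\<open>\<rho>\<close> exceeds all poles for \<open>|s| < 2\<close>, \<open>R\<close> also contains the path, and \<open>m\<close> leaves no pole of the cofactor in the annulus.\<close>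
  define \<rho> where "\<rho> = 2 + 2 * M"
  define R where "R = R0 + \<rho>"
  have \<rho>: "1 < \<rho>" "\<rho> < R" "1 < R" and R: "R0 \<le> R" "0 < R" using M R0(1) unfolding \<rho>_def R_def by linarith+
  obtain m where m: "m > 0" "(norm b * R^2 + M * 2 * R) * norm q ^ m < 1"
    by (rule exists_power_small)
  have mb: "norm b * R^2 * norm q ^ m < 1"
  proof -
    have "norm b * R^2 * norm q ^ m \<le> (norm b * R^2 + M * 2 * R) * norm q ^ m"
      using M R by (intro mult_right_mono) auto
    thus ?thesis using m(2) by linarith
  qed
  have mx2: "norm x * 2 * R * norm q ^ m < 1" if "norm x \<le> M" for x :: complex
  proof -
    have "norm x * 2 * R * norm q ^ m \<le> M * 2 * R * norm q ^ m"
      using that R by (intro mult_right_mono) auto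
    also have "\<dots> \<le> (norm b * R^2 + M * 2 * R) * norm q ^ m"
      by (intro mult_right_mono) auto
    finally show ?thesis using m(2) by linarith
  qed
  have mx: "norm x * R * norm q ^ m < 1" if "norm x \<le> M" for x :: complex
  proof -
    have "0 \<le> norm x * R * norm q ^ m" using R by simp
    thus ?thesis using mx2[OF that] by linarith
  qed
  let ?d = "pole b x1 x2 x3 x4"
  let ?p = "\<lambda>s. pole b (s * x1) (s * x2) (s * x3) (s * x4)"
  \<comment> \<open>The values of \<open>s\<close> where two poles are reciprocal (possibly a pole to itself) or coincide.\<close>
  define Bad where "Bad = {0} \<union>
     (\<Union>(i, j) \<in> {(i, j). i \<in> pole_indices m \<and> j \<in> pole_indices m \<and> 0 < pole_exp i + pole_exp j}. {s. s ^ (pole_exp i + pole_exp j) * (?d i * ?d j) = 1}) \<union>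
     (\<Union>(i, j) \<in> {(i, j). i \<in> pole_indices m \<and> j \<in> pole_indices m \<and> i \<noteq> j}. {?d i / ?d j})"
  have "finite Bad"
    unfolding Bad_def
  proof (intro finite_UnI finite_UN_I; (clarsimp intro!: finite_monomial_roots)?)
    show "finite {(i, j). i \<in> pole_indices m \<and> j \<in> pole_indices m \<and> (0 < pole_exp i \<or> 0 < pole_exp j)}"
      by (rule finite_subset[of _ "pole_indices m \<times> pole_indices m"]) auto
    show "finite {(i, j). i \<in> pole_indices m \<and> j \<in> pole_indices m \<and> i \<noteq> j}"
      by (rule finite_subset[of _ "pole_indices m \<times> pole_indices m"]) auto
  qed
  define S where "S = ball 0 2 - Bad"
  have S: "open S" unfolding S_def using \<open>finite Bad\<close> by (intro open_Diff finite_imp_closed) auto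
  have conn: "connected S" unfolding S_def
    using \<open>finite Bad\<close> by (intro connected_open_diff_countable) (auto intro: countable_finite)
  have d0: "?d i \<noteq> 0" for i by (rule pole_nz[OF b0 x0])
  have one: "1 \<in> S"
  proof -
    have "?d i * ?d j \<noteq> 1" for i j
    proof
      assume "?d i * ?d j = 1"
      hence "?d i = 1 / ?d j" using d0 by (simp add: field_simps)
      thus False using g unfolding good_path_def by (metis zero_neq_one)
    qed
    moreover have "?d i / ?d j \<noteq> 1" if "i \<in> pole_indices m" "j \<in> pole_indices m" "i \<noteq> j" for i j
      using inj_onD[OF inj, of i j m] that d0 by auto
    ultimately show ?thesis
      unfolding S_def Bad_def by fastforce
  qed
  have s2: "norm s < 2" "s \<noteq> 0" if "s \<in> S" for s using that by (auto simp: S_def Bad_def)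
  have p\<rho>: "norm (?p s ir) < \<rho>" if "norm s < 2" for s ir
  proof -
    have "norm (s * x) < \<rho>" if x: "norm x \<le> M" for x
    proof -
      have "norm (s * x) \<le> 2 * M" using \<open>norm s < 2\<close> x M unfolding norm_mult by (intro mult_mono) auto
      thus ?thesis by (simp add: \<rho>_def)
    qed
    thus ?thesis using M \<rho> b by (intro norm_pole_lt) auto
  qed
  have p0: "?p s ir \<noteq> 0" if "s \<in> S" for s ir
    using s2[OF that] d0 by (simp add: pole_scale)
  have ne: "?p s i \<noteq> ?p s j" if s: "s \<in> S" and ij: "i \<in> pole_indices m" "j \<in> pole_indices m" "i \<noteq> j" for s i j
  proof
    assume eq: "?p s i = ?p s j"
    have dij: "?d i \<noteq> ?d j" using inj_onD[OF inj, of i j m] ij by blast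
    have s0: "s \<noteq> 0" by (rule s2[OF s])
    have e: "pole_exp i \<in> {0, 1}" "pole_exp j \<in> {0, 1}" by (auto simp: pole_exp_def)
    have "?d i / ?d j \<in> Bad" "?d j / ?d i \<in> Bad"
      unfolding Bad_def by (rule UnI2, rule UN_I[of "(i, j)"]; use ij in simp)
        (rule UnI2, rule UN_I[of "(j, i)"]; use ij in simp)
    hence nb: "s \<noteq> ?d i / ?d j" "s \<noteq> ?d j / ?d i"
      using s unfolding S_def by blast+
    show False
    proof (cases "pole_exp i = pole_exp j")
      case True
      thus False using eq dij s0 by (simp add: pole_scale)
    next
      case False
      with e have "(pole_exp i = 0 \<and> pole_exp j = 1) \<or> (pole_exp i = 1 \<and> pole_exp j = 0)" by auto
      thus False using eq nb d0[of i] d0[of j] by (auto simp: pole_scale field_simps)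
    qed
  qed
  have ne1: "?p s i * ?p s j \<noteq> 1" if s: "s \<in> S" and ij: "i \<in> pole_indices m" "j \<in> pole_indices m" for s i j
  proof (cases "0 < pole_exp i + pole_exp j")
    case True
    have "s ^ (pole_exp i + pole_exp j) * (?d i * ?d j) \<noteq> 1"
    proof
      assume "s ^ (pole_exp i + pole_exp j) * (?d i * ?d j) = 1"
      hence "s \<in> Bad"
        unfolding Bad_def by (intro UnI1 UnI2 UN_I[of "(i, j)"]) (use ij True in auto)
      thus False using s by (simp add: S_def)
    qed
    thus ?thesis by (simp add: pole_scale power_add mult_ac)
  next
    case False
    have "norm (?p s i * ?p s j) < 1"
      using False b by (intro norm_mult_lt_1 pole_exp_0) auto
    thus ?thesis by auto
  qed
  let ?\<Phi> = "\<lambda>s. pole_sum (pole_indices m) (?p s) \<rho> (cofactor m b (s * x1) (s * x2) (s * x3) (s * x4))"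
  let ?f = "\<lambda>s. P q * (P (b * (s * x1 * (s * x2) * (s * x3) * (s * x4))) * pairs P (s * x1) (s * x2) (s * x3) (s * x4)) * ?\<Phi> s"
  let ?g = "\<lambda>s. 2 * P b * Wser b (s * x1) (s * x2) (s * x3) (s * x4)"
  have holf: "?f holomorphic_on S"
    unfolding pairs_def
    by (intro holomorphic_intros holomorphic_pole_sum[OF S mb \<rho>(1,2)] mx2 M s2(1) p\<rho> p0 ne ne1)
  have holg: "?g holomorphic_on S"
    using b by (intro holomorphic_intros holomorphic_Wser S) auto
  define e where "e = \<delta> / (1 + M)"
  have e: "0 < e" "e * M \<le> \<delta>" "e \<le> 1"
  proof -
    show "0 < e" using \<delta> M by (simp add: e_def add_pos_nonneg)
    have "\<delta> * M \<le> \<delta> * (1 + M)" "\<delta> \<le> 1 + M" using \<delta> M by (auto intro: mult_left_mono)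
    thus "e * M \<le> \<delta>" "e \<le> 1" using M by (simp_all add: e_def field_simps add_pos_nonneg)
  qed
  have "?f 1 = ?g 1"
  proof (rule analytic_continuation_open[of "ball 0 e - Bad" S ?f ?g])
    show "open (ball 0 e - Bad)" using \<open>finite Bad\<close> by (intro open_Diff finite_imp_closed) auto
    show "ball 0 e - Bad \<noteq> {}"
    proof
      assume "ball 0 e - Bad = {}"
      hence "ball 0 e \<subseteq> Bad" by blast
      hence "finite (ball (0::complex) e)" using \<open>finite Bad\<close> finite_subset by blast
      thus False using e finite_imp_not_open[of "ball (0::complex) e"] by auto
    qed
    show "ball 0 e - Bad \<subseteq> S" using e by (auto simp: S_def)
    fix s assume s: "s \<in> ball 0 e - Bad"
    hence sS: "s \<in> S" using e by (auto simp: S_def)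
    have sx: "norm (s * x) \<le> \<delta>" if "norm x \<le> M" for x :: complex
    proof -
      have "norm (s * x) \<le> e * M" using s that M e(1) unfolding norm_mult by (intro mult_mono) auto
      thus ?thesis using e by linarith
    qed
    have sx1: "norm (s * x) < 1" if "norm x \<le> M" for x :: complex
      using sx[OF that] \<delta> by linarith
    have sm: "norm (s * x) * R * norm q ^ m < 1" if "norm x \<le> M" for x :: complex
    proof -
      have "norm s \<le> 1" using s e by auto
      hence "norm (s * x) * R * norm q ^ m \<le> norm x * R * norm q ^ m"
        using R unfolding norm_mult by (intro mult_right_mono) (auto intro: mult_left_le_one_le)
      thus ?thesis using mx[OF that] by linarith
    qed
    have s0: "s * x \<noteq> 0" if "x \<noteq> 0" for x using s2[OF sS] that by simp
    have "\<not> (R \<le> 1)" using \<rho> by simp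
    hence circR: "path_image (circ 1) \<subseteq> annulus (1 / R) R"
      using \<rho> by (auto simp: annulus_def)
    have "cint (circ 1) (integrand b (s * x1) (s * x2) (s * x3) (s * x4)) = ?\<Phi> s"
    proof (rule cint_integrand_eq_pole_sum[OF b0 s0[OF x0(1)] s0[OF x0(2)] s0[OF x0(3)] s0[OF x0(4)] m(1) mb
          sm[OF M(1)] sm[OF M(2)] sm[OF M(3)] sm[OF M(4)] \<rho>(1,2)])
      show "norm (?p s ir) < \<rho>" for ir by (rule p\<rho>[OF s2(1)[OF sS]])
      show "good_path b (s * x1) (s * x2) (s * x3) (s * x4) (circ 1)"
        by (intro good_path_circ b b0 sx1 s0 M x0)
      show "inj_on (?p s) (pole_indices m)" using ne[OF sS] by (auto intro!: inj_onI)
    qed (rule circR)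
    moreover have "P q * Fint b (s * x1) (s * x2) (s * x3) (s * x4) = 2 * P b * Fser b (s * x1) (s * x2) (s * x3) (s * x4)"
      by (intro small b sx M)
    ultimately have 1: "P q * ?\<Phi> s = 2 * P b * Fser b (s * x1) (s * x2) (s * x3) (s * x4)"
      by (simp add: Fint_def)
    have nz: "P (b * (s * x1 * (s * x2) * (s * x3) * (s * x4))) * pairs P (s * x1) (s * x2) (s * x3) (s * x4) \<noteq> 0"
      by (intro Fser_denominator_nz b sx1 M)
    have alg: "D \<noteq> 0 \<Longrightarrow> A * \<Phi> = B * (N / D) \<Longrightarrow> A * D * \<Phi> = B * N" for A B D N \<Phi> :: complex
      by (simp add: field_simps)
    show "?f s = ?g s"
      by (rule alg[OF nz 1[unfolded Fser_def]])
  qed (use S conn one holf holg in auto)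
  moreover have "cint \<gamma> (integrand b x1 x2 x3 x4) = pole_sum (pole_indices m) ?d \<rho> (cofactor m b x1 x2 x3 x4)"
  proof (rule cint_integrand_eq_pole_sum[OF b0 x0 m(1) mb mx[OF M(1)] mx[OF M(2)] mx[OF M(3)] mx[OF M(4)] \<rho>(1,2) _ g R0(2)[OF R(1)] inj])
    show "norm (?d ir) < \<rho>" for ir using p\<rho>[of 1 ir] by simp
  qed
  ultimately show ?thesis by (simp add: integral_identity_def)
qed

end

section \<open>Admissible contours\<close>

text \<open>Only the piecewise differentiability of the path is known, so the integrals are compared through a
  bound that is uniform for holomorphic functions near the path.\<close>

lemma isCont_contour_integral:
  fixes f :: "'a :: {real_normed_vector, heine_borel} \<Rightarrow> complex \<Rightarrow> complex"
  assumes g: "valid_path g" and D: "open D" "\<And>z. z \<in> path_image g \<Longrightarrow> (p0, z) \<in> D"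
    and cont: "continuous_on D (\<lambda>(p, z). f p z)"
    and hol: "\<And>p S. (\<And>z. z \<in> S \<Longrightarrow> (p, z) \<in> D) \<Longrightarrow> f p holomorphic_on S"
  shows "isCont (\<lambda>p. contour_integral g (f p)) p0"
proof -
  have comp: "compact (path_image g)" by (rule compact_path_image[OF valid_path_imp_path[OF g]])
  have "compact ({p0} \<times> path_image g)" by (intro compact_Times comp) auto
  moreover have "{p0} \<times> path_image g \<subseteq> D" using D(2) by auto
  ultimately obtain e where e: "0 < e" "(\<Union>x\<in>{p0} \<times> path_image g. ball x e) \<subseteq> D"
    using compact_subset_open_imp_ball_epsilon_subset[of "{p0} \<times> path_image g" D] D(1) by auto
  define d where "d = e / 2"
  have d: "0 < d" "d + d = e" using e by (auto simp: d_def)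
  define S where "S = (\<Union>z\<in>path_image g. ball z d)"
  have S: "open S" "path_image g \<subseteq> S" using d by (auto simp: S_def)
  have inD: "(p, w) \<in> D" if pd: "dist p0 p < d" and w: "w \<in> S" for p w
  proof -
    obtain z where z: "z \<in> path_image g" "dist z w < d" using w by (auto simp: S_def)
    have "dist (p0, z) (p, w) \<le> dist p0 p + dist z w"
      unfolding dist_Pair_Pair by (rule sqrt_sum_squares_le_sum) auto
    also have "\<dots> < e" using pd z d by linarith
    finally have "(p, w) \<in> (\<Union>x\<in>{p0} \<times> path_image g. ball x e)"
      using z by (intro UN_I[of "(p0, z)"]) auto
    thus ?thesis using e(2) by blast
  qed
  define K where "K = (\<lambda>x. fst x + snd x) ` (path_image g \<times> cball 0 (d / 2))"
  have K: "compact K"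
    unfolding K_def by (intro compact_continuous_image compact_Times comp compact_cball continuous_intros)
  have KS: "K \<subseteq> S" using d unfolding K_def S_def by (force simp: dist_norm)
  define S' where "S' = (\<Union>z\<in>path_image g. ball z (d / 2))"
  have S': "open S'" "path_image g \<subseteq> S'" "S' \<subseteq> K"
  proof -
    show "S' \<subseteq> K"
    proof
      fix w assume "w \<in> S'"
      then obtain z where z: "z \<in> path_image g" "dist z w < d / 2" by (auto simp: S'_def)
      thus "w \<in> K" unfolding K_def by (intro image_eqI[of _ _ "(z, w - z)"]) (auto simp: dist_norm norm_minus_commute)
    qed
  qed (use d in \<open>auto simp: S'_def\<close>)
  have "\<exists>L. 0 < L \<and> (\<forall>h B. h holomorphic_on S' \<and> (\<forall>z \<in> S'. norm (h z) \<le> B) \<longrightarrow> norm (contour_integral g h) \<le> L * B)"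
    by (rule contour_integral_bound_exists[OF S'(1) g S'(2)])
  then obtain L where L: "0 < L"
      "\<And>h B. h holomorphic_on S' \<Longrightarrow> (\<forall>z \<in> S'. norm (h z) \<le> B) \<Longrightarrow> norm (contour_integral g h) \<le> L * B"
    by blast
  have "compact (cball p0 (d / 2) \<times> K)" by (intro compact_Times K compact_cball)
  moreover have sub: "cball p0 (d / 2) \<times> K \<subseteq> D" using inD KS d by force
  ultimately have uc: "uniformly_continuous_on (cball p0 (d / 2) \<times> K) (\<lambda>(p, z). f p z)"
    by (intro compact_uniformly_continuous continuous_on_subset[OF cont]) auto
  have integ: "f p contour_integrable_on g" if "dist p0 p < d" for p
  proof (rule contour_integrable_holomorphic_simple[OF _ S(1) g S(2)])
    show "f p holomorphic_on S" by (rule hol) (use inD that in blast)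
  qed
  show ?thesis
    unfolding continuous_at_eps_delta
  proof (intro allI impI)
    fix \<epsilon> :: real assume \<epsilon>: "0 < \<epsilon>"
    have "0 < \<epsilon> / (2 * L)" using \<epsilon> L by simp
    then obtain \<eta> where \<eta>: "0 < \<eta>"
      "\<And>x x'. x \<in> cball p0 (d / 2) \<times> K \<Longrightarrow> x' \<in> cball p0 (d / 2) \<times> K \<Longrightarrow> dist x' x < \<eta> \<Longrightarrow>
          dist (case x' of (p, z) \<Rightarrow> f p z) (case x of (p, z) \<Rightarrow> f p z) < \<epsilon> / (2 * L)"
      using uc unfolding uniformly_continuous_on_def by blast
    show "\<exists>d'>0. \<forall>p. dist p p0 < d' \<longrightarrow> dist (contour_integral g (f p)) (contour_integral g (f p0)) < \<epsilon>"
    proof (intro exI[of _ "min \<eta> (d / 2)"] conjI allI impI)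
      show "0 < min \<eta> (d / 2)" using \<eta> d by simp
      fix p assume p: "dist p p0 < min \<eta> (d / 2)"
      have pd: "dist p0 p < d" "dist p0 p0 < d" using p d by (auto simp: dist_commute)
      have "norm (contour_integral g (\<lambda>z. f p z - f p0 z)) \<le> L * (\<epsilon> / (2 * L))"
      proof (rule L(2))
        show "(\<lambda>z. f p z - f p0 z) holomorphic_on S'"
          by (intro holomorphic_intros hol) (use inD pd S'(3) KS in blast)+
        show "\<forall>z\<in>S'. norm (f p z - f p0 z) \<le> \<epsilon> / (2 * L)"
        proof
          fix z assume "z \<in> S'"
          hence "z \<in> K" using S' by blast
          hence "dist (case (p, z) of (p, z) \<Rightarrow> f p z) (case (p0, z) of (p, z) \<Rightarrow> f p z) < \<epsilon> / (2 * L)"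
            using p d by (intro \<eta>(2)) (auto simp: dist_Pair_Pair dist_commute)
          thus "norm (f p z - f p0 z) \<le> \<epsilon> / (2 * L)" by (simp add: dist_norm)
        qed
      qed
      also have "L * (\<epsilon> / (2 * L)) < \<epsilon>" using L \<epsilon> by simp
      finally show "dist (contour_integral g (f p)) (contour_integral g (f p0)) < \<epsilon>"
        by (simp add: contour_integral_diff[OF integ[OF pd(1)] integ[OF pd(2)]] dist_norm)
    qed
  qed
qed

context nome
begin

lemma outer_point_of_P_zero:
  assumes "x * z * q ^ r = 1"
  shows "P (x * z) = 0"
  using assms by (auto simp: P_eq_0_iff)

text \<open>The reciprocal of every pole is an outer point.\<close>

lemma admissible_imp_good_path:
  fixes t :: "complex ^ 4"
  assumes adm: "admissible b t q \<gamma>" and b: "b \<noteq> 0" and t: "\<And>r. t $ r \<noteq> 0"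
  shows "good_path b (t $ 1) (t $ 2) (t $ 3) (t $ 4) \<gamma>"
proof -
  let ?p = "pole b (t $ 1) (t $ 2) (t $ 3) (t $ 4)"
  have "1 / ?p ir \<in> outer_points b t q" for ir
  proof -
    obtain i r where ir: "ir = (i, r)" by (cases ir)
    have t_zero: "P (t $ j * (1 / (t $ j * q ^ i))) = 0" for j
      by (rule outer_point_of_P_zero[of _ _ i]) (use t q_nz in \<open>simp add: field_simps\<close>)
    have b_zero: "P (b * (1 / c)^2) = 0" if "c^2 = b * q ^ i" for c
      by (rule outer_point_of_P_zero[of _ _ i]) (use b q_nz in \<open>simp add: power_divide that\<close>)
    have "?p ir \<in> range (\<lambda>j. t $ j * q ^ i) \<or> (?p ir)^2 = b * q ^ i"
      using rangeI[of "\<lambda>j. t $ j * q ^ i"] unfolding ir pole_def by (simp del: mult_cancel_right)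
    then consider j where "?p ir = t $ j * q ^ i" | "(?p ir)^2 = b * q ^ i" by blast
    thus ?thesis
    proof cases
      case 1
      thus ?thesis unfolding outer_points_def using t_zero[of j] by (simp only: mem_Collect_eq) blast
    next
      case 2
      thus ?thesis unfolding outer_points_def using b_zero[of "?p ir"] by auto
    qed
  qed
  moreover have "inverse (1 / ?p ir) = ?p ir" for ir by (simp add: inverse_eq_divide)
  ultimately show ?thesis
    using adm unfolding admissible_def good_path_def by metis
qed

text \<open>Outer points that are far away never meet the path, so only a compact set of positions has to be
  avoided, and the parameters with an outer point in a compact set form a closed set.\<close>

lemma admissible_open:
  assumes adm: "admissible b0 t0 q \<gamma>"
  obtains N where "open N" "(b0, t0) \<in> N" "\<And>b t. (b, t) \<in> N \<Longrightarrow> admissible b t q \<gamma>"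
proof -
  let ?\<Gamma> = "path_image \<gamma>"
  have vp: "valid_path \<gamma>" and hom: "homotopic_loops (- {0}) (circ 1) \<gamma>"
    using adm by (auto simp: admissible_def)
  have path: "path \<gamma>" using vp valid_path_imp_path by blast
  have loop: "pathfinish \<gamma> = pathstart \<gamma>" using homotopic_loops_imp_loop[OF hom] by simp
  have im: "?\<Gamma> \<subseteq> - {0}" using homotopic_loops_imp_subset[OF hom] by simp
  obtain R where R: "1 < R" "?\<Gamma> \<subseteq> annulus (1 / R) R"
    by (rule loop_in_annulus[OF path im]) blast
  have n0: "winding_number \<gamma> 0 = 1"
    using winding_number_homotopic_loops[OF hom] by (simp add: winding_number_circlepath)
  have far: "z \<notin> ?\<Gamma> \<and> inverse z \<notin> ?\<Gamma> \<and> winding_number \<gamma> z = 0 \<and> winding_number \<gamma> (inverse z) = 1"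
    if z: "R < norm z" for z
  proof -
    have iz: "norm (inverse z) < 1 / R"
      using z R(1) by (simp add: norm_divide inverse_eq_divide frac_less2)
    have disj: "ball 0 (1 / R) \<inter> ?\<Gamma> = {}" using R(2) by (force simp: annulus_def)
    have "winding_number \<gamma> (inverse z) = winding_number \<gamma> 0"
      by (rule winding_number_eq[OF path loop _ _ _ disj]) (use iz R in auto)
    moreover have "winding_number \<gamma> z = 0"
      by (rule winding_number_zero_outside[OF path convex_cball[of 0 R] loop]) (use z R in \<open>auto simp: annulus_def\<close>)
    ultimately show ?thesis using n0 z iz R by (force simp: annulus_def)
  qed
  define A0 where "A0 = {z. z \<notin> ?\<Gamma> \<and> winding_number \<gamma> z = 0}"
  define A1 where "A1 = {z. z \<notin> ?\<Gamma> \<and> winding_number \<gamma> z = 1}"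
  \<comment> \<open>The admissible positions of an outer point.\<close>
  define W where "W = A0 \<inter> {z \<in> - {0}. inverse z \<in> A1}"
  have "open A0" "open A1" unfolding A0_def A1_def by (rule open_winding_number_levelsets[OF path loop])+
  moreover have "open {z \<in> - {0}. inverse z \<in> A1}"
    using continuous_open_preimage[of "- {0}" inverse A1] \<open>open A1\<close>
    by (simp add: continuous_on_inverse continuous_on_id Int_def vimage_def open_Compl)
  ultimately have W: "open W" unfolding W_def by blast
  define K where "K = cball 0 R - W"
  have K: "compact K" unfolding K_def by (intro compact_diff compact_cball W)
  define C where "C = {(z :: complex, p :: complex \<times> (complex ^ 4)). (\<exists>r. P (snd p $ r * z) = 0) \<or> P (fst p * z^2) = 0}"
  have C: "closed C"
  proof -
    have "C = (\<Union>r\<in>(UNIV::4 set). {x :: complex \<times> complex \<times> (complex ^ 4). P (snd (snd x) $ r * fst x) = 0}) \<union> {x :: complex \<times> complex \<times> (complex ^ 4). P (fst (snd x) * (fst x)^2) = 0}"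
      by (auto simp: C_def)
    also have "closed \<dots>"
      by (intro closed_Un closed_UN closed_Collect_eq continuous_intros finite ballI)
    finally show ?thesis .
  qed
  define N where "N = - {p. \<exists>z. z \<in> K \<and> (z, p) \<in> C}"
  have outer: "(z, (b, t)) \<in> C \<longleftrightarrow> z \<in> outer_points b t q" for z b and t :: "complex ^ 4"
    by (auto simp: C_def outer_points_def)
  have good: "(z \<notin> ?\<Gamma> \<and> inverse z \<notin> ?\<Gamma> \<and> winding_number \<gamma> z = 0 \<and> winding_number \<gamma> (inverse z) = 1) \<longleftrightarrow> z \<in> W"
    if "z \<noteq> 0" for z using that by (auto simp: W_def A0_def A1_def)
  have z0: "z \<noteq> 0" if "z \<in> outer_points b t q" for z b t
    using that by (auto simp: outer_points_def)
  show ?thesis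
  proof (rule that)
    show "open N" unfolding N_def using closed_compact_projection[OF K C] by (simp add: open_Compl)
    have "z \<in> W" if "z \<in> outer_points b0 t0 q" for z
      using adm that good[OF z0[OF that]] by (simp add: admissible_def)
    thus "(b0, t0) \<in> N" unfolding N_def K_def by (auto simp: outer)
    fix b t assume bt: "(b, t) \<in> N"
    show "admissible b t q \<gamma>"
      unfolding admissible_def
    proof (intro conjI ballI vp hom; goal_cases)
      fix z assume z: "z \<in> outer_points b t q"
      have "z \<notin> ?\<Gamma> \<and> inverse z \<notin> ?\<Gamma> \<and> winding_number \<gamma> z = 0 \<and> winding_number \<gamma> (inverse z) = 1"
      proof (cases "R < norm z")
        case False
        hence "z \<in> cball 0 R" by simp
        hence "z \<in> W" using bt z unfolding N_def K_def outer[symmetric] by blast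
        thus ?thesis using good[OF z0[OF z]] by simp
      qed (rule far)
      thus "z \<notin> ?\<Gamma>" "inverse z \<notin> ?\<Gamma>" "winding_number \<gamma> z = 0" "winding_number \<gamma> (inverse z) = 1"
        by auto
    qed
  qed
qed

lemma q_power_inj: "q ^ i = q ^ j \<Longrightarrow> i = j"
proof -
  assume "q ^ i = q ^ j"
  hence eq: "norm q ^ i = norm q ^ j" by (metis norm_power)
  have q: "0 < norm q" "norm q < 1" using q_nz q_less_1 by auto
  show "i = j"
    using eq power_strict_decreasing[OF _ q, of i j] power_strict_decreasing[OF _ q, of j i]
    by (cases i j rule: linorder_cases) auto
qed

text \<open>Poles can only coincide across different families, and never between the two square roots.\<close>

lemma pole_inj_weights:
  assumes b: "b \<noteq> 0" and x: "x1 \<noteq> 0" "x2 \<noteq> 0" "x3 \<noteq> 0" "x4 \<noteq> 0"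
    and ij: "i \<noteq> j" "snd i < 6" "snd j < 6"
    and eq: "pole b x1 x2 x3 x4 i = pole b x1 x2 x3 x4 j"
  shows "snd i \<noteq> snd j \<and> (snd i < 4 \<or> snd j < 4)"
proof -
  obtain k r l s where i: "i = (k, r)" and j: "j = (l, s)" by (cases i, cases j)
  have pow: "k = l" if "x * q ^ k = x * q ^ l" "x \<noteq> 0" for x
    using that q_power_inj by auto
  show ?thesis
  proof (rule ccontr)
    assume neg: "\<not> (snd i \<noteq> snd j \<and> (snd i < 4 \<or> snd j < 4))"
    show False
    proof (cases "r < 4")
      case True
      hence "r = s" "r \<in> {0, 1, 2, 3}" using neg i j by auto
      hence "k = l" using eq x pow unfolding i j pole_def by (auto split: if_splits)
      thus False using ij(1) \<open>r = s\<close> i j by simp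
    next
      case False
      hence rs: "r \<in> {4, 5}" "s \<in> {4, 5}" using neg ij i j by auto
      have "(pole b x1 x2 x3 x4 i)^2 = b * q ^ k" "(pole b x1 x2 x3 x4 j)^2 = b * q ^ l"
        using rs by (auto simp: i j pole_def)
      hence kl: "k = l" using eq pow b by simp
      hence "r \<noteq> s" using ij i j by simp
      hence "csqrt (b * q ^ k) = - csqrt (b * q ^ k)"
        using eq rs unfolding i j pole_def kl by auto
      hence "2 * csqrt (b * q ^ k) = 0" by (simp add: eq_neg_iff_add_eq_0)
      thus False using b q_nz by simp
    qed
  qed
qed

text \<open>Multiply \<open>x\<^sub>r\<close> by \<open>1 + r \<epsilon>\<close>. Every pole is affine in
  \<open>\<epsilon>\<close> and no two poles are the same affine function, so the poles are distinct for all but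
  countably many real \<open>\<epsilon>\<close>. Near \<open>\<epsilon> = 0\<close> the path stays admissible,
  and both sides are continuous at \<open>0\<close>.\<close>

lemma integral_identity_admissible:
  fixes t :: "complex ^ 4"
  assumes adm: "admissible b t q \<gamma>" and b: "0 < norm b" "norm b < 1" and t: "\<And>r. t $ r \<noteq> 0"
  shows "integral_identity b (t $ 1) (t $ 2) (t $ 3) (t $ 4) \<gamma>"
proof -
  let ?\<Gamma> = "path_image \<gamma>"
  have b0: "b \<noteq> 0" using b by auto
  have vp: "valid_path \<gamma>" and hom: "homotopic_loops (- {0}) (circ 1) \<gamma>"
    using adm by (auto simp: admissible_def)
  have im: "?\<Gamma> \<subseteq> - {0}" using homotopic_loops_imp_subset[OF hom] by simp
  define X1 X2 X3 X4 :: "real \<Rightarrow> complex" where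
    "X1 = (\<lambda>\<epsilon>. t $ 1 * (1 + of_real \<epsilon> * 1))" and "X2 = (\<lambda>\<epsilon>. t $ 2 * (1 + of_real \<epsilon> * 2))" and
    "X3 = (\<lambda>\<epsilon>. t $ 3 * (1 + of_real \<epsilon> * 3))" and "X4 = (\<lambda>\<epsilon>. t $ 4 * (1 + of_real \<epsilon> * 4))"
  note X_defs = X1_def X2_def X3_def X4_def
  have X0: "X1 0 = t $ 1" "X2 0 = t $ 2" "X3 0 = t $ 3" "X4 0 = t $ 4" by (simp_all add: X_defs)
  have contX: "continuous_on A X1" "continuous_on A X2" "continuous_on A X3" "continuous_on A X4" for A
    unfolding X_defs by (intro continuous_intros)+
  have contX2: "continuous_on A (\<lambda>p. X1 (fst p))" "continuous_on A (\<lambda>p. X2 (fst p))"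
    "continuous_on A (\<lambda>p. X3 (fst p))" "continuous_on A (\<lambda>p. X4 (fst p))" for A :: "(real \<times> complex) set"
    unfolding X_defs by (intro continuous_intros)+
  define T :: "real \<Rightarrow> complex ^ 4" where "T = (\<lambda>\<epsilon>. \<chi> r. t $ r * (1 + of_real \<epsilon> * (if r = 1 then 1 else if r = 2 then 2 else if r = 3 then 3 else 4)))"
  have TX: "T \<epsilon> $ 1 = X1 \<epsilon>" "T \<epsilon> $ 2 = X2 \<epsilon>" "T \<epsilon> $ 3 = X3 \<epsilon>" "T \<epsilon> $ 4 = X4 \<epsilon>" for \<epsilon>
    by (simp_all add: T_def X_defs)
  have T0: "T 0 = t" by (simp add: T_def vec_eq_iff)
  obtain N where N: "open N" "(b, t) \<in> N" "\<And>b t. (b, t) \<in> N \<Longrightarrow> admissible b t q \<gamma>"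
    by (rule admissible_open[OF adm]) blast
  have contT: "continuous_on UNIV (\<lambda>\<epsilon>. (b, T \<epsilon>))"
    unfolding T_def by (intro continuous_intros)
  have "open ((\<lambda>\<epsilon>. (b, T \<epsilon>)) -` N)" using continuous_on_open_vimage[OF open_UNIV, THEN iffD1, OF contT] N(1) by simp
  moreover have "0 \<in> (\<lambda>\<epsilon>. (b, T \<epsilon>)) -` N" using N(2) T0 by simp
  ultimately obtain e1 where e1: "0 < e1" "ball 0 e1 \<subseteq> (\<lambda>\<epsilon>. (b, T \<epsilon>)) -` N"
    using open_contains_ball by metis
  define pw :: "nat \<Rightarrow> complex" where "pw = (\<lambda>r. if r = 0 then 1 else if r = 1 then 2 else if r = 2 then 3 else if r = 3 then 4 else 0)"
  let ?A = "pole b (t $ 1) (t $ 2) (t $ 3) (t $ 4)"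
  have pole_X: "pole b (X1 \<epsilon>) (X2 \<epsilon>) (X3 \<epsilon>) (X4 \<epsilon>) i = ?A i + of_real \<epsilon> * (pw (snd i) * ?A i)" for \<epsilon> i
    by (cases i) (simp add: pole_def pw_def X_defs algebra_simps)
  define Bad where "Bad = (\<Union>(i, j) \<in> {(i, j). i \<noteq> j \<and> snd i < 6 \<and> snd j < 6}.
     {\<epsilon>. ?A i + complex_of_real \<epsilon> * (pw (snd i) * ?A i) = ?A j + of_real \<epsilon> * (pw (snd j) * ?A j)})"
  have "countable Bad"
    unfolding Bad_def
  proof (intro countable_UN, goal_cases)
    case (2 ij)
    obtain i j where ij: "ij = (i, j)" "i \<noteq> j" "snd i < 6" "snd j < 6" using 2 by auto
    let ?D = "pw (snd i) * ?A i - pw (snd j) * ?A j"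
    have *: "?A i \<noteq> ?A j" if "?D = 0"
    proof
      assume eq: "?A i = ?A j"
      have "snd i \<noteq> snd j \<and> (snd i < 4 \<or> snd j < 4)"
        by (rule pole_inj_weights[OF b0 t t t t ij(2-4) eq])
      hence "pw (snd i) \<noteq> pw (snd j)" by (auto simp: pw_def)
      thus False using that eq pole_nz[OF b0 t t t t] by (simp add: left_diff_distrib[symmetric])
    qed
    have "{\<epsilon>. ?A i + complex_of_real \<epsilon> * (pw (snd i) * ?A i) = ?A j + of_real \<epsilon> * (pw (snd j) * ?A j)} \<subseteq> {Re ((?A j - ?A i) / ?D)}"
    proof clarsimp
      fix \<epsilon> :: real assume e: "?A i + complex_of_real \<epsilon> * (pw (snd i) * ?A i) = ?A j + of_real \<epsilon> * (pw (snd j) * ?A j)"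
      hence e': "complex_of_real \<epsilon> * ?D = ?A j - ?A i" by (simp add: algebra_simps)
      hence "?D \<noteq> 0" using * by auto
      hence "complex_of_real \<epsilon> = (?A j - ?A i) / ?D" using e' by (simp add: field_simps)
      thus "\<epsilon> = Re ((?A j - ?A i) / ?D)" by (metis Re_complex_of_real)
    qed
    thus ?case unfolding ij by (simp add: countable_subset)
  qed auto
  define g where "g = (\<lambda>\<epsilon>. P q * (P (b * (X1 \<epsilon> * X2 \<epsilon> * X3 \<epsilon> * X4 \<epsilon>)) * pairs P (X1 \<epsilon>) (X2 \<epsilon>) (X3 \<epsilon>) (X4 \<epsilon>)) *
      cint \<gamma> (integrand b (X1 \<epsilon>) (X2 \<epsilon>) (X3 \<epsilon>) (X4 \<epsilon>)) - 2 * P b * Wser b (X1 \<epsilon>) (X2 \<epsilon>) (X3 \<epsilon>) (X4 \<epsilon>))"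
  define den where "den = (\<lambda>p. (P (b * (snd p)^2) * P (b / (snd p)^2)) *
     (P (X1 (fst p) * snd p) * P (X1 (fst p) / snd p)) * (P (X2 (fst p) * snd p) * P (X2 (fst p) / snd p)) *
     (P (X3 (fst p) * snd p) * P (X3 (fst p) / snd p)) * (P (X4 (fst p) * snd p) * P (X4 (fst p) / snd p)))"
  define D where "D = (UNIV \<times> - {0}) \<inter> den -` (- {0})"
  have contden: "continuous_on (UNIV \<times> - {0}) den"
    unfolding den_def by (intro continuous_intros contX2) auto
  have D: "open D"
    unfolding D_def by (rule continuous_open_preimage[OF contden]) (auto intro: open_Times)
  have Dnz: "z \<noteq> 0" "P (b * z^2) \<noteq> 0" "P (b / z^2) \<noteq> 0" "P (X1 \<epsilon> * z) \<noteq> 0" "P (X1 \<epsilon> / z) \<noteq> 0"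
    "P (X2 \<epsilon> * z) \<noteq> 0" "P (X2 \<epsilon> / z) \<noteq> 0" "P (X3 \<epsilon> * z) \<noteq> 0" "P (X3 \<epsilon> / z) \<noteq> 0" "P (X4 \<epsilon> * z) \<noteq> 0" "P (X4 \<epsilon> / z) \<noteq> 0"
    if "(\<epsilon>, z) \<in> D" for \<epsilon> z
    using that by (auto simp: D_def den_def)
  have "isCont (\<lambda>\<epsilon>. contour_integral \<gamma> (\<lambda>z. integrand b (X1 \<epsilon>) (X2 \<epsilon>) (X3 \<epsilon>) (X4 \<epsilon>) z / (2 * of_real pi * \<i> * z))) 0"
  proof (rule isCont_contour_integral[OF vp D])
    fix z assume z: "z \<in> ?\<Gamma>"
    have out: "w \<notin> ?\<Gamma> \<and> inverse w \<notin> ?\<Gamma>" if "w \<in> outer_points b t q" for w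
      using adm that unfolding admissible_def by blast
    have z0: "z \<noteq> 0" using z im by auto
    have "z \<notin> outer_points b t q" using out[of z] z by blast
    moreover have "1 / z \<notin> outer_points b t q" using out[of "1 / z"] z by (auto simp: inverse_eq_divide)
    ultimately show "(0, z) \<in> D"
      using z0 unfolding D_def den_def outer_points_def by (auto simp: X0 power_divide)
  next
    have c1: "continuous_on D (\<lambda>p. P (b * (X (fst p) * snd p)) / P (X (fst p) * snd p) * (P (b * (X (fst p) / snd p)) / P (X (fst p) / snd p)))"
      if "continuous_on D (\<lambda>p. X (fst p))" "\<And>\<epsilon> z. (\<epsilon>, z) \<in> D \<Longrightarrow> P (X \<epsilon> * z) \<noteq> 0" "\<And>\<epsilon> z. (\<epsilon>, z) \<in> D \<Longrightarrow> P (X \<epsilon> / z) \<noteq> 0"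
      for X :: "real \<Rightarrow> complex"
      by (rule continuous_on_mult; rule continuous_on_divide)
         (auto intro!: continuous_intros that(1) dest: Dnz(1) that(2,3))
    have c2: "continuous_on D (\<lambda>p. P ((snd p)^2) * P (1 / (snd p)^2) / (P (b * (snd p)^2) * P (b / (snd p)^2)))"
      by (rule continuous_on_divide) (auto intro!: continuous_intros dest: Dnz(1,2,3))
    have c3: "continuous_on D (\<lambda>p. 2 * of_real pi * \<i> * snd p)" by (intro continuous_intros)
    show "continuous_on D (\<lambda>(\<epsilon>, z). integrand b (X1 \<epsilon>) (X2 \<epsilon>) (X3 \<epsilon>) (X4 \<epsilon>) z / (2 * of_real pi * \<i> * z))"
      unfolding case_prod_unfold integrand_def weight_def kernel_def G_def
      by (intro continuous_on_divide[OF _ c3] continuous_on_mult[OF c2] continuous_on_mult[OF _ c1] c1 contX2 Dnz)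
         (auto dest: Dnz(1))
    fix \<epsilon> S assume S: "\<And>z. z \<in> S \<Longrightarrow> (\<epsilon>, z) \<in> D"
    note nz = Dnz[OF S]
    have h1: "(\<lambda>z. P (b * (x * z)) / P (x * z) * (P (b * (x / z)) / P (x / z))) holomorphic_on S"
      if "\<And>z. z \<in> S \<Longrightarrow> P (x * z) \<noteq> 0" "\<And>z. z \<in> S \<Longrightarrow> P (x / z) \<noteq> 0" for x
      by (rule holomorphic_on_mult; rule holomorphic_on_divide)
         (auto intro!: holomorphic_intros dest: nz(1) that)
    have h2: "(\<lambda>z. P (z^2) * P (1 / z^2) / (P (b * z^2) * P (b / z^2))) holomorphic_on S"
      by (rule holomorphic_on_divide) (auto intro!: holomorphic_intros dest: nz(1,2,3))
    have h3: "(\<lambda>z. 2 * of_real pi * \<i> * z) holomorphic_on S" by (intro holomorphic_intros)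
    show "(\<lambda>z. integrand b (X1 \<epsilon>) (X2 \<epsilon>) (X3 \<epsilon>) (X4 \<epsilon>) z / (2 * of_real pi * \<i> * z)) holomorphic_on S"
      unfolding integrand_def weight_def kernel_def G_def
      by (intro holomorphic_on_divide[OF _ h3] holomorphic_on_mult[OF h2] holomorphic_on_mult[OF _ h1] h1 nz(2-11)) (auto dest: nz(1))
  qed
  note cont1 = this
  have cont2: "isCont (\<lambda>\<epsilon>. P q * (P (b * (X1 \<epsilon> * X2 \<epsilon> * X3 \<epsilon> * X4 \<epsilon>)) * pairs P (X1 \<epsilon>) (X2 \<epsilon>) (X3 \<epsilon>) (X4 \<epsilon>))) 0"
    by (rule continuous_on_interior[of UNIV]) (auto simp: pairs_def intro!: continuous_intros contX)
  have cont3: "isCont (\<lambda>\<epsilon>. 2 * P b * Wser b (X1 \<epsilon>) (X2 \<epsilon>) (X3 \<epsilon>) (X4 \<epsilon>)) 0"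
    by (rule continuous_on_interior[of UNIV]) (use b in \<open>auto intro!: continuous_intros continuous_Wser contX\<close>)
  have contg: "isCont g 0"
    unfolding g_def cint_def by (rule continuous_diff[OF continuous_mult[OF cont2 cont1] cont3])
  have gz: "g \<epsilon> = 0" if \<epsilon>: "\<bar>\<epsilon>\<bar> < e1" "\<bar>\<epsilon>\<bar> < 1 / 8" "\<epsilon> \<notin> Bad" for \<epsilon>
  proof -
    have "(b, T \<epsilon>) \<in> N" using e1(2) \<epsilon> by (auto simp: subset_iff)
    hence adm': "admissible b (T \<epsilon>) q \<gamma>" by (rule N(3))
    have nz: "1 + of_real \<epsilon> * w \<noteq> 0" if "norm w \<le> 4" for w :: complex
    proof
      assume "1 + of_real \<epsilon> * w = 0"
      hence "norm (of_real \<epsilon> * w) = 1" by (metis add_eq_0_iff norm_minus_cancel norm_one)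
      moreover have "norm (of_real \<epsilon> * w) \<le> 1 / 8 * 4" using \<epsilon> that unfolding norm_mult by (intro mult_mono) auto
      ultimately show False by simp
    qed
    have Xnz: "X1 \<epsilon> \<noteq> 0" "X2 \<epsilon> \<noteq> 0" "X3 \<epsilon> \<noteq> 0" "X4 \<epsilon> \<noteq> 0"
      using nz[of 1] nz[of 2] nz[of 3] nz[of 4] t by (auto simp: X_defs)
    hence Tnz: "T \<epsilon> $ r \<noteq> 0" for r using TX[of \<epsilon>] exhaust_4[of r] by auto
    have good: "good_path b (X1 \<epsilon>) (X2 \<epsilon>) (X3 \<epsilon>) (X4 \<epsilon>) \<gamma>"
      using admissible_imp_good_path[OF adm' b0 Tnz] by (simp add: TX)
    have "inj_on (pole b (X1 \<epsilon>) (X2 \<epsilon>) (X3 \<epsilon>) (X4 \<epsilon>)) (pole_indices m)" for m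
    proof (rule inj_onI, rule ccontr)
      fix i j assume ij: "i \<in> pole_indices m" "j \<in> pole_indices m" "i \<noteq> j"
        "pole b (X1 \<epsilon>) (X2 \<epsilon>) (X3 \<epsilon>) (X4 \<epsilon>) i = pole b (X1 \<epsilon>) (X2 \<epsilon>) (X3 \<epsilon>) (X4 \<epsilon>) j"
      hence "\<epsilon> \<in> Bad"
        unfolding Bad_def pole_X by (intro UN_I[of "(i, j)"]) (auto simp: pole_indices_def)
      thus False using \<epsilon> by blast
    qed
    from integral_identity_distinct[OF b Xnz good this] show ?thesis
      by (simp add: integral_identity_def g_def)
  qed
  have "g 0 = 0"
  proof (rule ccontr)
    assume g0: "g 0 \<noteq> 0"
    then obtain d where d: "0 < d" "\<And>\<epsilon>. dist \<epsilon> 0 < d \<Longrightarrow> dist (g \<epsilon>) (g 0) < norm (g 0)"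
      using contg unfolding continuous_at_eps_delta by (metis zero_less_norm_iff)
    define e where "e = min d (min e1 (1 / 8))"
    have e: "0 < e" "e \<le> d" "e \<le> e1" "e \<le> 1 / 8" using d e1 by (auto simp: e_def)
    have "{0<..<e} \<subseteq> Bad"
    proof
      fix \<epsilon> assume \<epsilon>: "\<epsilon> \<in> {0<..<e}"
      have "g \<epsilon> \<noteq> 0" using d(2)[of \<epsilon>] \<epsilon> e by (auto simp: dist_norm)
      thus "\<epsilon> \<in> Bad" using gz[of \<epsilon>] \<epsilon> e by auto
    qed
    hence "countable {0<..<e}" using \<open>countable Bad\<close> countable_subset by blast
    thus False using uncountable_open_interval[of 0 e] e by simp
  qed
  thus ?thesis by (simp add: g_def integral_identity_def X0)
qed

end

section \<open>Analytic continuation and the value of the integral side\<close>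

text \<open>The five coordinates of the parameter space; \<open>None\<close> stands for
  \<open>b\<close>.\<close>

definition coord :: "complex \<times> (complex ^ 4) \<Rightarrow> 4 option \<Rightarrow> complex" where
  "coord p c = (case c of None \<Rightarrow> fst p | Some r \<Rightarrow> snd p $ r)"

definition set_coord :: "complex \<times> (complex ^ 4) \<Rightarrow> 4 option \<Rightarrow> complex \<Rightarrow> complex \<times> (complex ^ 4)" where
  "set_coord p c w = (case c of None \<Rightarrow> (w, snd p) | Some r \<Rightarrow> (fst p, \<chi> i. if i = r then w else snd p $ i))"

definition polydisc :: "complex \<times> (complex ^ 4) \<Rightarrow> real \<Rightarrow> (complex \<times> (complex ^ 4)) set" where
  "polydisc p e = {p'. \<forall>c. norm (coord p' c - coord p c) < e}"

lemma coord_set_coord: "coord (set_coord p c w) c' = (if c' = c then w else coord p c')"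
  by (auto simp: coord_def set_coord_def split: option.splits)

lemma set_coord_coord [simp]: "set_coord p c (coord p c) = p"
  by (cases p) (auto simp: coord_def set_coord_def vec_eq_iff split: option.splits)

lemma set_coord_twice [simp]: "set_coord (set_coord p c w) c w' = set_coord p c w'"
  by (auto simp: set_coord_def vec_eq_iff split: option.splits)

lemma continuous_on_coord: "continuous_on A (\<lambda>p. coord p c)"
  by (cases c) (auto simp: coord_def intro!: continuous_intros)

lemma open_polydisc: "open (polydisc p e)"
proof -
  have "polydisc p e = (\<Inter>c\<in>UNIV. {p'. norm (coord p' c - coord p c) < e})"
    by (auto simp: polydisc_def)
  also have "open \<dots>"
    by (intro open_INT finite ballI open_Collect_less continuous_intros continuous_on_coord)
  finally show ?thesis .
qed

lemma centre_in_polydisc: "0 < e \<Longrightarrow> p \<in> polydisc p e"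
  by (simp add: polydisc_def)

lemma open_contains_polydisc:
  assumes "open U" "p \<in> U"
  obtains e where "0 < e" "polydisc p e \<subseteq> U"
proof -
  obtain d where d: "0 < d" "ball p d \<subseteq> U" using assms open_contains_ball by metis
  show ?thesis
  proof (rule that[of "d / 5"])
    show "polydisc p (d / 5) \<subseteq> U"
    proof
      fix p' assume "p' \<in> polydisc p (d / 5)"
      hence c: "norm (coord p' c - coord p c) < d / 5" for c by (simp add: polydisc_def)
      have "norm (snd p' - snd p) \<le> (\<Sum>r\<in>UNIV. norm ((snd p' - snd p) $ r))"
        unfolding norm_vec_def by (rule L2_set_le_sum) auto
      also have "\<dots> < (\<Sum>r\<in>(UNIV :: 4 set). d / 5)"
        by (rule sum_strict_mono) (use c[of "Some _"] in \<open>auto simp: coord_def\<close>)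
      finally have "norm (snd p' - snd p) < 4 * (d / 5)" by simp
      moreover have "norm (fst p' - fst p) < d / 5" using c[of None] by (simp add: coord_def)
      moreover have "norm (p' - p) \<le> norm (fst p' - fst p) + norm (snd p' - snd p)"
        unfolding norm_prod_def by (simp add: sqrt_sum_squares_le_sum)
      ultimately have "norm (p' - p) < d" by linarith
      thus "p' \<in> U" using d(2) by (auto simp: dist_norm norm_minus_commute)
    qed
  qed (use d in simp)
qed

text \<open>The set of coordinates that may leave the small polydisc is enlarged one by one, each time by the
  identity theorem in that coordinate.\<close>

lemma separately_holomorphic_zero_on_polydisc:
  assumes hol: "\<And>p c. p \<in> polydisc p0 e \<Longrightarrow> (\<lambda>w. H (set_coord p c w)) field_differentiable at (coord p c)"
    and sub: "polydisc p1 e1 \<subseteq> polydisc p0 e" and e1: "0 < e1"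
    and zero: "\<And>p. p \<in> polydisc p1 e1 \<Longrightarrow> H p = (0 :: complex)"
    and p: "p \<in> polydisc p0 e"
  shows "H p = 0"
proof -
  have claim: "\<forall>p\<in>polydisc p0 e. (\<forall>c. c \<notin> C \<longrightarrow> norm (coord p c - coord p1 c) < e1) \<longrightarrow> H p = 0" if "finite C" for C
    using that
  proof (induction C rule: finite_induct)
    case empty
    thus ?case using zero by (auto simp: polydisc_def)
  next
    case (insert c C)
    show ?case
    proof (intro ballI impI)
      fix p assume p: "p \<in> polydisc p0 e" and near: "\<forall>c'. c' \<notin> insert c C \<longrightarrow> norm (coord p c' - coord p1 c') < e1"
      have inD: "set_coord p c w \<in> polydisc p0 e" if "w \<in> ball (coord p0 c) e" for w
        using p that by (auto simp: polydisc_def coord_set_coord dist_norm norm_minus_commute)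
      have "(\<lambda>w. H (set_coord p c w)) field_differentiable at w" if "w \<in> ball (coord p0 c) e" for w
        using hol[OF inD[OF that], of c] by (simp add: coord_set_coord)
      hence h: "(\<lambda>w. H (set_coord p c w)) holomorphic_on ball (coord p0 c) e"
        by (auto simp: holomorphic_on_def intro: field_differentiable_at_within)
      have ball: "ball (coord p1 c) e1 \<subseteq> ball (coord p0 c) e"
      proof
        fix w assume "w \<in> ball (coord p1 c) e1"
        hence "set_coord p1 c w \<in> polydisc p1 e1"
          using e1 by (auto simp: polydisc_def coord_set_coord dist_norm norm_minus_commute)
        hence "set_coord p1 c w \<in> polydisc p0 e" using sub by blast
        hence "norm (coord (set_coord p1 c w) c - coord p0 c) < e" unfolding polydisc_def by blast
        thus "w \<in> ball (coord p0 c) e" by (simp add: coord_set_coord dist_norm norm_minus_commute)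
      qed
      have "H (set_coord p c (coord p c)) = 0"
      proof (rule analytic_continuation_open[OF _ _ _ _ ball h holomorphic_on_const[of 0]])
        fix w assume w: "w \<in> ball (coord p1 c) e1"
        have "\<forall>c'. c' \<notin> C \<longrightarrow> norm (coord (set_coord p c w) c' - coord p1 c') < e1"
          using near w by (auto simp: coord_set_coord dist_norm norm_minus_commute)
        thus "H (set_coord p c w) = 0" using insert.IH inD ball w by blast
      next
        have "norm (coord p c - coord p0 c) < e" using p by (simp add: polydisc_def)
        thus "coord p c \<in> ball (coord p0 c) e" by (simp add: dist_norm norm_minus_commute)
      qed (use e1 in auto)
      thus "H p = 0" by simp
    qed
  qed
  show ?thesis using claim[of UNIV] p by simp
qed

text \<open>The interior of the zero set is closed relative to \<open>U\<close>: a polydisc around a limit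
  point meets it, and is then contained in it.\<close>

lemma separately_holomorphic_identity:
  assumes U: "open U" "connected U"
    and hol: "\<And>p c. p \<in> U \<Longrightarrow> (\<lambda>w. H (set_coord p c w)) field_differentiable at (coord p c)"
    and V: "open V" "V \<subseteq> U" "V \<noteq> {}" "\<And>p. p \<in> V \<Longrightarrow> H p = (0 :: complex)"
    and p: "p \<in> U"
  shows "H p = 0"
proof -
  define Z where "Z = interior {p \<in> U. H p = 0}"
  have Z: "open Z" "Z \<subseteq> {p \<in> U. H p = 0}" by (auto simp: Z_def interior_subset)
  have "V \<subseteq> Z" unfolding Z_def using V by (intro interior_maximal) auto
  have spread: "polydisc p0 e \<subseteq> Z"
    if sub: "polydisc p0 e \<subseteq> U" and meet: "p1 \<in> polydisc p0 e \<inter> Z" for p0 e p1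
  proof -
    have "open (polydisc p0 e \<inter> Z)" using open_polydisc Z(1) by blast
    then obtain e1 where e1: "0 < e1" "polydisc p1 e1 \<subseteq> polydisc p0 e \<inter> Z"
      using open_contains_polydisc[OF _ meet] by metis
    have "H p = 0" if "p \<in> polydisc p0 e" for p
      by (rule separately_holomorphic_zero_on_polydisc[of p0 e H p1 e1])
         (use hol sub e1 Z(2) that in blast)+
    hence "polydisc p0 e \<subseteq> {p \<in> U. H p = 0}" using sub by blast
    thus ?thesis unfolding Z_def by (rule interior_maximal) (rule open_polydisc)
  qed
  have "open (U - Z)"
    unfolding open_subopen[of "U - Z"]
  proof
    fix p0 assume p0: "p0 \<in> U - Z"
    then obtain e where e: "0 < e" "polydisc p0 e \<subseteq> U" using open_contains_polydisc[OF U(1), of p0] by blast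
    have "polydisc p0 e \<inter> Z = {}" using spread[OF e(2)] p0 centre_in_polydisc[OF e(1)] by blast
    hence "polydisc p0 e \<subseteq> U - Z" using e(2) by blast
    thus "\<exists>T. open T \<and> p0 \<in> T \<and> T \<subseteq> U - Z"
      by (intro exI[of _ "polydisc p0 e"] conjI open_polydisc centre_in_polydisc e(1))
  qed
  hence "Z \<inter> U = {} \<or> (U - Z) \<inter> U = {}"
    using U(2) Z(1) by (intro connectedD) auto
  hence "p \<in> Z" using \<open>V \<subseteq> Z\<close> V(2,3) p by blast
  thus ?thesis using Z(2) by blast
qed

lemma jointly_analytic_coord:
  assumes "jointly_analytic F U" "p \<in> U"
  shows "(\<lambda>w. F (set_coord p c w)) field_differentiable at (coord p c)"
proof (cases c)
  case None
  thus ?thesis using assms by (cases p) (auto simp: jointly_analytic_def set_coord_def coord_def)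
next
  case (Some r)
  obtain b t where p: "p = (b, t)" by (cases p)
  have "(\<lambda>w. F (b, t + axis r w)) field_differentiable at 0"
    using assms unfolding p jointly_analytic_def by blast
  hence "((\<lambda>w. F (b, t + axis r w)) \<circ> (\<lambda>w. w - t $ r)) field_differentiable at (t $ r)"
    by (intro field_differentiable_compose) (auto intro!: derivative_intros)
  moreover have "t + axis r (w - t $ r) = (\<chi> i. if i = r then w else t $ i)" for w
    by (auto simp: vec_eq_iff axis_def)
  ultimately show ?thesis
    unfolding p Some set_coord_def coord_def o_def snd_conv fst_conv option.case by simp
qed

context nome
begin

abbreviation prod4 :: "complex ^ 4 \<Rightarrow> complex" where
  "prod4 t \<equiv> t $ 1 * t $ 2 * t $ 3 * t $ 4"

text \<open>\<open>P (b Y)\<close> times the integral side.\<close>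

definition B2_numerator :: "complex \<Rightarrow> complex ^ 4 \<Rightarrow> complex" where
  "B2_numerator b t = P (b^2) * P (q * b^2) / P (q * b) * Wser b (t $ 1) (t $ 2) (t $ 3) (t $ 4)"

lemma B2_integrand_eq_integrand:
  "B2_integrand b t q z = integrand b (t $ 1) (t $ 2) (t $ 3) (t $ 4) z / (2 * of_real pi * \<i> * z)"
proof -
  have K: "qpochs_inf [b * x * z, b * x / z] q / qpochs_inf [x * z, x / z] q = kernel b x z" for x
    by (simp add: qpochs_inf_def kernel_def G_def mult.assoc)
  have w: "qpochs_inf [z^2, 1 / z^2] q / qpochs_inf [b * z^2, b / z^2] q = weight b z"
    by (simp add: qpochs_inf_def weight_def)
  have "(\<Prod>r\<in>UNIV. kernel b (t $ r) z) = kernel b (t $ 1) z * kernel b (t $ 2) z * kernel b (t $ 3) z * kernel b (t $ 4) z"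
    unfolding UNIV_4 by (simp del: prod.insert_if add: prod.insert mult.assoc)
  thus ?thesis unfolding B2_integrand_def K w integrand_def by (simp only:)
qed

lemma P_qb_nz: "norm b < 1 \<Longrightarrow> P (q * b) \<noteq> 0"
  by (intro P_nz norm_mult_lt_1 q_less_1)

lemma B2_along_value:
  fixes t :: "complex ^ 4"
  assumes adm: "admissible b t q \<gamma>" and b: "0 < norm b" "norm b < 1" and t: "\<And>r. t $ r \<noteq> 0"
  shows "P (b * prod4 t) * B2_along b t q \<gamma> = B2_numerator b t"
proof -
  have c: "contour_integral \<gamma> (B2_integrand b t q) = cint \<gamma> (integrand b (t $ 1) (t $ 2) (t $ 3) (t $ 4))"
    unfolding cint_def by (rule contour_integral_cong) (auto simp: B2_integrand_eq_integrand)
  have alg: "Pb \<noteq> 0 \<Longrightarrow> Pq * (PY * pr) * I = 2 * Pb * N \<Longrightarrow> Pqb \<noteq> 0 \<Longrightarrow>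
      PY * (pr * (A * (B * Pq) / (2 * (Pb * Pqb))) * I) = A * B / Pqb * N" for Pb Pq PY pr I N Pqb A B :: complex
  proof -
    assume a: "Pb \<noteq> 0" "Pq * (PY * pr) * I = 2 * Pb * N" "Pqb \<noteq> 0"
    have "PY * (pr * (A * (B * Pq) / (2 * (Pb * Pqb))) * I) = (A * B) * (Pq * (PY * pr) * I) / (2 * Pb * Pqb)"
      by (simp add: mult_ac)
    also have "\<dots> = A * B / Pqb * N" unfolding a(2) using a(1,3) by simp
    finally show ?thesis .
  qed
  show ?thesis
    unfolding B2_along_def c B2_numerator_def
    using alg[OF P_nz[OF b(2)] integral_identity_admissible[OF assms, unfolded integral_identity_def] P_qb_nz[OF b(2)],
        of "P (b^2)" "P (q * b^2)"]
    by (simp add: qpochs_inf_def pair_products_def pairs_def mult_ac)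
qed

text \<open>Off the zeros of \<open>P (b Y)\<close> the series side is analytic; this set serves as the domain
  of the continuation.\<close>

definition regular_domain :: "(complex \<times> (complex ^ 4)) set" where
  "regular_domain = {(b, t) \<in> param_domain. P (b * prod4 t) \<noteq> 0}"

lemma open_param_domain: "open param_domain"
proof -
  have "param_domain = {p. 0 < norm (fst p)} \<inter> {p. norm (fst p) < 1} \<inter> (\<Inter>r\<in>UNIV. {p. snd p $ r \<noteq> (0 :: complex)})"
    by (auto simp: param_domain_def)
  also have "open \<dots>"
    by (intro open_Int open_INT finite ballI open_Collect_less open_Collect_neq continuous_intros)
  finally show ?thesis .
qed

lemma open_regular_domain: "open regular_domain"
proof -
  have "regular_domain = param_domain \<inter> {p. P (fst p * prod4 (snd p)) \<noteq> 0}"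
    by (auto simp: regular_domain_def)
  also have "open \<dots>"
    by (intro open_Int open_param_domain open_Collect_neq continuous_intros)
  finally show ?thesis .
qed

lemma jointly_analytic_numerator_quotient:
  "jointly_analytic (\<lambda>(b, t). B2_numerator b t / P (b * prod4 t)) regular_domain"
  unfolding jointly_analytic_def
proof (intro conjI open_regular_domain)
  have nz: "0 < norm (fst p) \<and> norm (fst p) < 1" "P (q * fst p) \<noteq> 0" "P (fst p * prod4 (snd p)) \<noteq> 0" if "p \<in> regular_domain" for p
    using that P_qb_nz by (auto simp: regular_domain_def param_domain_def)
  show "continuous_on regular_domain (\<lambda>(b, t). B2_numerator b t / P (b * prod4 t))"
    unfolding case_prod_unfold B2_numerator_def
    by (intro continuous_intros continuous_Wser[OF open_regular_domain] ballI nz)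
  have "(\<lambda>w. B2_numerator w t / P (w * prod4 t)) field_differentiable at b"
    and "(\<lambda>w. B2_numerator b (t + axis r w) / P (b * prod4 (t + axis r w))) field_differentiable at 0"
    if bt: "(b, t) \<in> regular_domain" for b t r
  proof -
    let ?A = "(\<lambda>w. (w, t)) -` regular_domain"
    have A: "open ?A" by (intro open_vimage open_regular_domain continuous_intros)
    have nzA: "0 < norm w \<and> norm w < 1" "P (q * w) \<noteq> 0" "P (w * prod4 t) \<noteq> 0" if "w \<in> ?A" for w
      using nz[of "(w, t)"] that by auto
    have "(\<lambda>w. B2_numerator w t / P (w * prod4 t)) holomorphic_on ?A"
      unfolding B2_numerator_def by (intro holomorphic_intros holomorphic_Wser[OF A] nzA)
    thus "(\<lambda>w. B2_numerator w t / P (w * prod4 t)) field_differentiable at b"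
      using bt A by (auto intro: holomorphic_on_imp_differentiable_at)
    let ?B = "(\<lambda>w. (b, t + axis r w)) -` regular_domain"
    have ax: "(t + axis r w) $ i = t $ i + (if i = r then w else 0)" for i w by (simp add: axis_def)
    have hax: "(\<lambda>w. (t + axis r w) $ i) holomorphic_on S" for i S
      unfolding ax by (cases "i = r") (auto intro!: holomorphic_intros)
    have "continuous_on UNIV (\<lambda>w. \<chi> i. (t + axis r w) $ i)"
      by (intro continuous_on_vec_lambda holomorphic_on_imp_continuous_on hax)
    hence "continuous_on UNIV (\<lambda>w. t + axis r w)" by (simp only: vec_nth_inverse)
    hence B: "open ?B" by (intro open_vimage open_regular_domain continuous_on_Pair continuous_on_const)
    have nzB: "P (b * prod4 (t + axis r w)) \<noteq> 0" if "w \<in> ?B" for w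
      using nz[of "(b, t + axis r w)"] that by auto
    have "(\<lambda>w. B2_numerator b (t + axis r w) / P (b * prod4 (t + axis r w))) holomorphic_on ?B"
      unfolding B2_numerator_def using nz[OF bt] by (intro holomorphic_intros hax holomorphic_Wser[OF B] nzB) auto
    moreover have "axis r (0 :: complex) = 0" by (simp add: axis_def vec_eq_iff)
    hence "0 \<in> ?B" using bt by (simp only: vimage_eq add_0_right)
    ultimately show "(\<lambda>w. B2_numerator b (t + axis r w) / P (b * prod4 (t + axis r w))) field_differentiable at 0"
      using B by (auto intro: holomorphic_on_imp_differentiable_at)
  qed
  thus "\<forall>(b, t)\<in>regular_domain. (\<lambda>w. case (w, t) of (b, t) \<Rightarrow> B2_numerator b t / P (b * prod4 t)) field_differentiable at b \<and>
       (\<forall>r. (\<lambda>w. case (b, t + axis r w) of (b, t) \<Rightarrow> B2_numerator b t / P (b * prod4 t)) field_differentiable at 0)"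
    unfolding case_prod_conv by blast
qed

text \<open>The product of punctured unit discs, on which \<open>P (b Y)\<close> has no zeros, is connected,
  and every point is connected to it by scaling the four parameters along a punctured plane with countably many
  points removed.\<close>

lemma connected_regular_domain: "connected regular_domain"
proof -
  define A where "A = ball (0 :: complex) 1 - {0}"
  have A: "connected A" unfolding A_def by (intro connected_open_diff_countable) auto
  \<comment> \<open>Here \<open>|b Y| < 1\<close>.\<close>
  define core where "core = {(b, t :: complex ^ 4). b \<in> A \<and> (\<forall>r. t $ r \<in> A)}"
  have conn_core: "connected core"
  proof -
    let ?v = "\<lambda>(a1, a2, a3, a4). (\<chi> r. if r = 1 then a1 else if r = 2 then a2 else if r = 3 then a3 else a4) :: complex ^ 4"
    let ?f = "\<lambda>(b, a). (b, ?v a) :: complex \<times> (complex ^ 4)"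
    have "core = ?f ` (A \<times> (A \<times> (A \<times> (A \<times> A))))"
    proof
      show "core \<subseteq> ?f ` (A \<times> (A \<times> (A \<times> (A \<times> A))))"
      proof clarify
        fix b t assume bt: "(b, t) \<in> core"
        have "(\<chi> r. if r = 1 then t $ 1 else if r = 2 then t $ 2 else if r = 3 then t $ 3 else t $ 4) = t"
          by (auto simp: vec_eq_iff) (metis exhaust_4)
        hence eq: "(b, t) = ?f (b, t $ 1, t $ 2, t $ 3, t $ 4)" by simp
        have "(b, t $ 1, t $ 2, t $ 3, t $ 4) \<in> A \<times> (A \<times> (A \<times> (A \<times> A)))"
          using bt by (auto simp: core_def)
        thus "(b, t) \<in> ?f ` (A \<times> (A \<times> (A \<times> (A \<times> A))))"
          by (intro image_eqI[of "(b, t)" ?f "(b, t $ 1, t $ 2, t $ 3, t $ 4)"] eq)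
      qed
      show "?f ` (A \<times> (A \<times> (A \<times> (A \<times> A)))) \<subseteq> core" by (auto simp: core_def)
    qed
    moreover have "continuous_on S ?f" for S
    proof -
      have c: "continuous_on S (\<lambda>p :: complex \<times> complex \<times> complex \<times> complex \<times> complex. if (r :: 4) = 1 then fst (snd p) else if r = 2 then fst (snd (snd p))
         else if r = 3 then fst (snd (snd (snd p))) else snd (snd (snd (snd p))))" for r
        by (cases "r = 1"; cases "r = 2"; cases "r = 3"; simp add: continuous_intros)
      show ?thesis
        unfolding case_prod_unfold by (intro continuous_on_Pair continuous_on_vec_lambda c continuous_intros)
    qed
    ultimately show ?thesis
      by (simp add: connected_continuous_image connected_Times A)
  qed
  have core_sub: "core \<subseteq> regular_domain"
  proof clarify
    fix b t assume bt: "(b, t) \<in> core"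
    have "norm (b * prod4 t) < 1"
      using bt by (intro norm_mult_lt_1) (auto simp: core_def A_def)
    thus "(b, t) \<in> regular_domain"
      using bt P_nz by (auto simp: core_def A_def regular_domain_def param_domain_def)
  qed
  define line where "line = (\<lambda>(b, t :: complex ^ 4). (\<lambda>s. (b, s *s t)) ` {s. s \<noteq> 0 \<and> P (b * prod4 (s *s t)) \<noteq> 0})"
  have line: "connected (line p)" "line p \<subseteq> regular_domain" "p \<in> line p" "core \<inter> line p \<noteq> {}"
    if p: "p \<in> regular_domain" for p
  proof -
    obtain b t where bt: "p = (b, t)" by (cases p)
    have b: "0 < norm b" "norm b < 1" and t: "t $ r \<noteq> 0" and PY: "P (b * prod4 t) \<noteq> 0" for r
      using p by (auto simp: bt regular_domain_def param_domain_def)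
    let ?S = "{s. s \<noteq> 0 \<and> P (b * prod4 (s *s t)) \<noteq> 0}"
    have scale: "prod4 (s *s t) = s ^ 4 * prod4 t" for s
      by (simp add: eval_nat_numeral mult_ac)
    have S: "?S = UNIV - ({0} \<union> (\<Union>r. {s. s ^ 4 * (b * prod4 t * q ^ r) = 1}))"
      unfolding scale by (auto simp: P_eq_0_iff mult_ac)
    have cnt: "countable ({0} \<union> (\<Union>r. {s. s ^ 4 * (b * prod4 t * q ^ r) = 1}))"
      by (intro countable_Un countable_UN countableI_type countable_finite[OF finite_monomial_roots]) auto
    have "connected ?S"
      unfolding S by (rule connected_open_diff_countable[OF _ _ connected_UNIV cnt]) auto
    moreover have "continuous_on ?S (\<lambda>s. (b, s *s t))"
      unfolding vector_scalar_mult_def by (intro continuous_intros)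
    ultimately show "connected (line p)"
      unfolding line_def bt case_prod_conv by (intro connected_continuous_image)
    show "line p \<subseteq> regular_domain"
      using b t unfolding line_def bt by (auto simp: regular_domain_def param_domain_def)
    show "p \<in> line p"
      unfolding line_def bt case_prod_conv by (rule image_eqI[of _ _ 1]) (use PY in auto)
    define M where "M = norm (t $ 1) + norm (t $ 2) + norm (t $ 3) + norm (t $ 4)"
    have M: "norm (t $ r) \<le> M" for r
      using exhaust_4[of r] by (auto simp: M_def)
    hence M0: "0 \<le> M" using norm_ge_zero order_trans by blast
    define s where "s = complex_of_real (1 / (2 + M))"
    have s: "norm s = 1 / (2 + M)" unfolding s_def norm_of_real using M0 by simp
    hence s0: "s \<noteq> 0" using M0 by auto
    have st: "norm (s * t $ r) < 1" for r
    proof -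
      have "norm (s * t $ r) \<le> 1 / (2 + M) * M" using M[of r] M0 unfolding norm_mult s by (intro mult_left_mono) auto
      also have "1 / (2 + M) * M < 1" using M0 by (simp add: pos_divide_less_eq)
      finally show ?thesis .
    qed
    have "(b, s *s t) \<in> core" using st s0 t b by (auto simp: core_def A_def)
    moreover from this have "P (b * prod4 (s *s t)) \<noteq> 0"
      using core_sub by (auto simp: regular_domain_def)
    ultimately show "core \<inter> line p \<noteq> {}" using s0 unfolding line_def bt case_prod_conv by blast
  qed
  let ?\<C> = "insert core ((\<lambda>p. core \<union> line p) ` regular_domain)"
  have "(1 / 2, \<chi> r. 1 / 2) \<in> core" by (auto simp: core_def A_def norm_divide)
  hence "(1 / 2, \<chi> r. 1 / 2) \<in> \<Inter> ?\<C>" by simp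
  hence "\<Inter> ?\<C> \<noteq> {}" by (rule ex_in_conv[THEN iffD1, OF exI])
  moreover have "connected S" if "S \<in> ?\<C>" for S
  proof (cases "S = core")
    case False
    hence "S \<in> (\<lambda>p. core \<union> line p) ` regular_domain" using that by simp
    then obtain p where "p \<in> regular_domain" "S = core \<union> line p" by (rule imageE)
    thus ?thesis using connected_Un[OF conn_core line(1,4)] by simp
  qed (simp add: conn_core)
  ultimately have "connected (\<Union> ?\<C>)" by (intro connected_Union)
  moreover have "regular_domain = \<Union> ?\<C>"
  proof
    show "regular_domain \<subseteq> \<Union> ?\<C>"
    proof
      fix p assume p: "p \<in> regular_domain"
      show "p \<in> \<Union> ?\<C>"
        by (rule UnionI[of "core \<union> line p"]) (use p line(3)[OF p] in simp_all)
    qed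
    show "\<Union> ?\<C> \<subseteq> regular_domain"
    proof (rule Union_least)
      fix S assume "S \<in> ?\<C>"
      thus "S \<subseteq> regular_domain"
        by (elim insertE imageE) (use core_sub line(2) in simp_all)
    qed
  qed
  ultimately show ?thesis by simp
qed

lemma admissible_circ:
  fixes t :: "complex ^ 4"
  assumes b: "norm b < 1" and t: "\<And>r. norm (t $ r) < 1"
  shows "admissible b t q (circ 1)"
proof -
  have "z \<notin> path_image (circ 1) \<and> inverse z \<notin> path_image (circ 1) \<and>
      winding_number (circ 1) z = 0 \<and> winding_number (circ 1) (inverse z) = 1"
    if z: "z \<in> outer_points b t q" for z
  proof -
  have key: "1 < norm w" if "x * w * q ^ k = 1" "norm x < 1" for x w k
  proof (rule ccontr)
    assume "\<not> 1 < norm w"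
    hence w: "norm w \<le> 1" by simp
    have "norm x * (norm w * norm q ^ k) \<le> norm x * 1"
      using w q_less_1 by (intro mult_left_mono mult_le_one power_le_one) auto
    hence "norm (x * w * q ^ k) < 1" using that(2) by (simp add: norm_mult norm_power mult_ac)
    thus False using that(1) by simp
  qed
  have z1: "1 < norm z"
  proof -
    have "1 < norm z \<or> 1 < norm (z^2)"
      using z key b t unfolding outer_points_def P_eq_0_iff mem_Collect_eq by metis
    thus ?thesis using power_le_one[OF norm_ge_zero, of z 2] by (auto simp: norm_power not_less[symmetric])
  qed
    have iz: "norm (inverse z) < 1" using z1 by (simp add: norm_inverse inverse_less_1_iff)
    have "winding_number (circ 1) z = 0"
      by (rule winding_number_zero_outside[of _ "cball 0 1"]) (use z1 in auto)
    moreover have "winding_number (circ 1) (inverse z) = 1"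
      using iz by (intro winding_number_circlepath) auto
    ultimately show ?thesis using z1 iz by auto
  qed
  thus ?thesis
    unfolding admissible_def using homotopic_loops_circ[of 1] by simp
qed

text \<open>Existence: \<open>regular_domain\<close> with the series side. Uniqueness: \<open>P (b Y)\<close>
  times any continuation agrees with \<open>B2_numerator\<close> near an admissible point, because the same path
  is admissible for all nearby parameters. Multiplying by \<open>P (b Y)\<close> avoids its zeros, which the
  domain of the other continuation may contain.\<close>

lemma B2_continuation_value:
  fixes t :: "complex ^ 4"
  assumes b: "0 < norm b" "norm b < 1" and t: "\<And>r. t $ r \<noteq> 0" and nz: "P (b * prod4 t) \<noteq> 0"
  shows "B2_continuation b t q v \<longleftrightarrow> v = B2_numerator b t / P (b * prod4 t)"
proof
  assume v: "v = B2_numerator b t / P (b * prod4 t)"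
  let ?F = "\<lambda>(b, t). B2_numerator b t / P (b * prod4 t)"
  have "(b, t) \<in> regular_domain" using assms by (auto simp: regular_domain_def param_domain_def)
  moreover have "regular_domain \<subseteq> param_domain" by (auto simp: regular_domain_def)
  moreover have "\<exists>(b', t')\<in>regular_domain. \<exists>\<gamma>. admissible b' t' q \<gamma>"
  proof (rule bexI[of _ "(1 / 2, \<chi> r. 1 / 2)"])
    have n: "norm (1 / 2 :: complex) < 1" by (simp add: norm_divide)
    show "case (1 / 2, \<chi> r. 1 / 2) of (b', t') \<Rightarrow> \<exists>\<gamma>. admissible b' t' q \<gamma>"
      using admissible_circ[of "1 / 2" "\<chi> r. 1 / 2"] n by auto
    have "norm (1 / 2 * prod4 (\<chi> r. 1 / 2)) < 1"
      unfolding vec_lambda_beta by (intro norm_mult_lt_1 n)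
    from P_nz[OF this] show "(1 / 2, \<chi> r. 1 / 2) \<in> regular_domain"
      using n by (auto simp: regular_domain_def param_domain_def)
  qed
  moreover have "B2_numerator b' t' / P (b' * prod4 t') = B2_along b' t' q \<gamma>"
    if bt: "(b', t') \<in> regular_domain" and adm: "admissible b' t' q \<gamma>" for b' t' \<gamma>
  proof -
    from that have "P (b' * prod4 t') * B2_along b' t' q \<gamma> = B2_numerator b' t'"
      by (intro B2_along_value) (auto simp: regular_domain_def param_domain_def)
    moreover have "P (b' * prod4 t') \<noteq> 0" using bt by (auto simp: regular_domain_def)
    ultimately show ?thesis by (simp add: field_simps)
  qed
  hence "\<forall>(b', t')\<in>regular_domain. \<forall>\<gamma>. admissible b' t' q \<gamma> \<longrightarrow> ?F (b', t') = B2_along b' t' q \<gamma>"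
    unfolding case_prod_conv by blast
  ultimately show "B2_continuation b t q v"
    unfolding B2_continuation_def using v connected_regular_domain jointly_analytic_numerator_quotient
    by (intro exI[of _ regular_domain] exI[of _ ?F]) auto
next
  assume "B2_continuation b t q v"
  then obtain U F where UF: "(b, t) \<in> U \<and> U \<subseteq> param_domain \<and> connected U \<and> jointly_analytic F U \<and>
        (\<exists>(b', t')\<in>U. \<exists>\<gamma>. admissible b' t' q \<gamma>) \<and>
        (\<forall>(b', t')\<in>U. \<forall>\<gamma>. admissible b' t' q \<gamma> \<longrightarrow> F (b', t') = B2_along b' t' q \<gamma>) \<and> v = F (b, t)"
    unfolding B2_continuation_def by (elim exE)
  hence U: "(b, t) \<in> U" "U \<subseteq> param_domain" "connected U" and F: "jointly_analytic F U"
    and v: "v = F (b, t)"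
    and ex: "\<exists>(b', t')\<in>U. \<exists>\<gamma>. admissible b' t' q \<gamma>"
    and all: "\<forall>(b', t')\<in>U. \<forall>\<gamma>. admissible b' t' q \<gamma> \<longrightarrow> F (b', t') = B2_along b' t' q \<gamma>"
    by simp_all
  have val: "F (b', t') = B2_along b' t' q \<gamma>" if "(b', t') \<in> U" "admissible b' t' q \<gamma>" for b' t' \<gamma>
    using bspec[OF all that(1)] that(2) by simp
  from ex obtain b' t' \<gamma> where adm: "(b', t') \<in> U" "admissible b' t' q \<gamma>" by auto
  have opU: "open U" using F by (simp add: jointly_analytic_def)
  obtain N where N: "open N" "(b', t') \<in> N" "\<And>b t. (b, t) \<in> N \<Longrightarrow> admissible b t q \<gamma>"
    by (rule admissible_open[OF adm(2)]) blast
  define H where "H = (\<lambda>p. P (fst p * prod4 (snd p)) * F p - B2_numerator (fst p) (snd p))"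
  have "H (b, t) = 0"
  proof (rule separately_holomorphic_identity[OF opU U(3) _ _ _ _ _ U(1)])
    show "open (U \<inter> N)" "U \<inter> N \<subseteq> U" "U \<inter> N \<noteq> {}" using opU N adm by auto
    fix p assume p: "p \<in> U \<inter> N"
    show "H p = 0"
    proof (cases p)
      case (Pair b t)
      have "admissible b t q \<gamma>" using p N(3) Pair by auto
      thus ?thesis using p U(2) val[of b t \<gamma>] B2_along_value[of b t \<gamma>] unfolding Pair H_def
        by (auto simp: param_domain_def)
    qed
  next
    fix p c assume p: "p \<in> U"
    have hN: "(\<lambda>w. P (fst (set_coord p c w) * prod4 (snd (set_coord p c w)))) field_differentiable at (coord p c)"
      "(\<lambda>w. B2_numerator (fst (set_coord p c w)) (snd (set_coord p c w))) field_differentiable at (coord p c)"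
    proof -
      let ?A = "(\<lambda>w. set_coord p c w) -` param_domain"
      have hf: "(\<lambda>w. fst (set_coord p c w)) holomorphic_on S" for S
        by (cases c) (auto simp: set_coord_def intro!: holomorphic_intros)
      have hs: "(\<lambda>w. snd (set_coord p c w) $ i) holomorphic_on S" for i S
        by (cases c; cases "c = Some i") (auto simp: set_coord_def intro!: holomorphic_intros)
      have "continuous_on UNIV (\<lambda>w. (fst (set_coord p c w), \<chi> i. snd (set_coord p c w) $ i))"
        by (intro continuous_on_Pair continuous_on_vec_lambda holomorphic_on_imp_continuous_on hf hs)
      hence "continuous_on UNIV (\<lambda>w. set_coord p c w)" by (simp only: vec_nth_inverse prod.collapse)
      hence A: "open ?A" by (intro open_vimage open_param_domain)
      have inA: "coord p c \<in> ?A" using p U(2) by auto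
      have "0 < norm (fst (set_coord p c w)) \<and> norm (fst (set_coord p c w)) < 1" if "w \<in> ?A" for w
        using that by (auto simp: param_domain_def case_prod_unfold)
      note nb = this
      have "(\<lambda>w. B2_numerator (fst (set_coord p c w)) (snd (set_coord p c w))) holomorphic_on ?A"
        unfolding B2_numerator_def
        by (intro holomorphic_intros hf hs holomorphic_Wser[OF A] nb P_qb_nz) (use nb in blast)
      thus "(\<lambda>w. B2_numerator (fst (set_coord p c w)) (snd (set_coord p c w))) field_differentiable at (coord p c)"
        using A inA by (rule holomorphic_on_imp_differentiable_at)
      have "(\<lambda>w. P (fst (set_coord p c w) * prod4 (snd (set_coord p c w)))) holomorphic_on ?A"
        by (intro holomorphic_intros hf hs)
      thus "(\<lambda>w. P (fst (set_coord p c w) * prod4 (snd (set_coord p c w)))) field_differentiable at (coord p c)"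
        using A inA by (rule holomorphic_on_imp_differentiable_at)
    qed
    show "(\<lambda>w. H (set_coord p c w)) field_differentiable at (coord p c)"
      unfolding H_def
      by (intro field_differentiable_diff field_differentiable_mult hN jointly_analytic_coord[OF F p])
  qed
  thus "v = B2_numerator b t / P (b * prod4 t)"
    unfolding v H_def using nz by (simp add: field_simps)
qed

lemma B2_value:
  fixes t :: "complex ^ 4"
  assumes b: "0 < norm b" "norm b < 1" and t: "\<And>r. t $ r \<noteq> 0" and nz: "P (b * prod4 t) \<noteq> 0"
  shows "B2 b t q = B2_numerator b t / P (b * prod4 t)"
proof (cases "\<exists>\<gamma>. admissible b t q \<gamma>")
  case True
  have val: "B2_along b t q \<gamma> = B2_numerator b t / P (b * prod4 t)" if "admissible b t q \<gamma>" for \<gamma>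
    using B2_along_value[OF that b t] nz by (simp add: field_simps)
  show ?thesis
    unfolding B2_def if_P[OF True] by (rule the_equality) (use True val in auto)
next
  case False
  show ?thesis
    unfolding B2_def if_not_P[OF False] B2_continuation_value[OF b t nz] by simp
qed

end

section \<open>The very well poised series\<close>

context nome
begin

lemma Pn_add: "Pn x (m + n) = Pn x m * Pn (x * q ^ m) n"
  by (induction n) (simp_all add: Pn_Suc power_add mult_ac)

lemma Pn_eq_0: "x * q ^ r = 1 \<Longrightarrow> r < k \<Longrightarrow> Pn x k = 0"
  unfolding qpoch_def by (intro prod_zero) auto

lemma P_nz_of_Pn_nz: "(\<And>k. Pn x k \<noteq> 0) \<Longrightarrow> P x \<noteq> 0"
  using Pn_eq_0 P_eq_0_iff by blast

text \<open>The parameters \<open>\<plusminus>b T/\<surd>q, \<plusminus>b T\<close>, and likewise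
  \<open>\<plusminus>T \<surd>q, \<plusminus>T\<close> among the lower parameters, combine to one finite product
  of double length.\<close>

lemma Pn_quadruple:
  assumes "x^2 = q * y^2"
  shows "Pn x k * Pn (- x) k * (Pn y k * Pn (- y) k) = Pn (y^2) (2 * k)"
proof (induction k)
  case 0
  thus ?case by (simp add: Pn_0)
next
  case (Suc k)
  have "(1 - x * q ^ k) * (1 - (- x) * q ^ k) = 1 - x^2 * (q ^ k)^2"
    "(1 - y * q ^ k) * (1 - (- y) * q ^ k) = 1 - y^2 * (q ^ k)^2"
    by (simp_all add: algebra_simps power2_eq_square)
  hence e: "(1 - x * q ^ k) * (1 - (- x) * q ^ k) = 1 - y^2 * q ^ Suc (2 * k)"
    "(1 - y * q ^ k) * (1 - (- y) * q ^ k) = 1 - y^2 * q ^ (2 * k)"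
    unfolding assms by (simp_all add: power_mult[symmetric] power_even_eq mult_ac)
  have "Pn x (Suc k) * Pn (- x) (Suc k) * (Pn y (Suc k) * Pn (- y) (Suc k)) =
     (Pn x k * Pn (- x) k * (Pn y k * Pn (- y) k)) *
     (((1 - y * q ^ k) * (1 - (- y) * q ^ k)) * ((1 - x * q ^ k) * (1 - (- x) * q ^ k)))"
    by (simp only: Pn_Suc mult_ac)
  also have "\<dots> = Pn (y^2) (2 * Suc k)"
    unfolding Suc.IH e by (simp add: Pn_Suc mult_ac)
  finally show ?case .
qed

text \<open>The origin of the factor \<open>1 - a q\<^bsup>2k\<^esup>\<close> with \<open>a =
  s\<^sup>2\<close>.\<close>

lemma Pn_well_poised:
  "Pn (q * s) k * Pn (- q * s) k * (1 - s^2) = (1 - s^2 * q ^ (2 * k)) * (Pn s k * Pn (- s) k)"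
proof -
  have 1: "Pn (q * s) k * (1 - s) = (1 - s * q ^ k) * Pn s k" for s
    using Pn_Suc[of s k] Pn_Suc_shift[of s k] by (simp add: mult_ac)
  have "Pn (q * s) k * Pn (- q * s) k * (1 - s^2) = (Pn (q * s) k * (1 - s)) * (Pn (q * (- s)) k * (1 - (- s)))"
    by (simp add: power2_eq_square algebra_simps)
  also have "\<dots> = ((1 - s * q ^ k) * (1 - (- s) * q ^ k)) * (Pn s k * Pn (- s) k)"
    unfolding 1 by (simp only: mult_ac)
  also have "(1 - s * q ^ k) * (1 - (- s) * q ^ k) = 1 - s^2 * (q ^ k)^2"
    by (simp add: algebra_simps power2_eq_square)
  also have "(q ^ k)^2 = q ^ (2 * k)" by (simp add: power_even_eq)
  finally show ?thesis .
qed

lemma c_coeff_well_poised: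
  assumes nz: "Pn s k * Pn (- s) k \<noteq> 0" and s: "s^2 = b * Y / q"
  shows "Pn (b * Y / q) k * (Pn (q * s) k * Pn (- q * s) k) = c_coeff b Y k * (Pn s k * Pn (- s) k)"
proof (cases k)
  case 0
  thus ?thesis by (simp add: Pn_0 c_coeff_def)
next
  case (Suc j)
  have "(1 - s) * (1 + s) \<noteq> 0" using nz unfolding Suc Pn_Suc_shift by auto
  hence a: "1 - s^2 \<noteq> 0" by (simp add: power2_eq_square algebra_simps)
  have "s^2 * q ^ (2 * k) = b * Y * q ^ (2 * j + 1)" using q_nz by (simp add: s Suc)
  moreover have "Pn (b * Y / q) k = (1 - s^2) * Pn (b * Y) j"
    unfolding Suc Pn_Suc_shift s using q_nz by simp
  ultimately have "Pn (b * Y / q) k * (Pn (q * s) k * Pn (- q * s) k) = (1 - b * Y * q ^ (2 * j + 1)) * Pn (b * Y) j * (Pn s k * Pn (- s) k)"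
    using Pn_well_poised[of s k] by (simp add: mult_ac)
  thus ?thesis by (simp add: c_coeff_def Suc)
qed

text \<open>The lower parameter dual to \<open>t\<^sub>1 t\<^sub>2\<close> is \<open>b t\<^sub>3
  t\<^sub>4\<close>, and so on, so the six lower products complete \<open>(b x q\<^sup>k;q)\<close> to \<open>(b
  x;q)\<close>. The last two conclusions give the nonvanishing of the infinite products by which the series was
  multiplied.\<close>

lemma vwp_term:
  fixes t :: "complex ^ 4"
  defines "Y \<equiv> prod4 t"
  assumes b0: "b \<noteq> 0" and t: "\<And>r. t $ r \<noteq> 0" and T: "T^2 = Y"
    and nz: "qpochs (q # vwp_lower (b * T^2 / q) (W_params b t T q) q) q k \<noteq> 0"
  shows "pairs (\<lambda>x. P (b * x)) (t $ 1) (t $ 2) (t $ 3) (t $ 4) * P Y *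
     (qpochs (b * T^2 / q # q * csqrt (b * T^2 / q) # - q * csqrt (b * T^2 / q) # W_params b t T q) q k /
      qpochs (q # vwp_lower (b * T^2 / q) (W_params b t T q) q) q k * (b^2) ^ k) =
     Wterm b (t $ 1) (t $ 2) (t $ 3) (t $ 4) k"
    (is "?C * _ * (?U / ?L * _) = _")
    and "Pn Y (2 * k) \<noteq> 0" and "pairs (\<lambda>x. Pn (b * x) k) (t $ 1) (t $ 2) (t $ 3) (t $ 4) \<noteq> 0"
proof -
  define a where "a = b * Y / q"
  define s where "s = csqrt a"
  have s: "s^2 = b * Y / q" by (simp add: s_def a_def)
  have Y0: "Y \<noteq> 0" using t by (simp add: Y_def)
  have T0: "T \<noteq> 0" using T Y0 by auto
  let ?pr = "pairs (\<lambda>x. Pn x k) (t $ 1) (t $ 2) (t $ 3) (t $ 4)"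
  let ?prb = "pairs (\<lambda>x. Pn (b * x) k) (t $ 1) (t $ 2) (t $ 3) (t $ 4)"
  have aq: "a * q = b * T^2" using q_nz T by (simp add: a_def)
  have dual: "a * q / (t $ 1 * t $ 2) = b * (t $ 3 * t $ 4)" "a * q / (t $ 1 * t $ 3) = b * (t $ 2 * t $ 4)"
    "a * q / (t $ 1 * t $ 4) = b * (t $ 2 * t $ 3)" "a * q / (t $ 2 * t $ 3) = b * (t $ 1 * t $ 4)"
    "a * q / (t $ 2 * t $ 4) = b * (t $ 1 * t $ 3)" "a * q / (t $ 3 * t $ 4) = b * (t $ 1 * t $ 2)"
    unfolding aq T Y_def using t by (simp_all add: field_simps)
  have low: "a * q / (q / b) = b^2 * Y / q" "a * q / (b * T / csqrt q) = T * csqrt q" "a * q / (- (b * T / csqrt q)) = - (T * csqrt q)"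
    "a * q / (b * T) = T" "a * q / (- (b * T)) = - T"
    unfolding aq using q_nz b0 T0 by (simp_all add: T[symmetric] field_simps power2_eq_square)
  have "(T * csqrt q)^2 = q * T^2" by (simp add: power_mult_distrib mult.commute)
  note quad_low = Pn_quadruple[OF this, of k, unfolded T]
  have y2: "(b * T / csqrt q)^2 = b^2 * Y / q" by (simp add: power_mult_distrib power_divide T)
  have "(b * T)^2 = q * (b * T / csqrt q)^2" unfolding y2 using q_nz by (simp add: power_mult_distrib T)
  note quad_up = Pn_quadruple[OF this, of k, unfolded y2]
  have L: "?L = Pn q k * (Pn s k * Pn (- s) k) * ?prb * Pn (b^2 * Y / q) k * Pn Y (2 * k)"
  proof -
    have "?L = Pn q k * (Pn s k * Pn (- s) k) * ?prb * Pn (b^2 * Y / q) k *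
       (Pn (T * csqrt q) k * Pn (- (T * csqrt q)) k * (Pn T k * Pn (- T) k))"
      unfolding vwp_lower_def W_params_def pair_products_def T a_def[symmetric] s_def[symmetric]
      by (simp only: list.map append.simps dual low qpochs_def prod_list.Cons prod_list.Nil pairs_def mult_1_right)
         (simp only: mult_ac)
    thus ?thesis unfolding quad_low .
  qed
  have U: "?U = Pn (b * Y / q) k * (Pn (q * s) k * Pn (- q * s) k) * ?pr * Pn (q / b) k * Pn (b^2 * Y / q) (2 * k)"
  proof -
    have "?U = Pn a k * (Pn (q * s) k * Pn (- q * s) k) * ?pr * Pn (q / b) k *
       (Pn (b * T) k * Pn (- (b * T)) k * (Pn (b * T / csqrt q) k * Pn (- (b * T / csqrt q)) k))"
      unfolding W_params_def pair_products_def T a_def[symmetric] s_def[symmetric]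
      by (simp only: list.map append.simps qpochs_def prod_list.Cons prod_list.Nil pairs_def mult_1_right)
         (simp only: mult_ac)
    thus ?thesis unfolding quad_up a_def .
  qed
  show nzs: "Pn Y (2 * k) \<noteq> 0" "?prb \<noteq> 0" using nz unfolding L by auto
  have h1: "Pn (b * Y / q) k * (Pn (q * s) k * Pn (- q * s) k) = c_coeff b Y k * (Pn s k * Pn (- s) k)"
    using nz unfolding L by (intro c_coeff_well_poised s) auto
  have h2: "Pn (b^2 * Y / q) (2 * k) = Pn (b^2 * Y / q) k * Pn (b^2 * Y * q ^ (k - 1)) k"
  proof (cases k)
    case (Suc j)
    have "b^2 * Y / q * q ^ k = b^2 * Y * q ^ (k - 1)" using q_nz by (simp add: Suc)
    thus ?thesis using Pn_add[of "b^2 * Y / q" k k] by (simp add: mult_2)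
  qed (simp add: Pn_0)
  have h3: "?C = ?prb * pairs (\<lambda>x. P (b * x * q ^ k)) (t $ 1) (t $ 2) (t $ 3) (t $ 4)"
    unfolding pairs_def P_split[of "b * _" k] by (simp only: mult_ac)
  have h4: "P Y = Pn Y (2 * k) * P (Y * q ^ (2 * k))" by (rule P_split)
  have h5: "pairs (\<lambda>x. P (b * x * q ^ k) * Pn x k) (t $ 1) (t $ 2) (t $ 3) (t $ 4) =
     pairs (\<lambda>x. P (b * x * q ^ k)) (t $ 1) (t $ 2) (t $ 3) (t $ 4) * ?pr"
    unfolding pairs_def by (simp only: mult_ac)
  have alg: "x * y * (u / l * v) = n" if "l \<noteq> 0" "x * y * u * v = n * l" for x y u l v n :: complex
    using that by (simp add: field_simps)
  have b2: "(b^2) ^ k = b ^ (2 * k)" by (simp add: power_mult)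
  show "?C * P Y * (?U / ?L * (b^2) ^ k) = Wterm b (t $ 1) (t $ 2) (t $ 3) (t $ 4) k"
  proof (rule alg[OF nz])
    have qk: "x / Pn q k * y * (Pn q k * z) = x * y * z" for x y z using Pn_q_nz[of k] by simp
    have "Wterm b (t $ 1) (t $ 2) (t $ 3) (t $ 4) k * ?L =
      Pn (q / b) k * b ^ (2 * k) / Pn q k *
       (P (Y * q ^ (2 * k)) * c_coeff b Y k * Pn (b^2 * Y * q ^ (k - 1)) k *
          (pairs (\<lambda>x. P (b * x * q ^ k)) (t $ 1) (t $ 2) (t $ 3) (t $ 4) * ?pr)) *
       (Pn q k * ((Pn s k * Pn (- s) k) * ?prb * Pn (b^2 * Y / q) k * Pn Y (2 * k)))"
      unfolding L Wterm_def h5 u_coeff_def Y_def by (simp only: mult.assoc)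
    also have "\<dots> = ?C * P Y * ?U * (b^2) ^ k"
      unfolding qk U h1 h2 h3 h4 b2 by (simp only: mult_ac)
    finally show "?C * P Y * ?U * (b^2) ^ k = Wterm b (t $ 1) (t $ 2) (t $ 3) (t $ 4) k * ?L" by simp
  qed
qed

lemma vwp_value:
  fixes t :: "complex ^ 4"
  assumes b: "0 < norm b" "norm b < 1" and t: "\<And>r. t $ r \<noteq> 0" and T: "T^2 = prod4 t"
    and gen: "generic b t T q"
  shows "pairs (\<lambda>x. P (b * x)) (t $ 1) (t $ 2) (t $ 3) (t $ 4) * P (prod4 t) *
     vwp (b * T^2 / q) (W_params b t T q) q (b^2) = Wser b (t $ 1) (t $ 2) (t $ 3) (t $ 4)"
proof -
  let ?x = "\<lambda>k. qpochs (b * T^2 / q # q * csqrt (b * T^2 / q) # - q * csqrt (b * T^2 / q) # W_params b t T q) q k /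
      qpochs (q # vwp_lower (b * T^2 / q) (W_params b t T q) q) q k * (b^2) ^ k"
  let ?C = "pairs (\<lambda>x. P (b * x)) (t $ 1) (t $ 2) (t $ 3) (t $ 4) * P (prod4 t)"
  let ?N = "Wterm b (t $ 1) (t $ 2) (t $ 3) (t $ 4)"
  have b0: "b \<noteq> 0" using b by auto
  have nz: "qpochs (q # vwp_lower (b * T^2 / q) (W_params b t T q) q) q k \<noteq> 0" for k
    using gen by (simp add: generic_def)
  note half_weight = vwp_term[OF b0 t T nz]
  have PY: "P (prod4 t) \<noteq> 0"
  proof
    assume "P (prod4 t) = 0"
    then obtain r where "prod4 t * q ^ r = 1" by (auto simp: P_eq_0_iff)
    thus False using Pn_eq_0[of "prod4 t" r "2 * Suc r"] half_weight(2)[of "Suc r"] by simp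
  qed
  have "Pn (b * (t $ i * t $ j)) k \<noteq> 0"
    if "(i, j) \<in> {(1, 2), (1, 3), (1, 4), (2, 3), (2, 4), (3, 4)}" for i j k
    using half_weight(3)[of k] that unfolding pairs_def by auto
  hence "P (b * (t $ i * t $ j)) \<noteq> 0"
    if "(i, j) \<in> {(1, 2), (1, 3), (1, 4), (2, 3), (2, 4), (3, 4)}" for i j
    using that by (intro P_nz_of_Pn_nz) blast
  hence C: "?C \<noteq> 0" using PY unfolding pairs_def by simp
  have x: "?x k = ?N k / ?C" for k
    using half_weight(1)[of k] C by (simp add: field_simps)
  have sN: "summable ?N"
    by (rule summable_norm_cancel[OF Wterm_summable[OF b]])
  have "vwp (b * T^2 / q) (W_params b t T q) q (b^2) = (\<Sum>k. ?N k / ?C)"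
    unfolding vwp_def qhyp_def x ..
  also have "\<dots> = Wser b (t $ 1) (t $ 2) (t $ 3) (t $ 4) / ?C"
    unfolding Wser_def by (rule suminf_divide[OF sN])
  finally show ?thesis using C by simp
qed

end

theorem mainTheorem4:
  fixes q b T :: complex and t :: "complex ^ 4"
  assumes "0 < norm q" "norm q < 1"
    and "0 < norm b" "norm b < 1"
    and "\<And>r. t$r \<noteq> 0"
    and "T^2 = t$1 * t$2 * t$3 * t$4"
    and "generic b t T q"
  shows "B2 b t q =
    qpochs_inf (map (\<lambda>x. b * x) (pair_products t)) q *
    (qpochs_inf [q * b^2, b^2, T^2] q / qpochs_inf [q * b, b * T^2] q) *
    vwp (b * T^2 / q) (W_params b t T q) q (b^2)"
proof -
  interpret nome q using assms(1,2) by unfold_locales auto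
  have nz: "P (b * prod4 t) \<noteq> 0"
    using assms(7) by (simp add: generic_def qpochs_inf_def assms(6))
  let ?C = "pairs (\<lambda>x. P (b * x)) (t $ 1) (t $ 2) (t $ 3) (t $ 4)"
  let ?W = "vwp (b * T^2 / q) (W_params b t T q) q (b^2)"
  have "B2 b t q = P (b^2) * P (q * b^2) / P (q * b) * (?C * P (prod4 t) * ?W) / P (b * prod4 t)"
    unfolding B2_value[OF assms(3-5) nz] B2_numerator_def vwp_value[OF assms(3-7)] ..
  also have "\<dots> = ?C * (P (q * b^2) * (P (b^2) * P (prod4 t)) / (P (q * b) * P (b * prod4 t))) * ?W"
    by (simp add: mult_ac)
  also have "\<dots> = qpochs_inf (map (\<lambda>x. b * x) (pair_products t)) q *
    (qpochs_inf [q * b^2, b^2, T^2] q / qpochs_inf [q * b, b * T^2] q) * ?W"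
    by (simp add: qpochs_inf_def pair_products_def pairs_def assms(6) mult.assoc)
  finally show ?thesis .
qed

end
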